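(* For each $k=1,2,3,4$ the category of coherent (resp. strongly coherent) complete restriction monoids and their morphisms of type $k$ is equivalent to the category of distributive restriction semigroups (resp. distributive restriction $\wedge$-semigroups) and their morphisms of type $k$.
   Context: **Restriction semigroups.** An Ehresmann semigroup is a semigroup $S$ with a non-empty set $E$ of idempotents (the projections) and maps $\lambda,\rho:S\to E$ such that: $E$ is a commutative subsemigroup; $\lambda(a)=\rho(a)=a$ for $a\in E$; $a\lambda(a)=a$ and $\rho(a)a=a$; $\lambda(\lambda(a)b)=\lambda(ab)$ and $\rho(a\rho(b))=\rho(ab)$. It is a restriction semigroup if moreover $fa=a\lambda(fa)$ and $af=\rho(af)a$ for all $a\in S$, $f\in E$. Natural partial order: $a\le b$ iff $a=gb=bf$ for some $f,g\in E$. If $S$ is a monoid with identity $e$, then $E=e^{\downarrow}=\{x:x\le e\}$. Elements $a,b$ are compatible if $a\lambda(b)=b\lambda(a)$ and $\rho(b)a=\rho(a)b$; a non-empty subset is compatible if any two of its elements are compatible. **Complete restriction monoids.** A complete restriction monoid is a restriction semigroup that is a monoid, such that $E$ is a frame and $S$ has joins of all non-empty compatible subsets. $\mathcal L^{\vee}(S)$ is the frame of order ideals $A\subseteq S$ such that $\bigvee X\in A$ for every (non-empty) compatible $X\subseteq A$, ordered by inclusion. An element $a$ of a frame is finite if $a=\bigvee M$ implies $a=\bigvee F$ for some finite $F\subseteq M$; a frame is coherent if every element is a join of finite elements and the meet of any two finite elements is finite (the top need not be finite). $S$ is coherent if $e^{\downarrow}$ is a coherent frame, strongly coherent if $\mathcal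 L^{\vee}(S)$ is. A morphism $\varphi:S\to T$ of complete restriction monoids is a semigroup homomorphism commuting with $\lambda,\rho$ whose restriction to projections is a frame morphism $E_S\to E_T$. It is proper if every $t\in T$ is $t=\bigvee X$ for some $X\subseteq T$ such that for each $x\in X$ there is $s\in S$ with $\varphi(s)\ge x$; a $\wedge$-morphism if it preserves binary meets. Types: 1 morphisms; 2 proper morphisms; 3 $\wedge$-morphisms; 4 proper $\wedge$-morphisms. **Distributive restriction semigroups.** A restriction semigroup $S$ is distributive if $E$ is a distributive lattice (with a bottom element, not necessarily with a top) and $S$ has joins of all non-empty finite compatible subsets (that is, $a\vee b$ exists in $S$ for all compatible $a,b$); it is a $\wedge$-semigroup if in addition $a\wedge b$ exists for all $a,b\in S$. A morphism $f:S\to T$ of distributive restriction semigroups is a semigroup homomorphism commuting with $\lambda,\rho$ whose restriction $E_S\to E_T$ is a morphism of distributive lattices, i.e. preserves the bottom, $\vee$ and $\wedge$ and is such that for every $a\in E_T$ there is $b\in E_S$ with $f(b)\ge a$. It is proper if for every $t\in T$ there are $n\ge1$, $t_1,\dots,t_n\in T$, $s_1,\dots,s_n\in S$ with $t=\bigvee t_i$ and $f(s_i)\ge t_i$ for all $i$; weakly meet-preserving if $t\le f(a),f(b)$ implies that there is $c\le a,b$ with $t\le f(c)$. Types: 1 morphisms; 2 proper morphisms; 3 weakly meet-preserving morphisms; 4 proper and weakly meet-preserving morphisms.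
   Formalization: Morphisms of coherent monoids must also send finite projections to finite projections (else {0,1} is initial and the claim fails for k=1,3); preserving binary meets means either meet exists iff the other does and they agree; order ideals are non-empty. *)

theory Defs
  imports "HOL-Algebra.Complete_Lattice" "HOL-Library.FuncSet"
begin

section \<open>Frames and distributive lattices\<close>

definition frame :: "('a, 'b) gorder_scheme \<Rightarrow> bool" where
  "frame L \<longleftrightarrow> complete_lattice L \<and>
     (\<forall>a\<in>carrier L. \<forall>M\<subseteq>carrier L. a \<sqinter>\<^bsub>L\<^esub> (\<Squnion>\<^bsub>L\<^esub> M) = \<Squnion>\<^bsub>L\<^esub> ((\<lambda>m. a \<sqinter>\<^bsub>L\<^esub> m) ` M))"

definition finite_element :: "('a, 'b) gorder_scheme \<Rightarrow> 'a \<Rightarrow> bool" where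
  "finite_element L a \<longleftrightarrow> a \<in> carrier L \<and>
     (\<forall>M\<subseteq>carrier L. a = \<Squnion>\<^bsub>L\<^esub> M \<longrightarrow> (\<exists>F\<subseteq>M. finite F \<and> a = \<Squnion>\<^bsub>L\<^esub> F))"

definition coherent_frame :: "('a, 'b) gorder_scheme \<Rightarrow> bool" where
  "coherent_frame L \<longleftrightarrow> frame L \<and>
     (\<forall>a\<in>carrier L. \<exists>M\<subseteq>{m. finite_element L m}. a = \<Squnion>\<^bsub>L\<^esub> M) \<and>
     (\<forall>a b. finite_element L a \<and> finite_element L b \<longrightarrow> finite_element L (a \<sqinter>\<^bsub>L\<^esub> b))"

definition frame_morphism ::
  "('a, 'c) gorder_scheme \<Rightarrow> ('b, 'd) gorder_scheme \<Rightarrow> ('a \<Rightarrow> 'b) \<Rightarrow> bool" where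
  "frame_morphism L M f \<longleftrightarrow> f \<in> carrier L \<rightarrow> carrier M \<and>
     (\<forall>X\<subseteq>carrier L. f (\<Squnion>\<^bsub>L\<^esub> X) = \<Squnion>\<^bsub>M\<^esub> (f ` X)) \<and>
     (\<forall>x\<in>carrier L. \<forall>y\<in>carrier L. f (x \<sqinter>\<^bsub>L\<^esub> y) = f x \<sqinter>\<^bsub>M\<^esub> f y) \<and>
     f \<top>\<^bsub>L\<^esub> = \<top>\<^bsub>M\<^esub>"

text \<open>Distributive lattices have a bottom but not necessarily a top; for morphisms the
  preservation of a top is replaced by cofinality of the image.\<close>

definition distributive_lattice :: "('a, 'b) gorder_scheme \<Rightarrow> bool" where
  "distributive_lattice L \<longleftrightarrow> lattice L \<and> weak_partial_order_bottom L \<and>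
     (\<forall>x\<in>carrier L. \<forall>y\<in>carrier L. \<forall>z\<in>carrier L.
        x \<sqinter>\<^bsub>L\<^esub> (y \<squnion>\<^bsub>L\<^esub> z) = (x \<sqinter>\<^bsub>L\<^esub> y) \<squnion>\<^bsub>L\<^esub> (x \<sqinter>\<^bsub>L\<^esub> z))"

definition distributive_lattice_morphism ::
  "('a, 'c) gorder_scheme \<Rightarrow> ('b, 'd) gorder_scheme \<Rightarrow> ('a \<Rightarrow> 'b) \<Rightarrow> bool" where
  "distributive_lattice_morphism L M f \<longleftrightarrow> f \<in> carrier L \<rightarrow> carrier M \<and>
     f \<bottom>\<^bsub>L\<^esub> = \<bottom>\<^bsub>M\<^esub> \<and>
     (\<forall>x\<in>carrier L. \<forall>y\<in>carrier L. f (x \<squnion>\<^bsub>L\<^esub> y) = f x \<squnion>\<^bsub>M\<^esub> f y) \<and>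
     (\<forall>x\<in>carrier L. \<forall>y\<in>carrier L. f (x \<sqinter>\<^bsub>L\<^esub> y) = f x \<sqinter>\<^bsub>M\<^esub> f y) \<and>
     (\<forall>a\<in>carrier M. \<exists>b\<in>carrier L. a \<sqsubseteq>\<^bsub>M\<^esub> f b)"


section \<open>Restriction semigroups\<close>

record 'a rsemigroup = "'a partial_object" +
  rmult :: "'a \<Rightarrow> 'a \<Rightarrow> 'a"  (infixl "\<odot>\<index>" 70)
  proj :: "'a set"
  lam :: "'a \<Rightarrow> 'a"
  rho :: "'a \<Rightarrow> 'a"

locale ehresmann_semigroup =
  fixes S :: "('a, 'b) rsemigroup_scheme" (structure)
  assumes mult_closed: "\<lbrakk>a \<in> carrier S; b \<in> carrier S\<rbrakk> \<Longrightarrow> a \<odot> b \<in> carrier S"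
    and mult_assoc:
      "\<lbrakk>a \<in> carrier S; b \<in> carrier S; c \<in> carrier S\<rbrakk> \<Longrightarrow> (a \<odot> b) \<odot> c = a \<odot> (b \<odot> c)"
    and proj_subset: "proj S \<subseteq> carrier S"
    and proj_nonempty: "proj S \<noteq> {}"
    and proj_idem: "f \<in> proj S \<Longrightarrow> f \<odot> f = f"
    and proj_closed: "\<lbrakk>f \<in> proj S; g \<in> proj S\<rbrakk> \<Longrightarrow> f \<odot> g \<in> proj S"
    and proj_comm: "\<lbrakk>f \<in> proj S; g \<in> proj S\<rbrakk> \<Longrightarrow> f \<odot> g = g \<odot> f"
    and lam_closed: "a \<in> carrier S \<Longrightarrow> lam S a \<in> proj S"
    and rho_closed: "a \<in> carrier S \<Longrightarrow> rho S a \<in> proj S"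
    and lam_proj: "f \<in> proj S \<Longrightarrow> lam S f = f"
    and rho_proj: "f \<in> proj S \<Longrightarrow> rho S f = f"
    and mult_lam: "a \<in> carrier S \<Longrightarrow> a \<odot> lam S a = a"
    and rho_mult: "a \<in> carrier S \<Longrightarrow> rho S a \<odot> a = a"
    and lam_lam_mult:
      "\<lbrakk>a \<in> carrier S; b \<in> carrier S\<rbrakk> \<Longrightarrow> lam S (lam S a \<odot> b) = lam S (a \<odot> b)"
    and rho_mult_rho:
      "\<lbrakk>a \<in> carrier S; b \<in> carrier S\<rbrakk> \<Longrightarrow> rho S (a \<odot> rho S b) = rho S (a \<odot> b)"

locale restriction_semigroup = ehresmann_semigroup +
  assumes left_restriction: "\<lbrakk>a \<in> carrier S; f \<in> proj S\<rbrakk> \<Longrightarrow> f \<odot> a = a \<odot> lam S (f \<odot> a)"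
    and right_restriction: "\<lbrakk>a \<in> carrier S; f \<in> proj S\<rbrakk> \<Longrightarrow> a \<odot> f = rho S (a \<odot> f) \<odot> a"

definition natural_order :: "('a, 'b) rsemigroup_scheme \<Rightarrow> 'a gorder" where
  "natural_order S = \<lparr>carrier = carrier S, eq = (=),
     le = (\<lambda>a b. \<exists>g\<in>proj S. \<exists>f\<in>proj S. a = g \<odot>\<^bsub>S\<^esub> b \<and> a = b \<odot>\<^bsub>S\<^esub> f)\<rparr>"

text \<open>In a monoid with identity \<open>e\<close> the projections form the principal ideal
  \<open>{x. x \<le> e}\<close>, so this is then the order on that ideal.\<close>

definition proj_order :: "('a, 'b) rsemigroup_scheme \<Rightarrow> 'a gorder" where
  "proj_order S = (natural_order S)\<lparr>carrier := proj S\<rparr>"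

definition compatible :: "('a, 'b) rsemigroup_scheme \<Rightarrow> 'a \<Rightarrow> 'a \<Rightarrow> bool" where
  "compatible S a b \<longleftrightarrow> a \<odot>\<^bsub>S\<^esub> lam S b = b \<odot>\<^bsub>S\<^esub> lam S a \<and> rho S b \<odot>\<^bsub>S\<^esub> a = rho S a \<odot>\<^bsub>S\<^esub> b"

definition compatible_set :: "('a, 'b) rsemigroup_scheme \<Rightarrow> 'a set \<Rightarrow> bool" where
  "compatible_set S X \<longleftrightarrow> X \<noteq> {} \<and> X \<subseteq> carrier S \<and> (\<forall>a\<in>X. \<forall>b\<in>X. compatible S a b)"

definition order_ideal :: "('a, 'b) rsemigroup_scheme \<Rightarrow> 'a set \<Rightarrow> bool" where
  "order_ideal S A \<longleftrightarrow> A \<noteq> {} \<and> A \<subseteq> carrier S \<and>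
     (\<forall>a\<in>A. \<forall>b\<in>carrier S. b \<sqsubseteq>\<^bsub>natural_order S\<^esub> a \<longrightarrow> b \<in> A)"

definition rs_hom ::
  "('a, 'c) rsemigroup_scheme \<Rightarrow> ('b, 'd) rsemigroup_scheme \<Rightarrow> ('a \<Rightarrow> 'b) \<Rightarrow> bool" where
  "rs_hom S T f \<longleftrightarrow> f \<in> carrier S \<rightarrow>\<^sub>E carrier T \<and>
     (\<forall>a\<in>carrier S. \<forall>b\<in>carrier S. f (a \<odot>\<^bsub>S\<^esub> b) = f a \<odot>\<^bsub>T\<^esub> f b) \<and>
     (\<forall>a\<in>carrier S. f (lam S a) = lam T (f a)) \<and>
     (\<forall>a\<in>carrier S. f (rho S a) = rho T (f a))"


section \<open>Complete restriction monoids\<close>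

definition complete_restriction_monoid :: "('a, 'b) rsemigroup_scheme \<Rightarrow> bool" where
  "complete_restriction_monoid S \<longleftrightarrow> restriction_semigroup S \<and>
     (\<exists>e\<in>carrier S. \<forall>a\<in>carrier S. e \<odot>\<^bsub>S\<^esub> a = a \<and> a \<odot>\<^bsub>S\<^esub> e = a) \<and>
     frame (proj_order S) \<and>
     (\<forall>X. compatible_set S X \<longrightarrow> (\<exists>s. is_lub (natural_order S) s X))"

definition Lvee :: "('a, 'b) rsemigroup_scheme \<Rightarrow> 'a set gorder" where
  "Lvee S = \<lparr>carrier = {A. order_ideal S A \<and>
       (\<forall>X\<subseteq>A. compatible_set S X \<longrightarrow> (\<forall>s. is_lub (natural_order S) s X \<longrightarrow> s \<in> A))},
     eq = (=), le = (\<subseteq>)\<rparr>"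

definition coherent_crm :: "('a, 'b) rsemigroup_scheme \<Rightarrow> bool" where
  "coherent_crm S \<longleftrightarrow> complete_restriction_monoid S \<and> coherent_frame (proj_order S)"

definition strongly_coherent_crm :: "('a, 'b) rsemigroup_scheme \<Rightarrow> bool" where
  "strongly_coherent_crm S \<longleftrightarrow> complete_restriction_monoid S \<and> coherent_frame (Lvee S)"

definition crm_morphism ::
  "('a, 'c) rsemigroup_scheme \<Rightarrow> ('b, 'd) rsemigroup_scheme \<Rightarrow> ('a \<Rightarrow> 'b) \<Rightarrow> bool" where
  "crm_morphism S T f \<longleftrightarrow> rs_hom S T f \<and> frame_morphism (proj_order S) (proj_order T) f"

definition crm_proper ::
  "('a, 'c) rsemigroup_scheme \<Rightarrow> ('b, 'd) rsemigroup_scheme \<Rightarrow> ('a \<Rightarrow> 'b) \<Rightarrow> bool" where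
  "crm_proper S T f \<longleftrightarrow> (\<forall>t\<in>carrier T. \<exists>X\<subseteq>carrier T. is_lub (natural_order T) t X \<and>
     (\<forall>x\<in>X. \<exists>s\<in>carrier S. x \<sqsubseteq>\<^bsub>natural_order T\<^esub> f s))"

text \<open>A complete restriction monoid need not have a zero, so the binary meet is a partial
  operation. Preserving it means \<open>f (a \<and> b) = f a \<and> f b\<close>, where either side
  exists if the other does. If all binary meets of the source exist, as in the presence of a
  zero, this is the usual condition.\<close>

definition crm_meet_preserving ::
  "('a, 'c) rsemigroup_scheme \<Rightarrow> ('b, 'd) rsemigroup_scheme \<Rightarrow> ('a \<Rightarrow> 'b) \<Rightarrow> bool" where
  "crm_meet_preserving S T f \<longleftrightarrow> (\<forall>a\<in>carrier S. \<forall>b\<in>carrier S. \<forall>m.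
     is_glb (natural_order T) m {f a, f b} \<longleftrightarrow>
     (\<exists>c. is_glb (natural_order S) c {a, b} \<and> m = f c))"

text \<open>Morphisms between coherent objects are required to be coherent, that is, their
  restriction to projections maps finite elements to finite elements, as is customary for
  coherent frames. Without this condition the monoid \<open>{0, 1}\<close> would be an initial
  object for \<open>k = 1\<close>, whereas distributive restriction semigroups have none.\<close>

definition preserves_finite_projections ::
  "('a, 'c) rsemigroup_scheme \<Rightarrow> ('b, 'd) rsemigroup_scheme \<Rightarrow> ('a \<Rightarrow> 'b) \<Rightarrow> bool" where
  "preserves_finite_projections S T f \<longleftrightarrow>
     (\<forall>a. finite_element (proj_order S) a \<longrightarrow> finite_element (proj_order T) (f a))"

text \<open>The types: 1 all, 2 proper, 3 meet-preserving, 4 proper and meet-preserving.\<close>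

definition crm_hom ::
  "nat \<Rightarrow> ('a, 'c) rsemigroup_scheme \<Rightarrow> ('b, 'd) rsemigroup_scheme \<Rightarrow> ('a \<Rightarrow> 'b) \<Rightarrow> bool" where
  "crm_hom k S T f \<longleftrightarrow> crm_morphism S T f \<and> preserves_finite_projections S T f \<and>
     (k \<in> {2, 4} \<longrightarrow> crm_proper S T f) \<and> (k \<in> {3, 4} \<longrightarrow> crm_meet_preserving S T f)"


section \<open>Distributive restriction semigroups\<close>

definition distributive_rs :: "('a, 'b) rsemigroup_scheme \<Rightarrow> bool" where
  "distributive_rs S \<longleftrightarrow> restriction_semigroup S \<and> distributive_lattice (proj_order S) \<and>
     (\<forall>X. finite X \<and> compatible_set S X \<longrightarrow> (\<exists>s. is_lub (natural_order S) s X))"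

definition distributive_meet_rs :: "('a, 'b) rsemigroup_scheme \<Rightarrow> bool" where
  "distributive_meet_rs S \<longleftrightarrow> distributive_rs S \<and>
     (\<forall>a\<in>carrier S. \<forall>b\<in>carrier S. \<exists>m. is_glb (natural_order S) m {a, b})"

definition drs_morphism ::
  "('a, 'c) rsemigroup_scheme \<Rightarrow> ('b, 'd) rsemigroup_scheme \<Rightarrow> ('a \<Rightarrow> 'b) \<Rightarrow> bool" where
  "drs_morphism S T f \<longleftrightarrow>
     rs_hom S T f \<and> distributive_lattice_morphism (proj_order S) (proj_order T) f"

definition drs_proper ::
  "('a, 'c) rsemigroup_scheme \<Rightarrow> ('b, 'd) rsemigroup_scheme \<Rightarrow> ('a \<Rightarrow> 'b) \<Rightarrow> bool" where
  "drs_proper S T f \<longleftrightarrow> (\<forall>t\<in>carrier T. \<exists>(n::nat) t' s'. 1 \<le> n \<and>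
     (\<forall>i\<in>{1..n}. t' i \<in> carrier T \<and> s' i \<in> carrier S \<and> t' i \<sqsubseteq>\<^bsub>natural_order T\<^esub> f (s' i)) \<and>
     is_lub (natural_order T) t (t' ` {1..n}))"

definition drs_weakly_meet_preserving ::
  "('a, 'c) rsemigroup_scheme \<Rightarrow> ('b, 'd) rsemigroup_scheme \<Rightarrow> ('a \<Rightarrow> 'b) \<Rightarrow> bool" where
  "drs_weakly_meet_preserving S T f \<longleftrightarrow>
     (\<forall>t\<in>carrier T. \<forall>a\<in>carrier S. \<forall>b\<in>carrier S.
        t \<sqsubseteq>\<^bsub>natural_order T\<^esub> f a \<and> t \<sqsubseteq>\<^bsub>natural_order T\<^esub> f b \<longrightarrow>
        (\<exists>c\<in>carrier S. c \<sqsubseteq>\<^bsub>natural_order S\<^esub> a \<and> c \<sqsubseteq>\<^bsub>natural_order S\<^esub> b \<and>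
           t \<sqsubseteq>\<^bsub>natural_order T\<^esub> f c))"

definition drs_hom ::
  "nat \<Rightarrow> ('a, 'c) rsemigroup_scheme \<Rightarrow> ('b, 'd) rsemigroup_scheme \<Rightarrow> ('a \<Rightarrow> 'b) \<Rightarrow> bool" where
  "drs_hom k S T f \<longleftrightarrow> drs_morphism S T f \<and>
     (k \<in> {2, 4} \<longrightarrow> drs_proper S T f) \<and> (k \<in> {3, 4} \<longrightarrow> drs_weakly_meet_preserving S T f)"


section \<open>Categories, functors and natural isomorphisms\<close>

text \<open>Hom-sets need not be disjoint, so identities, composition and the action of a functor
  on arrows are indexed by the objects involved; \<open>Comp C X Y Z g f\<close> is \<open>g\<close>
  after \<open>f\<close>.\<close>

record ('o, 'm) cat =
  Obj :: "'o set"
  Hom :: "'o \<Rightarrow> 'o \<Rightarrow> 'm set"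
  Ident :: "'o \<Rightarrow> 'm"
  Comp :: "'o \<Rightarrow> 'o \<Rightarrow> 'o \<Rightarrow> 'm \<Rightarrow> 'm \<Rightarrow> 'm"

definition is_category :: "('o, 'm) cat \<Rightarrow> bool" where
  "is_category C \<longleftrightarrow>
     (\<forall>X\<in>Obj C. Ident C X \<in> Hom C X X) \<and>
     (\<forall>X\<in>Obj C. \<forall>Y\<in>Obj C. \<forall>Z\<in>Obj C. \<forall>f\<in>Hom C X Y. \<forall>g\<in>Hom C Y Z.
        Comp C X Y Z g f \<in> Hom C X Z) \<and>
     (\<forall>X\<in>Obj C. \<forall>Y\<in>Obj C. \<forall>f\<in>Hom C X Y.
        Comp C X X Y f (Ident C X) = f \<and> Comp C X Y Y (Ident C Y) f = f) \<and>
     (\<forall>W\<in>Obj C. \<forall>X\<in>Obj C. \<forall>Y\<in>Obj C. \<forall>Z\<in>Obj C.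
        \<forall>f\<in>Hom C W X. \<forall>g\<in>Hom C X Y. \<forall>h\<in>Hom C Y Z.
        Comp C W X Z (Comp C X Y Z h g) f = Comp C W Y Z h (Comp C W X Y g f))"

record ('o, 'm, 'p, 'n) fctr =
  on_obj :: "'o \<Rightarrow> 'p"
  on_arr :: "'o \<Rightarrow> 'o \<Rightarrow> 'm \<Rightarrow> 'n"

definition is_functor ::
  "('o, 'm) cat \<Rightarrow> ('p, 'n) cat \<Rightarrow> ('o, 'm, 'p, 'n) fctr \<Rightarrow> bool" where
  "is_functor C D F \<longleftrightarrow>
     (\<forall>X\<in>Obj C. on_obj F X \<in> Obj D) \<and>
     (\<forall>X\<in>Obj C. \<forall>Y\<in>Obj C. \<forall>f\<in>Hom C X Y.
        on_arr F X Y f \<in> Hom D (on_obj F X) (on_obj F Y)) \<and>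
     (\<forall>X\<in>Obj C. on_arr F X X (Ident C X) = Ident D (on_obj F X)) \<and>
     (\<forall>X\<in>Obj C. \<forall>Y\<in>Obj C. \<forall>Z\<in>Obj C. \<forall>f\<in>Hom C X Y. \<forall>g\<in>Hom C Y Z.
        on_arr F X Z (Comp C X Y Z g f) =
        Comp D (on_obj F X) (on_obj F Y) (on_obj F Z) (on_arr F Y Z g) (on_arr F X Y f))"

definition fctr_comp ::
  "('p, 'n, 'q, 'k) fctr \<Rightarrow> ('o, 'm, 'p, 'n) fctr \<Rightarrow> ('o, 'm, 'q, 'k) fctr"
  (infixr "\<circ>\<^sub>F" 75) where
  "G \<circ>\<^sub>F F = \<lparr>on_obj = (\<lambda>X. on_obj G (on_obj F X)),
     on_arr = (\<lambda>X Y f. on_arr G (on_obj F X) (on_obj F Y) (on_arr F X Y f))\<rparr>"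

definition is_iso :: "('o, 'm) cat \<Rightarrow> 'o \<Rightarrow> 'o \<Rightarrow> 'm \<Rightarrow> bool" where
  "is_iso C X Y f \<longleftrightarrow> f \<in> Hom C X Y \<and>
     (\<exists>g\<in>Hom C Y X. Comp C X Y X g f = Ident C X \<and> Comp C Y X Y f g = Ident C Y)"

definition naturally_isomorphic ::
  "('o, 'm) cat \<Rightarrow> ('p, 'n) cat \<Rightarrow> ('o, 'm, 'p, 'n) fctr \<Rightarrow> ('o, 'm, 'p, 'n) fctr \<Rightarrow> bool" where
  "naturally_isomorphic C D F G \<longleftrightarrow>
     (\<exists>\<eta>. (\<forall>X\<in>Obj C. is_iso D (on_obj F X) (on_obj G X) (\<eta> X)) \<and>
       (\<forall>X\<in>Obj C. \<forall>Y\<in>Obj C. \<forall>f\<in>Hom C X Y.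
          Comp D (on_obj F X) (on_obj F Y) (on_obj G Y) (\<eta> Y) (on_arr F X Y f) =
          Comp D (on_obj F X) (on_obj G X) (on_obj G Y) (on_arr G X Y f) (\<eta> X)))"

definition fully_faithful ::
  "('o, 'm) cat \<Rightarrow> ('p, 'n) cat \<Rightarrow> ('o, 'm, 'p, 'n) fctr \<Rightarrow> bool" where
  "fully_faithful C D F \<longleftrightarrow> (\<forall>X\<in>Obj C. \<forall>Y\<in>Obj C.
     bij_betw (on_arr F X Y) (Hom C X Y) (Hom D (on_obj F X) (on_obj F Y)))"

text \<open>A type variable plays the role of a universe, and the completion of a semigroup
  carried by \<open>'a\<close> is carried by \<open>'a set\<close>. Thus no HOL type contains
  the objects of both categories together with their completions, and an equivalence has to be
  expressed across the two universes \<open>'a\<close> and \<open>'a set\<close>.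
  Here \<open>C\<close>, \<open>D\<close> are the two categories over \<open>'a\<close>,
  and \<open>C'\<close>, \<open>D'\<close> the same categories over \<open>'a set\<close>;
  \<open>I\<close>, \<open>J\<close> are the universe lifts, replacing a structure by its copy
  along \<open>x \<mapsto> {x}\<close>. The functors \<open>F\<close>, \<open>F'\<close>
  are meant to be the instances of one polymorphic functor at the two types. Up to the lifts, the
  definition then says that \<open>F\<close> and \<open>G\<close> are functors whose composites
  are naturally isomorphic to the identity functors.\<close>

definition equivalence_across_universes ::
  "('o, 'm) cat \<Rightarrow> ('o1, 'm1) cat \<Rightarrow> ('p, 'n) cat \<Rightarrow> ('p1, 'n1) cat \<Rightarrow>
   ('o, 'm, 'o1, 'm1) fctr \<Rightarrow> ('p, 'n, 'p1, 'n1) fctr \<Rightarrow>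
   ('o, 'm, 'p, 'n) fctr \<Rightarrow> ('o1, 'm1, 'p1, 'n1) fctr \<Rightarrow> ('p, 'n, 'o1, 'm1) fctr \<Rightarrow> bool" where
  "equivalence_across_universes C C' D D' I J F F' G \<longleftrightarrow>
     is_category C \<and> is_category C' \<and> is_category D \<and> is_category D' \<and>
     is_functor C C' I \<and> fully_faithful C C' I \<and>
     is_functor D D' J \<and> fully_faithful D D' J \<and>
     is_functor C D F \<and> is_functor C' D' F' \<and> is_functor D C' G \<and>
     naturally_isomorphic C C' (G \<circ>\<^sub>F F) I \<and>
     naturally_isomorphic D D' (F' \<circ>\<^sub>F G) J"


section \<open>The four categories, finite part and completion\<close>

definition concrete_cat ::
  "('a rsemigroup \<Rightarrow> bool) \<Rightarrow> ('a rsemigroup \<Rightarrow> 'a rsemigroup \<Rightarrow> ('a \<Rightarrow> 'a) \<Rightarrow> bool) \<Rightarrow>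
   ('a rsemigroup, 'a \<Rightarrow> 'a) cat" where
  "concrete_cat P H = \<lparr>Obj = {S. P S}, Hom = (\<lambda>S T. {f. H S T f}),
     Ident = (\<lambda>S. restrict id (carrier S)),
     Comp = (\<lambda>S T U g f. compose (carrier S) g f)\<rparr>"

definition coherent_cat :: "nat \<Rightarrow> ('a rsemigroup, 'a \<Rightarrow> 'a) cat" where
  "coherent_cat k = concrete_cat coherent_crm (crm_hom k)"

definition strongly_coherent_cat :: "nat \<Rightarrow> ('a rsemigroup, 'a \<Rightarrow> 'a) cat" where
  "strongly_coherent_cat k = concrete_cat strongly_coherent_crm (crm_hom k)"

definition distributive_cat :: "nat \<Rightarrow> ('a rsemigroup, 'a \<Rightarrow> 'a) cat" where
  "distributive_cat k = concrete_cat distributive_rs (drs_hom k)"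

definition distributive_meet_cat :: "nat \<Rightarrow> ('a rsemigroup, 'a \<Rightarrow> 'a) cat" where
  "distributive_meet_cat k = concrete_cat distributive_meet_rs (drs_hom k)"

definition lift_rs :: "'a rsemigroup \<Rightarrow> 'a set rsemigroup" where
  "lift_rs S = \<lparr>carrier = (\<lambda>x. {x}) ` carrier S,
     rmult = (\<lambda>A B. {the_elem A \<odot>\<^bsub>S\<^esub> the_elem B}),
     proj = (\<lambda>x. {x}) ` proj S,
     lam = (\<lambda>A. {lam S (the_elem A)}),
     rho = (\<lambda>A. {rho S (the_elem A)})\<rparr>"

definition lift_functor ::
  "('a rsemigroup, 'a \<Rightarrow> 'a, 'a set rsemigroup, 'a set \<Rightarrow> 'a set) fctr" where
  "lift_functor = \<lparr>on_obj = lift_rs,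
     on_arr = (\<lambda>S T f. \<lambda>A\<in>carrier (lift_rs S). {f (the_elem A)})\<rparr>"

text \<open>The elements \<open>a\<close> such that \<open>lam a\<close> is finite. As
  \<open>lam a\<close> and \<open>rho a\<close> generate isomorphic principal ideals of projections,
  it is equivalent to require that \<open>rho a\<close> be finite.\<close>

definition finite_part :: "'a rsemigroup \<Rightarrow> 'a rsemigroup" where
  "finite_part S = S\<lparr>
     carrier := {a \<in> carrier S. finite_element (proj_order S) (lam S a)},
     proj := {f. finite_element (proj_order S) f}\<rparr>"

definition finite_part_functor ::
  "('a rsemigroup, 'a \<Rightarrow> 'a, 'a rsemigroup, 'a \<Rightarrow> 'a) fctr" where
  "finite_part_functor = \<lparr>on_obj = finite_part,
     on_arr = (\<lambda>S T f. restrict f (carrier (finite_part S)))\<rparr>"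

text \<open>The completion consists of the compatible order ideals closed under binary joins, with
  elementwise operations.\<close>

definition completion :: "'a rsemigroup \<Rightarrow> 'a set rsemigroup" where
  "completion S =
    (let K = {A. order_ideal S A \<and> compatible_set S A \<and>
               (\<forall>a\<in>A. \<forall>b\<in>A. \<forall>s. is_lub (natural_order S) s {a, b} \<longrightarrow> s \<in> A)}
     in \<lparr>carrier = K,
         rmult = (\<lambda>A B. {a \<odot>\<^bsub>S\<^esub> b | a b. a \<in> A \<and> b \<in> B}),
         proj = {A \<in> K. A \<subseteq> proj S},
         lam = (\<lambda>A. lam S ` A),
         rho = (\<lambda>A. rho S ` A)\<rparr>)"

definition completion_functor ::
  "('a rsemigroup, 'a \<Rightarrow> 'a, 'a set rsemigroup, 'a set \<Rightarrow> 'a set) fctr" where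
  "completion_functor = \<lparr>on_obj = completion,
     on_arr = (\<lambda>S T f. \<lambda>A\<in>carrier (completion S).
       {t \<in> carrier T. \<exists>a\<in>A. t \<sqsubseteq>\<^bsub>natural_order T\<^esub> f a})\<rparr>"

end

theory Submission
  imports Defs
begin

text \<open>
  A coherent frame is the same thing as the distributive lattice of its finite elements, the frame
  being recovered as the ideals of the lattice. The theorem extends this from the projections to the
  whole semigroup, and in both settings the transfer rests on one observation: elements with a common
  upper bound are ordered as their images under \<open>lam\<close> are (\<open>bounded_le_iff\<close>). So an upper
  bound \<open>u\<close> of a set \<open>X\<close> is its join as soon as \<open>lam u\<close> is the join of
  \<open>lam ` X\<close> (\<open>nat_lub_criterion\<close>), and questions about joins in \<open>S\<close> become questions
  about joins of projections. Multiplication and homomorphisms preserve joins for this reason.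
  Moreover \<open>f \<mapsto> rho (a \<odot> f)\<close> maps the projections below \<open>lam a\<close> isomorphically
  onto those below \<open>rho a\<close> (\<open>lam_rho_order_iso\<close>). Hence \<open>lam a\<close> is finite if and
  only if \<open>rho a\<close> is, and the elements with this property form a distributive restriction
  semigroup, the finite part.

  In a coherent monoid each element is the directed join of the finite elements below it, and a finite
  element below a directed join is below a member of the directed set. So \<open>A \<mapsto> \<Squnion>A\<close> is an
  isomorphism from the completion of the finite part to the monoid, with inverse
  \<open>s \<mapsto> fin_below s\<close> (\<open>lub_iso\<close>). Conversely the completion of a distributive
  restriction semigroup consists of its directed lower sets, and inclusion is its natural order. Its
  finite projections are the principal ideals of projections
  (\<open>finite_element_completion_iff\<close>), its finite part consists of all principal ideals, and
  this is a copy of the original semigroup (\<open>principal_iso\<close>).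

  Morphisms are restricted to the finite parts in one direction, and in the other sent to the map that
  takes an ideal to the lower set generated by its image. Properness passes to finite parts because a
  finite element that is covered by a family is covered by finitely many finite elements below its
  members. Weak preservation of meets says that the extension of a morphism to ideals preserves their
  intersections, and these are the meets in the completion whenever they are nonempty.

  Isomorphisms are morphisms of all four types (\<open>iso_crm_hom\<close>, \<open>iso_drs_hom\<close>), and
  \<open>x \<mapsto> {x}\<close> is an isomorphism from a semigroup to its lift. This makes the lifts fully faithful and
  the components \<open>lub_iso\<close> and \<open>principal_iso\<close> invertible in each of the categories.

  The strongly coherent case is the restriction of this equivalence to full subcategories, so only
  objects have to be considered. A member of \<open>Lvee S\<close> below a principal ideal is itself
  principal; thus finite elements of \<open>S\<close> correspond to finite principal ideals, whose
  intersection is finite and principal again, and this yields meets in the finite part. In the other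
  direction \<open>Lvee\<close> of a completion is isomorphic to the frame of lower sets that are closed
  under finite joins (\<open>closed_order_iso\<close>). Its finite elements are the finitely generated ones,
  and the pairwise meets of two finite generating sets generate the intersection
  (\<open>closed_finite_Int\<close>).
\<close>

section \<open>Frames in terms of least upper bounds\<close>

lemma is_lub_iff:
  assumes "X \<subseteq> carrier L"
  shows "is_lub L s X \<longleftrightarrow> s \<in> carrier L \<and> (\<forall>x\<in>X. x \<sqsubseteq>\<^bsub>L\<^esub> s) \<and>
    (\<forall>u\<in>carrier L. (\<forall>x\<in>X. x \<sqsubseteq>\<^bsub>L\<^esub> u) \<longrightarrow> s \<sqsubseteq>\<^bsub>L\<^esub> u)"
  using assms unfolding least_def Upper_def by blast

lemma is_glb_iff:
  assumes "X \<subseteq> carrier L"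
  shows "is_glb L s X \<longleftrightarrow> s \<in> carrier L \<and> (\<forall>x\<in>X. s \<sqsubseteq>\<^bsub>L\<^esub> x) \<and>
    (\<forall>u\<in>carrier L. (\<forall>x\<in>X. u \<sqsubseteq>\<^bsub>L\<^esub> x) \<longrightarrow> u \<sqsubseteq>\<^bsub>L\<^esub> s)"
  using assms unfolding greatest_def Lower_def by blast

context partial_order begin

lemma sup_eqI: "is_lub L s X \<Longrightarrow> \<Squnion>X = s"
  unfolding Lattice.sup_def by (rule some_equality) (auto intro: least_unique)

lemma join_eqI: "is_lub L s {x, y} \<Longrightarrow> x \<squnion> y = s"
  unfolding join_def by (rule sup_eqI)

lemma meet_eqI: "is_glb L s {x, y} \<Longrightarrow> x \<sqinter> y = s"
  unfolding meet_def Lattice.inf_def by (rule some_equality) (auto intro: greatest_unique)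

text \<open>An infimum is obtained as the supremum of the lower bounds.\<close>

lemma complete_latticeI_lub:
  assumes "\<And>X. X \<subseteq> carrier L \<Longrightarrow> \<exists>s. is_lub L s X"
  shows "complete_lattice L"
proof (unfold_locales, fact assms)
  fix A assume A: "A \<subseteq> carrier L"
  have sub: "Lower L A \<subseteq> carrier L" by simp
  then obtain s where "is_lub L s (Lower L A)" using assms by blast
  note s = this[unfolded is_lub_iff[OF sub]]
  have low: "y \<in> Lower L A \<longleftrightarrow> y \<in> carrier L \<and> (\<forall>x\<in>A. y \<sqsubseteq> x)" for y
    using A unfolding Lower_def by blast
  have "is_glb L s A"
    unfolding is_glb_iff[OF A]
  proof (intro conjI ballI impI)
    show "s \<in> carrier L" using s by simp
    show "s \<sqsubseteq> x" if "x \<in> A" for x using s that A low by (meson subsetD)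
    show "u \<sqsubseteq> s" if "u \<in> carrier L" "\<forall>x\<in>A. u \<sqsubseteq> x" for u using s that low by metis
  qed
  then show "\<exists>i. is_glb L i A" ..
qed

text \<open>The step of the induction that turns binary joins into finite ones.\<close>

lemma lub_insert:
  assumes "is_lub L h X" "X \<subseteq> carrier L" "x \<in> carrier L" "is_lub L s {x, h}"
  shows "is_lub L s (insert x X)"
proof -
  have h: "h \<in> carrier L" "\<And>y. y \<in> X \<Longrightarrow> y \<sqsubseteq> h"
    "\<And>u. u \<in> carrier L \<Longrightarrow> \<forall>y\<in>X. y \<sqsubseteq> u \<Longrightarrow> h \<sqsubseteq> u"
    using assms(1)[unfolded is_lub_iff[OF assms(2)]] by blast+
  have sub: "{x, h} \<subseteq> carrier L" "insert x X \<subseteq> carrier L" using h assms by auto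
  have s: "s \<in> carrier L" "x \<sqsubseteq> s" "h \<sqsubseteq> s" "\<And>u. u \<in> carrier L \<Longrightarrow> x \<sqsubseteq> u \<Longrightarrow> h \<sqsubseteq> u \<Longrightarrow> s \<sqsubseteq> u"
    using assms(4)[unfolded is_lub_iff[OF sub(1)]] by auto
  have "y \<sqsubseteq> s" if "y \<in> X" for y 
    by (rule le_trans[OF h(2)[OF that] s(3) subsetD[OF assms(2) that] h(1) s(1)])
  then have "\<forall>y\<in>insert x X. y \<sqsubseteq> s" using s(2) by simp
  moreover have "s \<sqsubseteq> u" if "u \<in> carrier L" "\<forall>y\<in>insert x X. y \<sqsubseteq> u" for u
    using s(4)[OF that(1)] h(3)[OF that(1)] that(2) by simp
  ultimately show ?thesis unfolding is_lub_iff[OF sub(2)] using s(1) by simp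
qed

lemma latticeI_lub_glb:
  assumes "\<And>x y. x \<in> carrier L \<Longrightarrow> y \<in> carrier L \<Longrightarrow> \<exists>s. is_lub L s {x, y}"
    and "\<And>x y. x \<in> carrier L \<Longrightarrow> y \<in> carrier L \<Longrightarrow> \<exists>s. is_glb L s {x, y}"
  shows "lattice L"
  by (unfold_locales) (auto intro: assms)

text \<open>The operations \<open>\<Squnion>\<close> and \<open>\<sqinter>\<close> are given by a choice that depends on
  the order, whereas least upper bounds and greatest lower bounds are transported directly along order
  isomorphisms and restricted to suborders. Frames, finite elements and coherent frames are therefore
  restated in these terms.\<close>

lemma frame_iff:
  "frame L \<longleftrightarrow> (\<forall>X. X \<subseteq> carrier L \<longrightarrow> (\<exists>s. is_lub L s X)) \<and>
     (\<forall>a\<in>carrier L. \<forall>X. X \<subseteq> carrier L \<longrightarrow> (\<forall>s. is_lub L s X \<longrightarrow> (\<forall>m. is_glb L m {a, s} \<longrightarrow>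
        is_lub L m {n. \<exists>x\<in>X. is_glb L n {a, x}})))" (is "_ \<longleftrightarrow> ?A \<and> ?B")
proof (cases "?A")
  case True
  have "complete_lattice L" using True by (intro complete_latticeI_lub) simp
  then interpret complete_lattice L .
  have eq: "{n. \<exists>x\<in>X. is_glb L n {a, x}} = (\<lambda>x. a \<sqinter> x) ` X"
    if "a \<in> carrier L" "X \<subseteq> carrier L" for a X
  proof -
    have "is_glb L (a \<sqinter> x) {a, x}" if "x \<in> X" for x
      unfolding meet_def using that \<open>a \<in> carrier L\<close> \<open>X \<subseteq> carrier L\<close> by (intro inf_glb) auto
    then show ?thesis by (auto dest: meet_eqI)
  qed
  have "?B \<longleftrightarrow> (\<forall>a\<in>carrier L. \<forall>M\<subseteq>carrier L. a \<sqinter> (\<Squnion> M) = \<Squnion> ((\<lambda>m. a \<sqinter> m) ` M))"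
  proof (rule ball_cong[OF HOL.refl], rule all_cong)
    fix a X assume a: "a \<in> carrier L" and X: "X \<subseteq> carrier L"
    have 1: "is_lub L (\<Squnion>X) X" using X by (rule sup_lub)
    have 2: "is_glb L (a \<sqinter> \<Squnion>X) {a, \<Squnion>X}"
      unfolding meet_def using a X by (intro inf_glb) auto
    have 3: "is_lub L (\<Squnion>((\<sqinter>) a ` X)) ((\<sqinter>) a ` X)" using a X by (intro sup_lub) auto
    have "(\<forall>s. is_lub L s X \<longrightarrow> (\<forall>m. is_glb L m {a, s} \<longrightarrow>
        is_lub L m {n. \<exists>x\<in>X. is_glb L n {a, x}})) \<longleftrightarrow> is_lub L (a \<sqinter> \<Squnion>X) ((\<sqinter>) a ` X)"
      unfolding eq[OF a X] using 1 2 sup_eqI[of _ X] meet_eqI[of _ a "\<Squnion>X"] by metis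
    also have "\<dots> \<longleftrightarrow> a \<sqinter> \<Squnion>X = \<Squnion>((\<sqinter>) a ` X)"
      using 3 sup_eqI[of _ "(\<sqinter>) a ` X"] by metis
    finally show "(\<forall>s. is_lub L s X \<longrightarrow> (\<forall>m. is_glb L m {a, s} \<longrightarrow>
        is_lub L m {n. \<exists>x\<in>X. is_glb L n {a, x}})) \<longleftrightarrow> a \<sqinter> \<Squnion>X = \<Squnion>((\<sqinter>) a ` X)" .
  qed
  moreover have "complete_lattice L" by unfold_locales
  ultimately show ?thesis using True unfolding frame_def by blast
next
  case False
  have "\<not> frame L"
  proof
    assume "frame L"
    then interpret complete_lattice L unfolding frame_def by blast
    show False using False sup_exists by blast
  qed
  with False show ?thesis by blast
qed

end

lemma frame_complete: "frame L \<Longrightarrow> complete_lattice L"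
  unfolding frame_def by blast

lemma finite_element_iff:
  fixes L (structure)
  assumes "complete_lattice L"
  shows "finite_element L a \<longleftrightarrow> a \<in> carrier L \<and>
    (\<forall>M. M \<subseteq> carrier L \<longrightarrow> is_lub L a M \<longrightarrow> (\<exists>F. F \<subseteq> M \<and> finite F \<and> is_lub L a F))"
proof -
  interpret complete_lattice L by fact
  have "a = \<Squnion>M \<longleftrightarrow> is_lub L a M" if "M \<subseteq> carrier L" for M
    using that sup_lub sup_eqI by blast
  note 1 = this
  have 2: "(\<exists>F\<subseteq>M. finite F \<and> a = \<Squnion>F) \<longleftrightarrow> (\<exists>F\<subseteq>M. finite F \<and> is_lub L a F)"
    if "M \<subseteq> carrier L" for M
  proof -
    have "F \<subseteq> M \<Longrightarrow> a = \<Squnion>F \<longleftrightarrow> is_lub L a F" for F using 1[of F] that by blast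
    then show ?thesis by metis
  qed
  have "(\<forall>M\<subseteq>carrier L. a = \<Squnion>M \<longrightarrow> (\<exists>F\<subseteq>M. finite F \<and> a = \<Squnion>F)) \<longleftrightarrow>
      (\<forall>M\<subseteq>carrier L. is_lub L a M \<longrightarrow> (\<exists>F\<subseteq>M. finite F \<and> is_lub L a F))"
  proof (rule all_cong)
    fix M assume M: "M \<subseteq> carrier L"
    show "(a = \<Squnion>M \<longrightarrow> (\<exists>F\<subseteq>M. finite F \<and> a = \<Squnion>F)) \<longleftrightarrow>
      (is_lub L a M \<longrightarrow> (\<exists>F\<subseteq>M. finite F \<and> is_lub L a F))"
      unfolding 1[OF M] 2[OF M] ..
  qed
  then show ?thesis unfolding finite_element_def by blast
qed

lemma coherent_frame_iff:
  fixes L (structure)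
  assumes "complete_lattice L"
  shows "coherent_frame L \<longleftrightarrow> frame L \<and>
     (\<forall>a\<in>carrier L. \<exists>M. M \<subseteq> {m \<in> carrier L. finite_element L m} \<and> is_lub L a M) \<and>
     (\<forall>a\<in>carrier L. \<forall>b\<in>carrier L. \<forall>m. finite_element L a \<longrightarrow> finite_element L b \<longrightarrow>
        is_glb L m {a, b} \<longrightarrow> finite_element L m)"
proof -
  interpret complete_lattice L by fact
  have fin: "finite_element L a \<Longrightarrow> a \<in> carrier L" for a by (simp add: finite_element_def)
  have 1: "a = \<Squnion>M \<longleftrightarrow> is_lub L a M" if "M \<subseteq> carrier L" for M a
    using that sup_lub sup_eqI by blast
  have 2: "is_glb L m {a, b} \<longleftrightarrow> m = a \<sqinter> b" if "a \<in> carrier L" "b \<in> carrier L" for m a b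
  proof
    have "is_glb L (a \<sqinter> b) {a, b}" unfolding meet_def using that by (intro inf_glb) simp
    then show "m = a \<sqinter> b \<Longrightarrow> is_glb L m {a, b}" by simp
  qed (simp add: meet_eqI)
  have 3: "M \<subseteq> {m. finite_element L m} \<and> a = \<Squnion>M \<longleftrightarrow>
       M \<subseteq> {m \<in> carrier L. finite_element L m} \<and> is_lub L a M" for a M
    using 1[of M a] fin by blast
  have 4: "(finite_element L a \<and> finite_element L b \<longrightarrow> finite_element L (a \<sqinter> b)) \<longleftrightarrow>
     (a \<in> carrier L \<longrightarrow> b \<in> carrier L \<longrightarrow> (\<forall>m. finite_element L a \<longrightarrow> finite_element L b \<longrightarrow>
        is_glb L m {a, b} \<longrightarrow> finite_element L m))" for a b
    using 2[of a b] fin by metis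
  have A: "(\<exists>M\<subseteq>{m. finite_element L m}. a = \<Squnion>M) \<longleftrightarrow>
     (\<exists>M. M \<subseteq> {m \<in> carrier L. finite_element L m} \<and> is_lub L a M)" for a
    using 3 by (intro ex_cong1)
  have B: "(\<forall>a b. finite_element L a \<and> finite_element L b \<longrightarrow> finite_element L (a \<sqinter> b)) \<longleftrightarrow>
     (\<forall>a\<in>carrier L. \<forall>b\<in>carrier L. \<forall>m. finite_element L a \<longrightarrow> finite_element L b \<longrightarrow>
        is_glb L m {a, b} \<longrightarrow> finite_element L m)"
    unfolding 4 by blast
  show ?thesis unfolding coherent_frame_def A B ..
qed

section \<open>Finite elements of frames\<close>

lemma finite_element_carrier: "finite_element L k \<Longrightarrow> k \<in> carrier L"
  by (simp add: finite_element_def)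

text \<open>The members of \<open>M\<close> are below \<open>k\<close> anyway, so \<open>k\<close> is the join of a finite
  \<open>F \<subseteq> M\<close> once it is below all upper bounds of \<open>F\<close>.\<close>

lemma finite_elementI:
  assumes L: "complete_lattice L" and k: "k \<in> carrier L"
    and cov: "\<And>M. M \<subseteq> carrier L \<Longrightarrow> is_lub L k M \<Longrightarrow>
      \<exists>F. F \<subseteq> M \<and> finite F \<and> (\<forall>u\<in>carrier L. (\<forall>x\<in>F. x \<sqsubseteq>\<^bsub>L\<^esub> u) \<longrightarrow> k \<sqsubseteq>\<^bsub>L\<^esub> u)"
  shows "finite_element L k"
  unfolding finite_element_iff[OF L]
proof (intro conjI allI impI k)
  fix M assume M: "M \<subseteq> carrier L" "is_lub L k M"
  then obtain F where F: "F \<subseteq> M" "finite F" "\<forall>u\<in>carrier L. (\<forall>x\<in>F. x \<sqsubseteq>\<^bsub>L\<^esub> u) \<longrightarrow> k \<sqsubseteq>\<^bsub>L\<^esub> u"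
    using cov by metis
  have "F \<subseteq> carrier L" using F M by blast
  moreover have "\<forall>x\<in>M. x \<sqsubseteq>\<^bsub>L\<^esub> k" using M(2)[unfolded is_lub_iff[OF M(1)]] by blast
  ultimately have "is_lub L k F" using F k by (subst is_lub_iff) blast+
  then show "\<exists>F. F \<subseteq> M \<and> finite F \<and> is_lub L k F" using F by blast
qed

text \<open>In a frame finiteness is inherited by inequalities: \<open>k \<le> \<Squnion>M\<close> becomes the equation
  \<open>k = \<Squnion>{k \<sqinter> m | m \<in> M}\<close> by distributivity. The conclusion refers to upper bounds
  instead of a join of \<open>F\<close>, which spares the choice of that join when it is used.\<close>

lemma finite_element_cover:
  assumes L: "frame L" and k: "finite_element L k"
    and M: "M \<subseteq> carrier L" "is_lub L s M" and le: "k \<sqsubseteq>\<^bsub>L\<^esub> s"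
  shows "\<exists>F. F \<subseteq> M \<and> finite F \<and> (\<forall>u\<in>carrier L. (\<forall>x\<in>F. x \<sqsubseteq>\<^bsub>L\<^esub> u) \<longrightarrow> k \<sqsubseteq>\<^bsub>L\<^esub> u)"
proof -
  interpret complete_lattice L using L by (rule frame_complete)
  have kc: "k \<in> carrier L" using k by (rule finite_element_carrier)
  have s: "s = \<Squnion>\<^bsub>L\<^esub>M" "s \<in> carrier L" using sup_eqI[OF M(2)] least_closed[OF M(2)] by auto
  have "k \<sqinter>\<^bsub>L\<^esub> s = k"
    by (rule meet_eqI, subst is_glb_iff) (use kc s le in auto)
  moreover have "k \<sqinter>\<^bsub>L\<^esub> s = \<Squnion>\<^bsub>L\<^esub>((\<lambda>m. k \<sqinter>\<^bsub>L\<^esub> m) ` M)"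
    using L kc M(1) unfolding frame_def s by blast
  moreover have "(\<lambda>m. k \<sqinter>\<^bsub>L\<^esub> m) ` M \<subseteq> carrier L" using kc M(1) by auto
  ultimately obtain F' where F': "F' \<subseteq> (\<lambda>m. k \<sqinter>\<^bsub>L\<^esub> m) ` M" "finite F'" "k = \<Squnion>\<^bsub>L\<^esub>F'"
    using k unfolding finite_element_def by metis
  obtain F where F: "F \<subseteq> M" "finite F" "F' = (\<lambda>m. k \<sqinter>\<^bsub>L\<^esub> m) ` F"
    using finite_subset_image[OF F'(2,1)] by blast
  have "k \<sqsubseteq>\<^bsub>L\<^esub> u" if u: "u \<in> carrier L" "\<forall>x\<in>F. x \<sqsubseteq>\<^bsub>L\<^esub> u" for u
  proof -
    have "k \<sqinter>\<^bsub>L\<^esub> x \<sqsubseteq>\<^bsub>L\<^esub> u" if "x \<in> F" for x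
    proof (rule le_trans)
      have x: "x \<in> carrier L" using that F M by blast
      show "k \<sqinter>\<^bsub>L\<^esub> x \<sqsubseteq>\<^bsub>L\<^esub> x" using kc x by (rule meet_right)
      show "x \<sqsubseteq>\<^bsub>L\<^esub> u" using u that by blast
    qed (use kc u that F M in auto)
    moreover have "F' \<subseteq> carrier L" using F kc M by auto
    ultimately have "\<Squnion>\<^bsub>L\<^esub>F' \<sqsubseteq>\<^bsub>L\<^esub> u" using u F(3) by (intro sup_least) auto
    then show ?thesis using F'(3) by simp
  qed
  then show ?thesis using F by blast
qed

lemma finite_element_finite_lub:
  assumes L: "frame L" and X: "finite X" "\<And>x. x \<in> X \<Longrightarrow> finite_element L x" and s: "is_lub L s X"
  shows "finite_element L s"
proof (rule finite_elementI[OF frame_complete[OF L]])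
  have "X \<subseteq> carrier L" using X(2) by (auto dest: finite_element_carrier)
  note s' = s[unfolded is_lub_iff[OF this]]
  show "s \<in> carrier L" using s' by simp
  fix M assume M: "M \<subseteq> carrier L" "is_lub L s M"
  have "\<forall>x\<in>X. \<exists>F. F \<subseteq> M \<and> finite F \<and> (\<forall>u\<in>carrier L. (\<forall>y\<in>F. y \<sqsubseteq>\<^bsub>L\<^esub> u) \<longrightarrow> x \<sqsubseteq>\<^bsub>L\<^esub> u)"
    using finite_element_cover[OF L X(2) M] s' by simp
  from bchoice[OF this] obtain F where F: "\<forall>x\<in>X. F x \<subseteq> M \<and> finite (F x) \<and>
      (\<forall>u\<in>carrier L. (\<forall>y\<in>F x. y \<sqsubseteq>\<^bsub>L\<^esub> u) \<longrightarrow> x \<sqsubseteq>\<^bsub>L\<^esub> u)" by (elim exE)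
  show "\<exists>F. F \<subseteq> M \<and> finite F \<and> (\<forall>u\<in>carrier L. (\<forall>x\<in>F. x \<sqsubseteq>\<^bsub>L\<^esub> u) \<longrightarrow> s \<sqsubseteq>\<^bsub>L\<^esub> u)"
    using F s' X(1) by (intro exI[of _ "\<Union>x\<in>X. F x"]) auto
qed

lemma finite_element_bottom:
  assumes "frame L" "least L z (carrier L)"
  shows "finite_element L z"
  by (rule finite_element_finite_lub[OF assms(1), of "{}"]) (use assms(2) in simp_all)

text \<open>A directed set contains an upper bound of each of its finite subsets.\<close>

lemma finite_element_directed:
  assumes L: "frame L" and k: "finite_element L k"
    and M: "M \<subseteq> carrier L" "is_lub L s M" and le: "k \<sqsubseteq>\<^bsub>L\<^esub> s"
    and ne: "M \<noteq> {}" and dir: "\<And>x y. x \<in> M \<Longrightarrow> y \<in> M \<Longrightarrow> \<exists>z\<in>M. x \<sqsubseteq>\<^bsub>L\<^esub> z \<and> y \<sqsubseteq>\<^bsub>L\<^esub> z"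
  shows "\<exists>m\<in>M. k \<sqsubseteq>\<^bsub>L\<^esub> m"
proof -
  interpret complete_lattice L using L by (rule frame_complete)
  obtain F where F: "F \<subseteq> M" "finite F" "\<forall>u\<in>carrier L. (\<forall>x\<in>F. x \<sqsubseteq>\<^bsub>L\<^esub> u) \<longrightarrow> k \<sqsubseteq>\<^bsub>L\<^esub> u"
    using finite_element_cover[OF L k M le] by blast
  have "\<exists>m\<in>M. \<forall>x\<in>F. x \<sqsubseteq>\<^bsub>L\<^esub> m" using F(2,1)
  proof (induction F)
    case (insert x F)
    then obtain m where m: "m \<in> M" "\<forall>x\<in>F. x \<sqsubseteq>\<^bsub>L\<^esub> m" by auto
    then obtain z where z: "z \<in> M" "x \<sqsubseteq>\<^bsub>L\<^esub> z" "m \<sqsubseteq>\<^bsub>L\<^esub> z" using dir[of x m] insert by auto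
    have "y \<sqsubseteq>\<^bsub>L\<^esub> z" if "y \<in> F" for y
      using le_trans[of y m z] that insert.prems m z M by blast
    then show ?case using z by blast
  qed (use ne in auto)
  then obtain m where m: "m \<in> M" "\<forall>x\<in>F. x \<sqsubseteq>\<^bsub>L\<^esub> m" by blast
  then have "k \<sqsubseteq>\<^bsub>L\<^esub> m" using F(3) M(1) by (meson subsetD)
  then show ?thesis using m(1) by blast
qed

lemma coherent_frame_frame: "coherent_frame L \<Longrightarrow> frame L"
  by (simp add: coherent_frame_def)

lemma coherent_frame_approx:
  assumes L: "coherent_frame L" and a: "a \<in> carrier L"
  shows "is_lub L a {k. finite_element L k \<and> k \<sqsubseteq>\<^bsub>L\<^esub> a}"
proof -
  have C: "complete_lattice L" using L by (simp add: frame_complete coherent_frame_frame)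
  obtain M where M: "M \<subseteq> {m \<in> carrier L. finite_element L m}" "is_lub L a M"
    using L[unfolded coherent_frame_iff[OF C]] a by blast
  have "M \<subseteq> carrier L" using M by blast
  note M' = M(2)[unfolded is_lub_iff[OF this]]
  have sub: "{k. finite_element L k \<and> k \<sqsubseteq>\<^bsub>L\<^esub> a} \<subseteq> carrier L" by (auto dest: finite_element_carrier)
  show ?thesis unfolding is_lub_iff[OF sub] using M(1) M' by blast
qed

definition down_order :: "('a, 'b) gorder_scheme \<Rightarrow> 'a \<Rightarrow> ('a, 'b) gorder_scheme" where
  "down_order L u = L\<lparr>carrier := {x \<in> carrier L. x \<sqsubseteq>\<^bsub>L\<^esub> u}\<rparr>"

lemma down_order_sel [simp]:
  "carrier (down_order L u) = {x \<in> carrier L. x \<sqsubseteq>\<^bsub>L\<^esub> u}"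
  "le (down_order L u) = le L" "eq (down_order L u) = eq L"
  by (simp_all add: down_order_def)

lemma (in partial_order) down_order_partial_order: "partial_order (down_order L u)"
  by unfold_locales (auto intro: le_trans simp: eq_is_equal)

context
  fixes L :: "('a, 'b) gorder_scheme" and u
  assumes L: "complete_lattice L" and u: "u \<in> carrier L"
begin

interpretation complete_lattice L by (rule L)

lemma down_order_lub:
  assumes M: "M \<subseteq> carrier (down_order L u)"
  shows "is_lub (down_order L u) s M \<longleftrightarrow> is_lub L s M"
proof -
  have M': "M \<subseteq> carrier L" using M by auto
  have *: "is_lub (down_order L u) t M" if "is_lub L t M" for t
    using that[unfolded is_lub_iff[OF M']] M u unfolding is_lub_iff[OF M] by auto
  obtain t where t: "is_lub L t M" using sup_exists[OF M'] by blast
  show ?thesis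
    using * t partial_order.least_unique[OF down_order_partial_order] by metis
qed

lemma down_order_complete: "complete_lattice (down_order L u)"
proof (rule partial_order.complete_latticeI_lub[OF down_order_partial_order])
  fix X assume X: "X \<subseteq> carrier (down_order L u)"
  then have "X \<subseteq> carrier L" by auto
  then show "\<exists>s. is_lub (down_order L u) s X" using down_order_lub[OF X] sup_exists by simp
qed

text \<open>A set with join \<open>x \<sqsubseteq> u\<close> lies below \<open>u\<close>, so the same sets have to be
  tested in the frame and in its principal ideal.\<close>

lemma down_order_finite_element:
  "finite_element (down_order L u) x \<longleftrightarrow> finite_element L x \<and> x \<sqsubseteq>\<^bsub>L\<^esub> u"
proof -
  have D: "M \<subseteq> carrier (down_order L u)" if "M \<subseteq> carrier L" "is_lub L x M" "x \<sqsubseteq>\<^bsub>L\<^esub> u" for M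
  proof
    fix m assume m: "m \<in> M"
    have "x \<in> carrier L" using that(2) by (rule least_closed)
    moreover have "m \<sqsubseteq>\<^bsub>L\<^esub> x" using that(2)[unfolded is_lub_iff[OF that(1)]] m by blast
    ultimately show "m \<in> carrier (down_order L u)"
      using le_trans[of m x u] that(1,3) m u by auto
  qed
  show ?thesis
  proof (intro iffI conjI)
    assume A: "finite_element (down_order L u) x"
    then have x: "x \<in> carrier L" "x \<sqsubseteq>\<^bsub>L\<^esub> u" by (auto dest: finite_element_carrier)
    then show "x \<sqsubseteq>\<^bsub>L\<^esub> u" by simp
    show "finite_element L x" unfolding finite_element_iff[OF L]
    proof (intro conjI allI impI)
      fix M assume M: "M \<subseteq> carrier L" "is_lub L x M"
      note DM = D[OF M x(2)]
      then obtain F where "F \<subseteq> M" "finite F" "is_lub (down_order L u) x F"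
        using A[unfolded finite_element_iff[OF down_order_complete]] M down_order_lub[OF DM] by metis
      then show "\<exists>F. F \<subseteq> M \<and> finite F \<and> is_lub L x F"
        using down_order_lub[of F x] DM by (meson subset_trans)
    qed (fact x)
  next
    assume A: "finite_element L x \<and> x \<sqsubseteq>\<^bsub>L\<^esub> u"
    show "finite_element (down_order L u) x"
      unfolding finite_element_iff[OF down_order_complete]
    proof (intro conjI allI impI)
      show "x \<in> carrier (down_order L u)" using A by (auto dest: finite_element_carrier)
      fix M assume M: "M \<subseteq> carrier (down_order L u)" "is_lub (down_order L u) x M"
      moreover have "M \<subseteq> carrier L" using M by auto
      ultimately obtain F where "F \<subseteq> M" "finite F" "is_lub L x F"
        using A[unfolded finite_element_iff[OF L]] down_order_lub[OF M(1)] by metis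
      then show "\<exists>F. F \<subseteq> M \<and> finite F \<and> is_lub (down_order L u) x F"
        using down_order_lub[of F x] M(1) by (meson subset_trans)
    qed
  qed
qed

lemma down_order_glb:
  assumes "a \<in> carrier L" "a \<sqsubseteq>\<^bsub>L\<^esub> u" "b \<in> carrier L" "b \<sqsubseteq>\<^bsub>L\<^esub> u"
  shows "is_glb (down_order L u) m {a, b} \<longleftrightarrow> is_glb L m {a, b}"
proof -
  have 1: "{a, b} \<subseteq> carrier (down_order L u)" "{a, b} \<subseteq> carrier L" using assms by auto
  show ?thesis
    unfolding is_glb_iff[OF 1(1)] is_glb_iff[OF 1(2)]
    using assms u le_trans[of _ a u] by auto
qed

lemma down_order_frame:
  assumes F: "frame L"
  shows "frame (down_order L u)"
  unfolding partial_order.frame_iff[OF down_order_partial_order]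
proof (intro conjI allI impI ballI)
  note F' = F[unfolded frame_iff]
  fix X assume X: "X \<subseteq> carrier (down_order L u)"
  then have X': "X \<subseteq> carrier L" by auto
  then show "\<exists>s. is_lub (down_order L u) s X" using down_order_lub[OF X] sup_exists by simp
next
  note F' = F[unfolded frame_iff]
  fix a X s m
  assume a: "a \<in> carrier (down_order L u)" and X: "X \<subseteq> carrier (down_order L u)"
    and s: "is_lub (down_order L u) s X" and m: "is_glb (down_order L u) m {a, s}"
  have X': "X \<subseteq> carrier L" using X by auto
  have s': "is_lub L s X" using s down_order_lub[OF X] by simp
  have sc: "s \<in> carrier (down_order L u)" using s by (rule least_closed)
  have m': "is_glb L m {a, s}" using m down_order_glb[of a s m] a sc by simp
  have eq: "{n. \<exists>x\<in>X. is_glb (down_order L u) n {a, x}} = {n. \<exists>x\<in>X. is_glb L n {a, x}}"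
    using down_order_glb[of a] a X by (intro Collect_cong bex_cong) auto
  have "{n. \<exists>x\<in>X. is_glb L n {a, x}} \<subseteq> carrier (down_order L u)"
    unfolding eq[symmetric] by (auto dest: greatest_closed)
  from down_order_lub[OF this] show "is_lub (down_order L u) m {n. \<exists>x\<in>X. is_glb (down_order L u) n {a, x}}"
    unfolding eq using F' a X' s' m' by simp
qed

lemma down_order_coherent_frame:
  assumes F: "coherent_frame L"
  shows "coherent_frame (down_order L u)"
  unfolding coherent_frame_iff[OF down_order_complete]
proof (intro conjI allI impI ballI)
  show "frame (down_order L u)" using F by (intro down_order_frame coherent_frame_frame)
next
  fix a assume a: "a \<in> carrier (down_order L u)"
  let ?M = "{k. finite_element L k \<and> k \<sqsubseteq>\<^bsub>L\<^esub> a}"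
  have 1: "is_lub L a ?M" using a F by (intro coherent_frame_approx) auto
  have "k \<sqsubseteq>\<^bsub>L\<^esub> u" if "finite_element L k" "k \<sqsubseteq>\<^bsub>L\<^esub> a" for k
    using that le_trans[of k a u] a u finite_element_carrier[OF that(1)] by simp
  then have sub: "?M \<subseteq> {m \<in> carrier (down_order L u). finite_element (down_order L u) m}"
    unfolding down_order_finite_element by (auto dest: finite_element_carrier)
  then have "?M \<subseteq> carrier (down_order L u)" by blast
  then have "is_lub (down_order L u) a ?M" using 1 by (simp only: down_order_lub)
  then show "\<exists>M. M \<subseteq> {m \<in> carrier (down_order L u). finite_element (down_order L u) m} \<and>
      is_lub (down_order L u) a M" using sub by blast
next
  fix a b m
  assume a: "a \<in> carrier (down_order L u)" and b: "b \<in> carrier (down_order L u)"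
    and fin: "finite_element (down_order L u) a" "finite_element (down_order L u) b"
    and m: "is_glb (down_order L u) m {a, b}"
  have "m \<sqsubseteq>\<^bsub>L\<^esub> u" using greatest_closed[OF m] by simp
  moreover have "is_glb L m {a, b}" using m down_order_glb[of a b m] a b by simp
  then have "finite_element L m"
    using F[unfolded coherent_frame_iff[OF L], THEN conjunct2, THEN conjunct2, rule_format, of a b m]
      fin a b unfolding down_order_finite_element by simp
  ultimately show "finite_element (down_order L u) m"
    unfolding down_order_finite_element by simp
qed

end

section \<open>Order isomorphisms\<close>

text \<open>Besides the transport between isomorphic semigroups, order isomorphisms compare
  principal ideals inside one structure, and finite elements of \<open>Lvee S\<close> with finite projections.\<close>

definition order_iso :: "('a, 'c) gorder_scheme \<Rightarrow> ('b, 'd) gorder_scheme \<Rightarrow> ('a \<Rightarrow> 'b) \<Rightarrow> bool" where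
  "order_iso L M \<phi> \<longleftrightarrow> bij_betw \<phi> (carrier L) (carrier M) \<and>
     (\<forall>x\<in>carrier L. \<forall>y\<in>carrier L. \<phi> x \<sqsubseteq>\<^bsub>M\<^esub> \<phi> y \<longleftrightarrow> x \<sqsubseteq>\<^bsub>L\<^esub> y)"

context
  fixes L :: "('a, 'c) gorder_scheme" and M :: "('b, 'd) gorder_scheme" and \<phi>
  assumes iso: "order_iso L M \<phi>"
begin

lemma order_iso_carrier: "carrier M = \<phi> ` carrier L"
  using iso unfolding order_iso_def bij_betw_def by simp

lemma order_iso_inj: "inj_on \<phi> (carrier L)"
  using iso unfolding order_iso_def bij_betw_def by simp

lemma order_iso_le: "x \<in> carrier L \<Longrightarrow> y \<in> carrier L \<Longrightarrow> \<phi> x \<sqsubseteq>\<^bsub>M\<^esub> \<phi> y \<longleftrightarrow> x \<sqsubseteq>\<^bsub>L\<^esub> y"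
  using iso unfolding order_iso_def by simp

lemma order_iso_inv: "order_iso M L (inv_into (carrier L) \<phi>)"
  unfolding order_iso_def
proof (intro conjI ballI)
  show "bij_betw (inv_into (carrier L) \<phi>) (carrier M) (carrier L)"
    using iso unfolding order_iso_def by (simp add: bij_betw_inv_into)
qed (auto simp: order_iso_carrier order_iso_le inv_into_f_f[OF order_iso_inj])

lemma order_iso_lub:
  assumes "X \<subseteq> carrier L" "s \<in> carrier L"
  shows "is_lub M (\<phi> s) (\<phi> ` X) \<longleftrightarrow> is_lub L s X"
proof -
  have *: "\<phi> ` X \<subseteq> carrier M" using assms order_iso_carrier by auto
  have "x \<in> X \<Longrightarrow> x \<in> carrier L" for x using assms by blast
  then show ?thesis
    unfolding is_lub_iff[OF assms(1)] is_lub_iff[OF *] using assms(2)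
    by (auto simp: order_iso_carrier order_iso_le)
qed

lemma order_iso_glb:
  assumes "X \<subseteq> carrier L" "s \<in> carrier L"
  shows "is_glb M (\<phi> s) (\<phi> ` X) \<longleftrightarrow> is_glb L s X"
proof -
  have *: "\<phi> ` X \<subseteq> carrier M" using assms order_iso_carrier by auto
  have "x \<in> X \<Longrightarrow> x \<in> carrier L" for x using assms by blast
  then show ?thesis
    unfolding is_glb_iff[OF assms(1)] is_glb_iff[OF *] using assms(2)
    by (auto simp: order_iso_carrier order_iso_le)
qed

lemma order_iso_glb2:
  assumes "a \<in> carrier L" "b \<in> carrier L" "s \<in> carrier L"
  shows "is_glb M (\<phi> s) {\<phi> a, \<phi> b} \<longleftrightarrow> is_glb L s {a, b}"
  using order_iso_glb[of "{a, b}" s] assms by simp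

lemma order_iso_ex_lub:
  assumes "X \<subseteq> carrier L"
  shows "(\<exists>s. is_lub M s (\<phi> ` X)) \<longleftrightarrow> (\<exists>s. is_lub L s X)"
proof -
  have "is_lub M s Y \<Longrightarrow> s \<in> \<phi> ` carrier L" for s Y
    using order_iso_carrier least_closed by blast
  moreover have "is_lub L s X \<Longrightarrow> s \<in> carrier L" for s by (rule least_closed)
  ultimately show ?thesis using order_iso_lub[OF assms] by (metis imageE)
qed

end

lemma order_iso_complete_lattice:
  assumes iso: "order_iso L M \<phi>" and L: "complete_lattice L" and M: "partial_order M"
  shows "complete_lattice M"
proof (rule partial_order.complete_latticeI_lub[OF M])
  fix X assume "X \<subseteq> carrier M"
  then obtain Y where "Y \<subseteq> carrier L" "X = \<phi> ` Y"
    unfolding order_iso_carrier[OF iso] by (auto simp: subset_image_iff)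
  then show "\<exists>s. is_lub M s X"
    using order_iso_ex_lub[OF iso]
    using complete_lattice.axioms(1)[OF L] L
    by (meson weak_complete_lattice.sup_exists complete_lattice_def weak_complete_lattice_def
        complete_lattice.sup_exists)
qed

lemma order_iso_frame:
  assumes iso: "order_iso L M \<phi>" and L: "frame L" and LP: "partial_order L" and M: "partial_order M"
  shows "frame M"
  unfolding partial_order.frame_iff[OF M]
proof (intro conjI ballI allI impI)
  note C = order_iso_carrier[OF iso]
  note L' = L[unfolded partial_order.frame_iff[OF LP]]
  show "\<exists>s. is_lub M s X" if "X \<subseteq> carrier M" for X
  proof -
    from that[unfolded C] obtain Y where "Y \<subseteq> carrier L" "X = \<phi> ` Y" by (rule subset_imageE)
    then show ?thesis using L' order_iso_ex_lub[OF iso] by simp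
  qed
  fix a' X' s' m'
  assume "a' \<in> carrier M" "X' \<subseteq> carrier M" and lub: "is_lub M s' X'" and glb: "is_glb M m' {a', s'}"
  obtain a where a: "a' = \<phi> a" "a \<in> carrier L" using \<open>a' \<in> carrier M\<close> C by blast
  obtain X where X: "X' = \<phi> ` X" "X \<subseteq> carrier L"
    using \<open>X' \<subseteq> carrier M\<close> C by (auto simp: subset_image_iff)
  obtain s where s: "s' = \<phi> s" "s \<in> carrier L" using least_closed[OF lub] C by blast
  obtain m where m: "m' = \<phi> m" "m \<in> carrier L" using greatest_closed[OF glb] C by blast
  have "is_lub L s X" "is_glb L m {a, s}"
    using lub glb order_iso_lub[OF iso X(2) s(2)] order_iso_glb2[OF iso a(2) s(2) m(2)]
    unfolding a X s m by auto
  then have *: "is_lub L m {n. \<exists>x\<in>X. is_glb L n {a, x}}" using L' a X by blast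
  have sub: "{n. \<exists>x\<in>X. is_glb L n {a, x}} \<subseteq> carrier L" by auto
  have "{n. \<exists>x\<in>X'. is_glb M n {a', x}} = \<phi> ` {n. \<exists>x\<in>X. is_glb L n {a, x}}" (is "?l = ?r")
  proof
    show "?l \<subseteq> ?r"
    proof
      fix n' assume "n' \<in> ?l"
      then obtain x where x: "x \<in> X" "is_glb M n' {a', \<phi> x}" unfolding X by blast
      moreover then obtain n where n: "n' = \<phi> n" "n \<in> carrier L"
        using greatest_closed[OF x(2)] unfolding C by blast
      ultimately show "n' \<in> ?r"
        using order_iso_glb2[OF iso a(2) _ n(2), of x] X(2) unfolding a by blast
    qed
    show "?r \<subseteq> ?l"
    proof
      fix n' assume "n' \<in> ?r"
      then obtain n x where n: "n' = \<phi> n" "x \<in> X" "is_glb L n {a, x}" by blast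
      then have "is_glb M (\<phi> n) {\<phi> a, \<phi> x}"
        using order_iso_glb2[OF iso a(2), of x n] X(2) greatest_closed[OF n(3)] by blast
      then show "n' \<in> ?l" using n unfolding a X by blast
    qed
  qed
  then show "is_lub M m' {n. \<exists>x\<in>X'. is_glb M n {a', x}}"
    using * order_iso_lub[OF iso sub m(2)] unfolding m by simp
qed

lemma order_iso_finite_element:
  assumes iso: "order_iso L M \<phi>" and L: "complete_lattice L" and M: "partial_order M"
    and a: "a \<in> carrier L"
  shows "finite_element M (\<phi> a) \<longleftrightarrow> finite_element L a"
proof -
  have M': "complete_lattice M" using order_iso_complete_lattice[OF iso L M] .
  note C = order_iso_carrier[OF iso]
  have *: "(\<exists>F. F \<subseteq> \<phi> ` X \<and> finite F \<and> is_lub M (\<phi> a) F) \<longleftrightarrow> (\<exists>F. F \<subseteq> X \<and> finite F \<and> is_lub L a F)"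
    if "X \<subseteq> carrier L" for X
  proof -
    have "is_lub M (\<phi> a) (\<phi> ` F) \<longleftrightarrow> is_lub L a F" if "F \<subseteq> X" for F
      using that \<open>X \<subseteq> carrier L\<close> a order_iso_lub[OF iso, of F a] by blast
    then show ?thesis by (metis finite_subset_image finite_imageI image_mono)
  qed
  have "(\<forall>X. X \<subseteq> \<phi> ` carrier L \<longrightarrow> P X) \<longleftrightarrow> (\<forall>X. X \<subseteq> carrier L \<longrightarrow> P (\<phi> ` X))" for P
    by (metis image_mono subset_image_iff)
  then show ?thesis
    unfolding finite_element_iff[OF L] finite_element_iff[OF M'] C
    using a * order_iso_lub[OF iso _ a] by simp
qed

lemma order_iso_coherent_frame:
  assumes iso: "order_iso L M \<phi>" and L: "coherent_frame L" and M: "partial_order M"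
  shows "coherent_frame M"
proof -
  have fL: "frame L" using L unfolding coherent_frame_def by blast
  have cL: "complete_lattice L" using fL by (rule frame_complete)
  have pL: "partial_order L" using cL by (simp add: complete_lattice_def)
  have cM: "complete_lattice M" using order_iso_complete_lattice[OF iso cL M] .
  note C = order_iso_carrier[OF iso]
  note L' = L[unfolded coherent_frame_iff[OF cL]]
  note fin = order_iso_finite_element[OF iso cL M]
  show ?thesis
    unfolding coherent_frame_iff[OF cM]
  proof (intro conjI ballI allI impI)
    show "frame M" using order_iso_frame[OF iso fL pL M] .
    show "\<exists>X. X \<subseteq> {m \<in> carrier M. finite_element M m} \<and> is_lub M a X" if "a \<in> carrier M" for a
    proof -
      from that obtain b where b: "a = \<phi> b" "b \<in> carrier L" unfolding C by blast
      then obtain X where X: "X \<subseteq> {m \<in> carrier L. finite_element L m}" "is_lub L b X" using L' by blast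
      then have "is_lub M a (\<phi> ` X)" using order_iso_lub[OF iso _ b(2), of X] b by blast
      moreover have "\<phi> ` X \<subseteq> {m \<in> carrier M. finite_element M m}" using X fin C by auto
      ultimately show ?thesis by blast
    qed
    fix a b m assume "a \<in> carrier M" "b \<in> carrier M" "finite_element M a" "finite_element M b"
      and m: "is_glb M m {a, b}"
    moreover obtain a' b' m' where e: "a = \<phi> a'" "b = \<phi> b'" "m = \<phi> m'"
      "a' \<in> carrier L" "b' \<in> carrier L" "m' \<in> carrier L"
      using calculation(1,2) greatest_closed[OF m] unfolding C by blast
    ultimately show "finite_element M m"
      using fin L' order_iso_glb2[OF iso, of a' b' m'] unfolding e by blast
  qed
qed

section \<open>The natural order of a restriction semigroup\<close>

abbreviation nat_le :: "('a, 'b) rsemigroup_scheme \<Rightarrow> 'a \<Rightarrow> 'a \<Rightarrow> bool" (infix "\<preceq>\<index>" 50) where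
  "a \<preceq>\<^bsub>S\<^esub> b \<equiv> a \<sqsubseteq>\<^bsub>natural_order S\<^esub> b"

abbreviation nat_lub :: "('a, 'b) rsemigroup_scheme \<Rightarrow> 'a \<Rightarrow> 'a set \<Rightarrow> bool" where
  "nat_lub S \<equiv> is_lub (natural_order S)"

abbreviation proj_lub :: "('a, 'b) rsemigroup_scheme \<Rightarrow> 'a \<Rightarrow> 'a set \<Rightarrow> bool" where
  "proj_lub S \<equiv> is_lub (proj_order S)"

lemma natural_order_sel [simp]:
  "carrier (natural_order S) = carrier S" "eq (natural_order S) = (=)"
  by (simp_all add: natural_order_def)

lemma proj_order_sel [simp]:
  "carrier (proj_order S) = proj S" "eq (proj_order S) = (=)"
  "le (proj_order S) = le (natural_order S)"
  by (simp_all add: natural_order_def proj_order_def)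

lemma nat_le_iff: "a \<preceq>\<^bsub>S\<^esub> b \<longleftrightarrow> (\<exists>g\<in>proj S. \<exists>f\<in>proj S. a = g \<odot>\<^bsub>S\<^esub> b \<and> a = b \<odot>\<^bsub>S\<^esub> f)"
  by (simp add: natural_order_def)

lemma nat_lub_iff:
  "X \<subseteq> carrier S \<Longrightarrow> nat_lub S s X \<longleftrightarrow> s \<in> carrier S \<and> (\<forall>x\<in>X. x \<preceq>\<^bsub>S\<^esub> s) \<and>
    (\<forall>u\<in>carrier S. (\<forall>x\<in>X. x \<preceq>\<^bsub>S\<^esub> u) \<longrightarrow> s \<preceq>\<^bsub>S\<^esub> u)"
  by (simp add: is_lub_iff)

lemma proj_lub_iff:
  "X \<subseteq> proj S \<Longrightarrow> proj_lub S s X \<longleftrightarrow> s \<in> proj S \<and> (\<forall>x\<in>X. x \<preceq>\<^bsub>S\<^esub> s) \<and>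
    (\<forall>u\<in>proj S. (\<forall>x\<in>X. x \<preceq>\<^bsub>S\<^esub> u) \<longrightarrow> s \<preceq>\<^bsub>S\<^esub> u)"
  by (simp add: is_lub_iff)

context restriction_semigroup begin

lemmas [simp] = mult_closed proj_closed lam_closed rho_closed lam_proj rho_proj mult_lam rho_mult

lemma proj_carrier [simp]: "f \<in> proj S \<Longrightarrow> f \<in> carrier S"
  using proj_subset by blast

lemma lam_mult_proj: "a \<in> carrier S \<Longrightarrow> f \<in> proj S \<Longrightarrow> lam S (a \<odot> f) = lam S a \<odot> f"
  using lam_lam_mult[of a f] by simp

lemma rho_proj_mult: "a \<in> carrier S \<Longrightarrow> f \<in> proj S \<Longrightarrow> rho S (f \<odot> a) = f \<odot> rho S a"
  using rho_mult_rho[of f a] by simp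

text \<open>The factor on the right can always be taken to be \<open>lam a\<close>, and the restriction law then
  supplies the factor on the left. This makes the natural order an equation.\<close>

lemma le_iff_lam:
  assumes "a \<in> carrier S" "b \<in> carrier S"
  shows "a \<preceq> b \<longleftrightarrow> a = b \<odot> lam S a"
proof
  assume "a \<preceq> b"
  then obtain f where f: "f \<in> proj S" "a = b \<odot> f" unfolding nat_le_iff by blast
  then have "b \<odot> lam S a = (b \<odot> lam S b) \<odot> f"
    using assms by (simp add: lam_mult_proj mult_assoc del: mult_lam)
  then show "a = b \<odot> lam S a" using assms f by simp
next
  assume a: "a = b \<odot> lam S a"
  then have "a = rho S (b \<odot> lam S a) \<odot> b" using right_restriction[of b "lam S a"] assms by simp
  then show "a \<preceq> b" unfolding nat_le_iff
    using a assms by (metis lam_closed rho_closed)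
qed

lemma le_iff_rho:
  assumes "a \<in> carrier S" "b \<in> carrier S"
  shows "a \<preceq> b \<longleftrightarrow> a = rho S a \<odot> b"
proof
  assume "a \<preceq> b"
  then obtain g where g: "g \<in> proj S" "a = g \<odot> b" unfolding nat_le_iff by blast
  then have "rho S a \<odot> b = g \<odot> (rho S b \<odot> b)"
    using assms by (simp add: rho_proj_mult mult_assoc del: rho_mult)
  then show "a = rho S a \<odot> b" using assms g by simp
next
  assume a: "a = rho S a \<odot> b"
  then have "a = b \<odot> lam S (rho S a \<odot> b)" using left_restriction[of b "rho S a"] assms by simp
  then show "a \<preceq> b" unfolding nat_le_iff
    using a assms by (metis lam_closed rho_closed)
qed

lemma leD: "a \<preceq> b \<Longrightarrow> a \<in> carrier S \<Longrightarrow> b \<in> carrier S \<Longrightarrow> b \<odot> lam S a = a"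
  using le_iff_lam by simp

lemma leD_rho: "a \<preceq> b \<Longrightarrow> a \<in> carrier S \<Longrightarrow> b \<in> carrier S \<Longrightarrow> rho S a \<odot> b = a"
  using le_iff_rho by simp

lemma le_carrier: "a \<preceq> b \<Longrightarrow> b \<in> carrier S \<Longrightarrow> a \<in> carrier S"
  unfolding nat_le_iff by auto

lemma mult_proj_le: "a \<in> carrier S \<Longrightarrow> f \<in> proj S \<Longrightarrow> a \<odot> f \<preceq> a"
  using right_restriction[of a f] unfolding nat_le_iff by (metis mult_closed proj_carrier rho_closed)

lemma proj_mult_le: "a \<in> carrier S \<Longrightarrow> f \<in> proj S \<Longrightarrow> f \<odot> a \<preceq> a"
  using left_restriction[of a f] unfolding nat_le_iff by (metis mult_closed proj_carrier lam_closed)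

lemma le_refl [simp]: "a \<in> carrier S \<Longrightarrow> a \<preceq> a"
  by (simp add: le_iff_lam)

lemma le_trans:
  assumes "a \<preceq> b" "b \<preceq> c" and C: "c \<in> carrier S"
  shows "a \<preceq> c"
proof -
  have b: "b \<in> carrier S" using assms le_carrier by blast
  then have a: "a \<in> carrier S" using assms le_carrier by blast
  have "a = c \<odot> (lam S b \<odot> lam S a)"
    using leD[OF assms(1) a b] leD[OF assms(2) b C] a b C by (metis lam_closed mult_assoc proj_carrier)
  then show ?thesis using mult_proj_le[OF C, of "lam S b \<odot> lam S a"] a b by simp
qed

lemma le_proj: "a \<preceq> f \<Longrightarrow> f \<in> proj S \<Longrightarrow> a \<in> proj S"
  unfolding nat_le_iff by auto

lemma proj_le_iff: "f \<in> proj S \<Longrightarrow> g \<in> proj S \<Longrightarrow> f \<preceq> g \<longleftrightarrow> g \<odot> f = f"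
  using le_iff_lam[of f g] by auto

lemma le_antisym:
  assumes "a \<preceq> b" "b \<preceq> a" "a \<in> carrier S"
  shows "a = b"
proof -
  have b: "b \<in> carrier S" using assms le_carrier by blast
  have "lam S a = lam S b"
  proof -
    have "lam S a = lam S b \<odot> lam S a"
      using leD[OF assms(1,3) b] lam_mult_proj[of b "lam S a"] assms b by simp
    moreover have "lam S b = lam S a \<odot> lam S b"
      using leD[OF assms(2) b assms(3)] lam_mult_proj[of a "lam S b"] assms b by simp
    ultimately show ?thesis using proj_comm[of "lam S a" "lam S b"] assms b by simp
  qed
  then show ?thesis using leD[OF assms(1,3) b] b by simp
qed

lemma natural_order_partial_order: "partial_order (natural_order S)"
  by unfold_locales (auto intro: le_trans dest: le_antisym)

lemma proj_order_partial_order: "partial_order (proj_order S)"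
  by unfold_locales (auto intro: le_trans dest: le_antisym)

lemma lam_mono: "a \<preceq> b \<Longrightarrow> b \<in> carrier S \<Longrightarrow> lam S a \<preceq> lam S b"
  using leD[of a b] lam_mult_proj[of b "lam S a"] le_carrier[of a b] by (simp add: proj_le_iff)

lemma rho_mono: "a \<preceq> b \<Longrightarrow> b \<in> carrier S \<Longrightarrow> rho S a \<preceq> rho S b"
  using leD_rho[of a b] rho_proj_mult[of b "rho S a"] le_carrier[of a b]
  by (simp add: proj_le_iff proj_comm)

text \<open>By the left restriction law the projection in \<open>(a' \<odot> lam a) \<odot> b\<close> moves to the right of
  \<open>b\<close>, so that \<open>a \<odot> b\<close> is \<open>a' \<odot> b'\<close> times a projection.\<close>

lemma mult_mono:
  assumes "a \<preceq> a'" "b \<preceq> b'" and C: "a' \<in> carrier S" "b' \<in> carrier S"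
  shows "a \<odot> b \<preceq> a' \<odot> b'"
proof -
  have ab: "a \<in> carrier S" "b \<in> carrier S" using assms le_carrier by blast+
  have "a \<odot> b = (a' \<odot> lam S a) \<odot> b" using leD[OF assms(1)] C ab by simp
  also have "\<dots> = a' \<odot> (b \<odot> lam S (lam S a \<odot> b))"
    using C ab left_restriction[of b "lam S a"] by (simp add: mult_assoc)
  also have "\<dots> = a' \<odot> (b' \<odot> lam S b \<odot> lam S (lam S a \<odot> b))"
    using leD[OF assms(2)] C ab by simp
  also have "\<dots> = (a' \<odot> b') \<odot> (lam S b \<odot> lam S (lam S a \<odot> b))"
    using C ab by (simp add: mult_assoc)
  finally show ?thesis
    using mult_proj_le[of "a' \<odot> b'" "lam S b \<odot> lam S (lam S a \<odot> b)"] C ab by simp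
qed

text \<open>Both sides of each equation are obtained from \<open>c\<close> by multiplication with the same two
  projections, in either order.\<close>

lemma bounded_compatible:
  assumes "a \<preceq> c" "b \<preceq> c" "c \<in> carrier S"
  shows "compatible S a b"
proof -
  have ab: "a \<in> carrier S" "b \<in> carrier S" using assms le_carrier by blast+
  have "a \<odot> lam S b = c \<odot> (lam S a \<odot> lam S b)"
    using leD[OF assms(1)] assms(3) ab by (metis lam_closed mult_assoc proj_carrier)
  moreover have "b \<odot> lam S a = c \<odot> (lam S b \<odot> lam S a)"
    using leD[OF assms(2)] assms(3) ab by (metis lam_closed mult_assoc proj_carrier)
  moreover have "rho S b \<odot> a = (rho S b \<odot> rho S a) \<odot> c"
    using leD_rho[OF assms(1)] assms(3) ab by (metis rho_closed mult_assoc proj_carrier)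
  moreover have "rho S a \<odot> b = (rho S a \<odot> rho S b) \<odot> c"
    using leD_rho[OF assms(2)] assms(3) ab by (metis rho_closed mult_assoc proj_carrier)
  ultimately show ?thesis unfolding compatible_def
    using proj_comm[of "lam S a" "lam S b"] proj_comm[of "rho S a" "rho S b"] ab by simp
qed

lemma bounded_compatible_set:
  "X \<noteq> {} \<Longrightarrow> c \<in> carrier S \<Longrightarrow> (\<And>x. x \<in> X \<Longrightarrow> x \<preceq> c) \<Longrightarrow> compatible_set S X"
  unfolding compatible_set_def using bounded_compatible le_carrier by blast

lemma compatible_le:
  assumes "compatible S a b" "a \<in> carrier S" "b \<in> carrier S"
  shows "a \<odot> lam S b \<preceq> b"
  using assms mult_proj_le[of b "lam S a"] unfolding compatible_def by simp

text \<open>Both elements are determined by their projections, being \<open>c \<odot> lam a\<close> and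
  \<open>c \<odot> lam b\<close>. This is what reduces joins in \<open>S\<close> to joins of projections.\<close>

lemma bounded_le_iff:
  assumes "a \<preceq> c" "b \<preceq> c" "c \<in> carrier S"
  shows "a \<preceq> b \<longleftrightarrow> lam S a \<preceq> lam S b"
proof
  have ab: "a \<in> carrier S" "b \<in> carrier S" using assms le_carrier by blast+
  show "lam S a \<preceq> lam S b" if "a \<preceq> b" using lam_mono that ab by blast
  assume "lam S a \<preceq> lam S b"
  then have "lam S b \<odot> lam S a = lam S a" using ab by (simp add: proj_le_iff)
  then have "b \<odot> lam S a = a"
    using leD[OF assms(1) ab(1) assms(3)] leD[OF assms(2) ab(2) assms(3)] assms(3) ab
    by (metis lam_closed mult_assoc proj_carrier)
  then show "a \<preceq> b" using ab by (simp add: le_iff_lam)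
qed

lemma bounded_eqI_lam:
  assumes "a \<preceq> c" "b \<preceq> c" "c \<in> carrier S" "lam S a = lam S b"
  shows "a = b"
proof -
  have "a = c \<odot> lam S a" by (rule leD[OF assms(1) le_carrier[OF assms(1,3)] assms(3), symmetric])
  also have "\<dots> = c \<odot> lam S b" by (simp only: assms(4))
  also have "\<dots> = b" by (rule leD[OF assms(2) le_carrier[OF assms(2,3)] assms(3)])
  finally show ?thesis .
qed

lemma bounded_eqI_rho:
  assumes "a \<preceq> c" "b \<preceq> c" "c \<in> carrier S" "rho S a = rho S b"
  shows "a = b"
proof -
  have "a = rho S a \<odot> c" by (rule leD_rho[OF assms(1) le_carrier[OF assms(1,3)] assms(3), symmetric])
  also have "\<dots> = rho S b \<odot> c" by (simp only: assms(4))
  also have "\<dots> = b" by (rule leD_rho[OF assms(2) le_carrier[OF assms(2,3)] assms(3)])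
  finally show ?thesis .
qed

lemma rho_mult_below: "t \<in> carrier S \<Longrightarrow> g \<in> proj S \<Longrightarrow> g \<preceq> rho S t \<Longrightarrow> rho S (g \<odot> t) = g"
  by (simp add: rho_proj_mult proj_le_iff proj_comm)

lemma proj_order_glb: "f \<in> proj S \<Longrightarrow> g \<in> proj S \<Longrightarrow> is_glb (proj_order S) (f \<odot> g) {f, g}"
proof (subst is_glb_iff, simp, intro conjI ballI impI)
  assume f: "f \<in> proj S" and g: "g \<in> proj S"
  show "f \<odot> g \<in> carrier (proj_order S)" using f g by simp
  show "f \<odot> g \<sqsubseteq>\<^bsub>proj_order S\<^esub> x" if "x \<in> {f, g}" for x
    using that f g mult_proj_le[of f g] proj_mult_le[of g f] by auto
  fix u assume u: "u \<in> carrier (proj_order S)" "\<forall>x\<in>{f, g}. u \<sqsubseteq>\<^bsub>proj_order S\<^esub> x"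
  then have "f \<odot> u = u" "g \<odot> u = u" using f g by (auto simp: proj_le_iff)
  then have "(f \<odot> g) \<odot> u = u" using u f g by (simp add: mult_assoc)
  then show "u \<sqsubseteq>\<^bsub>proj_order S\<^esub> f \<odot> g" using u f g by (simp add: proj_le_iff)
qed

lemma proj_order_meet: "f \<in> proj S \<Longrightarrow> g \<in> proj S \<Longrightarrow> f \<sqinter>\<^bsub>proj_order S\<^esub> g = f \<odot> g"
  using partial_order.meet_eqI[OF proj_order_partial_order proj_order_glb] .

lemma nat_lub_singleton: "a \<in> carrier S \<Longrightarrow> nat_lub S a {a}"
  by (subst nat_lub_iff) auto

lemma nat_lub_unique: "nat_lub S a X \<Longrightarrow> nat_lub S b X \<Longrightarrow> a = b"
  using partial_order.least_unique[OF natural_order_partial_order] .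

text \<open>Associativity of joins, in the absence of a total join operation.\<close>

lemma nat_lub_Union:
  assumes "nat_lub S s X" "X \<subseteq> carrier S"
    and Y: "\<And>x. x \<in> X \<Longrightarrow> nat_lub S x (Y x)" "\<And>x. x \<in> X \<Longrightarrow> Y x \<subseteq> carrier S"
  shows "nat_lub S s (\<Union>x\<in>X. Y x)"
proof -
  have sub: "(\<Union>x\<in>X. Y x) \<subseteq> carrier S" using Y by blast
  have s: "s \<in> carrier S" "\<And>x. x \<in> X \<Longrightarrow> x \<preceq> s"
    "\<And>u. u \<in> carrier S \<Longrightarrow> \<forall>x\<in>X. x \<preceq> u \<Longrightarrow> s \<preceq> u"
    using assms(1) unfolding nat_lub_iff[OF assms(2)] by blast+
  have Y': "\<And>y. y \<in> Y x \<Longrightarrow> y \<preceq> x" "\<And>u. u \<in> carrier S \<Longrightarrow> \<forall>y\<in>Y x. y \<preceq> u \<Longrightarrow> x \<preceq> u" if "x \<in> X" for x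
    using Y[OF that] nat_lub_iff[of "Y x" S x] by blast+
  show ?thesis unfolding nat_lub_iff[OF sub]
  proof (intro conjI ballI impI)
    show "s \<in> carrier S" by (rule s)
    show "y \<preceq> s" if "y \<in> (\<Union>x\<in>X. Y x)" for y using that Y'(1) s(1,2) le_trans by blast
    show "s \<preceq> u" if "u \<in> carrier S" "\<forall>y\<in>(\<Union>x\<in>X. Y x). y \<preceq> u" for u
      using s(3)[OF that(1)] Y'(2)[OF _ that(1)] that(2) by blast
  qed
qed

definition down :: "'a \<Rightarrow> 'a set" where
  "down a = {b. b \<preceq> a}"

lemma mem_down [simp]: "b \<in> down a \<longleftrightarrow> b \<preceq> a"
  by (simp add: down_def)

lemma down_subset_iff: "a \<in> carrier S \<Longrightarrow> b \<in> carrier S \<Longrightarrow> down a \<subseteq> down b \<longleftrightarrow> a \<preceq> b"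
proof
  assume ab: "a \<in> carrier S" "b \<in> carrier S"
  show "a \<preceq> b" if "down a \<subseteq> down b" using subsetD[OF that, of a] ab by simp
  show "down a \<subseteq> down b" if "a \<preceq> b"
    using le_trans[OF _ that ab(2)] by (intro subsetI) simp
qed

end

section \<open>Joins of compatible sets\<close>

text \<open>The flag distinguishes the two settings: finite joins for distributive restriction semigroups,
  arbitrary joins for complete restriction monoids.\<close>

definition small :: "bool \<Rightarrow> 'x set \<Rightarrow> bool" where
  "small fin X \<longleftrightarrow> (fin \<longrightarrow> finite X)"

lemma small_simps [simp]: "small True X \<longleftrightarrow> finite X" "small False X"
  by (simp_all add: small_def)

lemma small_image: "small fin X \<Longrightarrow> small fin (g ` X)"
  by (simp add: small_def)

lemma small_UN: "small fin X \<Longrightarrow> (\<And>x. x \<in> X \<Longrightarrow> small fin (Y x)) \<Longrightarrow> small fin (\<Union>x\<in>X. Y x)"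
  by (simp add: small_def)

lemma small_finite: "finite X \<Longrightarrow> small fin X"
  by (simp add: small_def)

text \<open>The common part of both settings. The set \<open>X\<close> in the second assumption may be empty and
  then yields the least projection, but compatible sets are nonempty, since \<open>S\<close> need not have a
  zero. Joins of projections are thus a priori of two kinds; for nonempty sets they agree
  (\<open>proj_lub_iff_nat_lub\<close>).\<close>

locale joined_restriction_semigroup = restriction_semigroup +
  fixes fin :: bool
  assumes join_exists: "small fin X \<Longrightarrow> compatible_set S X \<Longrightarrow> \<exists>s. nat_lub S s X"
    and proj_join_exists: "small fin X \<Longrightarrow> X \<subseteq> proj S \<Longrightarrow>
      \<exists>h. proj_lub S h X \<and> (\<forall>f\<in>proj S. proj_lub S (f \<odot> h) ((\<odot>) f ` X))"
begin

text \<open>The join in \<open>S\<close> is below \<open>h\<close> and hence a projection.\<close>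

lemma nat_lub_of_proj_lub:
  assumes "small fin X" "X \<noteq> {}" "X \<subseteq> proj S" "proj_lub S h X"
  shows "nat_lub S h X"
proof -
  have X: "X \<subseteq> carrier S" using assms(3) by auto
  have h: "h \<in> proj S" "\<And>x. x \<in> X \<Longrightarrow> x \<preceq> h" "\<And>u. u \<in> proj S \<Longrightarrow> \<forall>x\<in>X. x \<preceq> u \<Longrightarrow> h \<preceq> u"
    using assms(4) unfolding proj_lub_iff[OF assms(3)] by blast+
  have "compatible_set S X" using bounded_compatible_set[OF assms(2), of h] h by simp
  then obtain s where s: "nat_lub S s X" using join_exists assms(1) by blast
  note s' = s[unfolded nat_lub_iff[OF X]]
  have "s \<preceq> h" using s' h by simp
  moreover have "h \<preceq> s" using h(3)[of s] s' le_proj[OF \<open>s \<preceq> h\<close> h(1)] by blast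
  ultimately have "s = h" using s' le_antisym by blast
  then show ?thesis using s by simp
qed

lemma proj_lub_iff_nat_lub:
  assumes "small fin X" "X \<noteq> {}" "X \<subseteq> proj S"
  shows "proj_lub S h X \<longleftrightarrow> nat_lub S h X"
proof
  assume h: "nat_lub S h X"
  obtain h' where "proj_lub S h' X" using proj_join_exists assms by blast
  moreover then have "h' = h" using h nat_lub_of_proj_lub[OF assms] nat_lub_unique by blast
  ultimately show "proj_lub S h X" by simp
qed (rule nat_lub_of_proj_lub[OF assms])

lemma proj_nat_lub_exists:
  assumes "small fin X" "X \<noteq> {}" "X \<subseteq> proj S"
  shows "\<exists>h\<in>proj S. nat_lub S h X"
  using proj_join_exists[OF assms(1,3)] nat_lub_of_proj_lub[OF assms] assms(3)
  by (auto simp: proj_lub_iff)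

lemma proj_nat_lub_distrib:
  assumes "small fin X" "X \<noteq> {}" "X \<subseteq> proj S" "nat_lub S h X" "f \<in> proj S"
  shows "nat_lub S (f \<odot> h) ((\<odot>) f ` X)"
proof -
  obtain h' where h': "proj_lub S h' X" "proj_lub S (f \<odot> h') ((\<odot>) f ` X)"
    using proj_join_exists assms by blast
  then have "h' = h" using assms(4) nat_lub_of_proj_lub[OF assms(1-3)] nat_lub_unique by blast
  moreover have "(\<odot>) f ` X \<subseteq> proj S" using assms(3,5) by auto
  ultimately show ?thesis
    using h'(2) nat_lub_of_proj_lub small_image assms(1,2) by (metis image_is_empty)
qed

text \<open>If \<open>h\<close> is the join of the projections \<open>lam x\<close>, then each \<open>x = x \<odot> lam x\<close> is
  below \<open>s \<odot> h\<close>. So \<open>s = s \<odot> h\<close>, which gives \<open>lam s \<le> h\<close>.\<close>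

lemma nat_lub_lam:
  assumes "small fin X" "X \<noteq> {}" "X \<subseteq> carrier S" "nat_lub S s X"
  shows "nat_lub S (lam S s) (lam S ` X)"
proof -
  note s = assms(4)[unfolded nat_lub_iff[OF assms(3)]]
  have L: "lam S ` X \<subseteq> proj S" using assms(3) by auto
  then have L': "lam S ` X \<subseteq> carrier S" by auto
  obtain h where h: "h \<in> proj S" "nat_lub S h (lam S ` X)"
    using proj_nat_lub_exists[OF small_image[OF assms(1)] _ L] assms(2) by blast
  note h' = h(2)[unfolded nat_lub_iff[OF L']]
  have "x \<preceq> s \<odot> h" if "x \<in> X" for x
    using mult_mono[of s s "lam S x" h] leD[of x s] that s h' assms(3) by auto
  then have "s \<preceq> s \<odot> h" using s h by simp
  then have "lam S s \<preceq> lam S s \<odot> h" using lam_mono[of s "s \<odot> h"] s h by (simp add: lam_mult_proj)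
  then have "lam S s \<preceq> h" using le_trans[OF _ proj_mult_le[of h "lam S s"], of "lam S s"] s h by simp
  moreover have "h \<preceq> lam S s" using h' s lam_mono by auto
  ultimately have "h = lam S s" using le_antisym h by auto
  then show ?thesis using h by simp
qed

lemma nat_lub_rho:
  assumes "small fin X" "X \<noteq> {}" "X \<subseteq> carrier S" "nat_lub S s X"
  shows "nat_lub S (rho S s) (rho S ` X)"
proof -
  note s = assms(4)[unfolded nat_lub_iff[OF assms(3)]]
  have L: "rho S ` X \<subseteq> proj S" using assms(3) by auto
  then have L': "rho S ` X \<subseteq> carrier S" by auto
  obtain h where h: "h \<in> proj S" "nat_lub S h (rho S ` X)"
    using proj_nat_lub_exists[OF small_image[OF assms(1)] _ L] assms(2) by blast
  note h' = h(2)[unfolded nat_lub_iff[OF L']]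
  have "x \<preceq> h \<odot> s" if "x \<in> X" for x
    using mult_mono[of "rho S x" h s s] leD_rho[of x s] that s h' assms(3) by auto
  then have "s \<preceq> h \<odot> s" using s h by simp
  then have "rho S s \<preceq> h \<odot> rho S s" using rho_mono[of s "h \<odot> s"] s h by (simp add: rho_proj_mult)
  then have "rho S s \<preceq> h" using le_trans[OF _ mult_proj_le[of h "rho S s"], of "rho S s"] s h by simp
  moreover have "h \<preceq> rho S s" using h' s rho_mono by auto
  ultimately have "h = rho S s" using le_antisym h by auto
  then show ?thesis using h by simp
qed

text \<open>The actual join \<open>y\<close> of \<open>X\<close> satisfies \<open>y \<le> u\<close> and
  \<open>lam u \<le> lam y\<close>, and below the common bound \<open>u\<close> the order is that of the projections.\<close>

lemma nat_lub_criterion: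
  assumes "small fin X" "X \<noteq> {}" "u \<in> carrier S" "\<And>x. x \<in> X \<Longrightarrow> x \<preceq> u"
    and "nat_lub S (lam S u) (lam S ` X)"
  shows "nat_lub S u X"
proof -
  have X: "X \<subseteq> carrier S" using assms(3,4) le_carrier by blast
  then have L': "lam S ` X \<subseteq> carrier S" by auto
  obtain y where y: "nat_lub S y X"
    using join_exists[OF assms(1)] bounded_compatible_set[OF assms(2,3,4)] by blast
  note y' = y[unfolded nat_lub_iff[OF X]]
  have "y \<preceq> u" using y' assms by blast
  moreover have "lam S u \<preceq> lam S y"
    using assms(5)[unfolded nat_lub_iff[OF L']] y' lam_mono by auto
  ultimately have "u \<preceq> y" using bounded_le_iff[of u u y] assms(3) by simp
  then have "y = u" using \<open>y \<preceq> u\<close> y' le_antisym by blast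
  then show ?thesis using y by simp
qed

lemma nat_lub_mult_proj:
  assumes "small fin X" "X \<noteq> {}" "X \<subseteq> carrier S" "nat_lub S s X" "f \<in> proj S"
  shows "nat_lub S (s \<odot> f) ((\<lambda>x. x \<odot> f) ` X)"
proof -
  note s = assms(4)[unfolded nat_lub_iff[OF assms(3)]]
  have 1: "nat_lub S (f \<odot> lam S s) ((\<odot>) f ` lam S ` X)"
    using assms nat_lub_lam[OF assms(1-4)] by (intro proj_nat_lub_distrib small_image) auto
  have 2: "(\<odot>) f ` lam S ` X = lam S ` (\<lambda>x. x \<odot> f) ` X"
    unfolding image_image using assms(3,5)
    by (intro image_cong) (auto simp: lam_mult_proj proj_comm subset_iff)
  have 3: "f \<odot> lam S s = lam S (s \<odot> f)" using s assms(5) by (simp add: lam_mult_proj proj_comm)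
  show ?thesis
    by (rule nat_lub_criterion)
      (use 1[unfolded 2 3] assms s in \<open>auto intro!: small_image mult_mono\<close>)
qed

text \<open>Each join restricts to the elements below it. Finite covers of one element are
  refined and compared by means of this fact.\<close>

lemma nat_lub_below:
  assumes "small fin X" "X \<noteq> {}" "X \<subseteq> carrier S" "nat_lub S s X" "c \<preceq> s"
  shows "nat_lub S c ((\<lambda>x. x \<odot> lam S c) ` X)"
proof -
  have s: "s \<in> carrier S" using least_closed[OF assms(4)] by simp
  then show ?thesis
    using nat_lub_mult_proj[OF assms(1-4), of "lam S c"] leD[OF assms(5)] le_carrier[OF assms(5)] by simp
qed

text \<open>The map \<open>g \<mapsto> lam (g \<odot> t)\<close> passes from projections on one side of \<open>t\<close> to
  projections on the other side. If \<open>h\<close> is above all \<open>lam (g \<odot> t)\<close>, then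
  \<open>g \<odot> t = t \<odot> lam (g \<odot> t)\<close> is below \<open>t \<odot> h\<close>. For elements below \<open>t\<close> this can be
  read off from \<open>rho\<close>, and \<open>rho (g \<odot> t) = g \<odot> rho t\<close> preserves joins in \<open>g\<close> by the
  distributive law for projections.\<close>

lemma nat_lub_lam_proj_mult:
  assumes "small fin G" "G \<noteq> {}" "G \<subseteq> proj S" "nat_lub S g G" and t: "t \<in> carrier S"
  shows "nat_lub S (lam S (g \<odot> t)) ((\<lambda>g. lam S (g \<odot> t)) ` G)"
proof -
  have G: "G \<subseteq> carrier S" using assms(3) by auto
  have "proj_lub S g G" using assms(4) proj_lub_iff_nat_lub[OF assms(1-3)] by simp
  then have g: "g \<in> proj S" using least_closed by fastforce
  note g' = assms(4)[unfolded nat_lub_iff[OF G]]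
  let ?L = "(\<lambda>g. lam S (g \<odot> t)) ` G"
  have L: "?L \<subseteq> proj S" using assms(3) t by auto
  have "proj_lub S (lam S (g \<odot> t)) ?L"
    unfolding proj_lub_iff[OF L]
  proof (intro conjI ballI impI)
    show "lam S (g \<odot> t) \<in> proj S" using g t by simp
    show "x \<preceq> lam S (g \<odot> t)" if "x \<in> ?L" for x
      using that g g' t by (auto intro!: lam_mono mult_mono)
    fix h assume h: "h \<in> proj S" "\<forall>x\<in>?L. x \<preceq> h"
    have eq: "(\<odot>) (rho S t) ` G = (\<lambda>k. rho S (k \<odot> t)) ` G"
      using assms(3) t by (intro image_cong) (auto simp: rho_proj_mult proj_comm subset_iff)
    have "nat_lub S (rho S t \<odot> g) ((\<odot>) (rho S t) ` G)"
      using assms by (intro proj_nat_lub_distrib) auto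
    then have *: "nat_lub S (rho S (g \<odot> t)) ((\<lambda>k. rho S (k \<odot> t)) ` G)"
      unfolding eq using g t by (simp add: rho_proj_mult proj_comm)
    have "(\<lambda>k. rho S (k \<odot> t)) ` G \<subseteq> carrier S" using G t by auto
    note * = *[unfolded nat_lub_iff[OF this]]
    have "rho S (k \<odot> t) \<preceq> rho S (t \<odot> h)" if k: "k \<in> G" for k
    proof -
      have kp: "k \<in> proj S" using k assms(3) by blast
      have "k \<odot> t = t \<odot> lam S (k \<odot> t)" using left_restriction kp t by simp
      moreover have "t \<odot> lam S (k \<odot> t) \<preceq> t \<odot> h" using h k kp t by (intro mult_mono) auto
      ultimately show ?thesis using rho_mono[of "k \<odot> t" "t \<odot> h"] h t by simp
    qed
    then have "rho S (g \<odot> t) \<preceq> rho S (t \<odot> h)" using * h t by auto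
    then have "rho S (g \<odot> t) \<odot> (g \<odot> t) \<preceq> rho S (t \<odot> h) \<odot> t"
      using g t h by (intro mult_mono proj_mult_le) auto
    then have "g \<odot> t \<preceq> t \<odot> h" using right_restriction[of t h] g t h by simp
    then have "lam S (g \<odot> t) \<preceq> lam S t \<odot> h" using lam_mono[of "g \<odot> t" "t \<odot> h"] t h by (simp add: lam_mult_proj)
    then show "lam S (g \<odot> t) \<preceq> h" using le_trans[OF _ proj_mult_le[of h "lam S t"], of "lam S (g \<odot> t)"] g t h by simp
  qed
  then show ?thesis using nat_lub_of_proj_lub[OF small_image[OF assms(1)] _ L] assms(2) by blast
qed

lemma nat_lub_mult_right:
  assumes "small fin X" "X \<noteq> {}" "X \<subseteq> carrier S" "nat_lub S s X" "a \<in> carrier S"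
  shows "nat_lub S (s \<odot> a) ((\<lambda>x. x \<odot> a) ` X)"
proof -
  note s = assms(4)[unfolded nat_lub_iff[OF assms(3)]]
  have 1: "nat_lub S (lam S (lam S s \<odot> a)) ((\<lambda>g. lam S (g \<odot> a)) ` lam S ` X)"
    using assms nat_lub_lam[OF assms(1-4)] by (intro nat_lub_lam_proj_mult small_image) auto
  have 2: "(\<lambda>g. lam S (g \<odot> a)) ` lam S ` X = lam S ` (\<lambda>x. x \<odot> a) ` X"
    unfolding image_image using assms(3,5)
    by (intro image_cong) (auto simp: lam_lam_mult subset_iff)
  have 3: "lam S (lam S s \<odot> a) = lam S (s \<odot> a)" using s assms(5) by (simp add: lam_lam_mult)
  show ?thesis
    by (rule nat_lub_criterion)
      (use 1[unfolded 2 3] assms s in \<open>auto intro!: small_image mult_mono\<close>)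
qed

text \<open>Since \<open>x = rho x \<odot> s\<close> for all \<open>x \<in> X\<close>, the joins of the \<open>x\<close> and of the
  \<open>a \<odot> x\<close> are governed by the projections \<open>rho x\<close> acting on \<open>s\<close> from the left.\<close>

lemma nat_lub_mult_left:
  assumes "small fin X" "X \<noteq> {}" "X \<subseteq> carrier S" "nat_lub S s X" "a \<in> carrier S"
  shows "nat_lub S (a \<odot> s) ((\<lambda>x. a \<odot> x) ` X)"
proof -
  note s = assms(4)[unfolded nat_lub_iff[OF assms(3)]]
  let ?G = "(\<odot>) (lam S a) ` rho S ` X"
  have 0: "nat_lub S (lam S a \<odot> rho S s) ?G"
    using assms nat_lub_rho[OF assms(1-4)] by (intro proj_nat_lub_distrib small_image) auto
  have 1: "nat_lub S (lam S (lam S a \<odot> rho S s \<odot> s)) ((\<lambda>g. lam S (g \<odot> s)) ` ?G)"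
    using assms s by (intro nat_lub_lam_proj_mult small_image 0) auto
  have "lam S (lam S a \<odot> rho S x \<odot> s) = lam S (a \<odot> x)" if "x \<in> X" for x
  proof -
    have x: "x \<in> carrier S" using that assms(3) by blast
    then have "lam S a \<odot> rho S x \<odot> s = lam S a \<odot> x"
      using leD_rho[of x s] s that assms(5) by (simp add: mult_assoc)
    then show ?thesis using x assms(5) by (simp add: lam_lam_mult)
  qed
  then have 2: "(\<lambda>g. lam S (g \<odot> s)) ` ?G = lam S ` (\<lambda>x. a \<odot> x) ` X"
    unfolding image_image by (intro image_cong) auto
  have 3: "lam S (lam S a \<odot> rho S s \<odot> s) = lam S (a \<odot> s)"
    using s assms(5) by (simp add: lam_lam_mult mult_assoc)
  show ?thesis
    by (rule nat_lub_criterion)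
      (use 1[unfolded 2 3] assms s in \<open>auto intro!: small_image mult_mono\<close>)
qed

end

section \<open>Complete restriction monoids and distributive restriction semigroups\<close>

lemma joined_restriction_semigroupI:
  "restriction_semigroup S \<Longrightarrow>
   (\<And>X. small fin X \<Longrightarrow> compatible_set S X \<Longrightarrow> \<exists>s. nat_lub S s X) \<Longrightarrow>
   (\<And>X. small fin X \<Longrightarrow> X \<subseteq> proj S \<Longrightarrow>
      \<exists>h. proj_lub S h X \<and> (\<forall>f\<in>proj S. proj_lub S (f \<odot>\<^bsub>S\<^esub> h) ((\<odot>\<^bsub>S\<^esub>) f ` X))) \<Longrightarrow>
   joined_restriction_semigroup S fin"
  by (simp add: joined_restriction_semigroup_def joined_restriction_semigroup_axioms_def)

lemma (in restriction_semigroup) proj_glb_image: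
  assumes "f \<in> proj S" "X \<subseteq> proj S"
  shows "{n. \<exists>x\<in>X. is_glb (proj_order S) n {f, x}} = (\<odot>) f ` X"
proof -
  have "is_glb (proj_order S) n {f, x} \<longleftrightarrow> n = f \<odot> x" if "x \<in> X" for n x
    using proj_order_glb[of f x] that assms
      partial_order.greatest_unique[OF proj_order_partial_order] by blast
  then show ?thesis by blast
qed

text \<open>The meet of two projections is their product, so the infinite distributive law is a statement
  about multiplication.\<close>

lemma (in restriction_semigroup) proj_frame_iff:
  "frame (proj_order S) \<longleftrightarrow> (\<forall>X. X \<subseteq> proj S \<longrightarrow>
      (\<exists>h. proj_lub S h X \<and> (\<forall>f\<in>proj S. proj_lub S (f \<odot> h) ((\<odot>) f ` X))))" (is "_ \<longleftrightarrow> ?R")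
proof
  assume A: "frame (proj_order S)"
  show ?R
  proof (intro allI impI)
    fix X assume X: "X \<subseteq> proj S"
    note A' = A[unfolded partial_order.frame_iff[OF proj_order_partial_order]]
    obtain h where h: "proj_lub S h X" using A' X by auto
    have hp: "h \<in> proj S" using least_closed[OF h] by simp
    have "proj_lub S (f \<odot> h) ((\<odot>) f ` X)" if "f \<in> proj S" for f
      using A'[THEN conjunct2, rule_format, of f X h "f \<odot> h"] h proj_order_glb[OF that hp]
        proj_glb_image[OF that X] X that by simp
    then show "\<exists>h. proj_lub S h X \<and> (\<forall>f\<in>proj S. proj_lub S (f \<odot> h) ((\<odot>) f ` X))" using h by blast
  qed
next
  assume R: ?R
  show "frame (proj_order S)"
    unfolding partial_order.frame_iff[OF proj_order_partial_order]
  proof (intro conjI allI impI ballI)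
    fix X assume "X \<subseteq> carrier (proj_order S)"
    then show "\<exists>s. proj_lub S s X" using R by auto
  next
    fix a X s m
    assume a: "a \<in> carrier (proj_order S)" and X: "X \<subseteq> carrier (proj_order S)"
      and s: "proj_lub S s X" and m: "is_glb (proj_order S) m {a, s}"
    have sp: "s \<in> proj S" using least_closed[OF s] by simp
    have "m = a \<odot> s" using m proj_order_glb[of a s] a sp
      partial_order.greatest_unique[OF proj_order_partial_order] by auto
    moreover obtain h where h: "proj_lub S h X" "\<forall>f\<in>proj S. proj_lub S (f \<odot> h) ((\<odot>) f ` X)"
      using R X by auto
    moreover have "h = s" using h s partial_order.least_unique[OF proj_order_partial_order] by blast
    ultimately show "proj_lub S m {n. \<exists>x\<in>X. is_glb (proj_order S) n {a, x}}"
      using proj_glb_image[of a X] a X by auto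
  qed
qed

lemma complete_restriction_monoid_iff:
  "complete_restriction_monoid S \<longleftrightarrow> joined_restriction_semigroup S False \<and>
     (\<exists>e\<in>carrier S. \<forall>a\<in>carrier S. e \<odot>\<^bsub>S\<^esub> a = a \<and> a \<odot>\<^bsub>S\<^esub> e = a)"
  unfolding complete_restriction_monoid_def joined_restriction_semigroup_def
    joined_restriction_semigroup_axioms_def
  using restriction_semigroup.proj_frame_iff[of S] by auto

text \<open>The bottom is the case of the empty set, and binary joins are that of a two-element set; larger
  finite sets follow by induction.\<close>

lemma (in restriction_semigroup) proj_distributive_lattice_iff:
  "distributive_lattice (proj_order S) \<longleftrightarrow> (\<forall>X. finite X \<longrightarrow> X \<subseteq> proj S \<longrightarrow>
      (\<exists>h. proj_lub S h X \<and> (\<forall>f\<in>proj S. proj_lub S (f \<odot> h) ((\<odot>) f ` X))))" (is "_ \<longleftrightarrow> ?R")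
proof
  assume A: "distributive_lattice (proj_order S)"
  then interpret L: lattice "proj_order S" unfolding distributive_lattice_def by blast
  interpret B: weak_partial_order_bottom "proj_order S" using A unfolding distributive_lattice_def by blast
  have dist: "f \<odot> (x \<squnion>\<^bsub>proj_order S\<^esub> y) = (f \<odot> x) \<squnion>\<^bsub>proj_order S\<^esub> (f \<odot> y)"
    if "f \<in> proj S" "x \<in> proj S" "y \<in> proj S" for f x y
    using A[unfolded distributive_lattice_def, THEN conjunct2, THEN conjunct2, rule_format, of f x y]
      that L.join_closed[of x y] by (simp add: proj_order_meet)
  have lub: "proj_lub S (x \<squnion>\<^bsub>proj_order S\<^esub> y) {x, y}" if "x \<in> proj S" "y \<in> proj S" for x y
    unfolding join_def using that by (intro L.sup_of_two_least) auto
  show ?R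
  proof (intro allI impI)
    fix X assume "finite X" "X \<subseteq> proj S"
    then show "\<exists>h. proj_lub S h X \<and> (\<forall>f\<in>proj S. proj_lub S (f \<odot> h) ((\<odot>) f ` X))"
    proof (induction X)
      case empty
      let ?z = "\<bottom>\<^bsub>proj_order S\<^esub>"
      have z: "least (proj_order S) ?z (proj S)" using B.bottom_least by simp
      then have zp: "?z \<in> proj S" "\<And>x. x \<in> proj S \<Longrightarrow> ?z \<preceq> x" by (auto simp: least_def)
      have "f \<odot> ?z = ?z" if "f \<in> proj S" for f
        using zp that by (simp add: proj_le_iff[symmetric])
      then show ?case using z by (intro exI[of _ ?z]) simp
    next
      case (insert x X)
      then obtain h where h: "proj_lub S h X" "\<And>f. f \<in> proj S \<Longrightarrow> proj_lub S (f \<odot> h) ((\<odot>) f ` X)" by auto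
      have hp: "h \<in> proj S" "x \<in> proj S" "X \<subseteq> proj S" using least_closed[OF h(1)] insert by auto
      let ?s = "x \<squnion>\<^bsub>proj_order S\<^esub> h"
      have "proj_lub S ?s (insert x X)"
        using L.lub_insert[OF h(1) _ _ lub[OF hp(2,1)]] hp by simp
      moreover have "proj_lub S (f \<odot> ?s) ((\<odot>) f ` insert x X)" if "f \<in> proj S" for f
        unfolding dist[OF that hp(2,1)] image_insert
      proof (rule L.lub_insert[OF h(2)[OF that]])
        show "(\<odot>) f ` X \<subseteq> carrier (proj_order S)" "f \<odot> x \<in> carrier (proj_order S)"
          using that hp by auto
        show "proj_lub S ((f \<odot> x) \<squnion>\<^bsub>proj_order S\<^esub> (f \<odot> h)) {f \<odot> x, f \<odot> h}"
          using that hp by (intro lub) simp_all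
      qed
      ultimately show ?case by blast
    qed
  qed
next
  assume R: ?R
  have lub2: "\<exists>h. proj_lub S h {x, y} \<and> (\<forall>f\<in>proj S. proj_lub S (f \<odot> h) {f \<odot> x, f \<odot> y})"
    if "x \<in> proj S" "y \<in> proj S" for x y
    using R[rule_format, of "{x, y}"] that by auto
  interpret L: lattice "proj_order S"
  proof (rule partial_order.latticeI_lub_glb[OF proj_order_partial_order])
    fix x y assume "x \<in> carrier (proj_order S)" "y \<in> carrier (proj_order S)"
    then have xy: "x \<in> proj S" "y \<in> proj S" by simp_all
    show "\<exists>s. proj_lub S s {x, y}" using lub2[OF xy] by blast
    show "\<exists>s. is_glb (proj_order S) s {x, y}" using proj_order_glb[OF xy] by blast
  qed
  show "distributive_lattice (proj_order S)"
    unfolding distributive_lattice_def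
  proof (intro conjI ballI)
    show "lattice (proj_order S)" by unfold_locales
    obtain h where "proj_lub S h {}" using R[rule_format, of "{}"] by auto
    then show "weak_partial_order_bottom (proj_order S)" by unfold_locales auto
    fix x y z assume xyz: "x \<in> carrier (proj_order S)" "y \<in> carrier (proj_order S)" "z \<in> carrier (proj_order S)"
    then obtain h where h: "proj_lub S h {y, z}" "proj_lub S (x \<odot> h) {x \<odot> y, x \<odot> z}"
      using lub2[of y z] by auto
    have "h \<in> proj S" using least_closed[OF h(1)] by simp
    then show "x \<sqinter>\<^bsub>proj_order S\<^esub> (y \<squnion>\<^bsub>proj_order S\<^esub> z) =
        x \<sqinter>\<^bsub>proj_order S\<^esub> y \<squnion>\<^bsub>proj_order S\<^esub> x \<sqinter>\<^bsub>proj_order S\<^esub> z"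
      using L.join_eqI[OF h(1)] L.join_eqI[OF h(2)] xyz by (simp add: proj_order_meet)
  qed
qed

lemma distributive_rs_iff: "distributive_rs S \<longleftrightarrow> joined_restriction_semigroup S True"
  unfolding distributive_rs_def joined_restriction_semigroup_def
    joined_restriction_semigroup_axioms_def
  using restriction_semigroup.proj_distributive_lattice_iff[of S] by auto

lemma (in joined_restriction_semigroup) proj_zero_exists:
  "\<exists>z\<in>proj S. \<forall>f\<in>proj S. z \<preceq> f"
proof -
  obtain z where "proj_lub S z {}" using proj_join_exists[of "{}"] small_finite by auto
  then show ?thesis by (auto simp: least_def)
qed

lemma (in restriction_semigroup) identity_proj:
  assumes "e \<in> carrier S" "\<forall>a\<in>carrier S. e \<odot> a = a \<and> a \<odot> e = a"
  shows "e \<in> proj S" "f \<in> proj S \<Longrightarrow> f \<preceq> e"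
proof -
  have "lam S e = e" using assms mult_lam[of e] lam_closed[of e] by (metis proj_carrier)
  then show e: "e \<in> proj S" using lam_closed[OF assms(1)] by simp
  show "f \<in> proj S \<Longrightarrow> f \<preceq> e" using assms e by (simp add: proj_le_iff)
qed

section \<open>Homomorphisms\<close>

locale rs_homomorphism = S: restriction_semigroup S + T: restriction_semigroup T
  for S :: "('a, 'c) rsemigroup_scheme" and T :: "('b, 'd) rsemigroup_scheme" +
  fixes f
  assumes hom: "rs_hom S T f"
begin

lemma hom_closed [simp]: "a \<in> carrier S \<Longrightarrow> f a \<in> carrier T"
  using hom unfolding rs_hom_def by auto

lemma hom_mult: "a \<in> carrier S \<Longrightarrow> b \<in> carrier S \<Longrightarrow> f (a \<odot>\<^bsub>S\<^esub> b) = f a \<odot>\<^bsub>T\<^esub> f b"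
  and hom_lam: "a \<in> carrier S \<Longrightarrow> f (lam S a) = lam T (f a)"
  and hom_rho: "a \<in> carrier S \<Longrightarrow> f (rho S a) = rho T (f a)"
  using hom unfolding rs_hom_def by auto

lemma hom_proj [simp]: "p \<in> proj S \<Longrightarrow> f p \<in> proj T"
  using hom_lam[of p] T.lam_closed[of "f p"] by simp

lemma hom_mono: "a \<preceq>\<^bsub>S\<^esub> b \<Longrightarrow> b \<in> carrier S \<Longrightarrow> f a \<preceq>\<^bsub>T\<^esub> f b"
  using S.le_carrier[of a b] S.leD[of a b] hom_mult[of b "lam S a"] hom_lam[of a]
  by (simp add: T.le_iff_lam)

end

lemma rs_hom_compose:
  assumes "restriction_semigroup S" "rs_hom S T f" "rs_hom T U g"
  shows "rs_hom S U (compose (carrier S) g f)"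
proof -
  interpret S: restriction_semigroup S by fact
  have f: "f a \<in> carrier T" if "a \<in> carrier S" for a using assms(2) that unfolding rs_hom_def by auto
  show ?thesis
    using assms(2,3) f unfolding rs_hom_def by (auto simp: compose_def)
qed

text \<open>The two kinds of morphisms in one notion. The last condition is the cofinality in the definition
  of morphisms of distributive lattices; if there are greatest projections, it says that the top is
  preserved. The bottom is the join of the empty set.\<close>

definition join_morphism ::
  "bool \<Rightarrow> ('a, 'c) rsemigroup_scheme \<Rightarrow> ('b, 'd) rsemigroup_scheme \<Rightarrow> ('a \<Rightarrow> 'b) \<Rightarrow> bool" where
  "join_morphism fin S T f \<longleftrightarrow> rs_hom S T f \<and>
     (\<forall>X s. small fin X \<longrightarrow> X \<subseteq> proj S \<longrightarrow> proj_lub S s X \<longrightarrow> proj_lub T (f s) (f ` X)) \<and>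
     (\<forall>u\<in>proj T. \<exists>h\<in>proj S. u \<preceq>\<^bsub>T\<^esub> f h)"

lemma crm_morphism_iff:
  assumes "complete_restriction_monoid S" "complete_restriction_monoid T"
  shows "crm_morphism S T f \<longleftrightarrow> join_morphism False S T f"
proof (cases "rs_hom S T f")
  case True
  have "restriction_semigroup S" "restriction_semigroup T"
    using assms by (auto simp: complete_restriction_monoid_def)
  then interpret rs_homomorphism S T f
    using True by (simp add: rs_homomorphism_def rs_homomorphism_axioms_def)
  have "complete_lattice (proj_order S)" "complete_lattice (proj_order T)"
    using assms by (auto simp: complete_restriction_monoid_def frame_complete)
  then interpret LS: complete_lattice "proj_order S" + LT: complete_lattice "proj_order T"
    by blast+
  have img: "f ` X \<subseteq> proj T" if "X \<subseteq> proj S" for X using that by auto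
  have sup: "(\<forall>X\<subseteq>proj S. f (\<Squnion>\<^bsub>proj_order S\<^esub> X) = \<Squnion>\<^bsub>proj_order T\<^esub> (f ` X)) \<longleftrightarrow>
      (\<forall>X s. X \<subseteq> proj S \<longrightarrow> proj_lub S s X \<longrightarrow> proj_lub T (f s) (f ` X))"
  proof (intro iffI allI impI)
    fix X s assume A: "\<forall>X\<subseteq>proj S. f (\<Squnion>\<^bsub>proj_order S\<^esub> X) = \<Squnion>\<^bsub>proj_order T\<^esub> (f ` X)"
      and X: "X \<subseteq> proj S" and s: "proj_lub S s X"
    have "f s = \<Squnion>\<^bsub>proj_order T\<^esub> (f ` X)" using A X LS.sup_eqI[OF s] by auto
    then show "proj_lub T (f s) (f ` X)" using LT.sup_lub[of "f ` X"] img[OF X] by simp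
  next
    fix X assume A: "\<forall>X s. X \<subseteq> proj S \<longrightarrow> proj_lub S s X \<longrightarrow> proj_lub T (f s) (f ` X)"
      and X: "X \<subseteq> proj S"
    then have "proj_lub T (f (\<Squnion>\<^bsub>proj_order S\<^esub> X)) (f ` X)" using LS.sup_lub[of X] by simp
    then show "f (\<Squnion>\<^bsub>proj_order S\<^esub> X) = \<Squnion>\<^bsub>proj_order T\<^esub> (f ` X)" using LT.sup_eqI by simp
  qed
  have topS: "\<top>\<^bsub>proj_order S\<^esub> \<in> proj S" "\<And>h. h \<in> proj S \<Longrightarrow> h \<preceq>\<^bsub>S\<^esub> \<top>\<^bsub>proj_order S\<^esub>"
    using LS.top_closed LS.top_higher by auto
  have topT: "\<top>\<^bsub>proj_order T\<^esub> \<in> proj T" "\<And>h. h \<in> proj T \<Longrightarrow> h \<preceq>\<^bsub>T\<^esub> \<top>\<^bsub>proj_order T\<^esub>"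
    using LT.top_closed LT.top_higher by auto
  have top: "f \<top>\<^bsub>proj_order S\<^esub> = \<top>\<^bsub>proj_order T\<^esub> \<longleftrightarrow> (\<forall>u\<in>proj T. \<exists>h\<in>proj S. u \<preceq>\<^bsub>T\<^esub> f h)"
  proof
    assume R: "\<forall>u\<in>proj T. \<exists>h\<in>proj S. u \<preceq>\<^bsub>T\<^esub> f h"
    then obtain h where h: "h \<in> proj S" "\<top>\<^bsub>proj_order T\<^esub> \<preceq>\<^bsub>T\<^esub> f h" using topT by blast
    then have "\<top>\<^bsub>proj_order T\<^esub> \<preceq>\<^bsub>T\<^esub> f \<top>\<^bsub>proj_order S\<^esub>"
      using topS T.le_trans[OF h(2) hom_mono[of h "\<top>\<^bsub>proj_order S\<^esub>"]] by simp
    then show "f \<top>\<^bsub>proj_order S\<^esub> = \<top>\<^bsub>proj_order T\<^esub>"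
      using topT topS T.le_antisym by auto
  qed (use topS topT in metis)
  have meet: "f (x \<sqinter>\<^bsub>proj_order S\<^esub> y) = f x \<sqinter>\<^bsub>proj_order T\<^esub> f y" if "x \<in> proj S" "y \<in> proj S" for x y
    using that by (simp add: S.proj_order_meet T.proj_order_meet hom_mult)
  show ?thesis
    unfolding crm_morphism_def join_morphism_def frame_morphism_def top[symmetric]
    using True sup meet by auto
qed (simp add: crm_morphism_def join_morphism_def)

lemma drs_morphism_iff:
  assumes "distributive_rs S" "distributive_rs T"
  shows "drs_morphism S T f \<longleftrightarrow> join_morphism True S T f"
proof (cases "rs_hom S T f")
  case True
  have "restriction_semigroup S" "restriction_semigroup T"
    using assms by (auto simp: distributive_rs_def)
  then interpret rs_homomorphism S T f
    using True by (simp add: rs_homomorphism_def rs_homomorphism_axioms_def)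
  have DS: "distributive_lattice (proj_order S)" and DT: "distributive_lattice (proj_order T)"
    using assms by (auto simp: distributive_rs_def)
  then interpret LS: lattice "proj_order S" + LT: lattice "proj_order T"
    unfolding distributive_lattice_def by blast+
  interpret BS: weak_partial_order_bottom "proj_order S" using DS unfolding distributive_lattice_def by blast
  interpret BT: weak_partial_order_bottom "proj_order T" using DT unfolding distributive_lattice_def by blast
  have meet: "f (x \<sqinter>\<^bsub>proj_order S\<^esub> y) = f x \<sqinter>\<^bsub>proj_order T\<^esub> f y" if "x \<in> proj S" "y \<in> proj S" for x y
    using that by (simp add: S.proj_order_meet T.proj_order_meet hom_mult)
  have lubS: "proj_lub S (x \<squnion>\<^bsub>proj_order S\<^esub> y) {x, y}" if "x \<in> proj S" "y \<in> proj S" for x y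
    unfolding join_def using that by (intro LS.sup_of_two_least) auto
  have lubT: "proj_lub T (x \<squnion>\<^bsub>proj_order T\<^esub> y) {x, y}" if "x \<in> proj T" "y \<in> proj T" for x y
    unfolding join_def using that by (intro LT.sup_of_two_least) auto
  have sup: "(f \<bottom>\<^bsub>proj_order S\<^esub> = \<bottom>\<^bsub>proj_order T\<^esub> \<and>
      (\<forall>x\<in>proj S. \<forall>y\<in>proj S. f (x \<squnion>\<^bsub>proj_order S\<^esub> y) = f x \<squnion>\<^bsub>proj_order T\<^esub> f y)) \<longleftrightarrow>
      (\<forall>X s. finite X \<longrightarrow> X \<subseteq> proj S \<longrightarrow> proj_lub S s X \<longrightarrow> proj_lub T (f s) (f ` X))"
    (is "?l1 \<and> ?l2 \<longleftrightarrow> ?r")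
  proof
    assume l: "?l1 \<and> ?l2"
    have "\<exists>h. proj_lub S h X \<and> proj_lub T (f h) (f ` X)" if "finite X" "X \<subseteq> proj S" for X
      using that
    proof (induction X)
      case empty
      then show ?case using BS.bottom_least BT.bottom_least l
        by (intro exI[of _ "\<bottom>\<^bsub>proj_order S\<^esub>"]) simp
    next
      case (insert x X)
      then obtain h where h: "proj_lub S h X" "proj_lub T (f h) (f ` X)" by auto
      have p: "h \<in> proj S" "x \<in> proj S" "X \<subseteq> proj S" using least_closed[OF h(1)] insert by auto
      let ?s = "x \<squnion>\<^bsub>proj_order S\<^esub> h"
      have "proj_lub S ?s (insert x X)"
        using LS.lub_insert[OF h(1) _ _ lubS[OF p(2,1)]] p by simp
      moreover have "f ?s = f x \<squnion>\<^bsub>proj_order T\<^esub> f h" using l p by blast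
      moreover have "proj_lub T (f x \<squnion>\<^bsub>proj_order T\<^esub> f h) (insert (f x) (f ` X))"
      proof (rule LT.lub_insert[OF h(2)])
        show "f ` X \<subseteq> carrier (proj_order T)" "f x \<in> carrier (proj_order T)" using p by auto
        show "proj_lub T (f x \<squnion>\<^bsub>proj_order T\<^esub> f h) {f x, f h}" using p by (intro lubT) simp_all
      qed
      ultimately show ?case by auto
    qed
    then show ?r using LS.least_unique by blast
  next
    assume r: ?r
    have "proj_lub T (f \<bottom>\<^bsub>proj_order S\<^esub>) {}"
      using r[rule_format, of "{}" "\<bottom>\<^bsub>proj_order S\<^esub>"] BS.bottom_least by simp
    then have ?l1 using BT.bottom_least LT.least_unique by auto
    moreover have ?l2
    proof (intro ballI)
      fix x y assume xy: "x \<in> proj S" "y \<in> proj S"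
      have "proj_lub T (f (x \<squnion>\<^bsub>proj_order S\<^esub> y)) {f x, f y}"
        using r[rule_format, of "{x, y}" "x \<squnion>\<^bsub>proj_order S\<^esub> y"] lubS[OF xy] xy by simp
      then show "f (x \<squnion>\<^bsub>proj_order S\<^esub> y) = f x \<squnion>\<^bsub>proj_order T\<^esub> f y" using LT.join_eqI by simp
    qed
    ultimately show "?l1 \<and> ?l2" ..
  qed
  have 1: "f \<in> proj S \<rightarrow> proj T" by auto
  show ?thesis
    unfolding drs_morphism_def join_morphism_def distributive_lattice_morphism_def small_simps sup[symmetric]
    using True meet 1 by auto
qed (simp add: drs_morphism_def join_morphism_def)

lemma join_morphism_compose:
  assumes S: "restriction_semigroup S" and T: "restriction_semigroup T" and U: "restriction_semigroup U"
    and f: "join_morphism fin S T f" and g: "join_morphism fin T U g"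
  shows "join_morphism fin S U (compose (carrier S) g f)"
proof -
  interpret f: rs_homomorphism S T f
    using S T f by (simp add: rs_homomorphism_def rs_homomorphism_axioms_def join_morphism_def)
  interpret g: rs_homomorphism T U g
    using U T g by (simp add: rs_homomorphism_def rs_homomorphism_axioms_def join_morphism_def)
  let ?h = "compose (carrier S) g f"
  have eq: "?h s = g (f s)" if "s \<in> carrier S" for s using that by (simp add: compose_eq)
  show ?thesis
    unfolding join_morphism_def
  proof (intro conjI allI impI ballI)
    show "rs_hom S U ?h" using rs_hom_compose[OF S f.hom g.hom] .
    fix X s assume X: "small fin X" "X \<subseteq> proj S" "proj_lub S s X"
    then have "proj_lub T (f s) (f ` X)" using f unfolding join_morphism_def by blast
    moreover have "f ` X \<subseteq> proj T" using X by auto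
    ultimately have "proj_lub U (g (f s)) (g ` f ` X)"
      using g small_image[OF X(1)] unfolding join_morphism_def by blast
    moreover have "?h ` X = g ` f ` X" using X eq by (auto simp: subset_iff image_iff)
    moreover have "s \<in> carrier S" using least_closed[OF X(3)] by simp
    ultimately show "proj_lub U (?h s) (?h ` X)" by (simp add: eq)
  next
    fix u assume "u \<in> proj U"
    then obtain h where h: "h \<in> proj T" "u \<preceq>\<^bsub>U\<^esub> g h" using g unfolding join_morphism_def by blast
    then obtain j where j: "j \<in> proj S" "h \<preceq>\<^bsub>T\<^esub> f j" using f unfolding join_morphism_def by blast
    then have "u \<preceq>\<^bsub>U\<^esub> g (f j)" using h g.T.le_trans[of u "g h" "g (f j)"] g.hom_mono by simp
    then show "\<exists>h\<in>proj S. u \<preceq>\<^bsub>U\<^esub> ?h h" using j eq by auto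
  qed
qed

locale join_homomorphism = S: joined_restriction_semigroup S fin + T: joined_restriction_semigroup T fin
  for S :: "('a, 'c) rsemigroup_scheme" and T :: "('b, 'd) rsemigroup_scheme" and fin +
  fixes f
  assumes join_morphism: "join_morphism fin S T f"
begin

sublocale rs_homomorphism S T f
  using join_morphism by unfold_locales (simp add: join_morphism_def)

text \<open>Only joins of projections are preserved by definition. For other elements the criterion in
  terms of \<open>lam\<close> applies, because \<open>f s\<close> is an upper bound of \<open>f ` X\<close>.\<close>

lemma hom_nat_lub:
  assumes X: "small fin X" "X \<noteq> {}" "X \<subseteq> carrier S" "nat_lub S s X"
  shows "nat_lub T (f s) (f ` X)"
proof (rule T.nat_lub_criterion)
  note s = X(4)[unfolded nat_lub_iff[OF X(3)]]
  show "small fin (f ` X)" using X by (simp add: small_image)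
  show "f ` X \<noteq> {}" "f s \<in> carrier T" using X s by auto
  show "x \<preceq>\<^bsub>T\<^esub> f s" if "x \<in> f ` X" for x using that hom_mono s by auto
  have L: "small fin (lam S ` X)" "lam S ` X \<noteq> {}" "lam S ` X \<subseteq> proj S"
    using X by (auto simp: small_image)
  have "proj_lub S (lam S s) (lam S ` X)"
    using S.nat_lub_lam[OF X] S.proj_lub_iff_nat_lub[OF L] by simp
  then have "proj_lub T (f (lam S s)) (f ` lam S ` X)"
    using join_morphism L unfolding join_morphism_def by blast
  moreover have "small fin (f ` lam S ` X)" "f ` lam S ` X \<noteq> {}" "f ` lam S ` X \<subseteq> proj T"
    using L by (auto simp: small_image)
  ultimately have 1: "nat_lub T (f (lam S s)) (f ` lam S ` X)" using T.nat_lub_of_proj_lub by blast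
  have 2: "f ` lam S ` X = lam T ` f ` X"
    unfolding image_image using X(3) hom_lam by (intro image_cong) auto
  show "nat_lub T (lam T (f s)) (lam T ` f ` X)"
    using 1 unfolding 2 using s by (simp add: hom_lam)
qed

end

lemma join_homomorphismI:
  "joined_restriction_semigroup S fin \<Longrightarrow> joined_restriction_semigroup T fin \<Longrightarrow>
   join_morphism fin S T f \<Longrightarrow> join_homomorphism S T fin f"
  by (simp add: join_homomorphism_def join_homomorphism_axioms_def)

text \<open>Only nonempty covers are considered, so that the rules for joins apply to them. Nothing is lost:
  an element with an empty cover is a least element (\<open>cover_of_zero\<close>).\<close>

definition proper_morphism ::
  "bool \<Rightarrow> ('a, 'c) rsemigroup_scheme \<Rightarrow> ('b, 'd) rsemigroup_scheme \<Rightarrow> ('a \<Rightarrow> 'b) \<Rightarrow> bool" where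
  "proper_morphism fin S T f \<longleftrightarrow> (\<forall>t\<in>carrier T. \<exists>X. X \<subseteq> carrier T \<and> X \<noteq> {} \<and> small fin X \<and>
     nat_lub T t X \<and> (\<forall>x\<in>X. \<exists>s\<in>carrier S. x \<preceq>\<^bsub>T\<^esub> f s))"

lemma proper_morphismE:
  assumes "proper_morphism fin S T f" "t \<in> carrier T"
  obtains X where "X \<subseteq> carrier T" "X \<noteq> {}" "small fin X" "nat_lub T t X"
    "\<And>x. x \<in> X \<Longrightarrow> \<exists>s\<in>carrier S. x \<preceq>\<^bsub>T\<^esub> f s"
  using bspec[OF assms(1)[unfolded proper_morphism_def] assms(2)] by blast

lemma (in join_homomorphism) cover_of_zero:
  assumes t: "t \<in> carrier T" "\<And>u. u \<in> carrier T \<Longrightarrow> t \<preceq>\<^bsub>T\<^esub> u"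
  shows "\<exists>s\<in>carrier S. t \<preceq>\<^bsub>T\<^esub> f s"
  using t S.proj_nonempty S.proj_carrier hom_closed by blast

lemma crm_proper_iff:
  assumes "complete_restriction_monoid S" "complete_restriction_monoid T" "crm_morphism S T f"
  shows "crm_proper S T f \<longleftrightarrow> proper_morphism False S T f"
proof -
  interpret join_homomorphism S T False f
    using assms crm_morphism_iff[OF assms(1,2)] by (intro join_homomorphismI) (auto simp: complete_restriction_monoid_iff)
  show ?thesis
    unfolding crm_proper_def proper_morphism_def
  proof (intro ball_cong refl iffI)
    fix t assume t: "t \<in> carrier T"
    assume "\<exists>X\<subseteq>carrier T. nat_lub T t X \<and> (\<forall>x\<in>X. \<exists>s\<in>carrier S. x \<preceq>\<^bsub>T\<^esub> f s)"
    then obtain X where X: "X \<subseteq> carrier T" "nat_lub T t X" "\<forall>x\<in>X. \<exists>s\<in>carrier S. x \<preceq>\<^bsub>T\<^esub> f s" by blast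
    show "\<exists>X. X \<subseteq> carrier T \<and> X \<noteq> {} \<and> small False X \<and> nat_lub T t X \<and>
      (\<forall>x\<in>X. \<exists>s\<in>carrier S. x \<preceq>\<^bsub>T\<^esub> f s)"
    proof (cases "X = {}")
      case True
      then have "t \<preceq>\<^bsub>T\<^esub> u" if "u \<in> carrier T" for u using X that by (simp add: least_def)
      then have "\<exists>s\<in>carrier S. t \<preceq>\<^bsub>T\<^esub> f s" using cover_of_zero t by blast
      then show ?thesis using T.nat_lub_singleton[OF t] t by (intro exI[of _ "{t}"]) auto
    qed (use X in \<open>auto intro!: exI[of _ X]\<close>)
  qed blast
qed

lemma drs_proper_iff: "drs_proper S T f \<longleftrightarrow> proper_morphism True S T f"
  unfolding drs_proper_def proper_morphism_def
proof (intro ball_cong refl iffI)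
  fix t
  assume "\<exists>(n::nat) t' s'. 1 \<le> n \<and> (\<forall>i\<in>{1..n}. t' i \<in> carrier T \<and> s' i \<in> carrier S \<and>
    t' i \<preceq>\<^bsub>T\<^esub> f (s' i)) \<and> nat_lub T t (t' ` {1..n})"
  then obtain n :: nat and t' s' where *: "1 \<le> n" "\<forall>i\<in>{1..n}. t' i \<in> carrier T \<and> s' i \<in> carrier S \<and>
    t' i \<preceq>\<^bsub>T\<^esub> f (s' i)" "nat_lub T t (t' ` {1..n})" by blast
  then show "\<exists>X. X \<subseteq> carrier T \<and> X \<noteq> {} \<and> small True X \<and> nat_lub T t X \<and>
      (\<forall>x\<in>X. \<exists>s\<in>carrier S. x \<preceq>\<^bsub>T\<^esub> f s)"
    by (intro exI[of _ "t' ` {1..n}"]) auto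
next
  fix t
  assume "\<exists>X. X \<subseteq> carrier T \<and> X \<noteq> {} \<and> small True X \<and> nat_lub T t X \<and>
      (\<forall>x\<in>X. \<exists>s\<in>carrier S. x \<preceq>\<^bsub>T\<^esub> f s)"
  then obtain X where X: "X \<subseteq> carrier T" "X \<noteq> {}" "finite X" "nat_lub T t X"
    "\<forall>x\<in>X. \<exists>s\<in>carrier S. x \<preceq>\<^bsub>T\<^esub> f s" by auto
  obtain s' where s': "\<And>x. x \<in> X \<Longrightarrow> s' x \<in> carrier S \<and> x \<preceq>\<^bsub>T\<^esub> f (s' x)" using X(5) by metis
  obtain t' where t': "bij_betw t' {1..card X} X" using ex_bij_betw_nat_finite_1[OF X(3)] by blast
  then have "t' ` {1..card X} = X" by (simp add: bij_betw_def)
  moreover have "1 \<le> card X" using X by (simp add: Suc_leI card_gt_0_iff)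
  ultimately show "\<exists>(n::nat) t' s'. 1 \<le> n \<and> (\<forall>i\<in>{1..n}. t' i \<in> carrier T \<and> s' i \<in> carrier S \<and>
    t' i \<preceq>\<^bsub>T\<^esub> f (s' i)) \<and> nat_lub T t (t' ` {1..n})"
    using X s' by (intro exI[of _ "card X"] exI[of _ t'] exI[of _ "s' \<circ> t'"]) auto
qed

text \<open>A cover of \<open>u\<close> by elements \<open>x \<le> g t\<close> is refined by covering each \<open>t\<close>, applying
  \<open>g\<close>, and restricting the result to \<open>x\<close>.\<close>

lemma proper_morphism_compose:
  assumes S: "restriction_semigroup S" and T: "joined_restriction_semigroup T fin"
    and U: "joined_restriction_semigroup U fin"
    and f: "rs_hom S T f" "proper_morphism fin S T f"
    and g: "join_morphism fin T U g" "proper_morphism fin T U g"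
  shows "proper_morphism fin S U (compose (carrier S) g f)"
  unfolding proper_morphism_def
proof
  interpret g: join_homomorphism T U fin g using T U g by (intro join_homomorphismI)
  interpret f: rs_homomorphism S T f
    using S f g.S.restriction_semigroup_axioms by (simp add: rs_homomorphism_def rs_homomorphism_axioms_def)
  fix u assume "u \<in> carrier U"
  from proper_morphismE[OF g(2) this] obtain X where X: "X \<subseteq> carrier U" "X \<noteq> {}" "small fin X"
    "nat_lub U u X" "\<And>x. x \<in> X \<Longrightarrow> \<exists>t\<in>carrier T. x \<preceq>\<^bsub>U\<^esub> g t" by metis
  have "\<exists>Z. Z \<subseteq> carrier U \<and> Z \<noteq> {} \<and> small fin Z \<and> nat_lub U x Z \<and>
    (\<forall>z\<in>Z. \<exists>s\<in>carrier S. z \<preceq>\<^bsub>U\<^esub> g (f s))" if x: "x \<in> X" for x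
  proof -
    have xc: "x \<in> carrier U" using x X by blast
    obtain t where t: "t \<in> carrier T" "x \<preceq>\<^bsub>U\<^esub> g t" using X(5)[OF x] by blast
    from proper_morphismE[OF f(2) t(1)] obtain Y where Y: "Y \<subseteq> carrier T" "Y \<noteq> {}" "small fin Y"
      "nat_lub T t Y" "\<And>y. y \<in> Y \<Longrightarrow> \<exists>s\<in>carrier S. y \<preceq>\<^bsub>T\<^esub> f s" by metis
    have "nat_lub U (g t) (g ` Y)" using Y by (intro g.hom_nat_lub) auto
    moreover have gY: "g ` Y \<subseteq> carrier U" using Y by auto
    ultimately have "nat_lub U x ((\<lambda>z. z \<odot>\<^bsub>U\<^esub> lam U x) ` g ` Y)"
      using Y t by (intro g.T.nat_lub_below[of _ "g t"] small_image) auto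
    moreover have "\<exists>s\<in>carrier S. g y \<odot>\<^bsub>U\<^esub> lam U x \<preceq>\<^bsub>U\<^esub> g (f s)" if y: "y \<in> Y" for y
    proof -
      obtain s where s: "s \<in> carrier S" "y \<preceq>\<^bsub>T\<^esub> f s" using Y(5)[OF y] by blast
      have "g y \<odot>\<^bsub>U\<^esub> lam U x \<preceq>\<^bsub>U\<^esub> g y" using y Y xc by (intro g.T.mult_proj_le) auto
      moreover have "g y \<preceq>\<^bsub>U\<^esub> g (f s)" using s by (intro g.hom_mono) auto
      ultimately show ?thesis using s g.T.le_trans[of _ "g y" "g (f s)"] by auto
    qed
    moreover have "(\<lambda>z. z \<odot>\<^bsub>U\<^esub> lam U x) ` g ` Y \<subseteq> carrier U" using gY xc by auto
    moreover have "small fin ((\<lambda>z. z \<odot>\<^bsub>U\<^esub> lam U x) ` g ` Y)" using Y(3) by (intro small_image)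
    ultimately show ?thesis
      using Y(2) by (intro exI[of _ "(\<lambda>z. z \<odot>\<^bsub>U\<^esub> lam U x) ` g ` Y"] conjI) simp_all
  qed
  then have "\<exists>Z. \<forall>x\<in>X. Z x \<subseteq> carrier U \<and> Z x \<noteq> {} \<and> small fin (Z x) \<and> nat_lub U x (Z x) \<and>
    (\<forall>z\<in>Z x. \<exists>s\<in>carrier S. z \<preceq>\<^bsub>U\<^esub> g (f s))" by (intro bchoice ballI)
  then obtain Z where Z0: "\<forall>x\<in>X. Z x \<subseteq> carrier U \<and> Z x \<noteq> {} \<and> small fin (Z x) \<and> nat_lub U x (Z x) \<and>
    (\<forall>z\<in>Z x. \<exists>s\<in>carrier S. z \<preceq>\<^bsub>U\<^esub> g (f s))" by (elim exE)
  have Z: "Z x \<subseteq> carrier U" "Z x \<noteq> {}" "small fin (Z x)" "nat_lub U x (Z x)"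
    "\<forall>z\<in>Z x. \<exists>s\<in>carrier S. z \<preceq>\<^bsub>U\<^esub> g (f s)" if "x \<in> X" for x
    using bspec[OF Z0 that] by simp_all
  have "nat_lub U u (\<Union>x\<in>X. Z x)" by (rule g.T.nat_lub_Union[OF X(4,1) Z(4,1)])
  moreover have "small fin (\<Union>x\<in>X. Z x)" by (rule small_UN[OF X(3) Z(3)])
  moreover have "(\<Union>x\<in>X. Z x) \<noteq> {}"
  proof -
    obtain x where "x \<in> X" using X(2) by blast
    then show ?thesis using Z(2)[of x] by blast
  qed
  moreover have "(\<Union>x\<in>X. Z x) \<subseteq> carrier U" using Z(1) by (rule UN_least)
  moreover have "\<exists>s\<in>carrier S. z \<preceq>\<^bsub>U\<^esub> compose (carrier S) g f s" if "z \<in> (\<Union>x\<in>X. Z x)" for z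
  proof -
    obtain s where "s \<in> carrier S" "z \<preceq>\<^bsub>U\<^esub> g (f s)" using \<open>z \<in> _\<close> Z(5) by blast
    then show ?thesis by (intro bexI[of _ s]) (simp_all add: compose_eq)
  qed
  ultimately show "\<exists>X. X \<subseteq> carrier U \<and> X \<noteq> {} \<and> small fin X \<and> nat_lub U u X \<and>
      (\<forall>x\<in>X. \<exists>s\<in>carrier S. x \<preceq>\<^bsub>U\<^esub> compose (carrier S) g f s)" by blast
qed

lemma crm_meet_preserving_compose:
  assumes "f \<in> carrier S \<rightarrow> carrier T" "crm_meet_preserving S T f" "crm_meet_preserving T U g"
  shows "crm_meet_preserving S U (compose (carrier S) g f)"
  unfolding crm_meet_preserving_def
proof (intro ballI allI)
  fix a b m assume ab: "a \<in> carrier S" "b \<in> carrier S"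
  have fab: "f a \<in> carrier T" "f b \<in> carrier T" using assms(1) ab by auto
  have c: "c \<in> carrier S" if "is_glb (natural_order S) c {a, b}" for c
    using greatest_closed[OF that] by simp
  have "is_glb (natural_order U) m {g (f a), g (f b)} \<longleftrightarrow>
      (\<exists>d. is_glb (natural_order T) d {f a, f b} \<and> m = g d)"
    using assms(3) fab unfolding crm_meet_preserving_def by blast
  also have "\<dots> \<longleftrightarrow> (\<exists>c. is_glb (natural_order S) c {a, b} \<and> m = g (f c))"
  proof -
    have *: "is_glb (natural_order T) d {f a, f b} \<longleftrightarrow>
        (\<exists>c. is_glb (natural_order S) c {a, b} \<and> d = f c)" for d
      using assms(2) ab unfolding crm_meet_preserving_def by simp
    show ?thesis unfolding * by blast
  qed
  also have "\<dots> \<longleftrightarrow> (\<exists>c. is_glb (natural_order S) c {a, b} \<and> m = compose (carrier S) g f c)"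
    using c by (metis compose_eq)
  finally show "is_glb (natural_order U) m {compose (carrier S) g f a, compose (carrier S) g f b} \<longleftrightarrow>
      (\<exists>c. is_glb (natural_order S) c {a, b} \<and> m = compose (carrier S) g f c)"
    using ab by (simp add: compose_eq)
qed

lemma drs_weakly_meet_preserving_compose:
  assumes S: "restriction_semigroup S" and T: "restriction_semigroup T" and U: "restriction_semigroup U"
    and f: "rs_hom S T f" and g: "rs_hom T U g"
    and "drs_weakly_meet_preserving S T f" "drs_weakly_meet_preserving T U g"
  shows "drs_weakly_meet_preserving S U (compose (carrier S) g f)"
  unfolding drs_weakly_meet_preserving_def
proof (intro ballI impI)
  interpret f: rs_homomorphism S T f
    using S T f by (simp add: rs_homomorphism_def rs_homomorphism_axioms_def)
  interpret g: rs_homomorphism T U g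
    using U T g by (simp add: rs_homomorphism_def rs_homomorphism_axioms_def)
  fix t a b assume ab: "t \<in> carrier U" "a \<in> carrier S" "b \<in> carrier S"
    and le: "t \<preceq>\<^bsub>U\<^esub> compose (carrier S) g f a \<and> t \<preceq>\<^bsub>U\<^esub> compose (carrier S) g f b"
  then have "t \<preceq>\<^bsub>U\<^esub> g (f a)" "t \<preceq>\<^bsub>U\<^esub> g (f b)" by (auto simp: compose_eq)
  then obtain c where c: "c \<in> carrier T" "c \<preceq>\<^bsub>T\<^esub> f a" "c \<preceq>\<^bsub>T\<^esub> f b" "t \<preceq>\<^bsub>U\<^esub> g c"
    using assms(7) ab unfolding drs_weakly_meet_preserving_def by (meson f.hom_closed)
  then obtain d where d: "d \<in> carrier S" "d \<preceq>\<^bsub>S\<^esub> a" "d \<preceq>\<^bsub>S\<^esub> b" "c \<preceq>\<^bsub>T\<^esub> f d"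
    using assms(6) ab unfolding drs_weakly_meet_preserving_def by meson
  have "t \<preceq>\<^bsub>U\<^esub> g (f d)" using c d g.T.le_trans[of t "g c" "g (f d)"] g.hom_mono[of c "f d"] by simp
  then show "\<exists>c\<in>carrier S. c \<preceq>\<^bsub>S\<^esub> a \<and> c \<preceq>\<^bsub>S\<^esub> b \<and> t \<preceq>\<^bsub>U\<^esub> compose (carrier S) g f c"
    using d by (auto simp: compose_eq)
qed

lemma crm_hom_compose:
  assumes S: "complete_restriction_monoid S" and T: "complete_restriction_monoid T"
    and U: "complete_restriction_monoid U" and f: "crm_hom k S T f" and g: "crm_hom k T U g"
  shows "crm_hom k S U (compose (carrier S) g f)"
proof -
  have R: "restriction_semigroup S" "restriction_semigroup T" "restriction_semigroup U"
    using S T U by (auto simp: complete_restriction_monoid_def)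
  have m: "join_morphism False S T f" "join_morphism False T U g" "crm_morphism S T f" "crm_morphism T U g"
    using f g S T U by (auto simp: crm_morphism_iff crm_hom_def)
  have h: "rs_hom S T f" using m by (simp add: join_morphism_def)
  then have fc: "f \<in> carrier S \<rightarrow> carrier T" by (auto simp: rs_hom_def)
  have mor: "crm_morphism S U (compose (carrier S) g f)"
    using join_morphism_compose[OF R m(1,2)] S U by (simp add: crm_morphism_iff)
  have "a \<in> carrier S" if "finite_element (proj_order S) a" for a
    using finite_element_carrier[OF that] restriction_semigroup.proj_carrier[OF R(1)] by simp
  then have "preserves_finite_projections S U (compose (carrier S) g f)"
    using f g unfolding crm_hom_def preserves_finite_projections_def by (auto simp: compose_eq)
  moreover have "crm_proper S U (compose (carrier S) g f)" if "crm_proper S T f" "crm_proper T U g"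
    using that m S T U mor proper_morphism_compose[OF R(1) _ _ h, of False U g]
    by (auto simp: crm_proper_iff complete_restriction_monoid_iff)
  ultimately show ?thesis
    using mor f g crm_meet_preserving_compose[OF fc, of U g] by (auto simp: crm_hom_def)
qed

lemma drs_hom_compose:
  assumes S: "distributive_rs S" and T: "distributive_rs T"
    and U: "distributive_rs U" and f: "drs_hom k S T f" and g: "drs_hom k T U g"
  shows "drs_hom k S U (compose (carrier S) g f)"
proof -
  have R: "restriction_semigroup S" "restriction_semigroup T" "restriction_semigroup U"
    using S T U by (auto simp: distributive_rs_def)
  have m: "join_morphism True S T f" "join_morphism True T U g"
    using f g S T U by (auto simp: drs_morphism_iff drs_hom_def)
  have h: "rs_hom S T f" "rs_hom T U g" using m by (auto simp: join_morphism_def)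
  have "drs_morphism S U (compose (carrier S) g f)"
    using join_morphism_compose[OF R m(1,2)] S U by (simp add: drs_morphism_iff)
  moreover have "drs_proper S U (compose (carrier S) g f)" if "drs_proper S T f" "drs_proper T U g"
    using that m S T U proper_morphism_compose[OF R(1) _ _ h(1), of True U g]
    by (auto simp: drs_proper_iff distributive_rs_iff)
  ultimately show ?thesis
    using f g drs_weakly_meet_preserving_compose[OF R h] by (auto simp: drs_hom_def)
qed

section \<open>Isomorphisms\<close>

text \<open>The condition on projections makes the axioms of a restriction semigroup pass from \<open>S\<close> to an
  arbitrary structure \<open>T\<close>. Between restriction semigroups it follows from bijectivity
  (\<open>rs_isoI\<close>).\<close>

definition rs_iso ::
  "('a, 'c) rsemigroup_scheme \<Rightarrow> ('b, 'd) rsemigroup_scheme \<Rightarrow> ('a \<Rightarrow> 'b) \<Rightarrow> bool" where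
  "rs_iso S T \<phi> \<longleftrightarrow> rs_hom S T \<phi> \<and> bij_betw \<phi> (carrier S) (carrier T) \<and> \<phi> ` proj S = proj T"

text \<open>All axioms for \<open>T\<close> are read off from \<open>S\<close>; in this way the lift to another universe becomes a
  restriction semigroup.\<close>

lemma rs_iso_restriction_semigroup:
  assumes "restriction_semigroup S" "rs_iso S T \<phi>"
  shows "restriction_semigroup T"
proof -
  interpret S: restriction_semigroup S by fact
  have C: "carrier T = \<phi> ` carrier S" "proj T = \<phi> ` proj S"
    using assms(2) by (auto simp: rs_iso_def bij_betw_def)
  have ops: "\<phi> a \<odot>\<^bsub>T\<^esub> \<phi> b = \<phi> (a \<odot>\<^bsub>S\<^esub> b)" "lam T (\<phi> a) = \<phi> (lam S a)" "rho T (\<phi> a) = \<phi> (rho S a)"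
    if "a \<in> carrier S" "b \<in> carrier S" for a b
    using assms(2) that by (auto simp: rs_iso_def rs_hom_def)
  have ops2: "lam T (\<phi> a) = \<phi> (lam S a)" "rho T (\<phi> a) = \<phi> (rho S a)" if "a \<in> carrier S" for a
    using ops(2,3)[OF that that] .
  show ?thesis
  proof unfold_locales
    show "proj T \<subseteq> carrier T" "proj T \<noteq> {}" unfolding C using S.proj_subset S.proj_nonempty by auto
  next
    fix f g assume "f \<in> proj T" "g \<in> proj T"
    then obtain f' g' where "f = \<phi> f'" "g = \<phi> g'" "f' \<in> proj S" "g' \<in> proj S" unfolding C by blast
    then show "f \<odot>\<^bsub>T\<^esub> g \<in> proj T" "f \<odot>\<^bsub>T\<^esub> g = g \<odot>\<^bsub>T\<^esub> f"
      by (simp_all add: C ops S.proj_comm)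
  next
    fix f assume "f \<in> proj T"
    then obtain f' where "f = \<phi> f'" "f' \<in> proj S" unfolding C by blast
    then show "f \<odot>\<^bsub>T\<^esub> f = f" "lam T f = f" "rho T f = f"
      by (simp_all add: ops ops2 S.proj_idem)
  next
    fix a assume "a \<in> carrier T"
    then obtain a' where "a = \<phi> a'" "a' \<in> carrier S" unfolding C by blast
    then show "lam T a \<in> proj T" "rho T a \<in> proj T" "a \<odot>\<^bsub>T\<^esub> lam T a = a" "rho T a \<odot>\<^bsub>T\<^esub> a = a"
      by (simp_all add: C ops ops2)
  next
    fix a b assume "a \<in> carrier T" "b \<in> carrier T"
    then obtain a' b' where "a = \<phi> a'" "b = \<phi> b'" "a' \<in> carrier S" "b' \<in> carrier S" unfolding C by blast
    then show "a \<odot>\<^bsub>T\<^esub> b \<in> carrier T" "lam T (lam T a \<odot>\<^bsub>T\<^esub> b) = lam T (a \<odot>\<^bsub>T\<^esub> b)"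
      "rho T (a \<odot>\<^bsub>T\<^esub> rho T b) = rho T (a \<odot>\<^bsub>T\<^esub> b)"
      by (simp_all add: C ops ops2 S.lam_lam_mult S.rho_mult_rho)
  next
    fix a b c assume "a \<in> carrier T" "b \<in> carrier T" "c \<in> carrier T"
    then obtain a' b' c' where "a = \<phi> a'" "b = \<phi> b'" "c = \<phi> c'"
      "a' \<in> carrier S" "b' \<in> carrier S" "c' \<in> carrier S" unfolding C by blast
    then show "a \<odot>\<^bsub>T\<^esub> b \<odot>\<^bsub>T\<^esub> c = a \<odot>\<^bsub>T\<^esub> (b \<odot>\<^bsub>T\<^esub> c)"
      by (simp add: C ops S.mult_assoc)
  next
    fix a f assume "a \<in> carrier T" "f \<in> proj T"
    then obtain a' f' where "a = \<phi> a'" "f = \<phi> f'" "a' \<in> carrier S" "f' \<in> proj S" unfolding C by blast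
    then show "f \<odot>\<^bsub>T\<^esub> a = a \<odot>\<^bsub>T\<^esub> lam T (f \<odot>\<^bsub>T\<^esub> a)" "a \<odot>\<^bsub>T\<^esub> f = rho T (a \<odot>\<^bsub>T\<^esub> f) \<odot>\<^bsub>T\<^esub> a"
      by (simp_all add: C ops ops2 S.left_restriction[symmetric] S.right_restriction[symmetric])
  qed
qed

text \<open>Projections are the elements fixed by \<open>lam\<close>, so a bijective homomorphism reflects them.\<close>

lemma rs_isoI:
  assumes S: "restriction_semigroup S" and T: "restriction_semigroup T" and \<phi>: "rs_hom S T \<phi>"
    and bij: "bij_betw \<phi> (carrier S) (carrier T)"
  shows "rs_iso S T \<phi>"
proof -
  interpret rs_homomorphism S T \<phi>
    using S T \<phi> by (simp add: rs_homomorphism_def rs_homomorphism_axioms_def)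
  have "q \<in> \<phi> ` proj S" if q: "q \<in> proj T" for q
  proof -
    have "q \<in> \<phi> ` carrier S" using bij q by (simp add: bij_betw_def)
    then obtain a where a: "a \<in> carrier S" "q = \<phi> a" by blast
    then have "\<phi> (lam S a) = \<phi> a" using q by (simp add: hom_lam)
    then have "lam S a = a" using bij a by (auto simp: bij_betw_def inj_on_def)
    then show ?thesis using a S.lam_closed[OF a(1)] by auto
  qed
  then have "\<phi> ` proj S = proj T" by auto
  then show ?thesis using \<phi> bij by (simp add: rs_iso_def)
qed

locale rs_isomorphism = S: restriction_semigroup S
  for S :: "('a, 'c) rsemigroup_scheme" +
  fixes T :: "('b, 'd) rsemigroup_scheme" and \<phi>
  assumes iso: "rs_iso S T \<phi>"
begin

sublocale T: restriction_semigroup T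
  using rs_iso_restriction_semigroup[OF S.restriction_semigroup_axioms iso] .

sublocale rs_homomorphism S T \<phi>
  using iso by unfold_locales (simp add: rs_iso_def)

lemma iso_carrier: "carrier T = \<phi> ` carrier S" and iso_proj: "proj T = \<phi> ` proj S"
  and iso_inj: "inj_on \<phi> (carrier S)"
  using iso by (auto simp: rs_iso_def bij_betw_def)

lemma iso_eq_iff: "a \<in> carrier S \<Longrightarrow> b \<in> carrier S \<Longrightarrow> \<phi> a = \<phi> b \<longleftrightarrow> a = b"
  using iso_inj by (auto simp: inj_on_def)

lemma iso_le_iff: "a \<in> carrier S \<Longrightarrow> b \<in> carrier S \<Longrightarrow> \<phi> a \<preceq>\<^bsub>T\<^esub> \<phi> b \<longleftrightarrow> a \<preceq>\<^bsub>S\<^esub> b"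
  by (simp add: T.le_iff_lam S.le_iff_lam hom_lam[symmetric] hom_mult[symmetric] iso_eq_iff)

lemma iso_natural_order: "order_iso (natural_order S) (natural_order T) \<phi>"
  using iso by (simp add: order_iso_def iso_le_iff rs_iso_def)

lemma iso_proj_order: "order_iso (proj_order S) (proj_order T) \<phi>"
proof -
  have "inj_on \<phi> (proj S)" using iso_inj S.proj_subset by (rule inj_on_subset)
  then show ?thesis by (simp add: order_iso_def iso_le_iff iso_proj bij_betw_def)
qed

lemma iso_compatible: "a \<in> carrier S \<Longrightarrow> b \<in> carrier S \<Longrightarrow> compatible T (\<phi> a) (\<phi> b) \<longleftrightarrow> compatible S a b"
  by (simp add: compatible_def hom_lam[symmetric] hom_rho[symmetric] hom_mult[symmetric] iso_eq_iff)

lemma iso_compatible_set: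
  assumes "X \<subseteq> carrier S"
  shows "compatible_set T (\<phi> ` X) \<longleftrightarrow> compatible_set S X"
proof -
  have "compatible T (\<phi> a) (\<phi> b) \<longleftrightarrow> compatible S a b" if "a \<in> X" "b \<in> X" for a b
    using that assms iso_compatible by blast
  then show ?thesis using assms by (auto simp: compatible_set_def)
qed

lemma iso_nat_lub: "X \<subseteq> carrier S \<Longrightarrow> s \<in> carrier S \<Longrightarrow> nat_lub T (\<phi> s) (\<phi> ` X) \<longleftrightarrow> nat_lub S s X"
  using order_iso_lub[OF iso_natural_order] by simp

lemma iso_proj_lub: "X \<subseteq> proj S \<Longrightarrow> s \<in> proj S \<Longrightarrow> proj_lub T (\<phi> s) (\<phi> ` X) \<longleftrightarrow> proj_lub S s X"
  using order_iso_lub[OF iso_proj_order] by simp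

lemma iso_subsetE:
  assumes "X \<subseteq> carrier T"
  obtains Y where "Y \<subseteq> carrier S" "X = \<phi> ` Y"
  using assms unfolding iso_carrier by (rule subset_imageE)

lemma iso_small: "X \<subseteq> carrier S \<Longrightarrow> small fin (\<phi> ` X) \<longleftrightarrow> small fin X"
  using iso_inj finite_image_iff[of \<phi> X] inj_on_subset by (auto simp: small_def)

lemma iso_joined:
  assumes "joined_restriction_semigroup S fin"
  shows "joined_restriction_semigroup T fin"
proof (rule joined_restriction_semigroupI)
  interpret S: joined_restriction_semigroup S fin by fact
  show "restriction_semigroup T" by (rule T.restriction_semigroup_axioms)
  fix X
  show "\<exists>s. nat_lub T s X" if X: "small fin X" "compatible_set T X"
  proof -
    obtain Y where Y: "Y \<subseteq> carrier S" "X = \<phi> ` Y"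
      using X(2) iso_subsetE unfolding compatible_set_def by blast
    then obtain s where "nat_lub S s Y"
      using S.join_exists X iso_compatible_set iso_small by blast
    then show ?thesis using order_iso_ex_lub[OF iso_natural_order, of Y] Y by auto
  qed
  show "\<exists>h. proj_lub T h X \<and> (\<forall>f\<in>proj T. proj_lub T (f \<odot>\<^bsub>T\<^esub> h) ((\<odot>\<^bsub>T\<^esub>) f ` X))"
    if X: "small fin X" "X \<subseteq> proj T"
  proof -
    from X(2)[unfolded iso_proj] obtain Y where Y: "Y \<subseteq> proj S" "X = \<phi> ` Y" by (rule subset_imageE)
    then have YC: "Y \<subseteq> carrier S" by auto
    then have "small fin Y" using X iso_small Y by simp
    then obtain h where h: "proj_lub S h Y"
      "\<And>f. f \<in> proj S \<Longrightarrow> proj_lub S (f \<odot>\<^bsub>S\<^esub> h) ((\<odot>\<^bsub>S\<^esub>) f ` Y)"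
      using S.proj_join_exists Y by blast
    have hp: "h \<in> proj S" using least_closed[OF h(1)] by simp
    have "proj_lub T (\<phi> f \<odot>\<^bsub>T\<^esub> \<phi> h) ((\<odot>\<^bsub>T\<^esub>) (\<phi> f) ` X)" if f: "f \<in> proj S" for f
    proof -
      have "(\<odot>\<^bsub>T\<^esub>) (\<phi> f) ` X = \<phi> ` (\<odot>\<^bsub>S\<^esub>) f ` Y"
        unfolding Y image_image using f YC by (intro image_cong) (auto simp: hom_mult)
      moreover have "proj_lub T (\<phi> (f \<odot>\<^bsub>S\<^esub> h)) (\<phi> ` (\<odot>\<^bsub>S\<^esub>) f ` Y)"
        using h(2)[OF f] f hp Y by (subst iso_proj_lub) auto
      ultimately show ?thesis using f hp by (simp add: hom_mult)
    qed
    moreover have "proj_lub T (\<phi> h) X" using h(1) hp Y iso_proj_lub by simp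
    ultimately show ?thesis unfolding iso_proj by blast
  qed
qed

lemma iso_distributive_rs: "distributive_rs S \<Longrightarrow> distributive_rs T"
  by (simp add: distributive_rs_iff iso_joined)

lemma iso_complete_restriction_monoid:
  assumes "complete_restriction_monoid S"
  shows "complete_restriction_monoid T"
proof -
  obtain e where e: "e \<in> carrier S" "\<forall>a\<in>carrier S. e \<odot>\<^bsub>S\<^esub> a = a \<and> a \<odot>\<^bsub>S\<^esub> e = a"
    using assms by (auto simp: complete_restriction_monoid_iff)
  then have "\<phi> e \<odot>\<^bsub>T\<^esub> \<phi> a = \<phi> a \<and> \<phi> a \<odot>\<^bsub>T\<^esub> \<phi> e = \<phi> a" if "a \<in> carrier S" for a
    using that hom_mult[of e a] hom_mult[of a e] by simp
  then show ?thesis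
    using assms e iso_joined unfolding complete_restriction_monoid_iff iso_carrier by blast
qed

lemma iso_coherent_crm: "coherent_crm S \<Longrightarrow> coherent_crm T"
  using iso_complete_restriction_monoid order_iso_coherent_frame[OF iso_proj_order]
    T.proj_order_partial_order by (auto simp: coherent_crm_def)

lemma iso_glb2:
  assumes "a \<in> carrier S" "b \<in> carrier S"
  shows "is_glb (natural_order T) m {\<phi> a, \<phi> b} \<longleftrightarrow>
    (\<exists>c. is_glb (natural_order S) c {a, b} \<and> m = \<phi> c)"
proof
  assume m: "is_glb (natural_order T) m {\<phi> a, \<phi> b}"
  then obtain c where c: "c \<in> carrier S" "m = \<phi> c" using greatest_closed[OF m] iso_carrier by auto
  then show "\<exists>c. is_glb (natural_order S) c {a, b} \<and> m = \<phi> c"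
    using m order_iso_glb2[OF iso_natural_order, of a b c] assms by auto
next
  assume "\<exists>c. is_glb (natural_order S) c {a, b} \<and> m = \<phi> c"
  then obtain c where c: "is_glb (natural_order S) c {a, b}" "m = \<phi> c" by blast
  then show "is_glb (natural_order T) m {\<phi> a, \<phi> b}"
    using order_iso_glb2[OF iso_natural_order, of a b c] assms greatest_closed[OF c(1)] by simp
qed

lemma iso_distributive_meet_rs: "distributive_meet_rs S \<Longrightarrow> distributive_meet_rs T"
  unfolding distributive_meet_rs_def iso_carrier using iso_distributive_rs iso_glb2 by auto

end

lemma Lvee_partial_order: "partial_order (Lvee S)"
  by unfold_locales (auto simp: Lvee_def)

lemma Lvee_carrier: "A \<in> carrier (Lvee S) \<longleftrightarrow> order_ideal S A \<and>
    (\<forall>X s. X \<subseteq> A \<longrightarrow> compatible_set S X \<longrightarrow> nat_lub S s X \<longrightarrow> s \<in> A)"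
  by (auto simp: Lvee_def)

lemma Lvee_le [simp]: "A \<sqsubseteq>\<^bsub>Lvee S\<^esub> B \<longleftrightarrow> A \<subseteq> B"
  by (simp add: Lvee_def)

lemma Lvee_subset: "A \<in> carrier (Lvee S) \<Longrightarrow> A \<subseteq> carrier S"
  by (auto simp: Lvee_def order_ideal_def)

context rs_isomorphism begin

lemma iso_Lvee_carrier:
  assumes A: "A \<subseteq> carrier S"
  shows "\<phi> ` A \<in> carrier (Lvee T) \<longleftrightarrow> A \<in> carrier (Lvee S)"
proof -
  have mem: "\<phi> b \<in> \<phi> ` A \<longleftrightarrow> b \<in> A" if "b \<in> carrier S" for b
    using inj_on_image_mem_iff[OF iso_inj that A] .
  have "order_ideal T (\<phi> ` A) \<longleftrightarrow> order_ideal S A"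
    using A unfolding order_ideal_def iso_carrier by (auto simp: mem iso_le_iff subset_iff)
  moreover have "(\<forall>X s. X \<subseteq> \<phi> ` A \<longrightarrow> compatible_set T X \<longrightarrow> nat_lub T s X \<longrightarrow> s \<in> \<phi> ` A) \<longleftrightarrow>
      (\<forall>X s. X \<subseteq> A \<longrightarrow> compatible_set S X \<longrightarrow> nat_lub S s X \<longrightarrow> s \<in> A)" (is "?l \<longleftrightarrow> ?r")
  proof
    assume l: ?l
    show ?r
    proof (intro allI impI)
      fix X s assume X: "X \<subseteq> A" "compatible_set S X" "nat_lub S s X"
      have s: "s \<in> carrier S" using least_closed[OF X(3)] by simp
      have "\<phi> s \<in> \<phi> ` A"
        using l[rule_format, of "\<phi> ` X" "\<phi> s"] X A iso_compatible_set[of X] iso_nat_lub[of X s] s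
        by (simp add: image_mono)
      then show "s \<in> A" using mem s by simp
    qed
  next
    assume r: ?r
    show ?l
    proof (intro allI impI)
      fix X' s' assume X': "X' \<subseteq> \<phi> ` A" "compatible_set T X'" "nat_lub T s' X'"
      from X'(1) obtain X where X: "X \<subseteq> A" "X' = \<phi> ` X" by (rule subset_imageE)
      obtain s where s: "s \<in> carrier S" "s' = \<phi> s"
        using least_closed[OF X'(3)] iso_carrier by auto
      have "X \<subseteq> carrier S" using X A by blast
      then have "s \<in> A"
        using r[rule_format, of X s] X X' s iso_compatible_set[of X] iso_nat_lub[of X s] by simp
      then show "s' \<in> \<phi> ` A" using s by simp
    qed
  qed
  ultimately show ?thesis unfolding Lvee_carrier by simp
qed

lemma iso_Lvee: "order_iso (Lvee S) (Lvee T) ((`) \<phi>)"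
  unfolding order_iso_def
proof (intro conjI ballI)
  show "bij_betw ((`) \<phi>) (carrier (Lvee S)) (carrier (Lvee T))"
    unfolding bij_betw_def
  proof
    show "inj_on ((`) \<phi>) (carrier (Lvee S))"
    proof (rule inj_onI)
      fix A B assume A: "A \<in> carrier (Lvee S)" and B: "B \<in> carrier (Lvee S)" and eq: "\<phi> ` A = \<phi> ` B"
      show "A = B"
        using inj_on_image_eq_iff[OF iso_inj Lvee_subset[OF A] Lvee_subset[OF B]] eq by simp
    qed
    show "(`) \<phi> ` carrier (Lvee S) = carrier (Lvee T)"
    proof (intro Set.set_eqI iffI)
      fix B assume B: "B \<in> carrier (Lvee T)"
      then obtain A where "A \<subseteq> carrier S" "B = \<phi> ` A" using iso_subsetE Lvee_subset by metis
      then show "B \<in> (`) \<phi> ` carrier (Lvee S)" using iso_Lvee_carrier B by blast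
    next
      fix B assume "B \<in> (`) \<phi> ` carrier (Lvee S)"
      then show "B \<in> carrier (Lvee T)" using iso_Lvee_carrier Lvee_subset by blast
    qed
  qed
  fix A B assume "A \<in> carrier (Lvee S)" "B \<in> carrier (Lvee S)"
  then have AB: "A \<subseteq> carrier S" "B \<subseteq> carrier S" by (auto dest: Lvee_subset)
  have "\<phi> x \<in> \<phi> ` B \<longleftrightarrow> x \<in> B" if "x \<in> A" for x
    using inj_on_image_mem_iff[OF iso_inj _ AB(2)] that AB(1) by blast
  then show "\<phi> ` A \<sqsubseteq>\<^bsub>Lvee T\<^esub> \<phi> ` B \<longleftrightarrow> A \<sqsubseteq>\<^bsub>Lvee S\<^esub> B"
    unfolding Lvee_le image_subset_iff by blast
qed

lemma iso_strongly_coherent_crm: "strongly_coherent_crm S \<Longrightarrow> strongly_coherent_crm T"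
  using iso_complete_restriction_monoid order_iso_coherent_frame[OF iso_Lvee]
    Lvee_partial_order by (auto simp: strongly_coherent_crm_def)

lemma iso_join_morphism: "join_morphism fin S T \<phi>"
  unfolding join_morphism_def
proof (intro conjI allI impI ballI)
  show "proj_lub T (\<phi> s) (\<phi> ` X)" if "X \<subseteq> proj S" "proj_lub S s X" for X s
    using that iso_proj_lub[of X s] least_closed[OF that(2)] by simp
  show "\<exists>h\<in>proj S. u \<preceq>\<^bsub>T\<^esub> \<phi> h" if "u \<in> proj T" for u
  proof -
    obtain h where "h \<in> proj S" "u = \<phi> h" using \<open>u \<in> proj T\<close> unfolding iso_proj by blast
    then show ?thesis by (intro bexI[of _ h]) simp_all
  qed
qed (rule hom)

lemma iso_proper: "proper_morphism fin S T \<phi>"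
  unfolding proper_morphism_def
proof
  fix t assume t: "t \<in> carrier T"
  then obtain s where s: "s \<in> carrier S" "t = \<phi> s" using iso_carrier by auto
  then have "\<exists>s\<in>carrier S. t \<preceq>\<^bsub>T\<^esub> \<phi> s" by (intro bexI[of _ s]) simp_all
  then show "\<exists>X. X \<subseteq> carrier T \<and> X \<noteq> {} \<and> small fin X \<and> nat_lub T t X \<and>
      (\<forall>x\<in>X. \<exists>s\<in>carrier S. x \<preceq>\<^bsub>T\<^esub> \<phi> s)"
    using t T.nat_lub_singleton[OF t] by (intro exI[of _ "{t}"]) (auto intro: small_finite)
qed

text \<open>Isomorphisms are morphisms of all four types. This gives the invertibility of the natural
  transformations, and full faithfulness of the lift.\<close>

lemma iso_crm_hom:
  assumes "complete_restriction_monoid S"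
  shows "crm_hom k S T \<phi>"
proof -
  have T: "complete_restriction_monoid T" using assms by (rule iso_complete_restriction_monoid)
  have c: "complete_lattice (proj_order S)"
    using assms by (simp add: complete_restriction_monoid_def frame_complete)
  have m: "crm_morphism S T \<phi>" using assms T iso_join_morphism by (simp add: crm_morphism_iff)
  have "preserves_finite_projections S T \<phi>"
    unfolding preserves_finite_projections_def
  proof (intro allI impI)
    fix a assume a: "finite_element (proj_order S) a"
    show "finite_element (proj_order T) (\<phi> a)"
      using order_iso_finite_element[OF iso_proj_order c T.proj_order_partial_order
          finite_element_carrier[OF a]] a by simp
  qed
  moreover have "crm_meet_preserving S T \<phi>"
    unfolding crm_meet_preserving_def using iso_glb2 by blast
  ultimately show ?thesis using m iso_proper crm_proper_iff[OF assms T m] by (simp add: crm_hom_def)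
qed

lemma iso_drs_hom:
  assumes "distributive_rs S"
  shows "drs_hom k S T \<phi>"
proof -
  have T: "distributive_rs T" using assms by (rule iso_distributive_rs)
  have m: "drs_morphism S T \<phi>" using assms T iso_join_morphism by (simp add: drs_morphism_iff)
  have "drs_weakly_meet_preserving S T \<phi>"
    unfolding drs_weakly_meet_preserving_def
  proof (intro ballI impI)
    fix t a b assume t: "t \<in> carrier T" and ab: "a \<in> carrier S" "b \<in> carrier S"
      and le: "t \<preceq>\<^bsub>T\<^esub> \<phi> a \<and> t \<preceq>\<^bsub>T\<^esub> \<phi> b"
    obtain c where "c \<in> carrier S" "t = \<phi> c" using t unfolding iso_carrier by blast
    then show "\<exists>c\<in>carrier S. c \<preceq>\<^bsub>S\<^esub> a \<and> c \<preceq>\<^bsub>S\<^esub> b \<and> t \<preceq>\<^bsub>T\<^esub> \<phi> c"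
      using le ab by (intro bexI[of _ c]) (simp_all add: iso_le_iff)
  qed
  then show ?thesis using m iso_proper by (simp add: drs_hom_def drs_proper_iff)
qed

lemma iso_inverse: "rs_iso T S (restrict (inv_into (carrier S) \<phi>) (carrier T))"
proof -
  let ?\<psi> = "restrict (inv_into (carrier S) \<phi>) (carrier T)"
  have inv: "?\<psi> (\<phi> a) = a" if "a \<in> carrier S" for a
    using that iso_inj by simp
  have "rs_hom T S ?\<psi>"
    unfolding rs_hom_def
  proof (intro conjI ballI)
    show "?\<psi> \<in> carrier T \<rightarrow>\<^sub>E carrier S" using inv by (auto simp: iso_carrier)
    fix a b assume "a \<in> carrier T" "b \<in> carrier T"
    then obtain a' b' where ab: "a = \<phi> a'" "b = \<phi> b'" "a' \<in> carrier S" "b' \<in> carrier S"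
      unfolding iso_carrier by blast
    show "?\<psi> (a \<odot>\<^bsub>T\<^esub> b) = ?\<psi> a \<odot>\<^bsub>S\<^esub> ?\<psi> b"
      using inv[OF ab(3)] inv[OF ab(4)] inv[of "a' \<odot>\<^bsub>S\<^esub> b'"] ab by (simp only: hom_mult S.mult_closed)
  next
    fix a assume "a \<in> carrier T"
    then obtain a' where a: "a = \<phi> a'" "a' \<in> carrier S" unfolding iso_carrier by blast
    have 1: "lam T a = \<phi> (lam S a')" "rho T a = \<phi> (rho S a')" using a by (simp_all add: hom_lam hom_rho)
    have "?\<psi> a = a'" unfolding a(1) using a(2) by (rule inv)
    moreover have "?\<psi> (lam T a) = lam S a'" "?\<psi> (rho T a) = rho S a'"
      unfolding 1 using a(2) by (intro inv; simp)+
    ultimately show "?\<psi> (lam T a) = lam S (?\<psi> a)" "?\<psi> (rho T a) = rho S (?\<psi> a)" by (simp_all only:)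
  qed
  moreover have "bij_betw ?\<psi> (carrier T) (carrier S)"
  proof (rule bij_betw_byWitness[where f' = \<phi>])
    show "\<forall>a\<in>carrier T. \<phi> (?\<psi> a) = a" "\<forall>a\<in>carrier S. ?\<psi> (\<phi> a) = a"
      "?\<psi> ` carrier T \<subseteq> carrier S" "\<phi> ` carrier S \<subseteq> carrier T"
      unfolding iso_carrier using inv unfolding iso_carrier by auto
  qed
  moreover have "?\<psi> ` proj T = proj S"
  proof -
    have "(\<lambda>x. ?\<psi> (\<phi> x)) ` proj S = (\<lambda>x. x) ` proj S" using inv by (intro image_cong) auto
    then show ?thesis unfolding iso_proj image_image by simp
  qed
  ultimately show ?thesis by (simp add: rs_iso_def)
qed

end

lemma rs_isomorphismI: "restriction_semigroup S \<Longrightarrow> rs_iso S T \<phi> \<Longrightarrow> rs_isomorphism S T \<phi>"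
  by (simp add: rs_isomorphism_def rs_isomorphism_axioms_def)

lemma concrete_cat_simps [simp]:
  "Obj (concrete_cat P H) = {S. P S}" "Hom (concrete_cat P H) S T = {f. H S T f}"
  "Ident (concrete_cat P H) S = restrict id (carrier S)"
  "Comp (concrete_cat P H) S T U g f = compose (carrier S) g f"
  by (simp_all add: concrete_cat_def)

lemma concrete_cat_is_iso:
  assumes S: "restriction_semigroup S" and iso: "rs_iso S T \<phi>"
    and H: "H S T \<phi>" "\<And>\<psi>. rs_iso T S \<psi> \<Longrightarrow> H T S \<psi>"
  shows "is_iso (concrete_cat P H) S T \<phi>"
proof -
  interpret rs_isomorphism S T \<phi> using S iso by (rule rs_isomorphismI)
  let ?\<psi> = "restrict (inv_into (carrier S) \<phi>) (carrier T)"
  have "compose (carrier S) ?\<psi> \<phi> = restrict id (carrier S)"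
    using iso_inj by (intro ext) (auto simp: compose_def)
  moreover have "compose (carrier T) \<phi> ?\<psi> = restrict id (carrier T)"
    unfolding iso_carrier using iso_inj by (intro ext) (auto simp: compose_def)
  ultimately show ?thesis
    using H(1) H(2)[OF iso_inverse] by (auto simp: is_iso_def)
qed

section \<open>The lift between universes\<close>

lemma lift_rs_iso:
  assumes "restriction_semigroup S"
  shows "rs_iso S (lift_rs S) (\<lambda>x\<in>carrier S. {x})" (is "rs_iso _ _ ?u")
proof -
  interpret restriction_semigroup S by fact
  have "rs_hom S (lift_rs S) ?u"
    unfolding rs_hom_def by (auto simp: lift_rs_def)
  moreover have "bij_betw ?u (carrier S) (carrier (lift_rs S))"
    by (rule bij_betw_byWitness[where f' = the_elem]) (auto simp: lift_rs_def)
  moreover have "?u ` proj S = (\<lambda>x. {x}) ` proj S" by (intro image_cong) auto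
  then have "?u ` proj S = proj (lift_rs S)" by (simp only: lift_rs_def rsemigroup.simps)
  ultimately show ?thesis by (simp add: rs_iso_def)
qed

lemma unlift_rs_iso:
  assumes "restriction_semigroup S"
  shows "rs_iso (lift_rs S) S (\<lambda>A\<in>carrier (lift_rs S). the_elem A)" (is "rs_iso _ _ ?u")
proof -
  interpret restriction_semigroup S by fact
  have "rs_hom (lift_rs S) S ?u"
    unfolding rs_hom_def by (auto simp: lift_rs_def)
  moreover have "bij_betw ?u (carrier (lift_rs S)) (carrier S)"
    by (rule bij_betw_byWitness[where f' = "\<lambda>x. {x}"]) (auto simp: lift_rs_def)
  moreover have "?u ` proj (lift_rs S) = proj S"
  proof -
    have "(\<lambda>x. ?u {x}) ` proj S = (\<lambda>x. x) ` proj S"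
      using proj_subset by (intro image_cong) (auto simp: lift_rs_def)
    moreover have "proj (lift_rs S) = (\<lambda>x. {x}) ` proj S" by (simp add: lift_rs_def)
    ultimately show ?thesis by (simp only: image_image image_ident)
  qed
  ultimately show ?thesis by (simp add: rs_iso_def)
qed

text \<open>This equation and its inverse exhibit \<open>f\<close> and its lift as composites of each other with
  isomorphisms. Since isomorphisms are morphisms of every type and types are closed under composition,
  \<open>f\<close> and its lift have the same types.\<close>

lemma lift_arr_eq:
  assumes "f \<in> carrier S \<rightarrow>\<^sub>E carrier T"
  shows "on_arr lift_functor S T f =
    compose (carrier (lift_rs S)) (\<lambda>x\<in>carrier T. {x})
      (compose (carrier (lift_rs S)) f (\<lambda>A\<in>carrier (lift_rs S). the_elem A))"
  using assms by (auto simp: lift_functor_def compose_def lift_rs_def fun_eq_iff restrict_def)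

lemma unlift_arr_eq:
  assumes "f \<in> carrier S \<rightarrow>\<^sub>E carrier T"
  shows "f = compose (carrier S) (\<lambda>A\<in>carrier (lift_rs T). the_elem A)
      (compose (carrier S) (on_arr lift_functor S T f) (\<lambda>x\<in>carrier S. {x}))"
proof
  fix x
  show "f x = compose (carrier S) (\<lambda>A\<in>carrier (lift_rs T). the_elem A)
      (compose (carrier S) (on_arr lift_functor S T f) (\<lambda>x\<in>carrier S. {x})) x"
  proof (cases "x \<in> carrier S")
    case True
    moreover have "f x \<in> carrier T" using assms True by auto
    ultimately show ?thesis by (simp add: compose_def lift_functor_def lift_rs_def)
  next
    case False
    then show ?thesis using assms by (simp add: compose_def PiE_arb[OF assms])
  qed
qed

text \<open>The lift of an arrow is its conjugate by the isomorphisms \<open>x \<mapsto> {x}\<close>, so full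
  faithfulness only depends on whether a class of morphisms is closed under this conjugation.\<close>

lemma lift_functor_fully_faithful:
  fixes P :: "'a rsemigroup \<Rightarrow> bool" and P' :: "'a set rsemigroup \<Rightarrow> bool"
  assumes R: "\<And>S. P S \<Longrightarrow> restriction_semigroup S"
    and P': "\<And>S. P S \<Longrightarrow> P' (lift_rs S)"
    and H: "\<And>S T f. H S T f \<Longrightarrow> f \<in> carrier S \<rightarrow>\<^sub>E carrier T"
    and H': "\<And>S T f. H' S T f \<Longrightarrow> f \<in> carrier S \<rightarrow>\<^sub>E carrier T"
    and arr: "\<And>S T f. P S \<Longrightarrow> P T \<Longrightarrow> f \<in> carrier S \<rightarrow>\<^sub>E carrier T \<Longrightarrow>
      H' (lift_rs S) (lift_rs T) (on_arr lift_functor S T f) \<longleftrightarrow> H S T f"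
  shows "is_functor (concrete_cat P H) (concrete_cat P' H') lift_functor"
    "fully_faithful (concrete_cat P H) (concrete_cat P' H') lift_functor"
proof -
  have obj: "on_obj lift_functor S = lift_rs S" for S :: "'a rsemigroup"
    by (simp add: lift_functor_def)
  have app: "on_arr lift_functor S T f {x} = {f x}" if "x \<in> carrier S" for S T :: "'a rsemigroup" and f x
    using that by (simp add: lift_functor_def lift_rs_def)
  show "is_functor (concrete_cat P H) (concrete_cat P' H') lift_functor"
    unfolding is_functor_def
  proof (intro conjI ballI)
    fix S T U f g
    assume "S \<in> Obj (concrete_cat P H)" "T \<in> Obj (concrete_cat P H)" "U \<in> Obj (concrete_cat P H)"
      and "f \<in> Hom (concrete_cat P H) S T" "g \<in> Hom (concrete_cat P H) T U"
    then have "f \<in> carrier S \<rightarrow>\<^sub>E carrier T" using H by simp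
    then show "on_arr lift_functor S U (Comp (concrete_cat P H) S T U g f) =
        Comp (concrete_cat P' H') (on_obj lift_functor S) (on_obj lift_functor T) (on_obj lift_functor U)
          (on_arr lift_functor T U g) (on_arr lift_functor S T f)"
      by (auto simp: lift_functor_def lift_rs_def compose_def fun_eq_iff restrict_def)
  next
    fix S assume "S \<in> Obj (concrete_cat P H)"
    show "on_arr lift_functor S S (Ident (concrete_cat P H) S) = Ident (concrete_cat P' H') (on_obj lift_functor S)"
      by (auto simp: lift_functor_def lift_rs_def fun_eq_iff restrict_def)
  qed (use P' arr H in \<open>auto simp: obj\<close>)
  show "fully_faithful (concrete_cat P H) (concrete_cat P' H') lift_functor"
    unfolding fully_faithful_def
  proof (intro ballI)
    fix S T assume "S \<in> Obj (concrete_cat P H)" "T \<in> Obj (concrete_cat P H)"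
    then have ST: "P S" "P T" by simp_all
    have "bij_betw (on_arr lift_functor S T) {f. H S T f} {f. H' (lift_rs S) (lift_rs T) f}"
      unfolding bij_betw_def
    proof
      show "inj_on (on_arr lift_functor S T) {f. H S T f}"
      proof (rule inj_onI)
        fix f g assume fg: "f \<in> {f. H S T f}" "g \<in> {f. H S T f}" "on_arr lift_functor S T f = on_arr lift_functor S T g"
        have "f x = g x" if "x \<in> carrier S" for x
          using app[OF that, of T f] app[OF that, of T g] fg(3) by simp
        then show "f = g" using fg H by (intro PiE_ext[of f "carrier S" "\<lambda>_. carrier T" g]) auto
      qed
      show "on_arr lift_functor S T ` {f. H S T f} = {f. H' (lift_rs S) (lift_rs T) f}"
      proof (intro Set.set_eqI iffI)
        fix g assume "g \<in> {f. H' (lift_rs S) (lift_rs T) f}"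
        then have g: "H' (lift_rs S) (lift_rs T) g" "g \<in> carrier (lift_rs S) \<rightarrow>\<^sub>E carrier (lift_rs T)"
          using H' by auto
        let ?f = "\<lambda>x\<in>carrier S. the_elem (g {x})"
        have gx: "\<exists>y\<in>carrier T. g {x} = {y}" if "x \<in> carrier S" for x
          using g(2) that by (auto simp: lift_rs_def PiE_iff)
        then have f: "?f \<in> carrier S \<rightarrow>\<^sub>E carrier T" by fastforce
        have "on_arr lift_functor S T ?f = g"
        proof (rule PiE_ext)
          show "g \<in> carrier (lift_rs S) \<rightarrow>\<^sub>E carrier (lift_rs T)" by (rule g)
          show "on_arr lift_functor S T ?f \<in> carrier (lift_rs S) \<rightarrow>\<^sub>E carrier (lift_rs T)"
            using f by (auto simp: lift_functor_def lift_rs_def)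
          fix A assume "A \<in> carrier (lift_rs S)"
          then obtain x where x: "x \<in> carrier S" "A = {x}" by (auto simp: lift_rs_def)
          then show "on_arr lift_functor S T ?f A = g A" using app[OF x(1), of T ?f] gx[OF x(1)] by auto
        qed
        then show "g \<in> on_arr lift_functor S T ` {f. H S T f}" using arr[OF ST f] g(1) by force
      qed (use arr[OF ST] H in auto)
    qed
    then show "bij_betw (on_arr lift_functor S T) (Hom (concrete_cat P H) S T)
        (Hom (concrete_cat P' H') (on_obj lift_functor S) (on_obj lift_functor T))"
      by (simp add: obj)
  qed
qed

lemma crm_hom_PiE: "crm_hom k S T f \<Longrightarrow> f \<in> carrier S \<rightarrow>\<^sub>E carrier T"
  by (simp add: crm_hom_def crm_morphism_def rs_hom_def)

lemma drs_hom_PiE: "drs_hom k S T f \<Longrightarrow> f \<in> carrier S \<rightarrow>\<^sub>E carrier T"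
  by (simp add: drs_hom_def drs_morphism_def rs_hom_def)

lemma lift_rs_isomorphism:
  "restriction_semigroup S \<Longrightarrow> rs_isomorphism S (lift_rs S) (\<lambda>x\<in>carrier S. {x})"
  by (simp add: rs_isomorphismI lift_rs_iso)

lemma unlift_rs_isomorphism:
  "restriction_semigroup S \<Longrightarrow> rs_isomorphism (lift_rs S) S (\<lambda>A\<in>carrier (lift_rs S). the_elem A)"
  by (blast intro: rs_isomorphismI unlift_rs_iso rs_iso_restriction_semigroup lift_rs_iso)

lemma crm_hom_lift_iff:
  assumes S: "complete_restriction_monoid S" and T: "complete_restriction_monoid T"
    and f: "f \<in> carrier S \<rightarrow>\<^sub>E carrier T"
  shows "crm_hom k (lift_rs S) (lift_rs T) (on_arr lift_functor S T f) \<longleftrightarrow> crm_hom k S T f"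
proof -
  have R: "restriction_semigroup S" "restriction_semigroup T"
    using S T by (auto simp: complete_restriction_monoid_def)
  interpret S: rs_isomorphism S "lift_rs S" "\<lambda>x\<in>carrier S. {x}" using R by (intro lift_rs_isomorphism)
  interpret T: rs_isomorphism T "lift_rs T" "\<lambda>x\<in>carrier T. {x}" using R by (intro lift_rs_isomorphism)
  interpret S': rs_isomorphism "lift_rs S" S "\<lambda>A\<in>carrier (lift_rs S). the_elem A"
    using R by (intro unlift_rs_isomorphism)
  interpret T': rs_isomorphism "lift_rs T" T "\<lambda>A\<in>carrier (lift_rs T). the_elem A"
    using R by (intro unlift_rs_isomorphism)
  note c = S.iso_complete_restriction_monoid[OF S] T.iso_complete_restriction_monoid[OF T] S T
  note h = S.iso_crm_hom[OF S] T.iso_crm_hom[OF T] S'.iso_crm_hom[OF c(1)] T'.iso_crm_hom[OF c(2)]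
  show ?thesis
  proof
    assume "crm_hom k (lift_rs S) (lift_rs T) (on_arr lift_functor S T f)"
    then show "crm_hom k S T f"
      by (subst unlift_arr_eq[OF f]) (intro crm_hom_compose[OF c(3,2,4)] crm_hom_compose[OF c(3,1,2)] h)
  next
    assume "crm_hom k S T f"
    then show "crm_hom k (lift_rs S) (lift_rs T) (on_arr lift_functor S T f)"
      by (subst lift_arr_eq[OF f]) (intro crm_hom_compose[OF c(1,4,2)] crm_hom_compose[OF c(1,3,4)] h)
  qed
qed

lemma drs_hom_lift_iff:
  assumes S: "distributive_rs S" and T: "distributive_rs T"
    and f: "f \<in> carrier S \<rightarrow>\<^sub>E carrier T"
  shows "drs_hom k (lift_rs S) (lift_rs T) (on_arr lift_functor S T f) \<longleftrightarrow> drs_hom k S T f"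
proof -
  have R: "restriction_semigroup S" "restriction_semigroup T"
    using S T by (auto simp: distributive_rs_def)
  interpret S: rs_isomorphism S "lift_rs S" "\<lambda>x\<in>carrier S. {x}" using R by (intro lift_rs_isomorphism)
  interpret T: rs_isomorphism T "lift_rs T" "\<lambda>x\<in>carrier T. {x}" using R by (intro lift_rs_isomorphism)
  interpret S': rs_isomorphism "lift_rs S" S "\<lambda>A\<in>carrier (lift_rs S). the_elem A"
    using R by (intro unlift_rs_isomorphism)
  interpret T': rs_isomorphism "lift_rs T" T "\<lambda>A\<in>carrier (lift_rs T). the_elem A"
    using R by (intro unlift_rs_isomorphism)
  note c = S.iso_distributive_rs[OF S] T.iso_distributive_rs[OF T] S T
  note h = S.iso_drs_hom[OF S] T.iso_drs_hom[OF T] S'.iso_drs_hom[OF c(1)] T'.iso_drs_hom[OF c(2)]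
  show ?thesis
  proof
    assume "drs_hom k (lift_rs S) (lift_rs T) (on_arr lift_functor S T f)"
    then show "drs_hom k S T f"
      by (subst unlift_arr_eq[OF f]) (intro drs_hom_compose[OF c(3,2,4)] drs_hom_compose[OF c(3,1,2)] h)
  next
    assume "drs_hom k S T f"
    then show "drs_hom k (lift_rs S) (lift_rs T) (on_arr lift_functor S T f)"
      by (subst lift_arr_eq[OF f]) (intro drs_hom_compose[OF c(1,4,2)] drs_hom_compose[OF c(1,3,4)] h)
  qed
qed

section \<open>The finite part of a coherent monoid\<close>

lemma finite_part_sel [simp]:
  "a \<in> carrier (finite_part S) \<longleftrightarrow> a \<in> carrier S \<and> finite_element (proj_order S) (lam S a)"
  "f \<in> proj (finite_part S) \<longleftrightarrow> finite_element (proj_order S) f"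
  "rmult (finite_part S) = rmult S" "lam (finite_part S) = lam S" "rho (finite_part S) = rho S"
  by (simp_all add: finite_part_def)

lemma compatible_finite_part [simp]: "compatible (finite_part S) = compatible S"
  by (simp add: compatible_def fun_eq_iff)

text \<open>The inverse is \<open>g \<mapsto> lam (g \<odot> a)\<close>: the restriction laws move a projection from one side of
  \<open>a\<close> to the other and back.\<close>

lemma (in restriction_semigroup) lam_rho_order_iso:
  assumes a: "a \<in> carrier S"
  shows "order_iso (down_order (proj_order S) (lam S a)) (down_order (proj_order S) (rho S a))
    (\<lambda>f. rho S (a \<odot> f))"
proof -
  have 1: "lam S (rho S (a \<odot> f) \<odot> a) = f" if "f \<in> proj S" "f \<preceq> lam S a" for f
    using right_restriction[of a f] a that by (simp add: lam_mult_proj proj_le_iff)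
  have 2: "rho S (a \<odot> lam S (g \<odot> a)) = g" if "g \<in> proj S" "g \<preceq> rho S a" for g
    using left_restriction[of a g] a that by (simp add: rho_mult_below)
  have 3: "rho S (a \<odot> f) \<preceq> rho S (a \<odot> f')" if "f \<in> proj S" "f' \<in> proj S" "f \<preceq> f'" for f f'
    using a that by (intro rho_mono mult_mono) simp_all
  have 4: "lam S (g \<odot> a) \<preceq> lam S (g' \<odot> a)" if "g \<in> proj S" "g' \<in> proj S" "g \<preceq> g'" for g g'
    using a that by (intro lam_mono mult_mono) simp_all
  show ?thesis
    unfolding order_iso_def
  proof (intro conjI ballI)
    show "bij_betw (\<lambda>f. rho S (a \<odot> f)) (carrier (down_order (proj_order S) (lam S a)))
        (carrier (down_order (proj_order S) (rho S a)))"
    proof (rule bij_betw_byWitness[where f' = "\<lambda>g. lam S (g \<odot> a)"])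
      show "(\<lambda>f. rho S (a \<odot> f)) ` carrier (down_order (proj_order S) (lam S a))
          \<subseteq> carrier (down_order (proj_order S) (rho S a))"
        using a by (auto intro: rho_mono mult_proj_le)
      show "(\<lambda>g. lam S (g \<odot> a)) ` carrier (down_order (proj_order S) (rho S a))
          \<subseteq> carrier (down_order (proj_order S) (lam S a))"
        using a by (auto intro: lam_mono proj_mult_le)
    qed (use 1 2 in auto)
    fix f f' assume f: "f \<in> carrier (down_order (proj_order S) (lam S a))"
      "f' \<in> carrier (down_order (proj_order S) (lam S a))"
    have "f \<preceq> f'" if "rho S (a \<odot> f) \<preceq> rho S (a \<odot> f')"
      using 4[OF _ _ that] 1[of f] 1[of f'] f a by simp
    then show "rho S (a \<odot> f) \<sqsubseteq>\<^bsub>down_order (proj_order S) (rho S a)\<^esub> rho S (a \<odot> f') \<longleftrightarrow>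
        f \<sqsubseteq>\<^bsub>down_order (proj_order S) (lam S a)\<^esub> f'"
      using 3[of f f'] f by auto
  qed
qed

locale coherent_monoid = joined_restriction_semigroup S False for S :: "'a rsemigroup" (structure) +
  assumes coherent_crm: "coherent_crm S"
begin

lemma coherent_frame_proj: "coherent_frame (proj_order S)"
  using coherent_crm by (simp add: coherent_crm_def)

lemma frame_proj: "frame (proj_order S)"
  using coherent_frame_proj by (rule coherent_frame_frame)

lemma complete_lattice_proj: "complete_lattice (proj_order S)"
  using frame_proj by (rule frame_complete)

lemma complete_monoid: "complete_restriction_monoid S"
  using coherent_crm by (simp add: coherent_crm_def)

abbreviation fin_proj :: "'a \<Rightarrow> bool" where "fin_proj \<equiv> finite_element (proj_order S)"

lemma fin_proj_proj [simp]: "fin_proj f \<Longrightarrow> f \<in> proj S"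
  using finite_element_carrier[of "proj_order S" f] by simp

lemma fin_proj_mult [simp]:
  assumes "fin_proj f" "fin_proj g"
  shows "fin_proj (f \<odot> g)"
proof -
  have "fin_proj (f \<sqinter>\<^bsub>proj_order S\<^esub> g)"
    using coherent_frame_proj assms unfolding coherent_frame_def by blast
  then show ?thesis using assms by (simp add: proj_order_meet)
qed

text \<open>Finiteness of an element depends only on the principal ideal that it generates.\<close>

lemma fin_proj_rho_iff: "a \<in> carrier S \<Longrightarrow> fin_proj (rho S a) \<longleftrightarrow> fin_proj (lam S a)"
proof -
  assume a: "a \<in> carrier S"
  have l: "lam S a \<in> carrier (proj_order S)" "rho S a \<in> carrier (proj_order S)" using a by simp_all
  have "finite_element (down_order (proj_order S) (rho S a)) (rho S (a \<odot> lam S a)) \<longleftrightarrow>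
      finite_element (down_order (proj_order S) (lam S a)) (lam S a)"
    using l by (intro order_iso_finite_element lam_rho_order_iso a
        down_order_complete complete_lattice_proj
        partial_order.down_order_partial_order proj_order_partial_order) auto
  then show ?thesis
    using a unfolding down_order_finite_element[OF complete_lattice_proj l(1)]
      down_order_finite_element[OF complete_lattice_proj l(2)] by simp
qed

text \<open>Here \<open>lam (a \<odot> b) = lam (lam a \<odot> b)\<close>, while \<open>rho (lam a \<odot> b) = lam a \<odot> rho b\<close> is a meet of
  finite projections. The passage between \<open>lam\<close> and \<open>rho\<close> is essential.\<close>

lemma fin_carrier_mult:
  assumes "a \<in> carrier (finite_part S)" "b \<in> carrier (finite_part S)"
  shows "a \<odot> b \<in> carrier (finite_part S)"
proof -
  have ab: "a \<in> carrier S" "b \<in> carrier S" "fin_proj (lam S a)" "fin_proj (rho S b)"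
    using assms fin_proj_rho_iff by auto
  then have "fin_proj (rho S (lam S a \<odot> b))" by (simp add: rho_proj_mult)
  then show ?thesis using ab fin_proj_rho_iff[of "lam S a \<odot> b"] by (simp add: lam_lam_mult)
qed

lemma finite_part_restriction_semigroup: "restriction_semigroup (finite_part S)"
proof unfold_locales
  obtain z where "least (proj_order S) z (proj S)"
    using proj_zero_exists by (auto simp: least_def)
  then have "fin_proj z" using finite_element_bottom[OF frame_proj] by simp
  then show "proj (finite_part S) \<noteq> {}" by auto
  show "a \<in> carrier (finite_part S) \<Longrightarrow> b \<in> carrier (finite_part S) \<Longrightarrow>
    a \<odot>\<^bsub>finite_part S\<^esub> b \<in> carrier (finite_part S)" for a b
    using fin_carrier_mult by simp
qed (auto simp: mult_assoc proj_idem proj_comm fin_proj_rho_iff lam_lam_mult rho_mult_rho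
    left_restriction[symmetric] right_restriction[symmetric])

lemma finite_part_le_iff:
  assumes "a \<in> carrier (finite_part S)" "b \<in> carrier (finite_part S)"
  shows "a \<preceq>\<^bsub>finite_part S\<^esub> b \<longleftrightarrow> a \<preceq> b"
  using restriction_semigroup.le_iff_lam[OF finite_part_restriction_semigroup assms]
    le_iff_lam[of a b] assms by simp

lemma finite_part_lub:
  assumes X: "X \<subseteq> carrier (finite_part S)" and s: "s \<in> carrier (finite_part S)" "nat_lub S s X"
  shows "nat_lub (finite_part S) s X"
proof -
  have "X \<subseteq> carrier S" using X by auto
  note s' = s(2)[unfolded nat_lub_iff[OF this]]
  show ?thesis
    unfolding nat_lub_iff[OF X]
  proof (intro conjI ballI impI s)
    show "x \<preceq>\<^bsub>finite_part S\<^esub> s" if "x \<in> X" for x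
      using that s' finite_part_le_iff[of x s] X s(1) by blast
    show "s \<preceq>\<^bsub>finite_part S\<^esub> u" if u: "u \<in> carrier (finite_part S)" "\<forall>x\<in>X. x \<preceq>\<^bsub>finite_part S\<^esub> u" for u
    proof -
      have "\<forall>x\<in>X. x \<preceq> u" using u X finite_part_le_iff by blast
      then have "s \<preceq> u" using s' u by simp
      then show ?thesis using finite_part_le_iff[OF s(1) u(1)] by simp
    qed
  qed
qed

text \<open>A finite join of finite projections is finite, and \<open>lam\<close> preserves joins.\<close>

lemma finite_lub_in_finite_part:
  assumes X: "X \<subseteq> carrier (finite_part S)" "X \<noteq> {}" "finite X" and s: "nat_lub S s X"
  shows "s \<in> carrier (finite_part S)"
proof -
  have XC: "X \<subseteq> carrier S" using X by auto
  have "nat_lub S (lam S s) (lam S ` X)" using nat_lub_lam[OF _ X(2) XC s] by simp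
  moreover have LX: "lam S ` X \<noteq> {}" "lam S ` X \<subseteq> proj S" using X XC by auto
  ultimately have lub: "proj_lub S (lam S s) (lam S ` X)" using proj_lub_iff_nat_lub[OF _ LX] by simp
  have "fin_proj (lam S s)"
    by (rule finite_element_finite_lub[OF frame_proj _ _ lub]) (use X in auto)
  then show ?thesis using least_closed[OF s] by simp
qed

lemma finite_part_distributive_rs: "distributive_rs (finite_part S)"
  unfolding distributive_rs_iff
proof (rule joined_restriction_semigroupI[OF finite_part_restriction_semigroup])
  fix X
  show "\<exists>s. nat_lub (finite_part S) s X" if X: "small True X" "compatible_set (finite_part S) X"
  proof -
    have X': "X \<noteq> {}" "X \<subseteq> carrier (finite_part S)" "compatible_set S X"
      using X(2) unfolding compatible_set_def by auto
    then obtain s where s: "nat_lub S s X" using join_exists by auto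
    then show ?thesis
      using finite_part_lub[OF X'(2) _ s] finite_lub_in_finite_part[OF X'(2,1) _ s] X(1) by auto
  qed
  show "\<exists>h. proj_lub (finite_part S) h X \<and> (\<forall>f\<in>proj (finite_part S).
      proj_lub (finite_part S) (f \<odot>\<^bsub>finite_part S\<^esub> h) ((\<odot>\<^bsub>finite_part S\<^esub>) f ` X))"
    if X: "small True X" "X \<subseteq> proj (finite_part S)"
  proof -
    have restrict: "proj_lub (finite_part S) h Y"
      if Y: "finite Y" "Y \<subseteq> proj (finite_part S)" "proj_lub S h Y" for h Y
    proof -
      have Yp: "Y \<subseteq> proj S" using Y(2) by auto
      note h = Y(3)[unfolded proj_lub_iff[OF Yp]]
      have hf: "fin_proj h"
        by (rule finite_element_finite_lub[OF frame_proj _ _ Y(3)]) (use Y in auto)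
      have le: "f \<preceq>\<^bsub>finite_part S\<^esub> g \<longleftrightarrow> f \<preceq> g" if "fin_proj f" "fin_proj g" for f g
        using that by (intro finite_part_le_iff) auto
      show ?thesis
        unfolding proj_lub_iff[OF Y(2)] using h hf Y(2) by (auto simp: le subset_iff)
    qed
    have Xp: "X \<subseteq> proj S" using X(2) by auto
    then obtain h where h: "proj_lub S h X" "\<And>f. f \<in> proj S \<Longrightarrow> proj_lub S (f \<odot> h) ((\<odot>) f ` X)"
      using proj_join_exists[of X] by auto
    have "proj_lub (finite_part S) (f \<odot> h) ((\<odot>) f ` X)" if "fin_proj f" for f
      using h(2)[of f] that X by (intro restrict) auto
    moreover have "proj_lub (finite_part S) h X" using restrict X h by simp
    ultimately show ?thesis by auto
  qed
qed

definition fin_below :: "'a \<Rightarrow> 'a set" where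
  "fin_below a = {b \<in> carrier (finite_part S). b \<preceq> a}"

lemma fin_below_subset: "fin_below a \<subseteq> carrier S" "fin_below a \<subseteq> carrier (finite_part S)"
  by (auto simp: fin_below_def)

text \<open>The finite elements below \<open>a\<close> correspond to the finite projections below \<open>lam a\<close>, by
  which properties of coherent frames are transferred.\<close>

lemma fin_below_eq:
  assumes a: "a \<in> carrier S"
  shows "fin_below a = (\<lambda>k. a \<odot> k) ` {k. fin_proj k \<and> k \<preceq> lam S a}"
proof (intro equalityI subsetI)
  fix b assume "b \<in> fin_below a"
  then have b: "b \<in> carrier S" "fin_proj (lam S b)" "b \<preceq> a" by (auto simp: fin_below_def)
  then show "b \<in> (\<lambda>k. a \<odot> k) ` {k. fin_proj k \<and> k \<preceq> lam S a}"
    using leD[OF b(3,1) a] lam_mono[OF b(3) a] by (intro image_eqI[of _ _ "lam S b"]) auto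
next
  fix b assume "b \<in> (\<lambda>k. a \<odot> k) ` {k. fin_proj k \<and> k \<preceq> lam S a}"
  then obtain k where k: "fin_proj k" "k \<preceq> lam S a" "b = a \<odot> k" by blast
  then have "lam S b = k" using a by (simp add: lam_mult_proj proj_le_iff)
  then show "b \<in> fin_below a" using k a mult_proj_le[of a k] by (simp add: fin_below_def)
qed

lemma fin_below_nonempty: "a \<in> carrier S \<Longrightarrow> fin_below a \<noteq> {}"
proof -
  assume a: "a \<in> carrier S"
  obtain z where z: "least (proj_order S) z (proj S)"
    using proj_zero_exists by (auto simp: least_def)
  then have "fin_proj z" using finite_element_bottom[OF frame_proj, of z] by simp
  moreover have "z \<preceq> lam S a" using z a by (simp add: least_def)
  ultimately show ?thesis unfolding fin_below_eq[OF a] by blast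
qed

lemma nat_lub_fin_below:
  assumes a: "a \<in> carrier S"
  shows "nat_lub S a (fin_below a)"
proof (rule nat_lub_criterion)
  let ?K = "{k. fin_proj k \<and> k \<preceq> lam S a}"
  have "lam S ` fin_below a = (\<lambda>k. k) ` ?K"
    unfolding fin_below_eq[OF a] image_image using a
    by (intro image_cong) (auto simp: lam_mult_proj proj_le_iff)
  then have eq: "lam S ` fin_below a = ?K" by simp
  have "proj_lub S (lam S a) ?K"
    using coherent_frame_approx[OF coherent_frame_proj, of "lam S a"] a by simp
  then show "nat_lub S (lam S a) (lam S ` fin_below a)"
    unfolding eq using fin_below_nonempty[OF a] eq by (intro nat_lub_of_proj_lub) auto
qed (use a fin_below_nonempty in \<open>auto simp: fin_below_def\<close>)

lemma fin_below_directed: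
  assumes a: "a \<in> carrier S" and b: "b \<in> fin_below a" and c: "c \<in> fin_below a"
  shows "\<exists>d\<in>fin_below a. b \<preceq> d \<and> c \<preceq> d"
proof -
  have bc: "b \<preceq> a" "c \<preceq> a" "{b, c} \<subseteq> carrier (finite_part S)" "{b, c} \<subseteq> carrier S"
    using b c by (auto simp: fin_below_def)
  obtain d where d: "nat_lub S d {b, c}"
    using join_exists[of "{b, c}"] bounded_compatible_set[of "{b, c}" a] a bc by auto
  have "d \<in> carrier (finite_part S)" using finite_lub_in_finite_part[OF bc(3) _ _ d] by simp
  moreover have "d \<preceq> a" "b \<preceq> d" "c \<preceq> d" using d bc a unfolding nat_lub_iff[OF bc(4)] by auto
  ultimately show ?thesis by (auto simp: fin_below_def)
qed

text \<open>The analogue for \<open>S\<close> of the defining property of finite elements: it holds for the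
  projections \<open>lam\<close>, and all elements involved are below \<open>d\<close>.\<close>

lemma finite_below_directed_lub:
  assumes t: "t \<in> carrier (finite_part S)" and D: "D \<noteq> {}" "D \<subseteq> carrier S" "nat_lub S d D" "t \<preceq> d"
    and dir: "\<And>x y. x \<in> D \<Longrightarrow> y \<in> D \<Longrightarrow> \<exists>z\<in>D. x \<preceq> z \<and> y \<preceq> z"
  shows "\<exists>x\<in>D. t \<preceq> x"
proof -
  note d = D(3)[unfolded nat_lub_iff[OF D(2)]]
  have L: "lam S ` D \<noteq> {}" "lam S ` D \<subseteq> proj S" using D by auto
  have "proj_lub S (lam S d) (lam S ` D)"
    using nat_lub_lam[OF _ D(1-3)] proj_lub_iff_nat_lub[OF _ L] by simp
  moreover have "lam S t \<preceq> lam S d" using lam_mono D(4) d by simp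
  moreover have "\<exists>z\<in>lam S ` D. x \<preceq> z \<and> y \<preceq> z" if xy: "x \<in> lam S ` D" "y \<in> lam S ` D" for x y
  proof -
    obtain x' y' where x': "x' \<in> D" "y' \<in> D" "x = lam S x'" "y = lam S y'" using xy by blast
    then obtain z where "z \<in> D" "x' \<preceq> z" "y' \<preceq> z" using dir by blast
    then show ?thesis using x' D(2) lam_mono by blast
  qed
  ultimately have "\<exists>m\<in>lam S ` D. lam S t \<preceq> m"
    using finite_element_directed[OF frame_proj, of "lam S t" "lam S ` D" "lam S d"] t L by simp
  then obtain x where x: "x \<in> D" "lam S t \<preceq> lam S x" by blast
  then have "t \<preceq> x" using bounded_le_iff[OF D(4), of x] d by blast
  then show ?thesis using x by blast
qed

end

lemma coherent_monoidI: "coherent_crm S \<Longrightarrow> coherent_monoid S"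
  by (simp add: coherent_monoid_def coherent_monoid_axioms_def coherent_crm_def complete_restriction_monoid_iff)

section \<open>The finite part of a morphism\<close>

text \<open>Two elements without a common lower bound have no meet, as there may be no zero. Otherwise the
  meet is the join of all common lower bounds.\<close>

lemma (in joined_restriction_semigroup) glb_exists_of_lower_bound:
  assumes fin: "\<not> fin" and t: "t \<preceq> a" "t \<preceq> b" and ab: "a \<in> carrier S" "b \<in> carrier S"
  shows "\<exists>m. is_glb (natural_order S) m {a, b}"
proof -
  let ?L = "{c \<in> carrier S. c \<preceq> a \<and> c \<preceq> b}"
  have "?L \<noteq> {}" using t ab le_carrier by blast
  then have "compatible_set S ?L" using bounded_compatible_set[of ?L a] ab by blast
  moreover have "small fin ?L" using fin by (simp add: small_def)
  ultimately obtain m where m: "nat_lub S m ?L" using join_exists by blast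
  have sub: "?L \<subseteq> carrier S" "{a, b} \<subseteq> carrier (natural_order S)" using ab by auto
  note m' = m[unfolded nat_lub_iff[OF sub(1)]]
  show ?thesis unfolding is_glb_iff[OF sub(2)] using m' ab by (intro exI[of _ m]) auto
qed

locale coherent_morphism = S: coherent_monoid S + T: coherent_monoid T
  for S :: "'a rsemigroup" and T :: "'b rsemigroup" +
  fixes f
  assumes crm_mor: "crm_morphism S T f" and pres_fin: "preserves_finite_projections S T f"
begin

sublocale join_homomorphism S T False f
  using crm_mor crm_morphism_iff[OF S.complete_monoid T.complete_monoid]
  by unfold_locales simp

lemma hom_fin_proj [simp]: "S.fin_proj p \<Longrightarrow> T.fin_proj (f p)"
  using pres_fin by (simp add: preserves_finite_projections_def)

lemma hom_finite_part: "a \<in> carrier (finite_part S) \<Longrightarrow> f a \<in> carrier (finite_part T)"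
  by (simp add: hom_lam[symmetric])

lemma hom_fin_below_lub:
  assumes a: "a \<in> carrier S"
  shows "nat_lub T (f a) (f ` S.fin_below a)" "f ` S.fin_below a \<noteq> {}" "f ` S.fin_below a \<subseteq> carrier T"
    "x \<in> f ` S.fin_below a \<Longrightarrow> y \<in> f ` S.fin_below a \<Longrightarrow> \<exists>z\<in>f ` S.fin_below a. x \<preceq>\<^bsub>T\<^esub> z \<and> y \<preceq>\<^bsub>T\<^esub> z"
proof -
  show "nat_lub T (f a) (f ` S.fin_below a)"
    using S.nat_lub_fin_below[OF a] S.fin_below_nonempty[OF a] S.fin_below_subset by (intro hom_nat_lub) auto
  show "f ` S.fin_below a \<noteq> {}" "f ` S.fin_below a \<subseteq> carrier T"
    using S.fin_below_nonempty[OF a] S.fin_below_subset(1)[of a] by auto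
  assume "x \<in> f ` S.fin_below a" "y \<in> f ` S.fin_below a"
  then obtain x' y' where x': "x = f x'" "y = f y'" "x' \<in> S.fin_below a" "y' \<in> S.fin_below a" by blast
  then obtain z where "z \<in> S.fin_below a" "x' \<preceq>\<^bsub>S\<^esub> z" "y' \<preceq>\<^bsub>S\<^esub> z"
    using S.fin_below_directed[OF a] by blast
  then show "\<exists>z\<in>f ` S.fin_below a. x \<preceq>\<^bsub>T\<^esub> z \<and> y \<preceq>\<^bsub>T\<^esub> z"
    using x' hom_mono S.fin_below_subset by blast
qed

text \<open>The image of \<open>a\<close> is the directed join of the images of the finite elements below \<open>a\<close>.\<close>

lemma finite_below_image:
  assumes "a \<in> carrier S" "t \<in> carrier (finite_part T)" "t \<preceq>\<^bsub>T\<^esub> f a"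
  shows "\<exists>b\<in>S.fin_below a. t \<preceq>\<^bsub>T\<^esub> f b"
  using T.finite_below_directed_lub[OF assms(2) hom_fin_below_lub(2,3,1)[OF assms(1)] assms(3)
    hom_fin_below_lub(4)[OF assms(1)]] by blast

abbreviation finite_part_map :: "'a \<Rightarrow> 'b" where "finite_part_map \<equiv> restrict f (carrier (finite_part S))"

lemma finite_part_map_eq [simp]: "a \<in> carrier (finite_part S) \<Longrightarrow> finite_part_map a = f a"
  by (simp only: restrict_apply if_True)

text \<open>Joins of finite sets of finite projections are the same in the finite part and in the monoid. Cofinality uses that a
  finite projection below \<open>f h\<close> is below the image of a finite one.\<close>

lemma finite_part_map_join_morphism: "join_morphism True (finite_part S) (finite_part T) finite_part_map"
  unfolding join_morphism_def
proof (intro conjI allI impI ballI)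
  interpret SF: restriction_semigroup "finite_part S" by (rule S.finite_part_restriction_semigroup)
  show "rs_hom (finite_part S) (finite_part T) finite_part_map"
    unfolding rs_hom_def
  proof (intro conjI ballI)
    show "finite_part_map \<in> carrier (finite_part S) \<rightarrow>\<^sub>E carrier (finite_part T)"
      using hom_finite_part by (auto simp del: finite_part_sel(1))
    fix a b assume ab: "a \<in> carrier (finite_part S)" "b \<in> carrier (finite_part S)"
    then have "finite_part_map (a \<odot>\<^bsub>finite_part S\<^esub> b) = f (a \<odot>\<^bsub>finite_part S\<^esub> b)" by (intro finite_part_map_eq SF.mult_closed)
    then show "finite_part_map (a \<odot>\<^bsub>finite_part S\<^esub> b) = finite_part_map a \<odot>\<^bsub>finite_part T\<^esub> finite_part_map b"
      unfolding finite_part_map_eq[OF ab(1)] finite_part_map_eq[OF ab(2)] using ab by (simp add: hom_mult)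
  next
    fix a assume a: "a \<in> carrier (finite_part S)"
    then have "finite_part_map (lam (finite_part S) a) = f (lam (finite_part S) a)"
      "finite_part_map (rho (finite_part S) a) = f (rho (finite_part S) a)" by (auto intro!: finite_part_map_eq SF.proj_carrier SF.lam_closed SF.rho_closed simp del: finite_part_sel)
    then show "finite_part_map (lam (finite_part S) a) = lam (finite_part T) (finite_part_map a)"
      "finite_part_map (rho (finite_part S) a) = rho (finite_part T) (finite_part_map a)"
      unfolding finite_part_map_eq[OF a] using a by (simp_all add: hom_lam hom_rho)
  qed
  fix X s assume X: "small True X" "X \<subseteq> proj (finite_part S)" "proj_lub (finite_part S) s X"
  have Xp: "X \<subseteq> proj S" using X(2) by auto
  obtain h where h: "proj_lub S h X" using S.proj_join_exists[of X] Xp by auto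
  have hf: "S.fin_proj h"
    by (rule finite_element_finite_lub[OF S.frame_proj _ _ h]) (use X in auto)
  have leS: "p \<preceq>\<^bsub>finite_part S\<^esub> q \<longleftrightarrow> p \<preceq>\<^bsub>S\<^esub> q" if "S.fin_proj p" "S.fin_proj q" for p q
    using that by (intro S.finite_part_le_iff) auto
  have leT: "p \<preceq>\<^bsub>finite_part T\<^esub> q \<longleftrightarrow> p \<preceq>\<^bsub>T\<^esub> q" if "T.fin_proj p" "T.fin_proj q" for p q
    using that by (intro T.finite_part_le_iff) auto
  have "proj_lub (finite_part S) h X"
    unfolding proj_lub_iff[OF X(2)] using h[unfolded proj_lub_iff[OF Xp]] hf X(2)
    by (auto simp: leS subset_iff)
  then have "h = s"
    using X(3) partial_order.least_unique[OF SF.proj_order_partial_order] by blast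
  then have lub: "proj_lub T (f s) (f ` X)" using h join_morphism Xp unfolding join_morphism_def by simp
  have sf: "S.fin_proj s" using hf \<open>h = s\<close> by simp
  have fX: "f ` X \<subseteq> proj (finite_part T)" "f ` X \<subseteq> proj T" using X(2) by auto
  have "proj_lub (finite_part T) (f s) (f ` X)"
    unfolding proj_lub_iff[OF fX(1)] using lub[unfolded proj_lub_iff[OF fX(2)]] sf fX(1)
    by (auto simp: leT subset_iff)
  moreover have "finite_part_map s = f s" using sf by (intro finite_part_map_eq) simp
  moreover have "finite_part_map ` X = f ` X" using X(2) by (intro image_cong refl finite_part_map_eq SF.proj_carrier) auto
  ultimately show "proj_lub (finite_part T) (finite_part_map s) (finite_part_map ` X)" by (simp only:)
next
  fix u assume "u \<in> proj (finite_part T)"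
  then have u: "T.fin_proj u" "u \<in> carrier (finite_part T)" by simp_all
  then obtain h where h: "h \<in> proj S" "u \<preceq>\<^bsub>T\<^esub> f h" 
    using join_morphism T.fin_proj_proj[OF u(1)] unfolding join_morphism_def by metis
  then obtain b where b: "b \<in> S.fin_below h" "u \<preceq>\<^bsub>T\<^esub> f b" using finite_below_image[of h u] u by auto
  then have bf: "b \<in> carrier (finite_part S)" "b \<in> proj S"
    using S.fin_below_subset S.le_proj[of b h] h by (auto simp: S.fin_below_def)
  then have "u \<preceq>\<^bsub>finite_part T\<^esub> finite_part_map b"
    unfolding finite_part_map_eq[OF bf(1)] using b u hom_finite_part[OF bf(1)] T.finite_part_le_iff by blast
  then show "\<exists>h\<in>proj (finite_part S). u \<preceq>\<^bsub>finite_part T\<^esub> finite_part_map h" using bf by (intro bexI[of _ b]) auto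
qed

text \<open>A cover of a finite \<open>t\<close> is refined to finite elements below the images of finite
  elements; as \<open>lam t\<close> is finite, finitely many of these suffice.\<close>

lemma finite_part_map_proper:
  assumes "crm_proper S T f"
  shows "proper_morphism True (finite_part S) (finite_part T) finite_part_map"
  unfolding proper_morphism_def
proof
  fix t assume t: "t \<in> carrier (finite_part T)"
  then have tT: "t \<in> carrier T" "T.fin_proj (lam T t)" by simp_all
  have "proper_morphism False S T f"
    using assms crm_proper_iff[OF S.complete_monoid T.complete_monoid crm_mor] by simp
  from proper_morphismE[OF this tT(1)] obtain X where X: "X \<subseteq> carrier T" "X \<noteq> {}" "nat_lub T t X"
    "\<And>x. x \<in> X \<Longrightarrow> \<exists>s\<in>carrier S. x \<preceq>\<^bsub>T\<^esub> f s" by metis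
  \<comment> \<open>All finite elements that may occur in the cover; their join is \<open>t\<close>, because every member
    of \<open>X\<close> is the join of finite elements.\<close>
  let ?Z = "{z \<in> carrier (finite_part T). z \<preceq>\<^bsub>T\<^esub> t \<and> (\<exists>b\<in>carrier (finite_part S). z \<preceq>\<^bsub>T\<^esub> f b)}"
  have ZT: "?Z \<subseteq> carrier T" by auto
  note X' = X(3)[unfolded nat_lub_iff[OF X(1)]]
  have small: "z \<preceq>\<^bsub>T\<^esub> u \<and> z \<in> carrier T" if "z \<in> T.fin_below x" "x \<preceq>\<^bsub>T\<^esub> u" "u \<in> carrier T" for z x u
    using that T.le_trans[of z x u] by (auto simp: T.fin_below_def)
  have below: "x \<preceq>\<^bsub>T\<^esub> u" if x: "x \<in> X" and u: "u \<in> carrier T" "\<forall>z\<in>?Z. z \<preceq>\<^bsub>T\<^esub> u" for x u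
  proof -
    have xT: "x \<in> carrier T" "x \<preceq>\<^bsub>T\<^esub> t" using x X(1) X' by blast+
    obtain s where s: "s \<in> carrier S" "x \<preceq>\<^bsub>T\<^esub> f s" using X(4)[OF x] by blast
    have "z \<preceq>\<^bsub>T\<^esub> u" if z: "z \<in> T.fin_below x" for z
    proof -
      have zf: "z \<in> carrier (finite_part T)" "z \<preceq>\<^bsub>T\<^esub> x" using z by (auto simp: T.fin_below_def)
      have "z \<preceq>\<^bsub>T\<^esub> f s" using T.le_trans[OF zf(2) s(2)] s(1) by simp
      then obtain b where "b \<in> S.fin_below s" "z \<preceq>\<^bsub>T\<^esub> f b" using finite_below_image[OF s(1) zf(1)] by blast
      moreover have "z \<preceq>\<^bsub>T\<^esub> t" using T.le_trans[OF zf(2) xT(2) tT(1)] .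
      ultimately have "z \<in> ?Z" using zf S.fin_below_subset by blast
      then show ?thesis using u by blast
    qed
    then show ?thesis
      using T.nat_lub_fin_below[OF xT(1)] u(1) unfolding nat_lub_iff[OF T.fin_below_subset(1)] by blast
  qed
  have "nat_lub T t ?Z"
    unfolding nat_lub_iff[OF ZT] using tT below X' by auto
  moreover obtain z0 where z0: "z0 \<in> ?Z"
  proof -
    obtain x where x: "x \<in> X" using X(2) by blast
    then have xT: "x \<in> carrier T" "x \<preceq>\<^bsub>T\<^esub> t" using X(1) X' by blast+
    obtain s where s: "s \<in> carrier S" "x \<preceq>\<^bsub>T\<^esub> f s" using X(4)[OF x] by blast
    obtain z where z: "z \<in> T.fin_below x" using T.fin_below_nonempty[OF xT(1)] by blast
    then have zf: "z \<in> carrier (finite_part T)" "z \<preceq>\<^bsub>T\<^esub> x" by (auto simp: T.fin_below_def)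
    have "z \<preceq>\<^bsub>T\<^esub> f s" using T.le_trans[OF zf(2) s(2)] s(1) by simp
    then obtain b where "b \<in> S.fin_below s" "z \<preceq>\<^bsub>T\<^esub> f b" using finite_below_image[OF s(1) zf(1)] by blast
    moreover have "z \<preceq>\<^bsub>T\<^esub> t" using T.le_trans[OF zf(2) xT(2) tT(1)] .
    ultimately have "z \<in> ?Z" using zf S.fin_below_subset by blast
    then show thesis using that by blast
  qed
  ultimately have "nat_lub T (lam T t) (lam T ` ?Z)" using ZT by (intro T.nat_lub_lam) auto
  moreover have LZ: "lam T ` ?Z \<subseteq> proj T" "lam T ` ?Z \<noteq> {}" using z0 by auto
  ultimately have "proj_lub T (lam T t) (lam T ` ?Z)" using T.proj_lub_iff_nat_lub[OF _ LZ(2,1)] by simp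
  from finite_element_cover[OF T.frame_proj tT(2) _ this] obtain F where
    F: "F \<subseteq> lam T ` ?Z" "finite F" "\<forall>u\<in>proj T. (\<forall>x\<in>F. x \<preceq>\<^bsub>T\<^esub> u) \<longrightarrow> lam T t \<preceq>\<^bsub>T\<^esub> u"
    using LZ tT by auto
  from finite_subset_image[OF F(2,1)] obtain W where W: "W \<subseteq> ?Z" "finite W" "F = lam T ` W" by blast
  \<comment> \<open>If \<open>lam t\<close> is the least projection, then \<open>W\<close> may be empty; \<open>z0\<close> keeps the cover nonempty.\<close>
  let ?W = "insert z0 W"
  have WZ: "?W \<subseteq> ?Z" using W z0 by blast
  have LW: "lam T ` ?W \<subseteq> proj T" using WZ by auto
  have "proj_lub T (lam T t) (lam T ` ?W)"
    unfolding proj_lub_iff[OF LW]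
  proof (intro conjI ballI impI)
    show "lam T t \<in> proj T" using tT by simp
    show "x \<preceq>\<^bsub>T\<^esub> lam T t" if "x \<in> lam T ` ?W" for x
    proof -
      obtain w where w: "x = lam T w" "w \<in> ?W" using \<open>x \<in> lam T ` ?W\<close> by blast
      then have "w \<in> ?Z" using WZ by blast
      then show ?thesis using w T.lam_mono tT by simp
    qed
    show "lam T t \<preceq>\<^bsub>T\<^esub> u" if "u \<in> proj T" "\<forall>x\<in>lam T ` ?W. x \<preceq>\<^bsub>T\<^esub> u" for u
      using F(3) W(3) that by blast
  qed
  then have 1: "nat_lub T (lam T t) (lam T ` ?W)"
    by (intro T.nat_lub_of_proj_lub[OF _ _ LW]) simp_all
  have 2: "w \<in> carrier (finite_part T)" "w \<preceq>\<^bsub>T\<^esub> t" "\<exists>b\<in>carrier (finite_part S). w \<preceq>\<^bsub>T\<^esub> f b"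
    if "w \<in> ?W" for w using WZ that by blast+
  have "nat_lub T t ?W"
    by (rule T.nat_lub_criterion[OF _ _ tT(1) 2(2) 1]) simp_all
  moreover have "?W \<subseteq> carrier (finite_part T)" using 2(1) by (rule subsetI)
  ultimately have "nat_lub (finite_part T) t ?W" by (intro T.finite_part_lub t)
  moreover have "\<exists>s\<in>carrier (finite_part S). w \<preceq>\<^bsub>finite_part T\<^esub> finite_part_map s" if w: "w \<in> ?W" for w
  proof -
    obtain b where b: "b \<in> carrier (finite_part S)" "w \<preceq>\<^bsub>T\<^esub> f b" using 2(3)[OF w] by blast
    then have "w \<preceq>\<^bsub>finite_part T\<^esub> finite_part_map b"
      unfolding finite_part_map_eq[OF b(1)] using T.finite_part_le_iff[OF 2(1)[OF w] hom_finite_part[OF b(1)]] by simp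
    then show ?thesis using b(1) by blast
  qed
  ultimately show "\<exists>X. X \<subseteq> carrier (finite_part T) \<and> X \<noteq> {} \<and> small True X \<and>
      nat_lub (finite_part T) t X \<and> (\<forall>x\<in>X. \<exists>s\<in>carrier (finite_part S). x \<preceq>\<^bsub>finite_part T\<^esub> finite_part_map s)"
    using \<open>?W \<subseteq> carrier (finite_part T)\<close> W(2) by (intro exI[of _ ?W] conjI) simp_all
qed

text \<open>Since \<open>t\<close> is a lower bound, \<open>f a\<close> and \<open>f b\<close> have a meet, which by assumption is the
  image of a meet of \<open>a\<close> and \<open>b\<close>. That meet need not be finite, but \<open>t\<close> is below the image of
  a finite element below it.\<close>

lemma finite_part_map_weakly_meet_preserving:
  assumes "crm_meet_preserving S T f"
  shows "drs_weakly_meet_preserving (finite_part S) (finite_part T) finite_part_map"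
  unfolding drs_weakly_meet_preserving_def
proof (intro ballI impI)
  fix t a b assume t: "t \<in> carrier (finite_part T)" and a: "a \<in> carrier (finite_part S)"
    and b: "b \<in> carrier (finite_part S)"
    and le: "t \<preceq>\<^bsub>finite_part T\<^esub> finite_part_map a \<and> t \<preceq>\<^bsub>finite_part T\<^esub> finite_part_map b"
  have C: "a \<in> carrier S" "b \<in> carrier S" "t \<in> carrier T" using t a b by simp_all
  have le': "t \<preceq>\<^bsub>T\<^esub> f a" "t \<preceq>\<^bsub>T\<^esub> f b"
    using le T.finite_part_le_iff[OF t hom_finite_part] a b unfolding finite_part_map_eq[OF a] finite_part_map_eq[OF b] by blast+
  then obtain m where m: "is_glb (natural_order T) m {f a, f b}"
    using T.glb_exists_of_lower_bound[of t "f a" "f b"] C by auto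
  then obtain c where c: "is_glb (natural_order S) c {a, b}" "m = f c"
    using assms C unfolding crm_meet_preserving_def by blast
  have "{f a, f b} \<subseteq> carrier (natural_order T)" "{a, b} \<subseteq> carrier (natural_order S)" using C by simp_all
  note m' = m[unfolded is_glb_iff[OF this(1)]] and c' = c(1)[unfolded is_glb_iff[OF this(2)]]
  have "t \<preceq>\<^bsub>T\<^esub> f c" using m' c(2) le' C by simp
  moreover have cC: "c \<in> carrier S" using c' by simp
  ultimately obtain d where d: "d \<in> S.fin_below c" "t \<preceq>\<^bsub>T\<^esub> f d" using finite_below_image[OF _ t] by blast
  then have df: "d \<in> carrier (finite_part S)" "d \<preceq>\<^bsub>S\<^esub> c" by (auto simp: S.fin_below_def)
  have "d \<preceq>\<^bsub>S\<^esub> a" "d \<preceq>\<^bsub>S\<^esub> b" using S.le_trans[OF df(2)] c' C by simp_all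
  then have "d \<preceq>\<^bsub>finite_part S\<^esub> a" "d \<preceq>\<^bsub>finite_part S\<^esub> b"
    using S.finite_part_le_iff[OF df(1)] a b by blast+
  moreover have "t \<preceq>\<^bsub>finite_part T\<^esub> finite_part_map d"
    unfolding finite_part_map_eq[OF df(1)] using T.finite_part_le_iff[OF t hom_finite_part[OF df(1)]] d by simp
  ultimately show "\<exists>c\<in>carrier (finite_part S). c \<preceq>\<^bsub>finite_part S\<^esub> a \<and> c \<preceq>\<^bsub>finite_part S\<^esub> b \<and>
      t \<preceq>\<^bsub>finite_part T\<^esub> finite_part_map c" using df(1) by blast
qed

end

lemma coherent_morphismI:
  "coherent_crm S \<Longrightarrow> coherent_crm T \<Longrightarrow> crm_hom k S T f \<Longrightarrow> coherent_morphism S T f"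
  by (simp add: coherent_morphism_def coherent_morphism_axioms_def coherent_monoidI crm_hom_def)

lemma finite_part_drs_hom:
  assumes S: "coherent_crm S" and T: "coherent_crm T" and f: "crm_hom k S T f"
  shows "drs_hom k (finite_part S) (finite_part T) (restrict f (carrier (finite_part S)))"
proof -
  interpret coherent_morphism S T f using assms by (rule coherent_morphismI)
  show ?thesis
    unfolding drs_hom_def drs_proper_iff
      drs_morphism_iff[OF S.finite_part_distributive_rs T.finite_part_distributive_rs]
    using finite_part_map_join_morphism finite_part_map_proper finite_part_map_weakly_meet_preserving f by (auto simp: crm_hom_def)
qed

section \<open>The ideal completion\<close>

locale distributive_semigroup = joined_restriction_semigroup S True for S :: "'a rsemigroup" (structure)
begin

lemma distributive: "distributive_rs S"
  by (simp add: distributive_rs_iff joined_restriction_semigroup_axioms)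

text \<open>Ideals in the order-theoretic sense, that is, directed lower sets. They are the compatible order
  ideals closed under binary joins (\<open>completion_carrier_iff\<close>), but directedness is easier to
  handle than compatibility.\<close>

definition ideal :: "'a set \<Rightarrow> bool" where
  "ideal A \<longleftrightarrow> A \<noteq> {} \<and> A \<subseteq> carrier S \<and> (\<forall>a\<in>A. \<forall>b. b \<preceq> a \<longrightarrow> b \<in> A) \<and>
     (\<forall>a\<in>A. \<forall>b\<in>A. \<exists>c\<in>A. a \<preceq> c \<and> b \<preceq> c)"

lemma idealD:
  assumes "ideal A"
  shows "A \<noteq> {}" "A \<subseteq> carrier S" "a \<in> A \<Longrightarrow> b \<preceq> a \<Longrightarrow> b \<in> A" "a \<in> A \<Longrightarrow> a \<in> carrier S"
  using assms unfolding ideal_def by blast+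

lemma ideal_directed:
  assumes "ideal A" "a \<in> A" "b \<in> A"
  obtains c where "c \<in> A" "a \<preceq> c" "b \<preceq> c" "c \<in> carrier S"
  using assms unfolding ideal_def by blast

lemma ideal_finite_lub:
  assumes A: "ideal A" and F: "finite F" "F \<noteq> {}" "F \<subseteq> A" and t: "nat_lub S t F"
  shows "t \<in> A"
proof -
  have "\<exists>c\<in>A. \<forall>x\<in>F. x \<preceq> c" using F
  proof (induction F rule: finite_ne_induct)
    case (singleton x)
    then have "x \<in> A" "x \<in> carrier S" using idealD[OF A] by auto
    then show ?case by (intro bexI[of _ x]) simp_all
  next
    case (insert x F)
    then obtain c where c: "c \<in> A" "\<forall>x\<in>F. x \<preceq> c" by auto
    moreover obtain d where d: "d \<in> A" "x \<preceq> d" "c \<preceq> d" "d \<in> carrier S"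
      using ideal_directed[OF A, of x c] insert.prems c by blast
    ultimately have "\<forall>y\<in>insert x F. y \<preceq> d" using le_trans[of _ c d] by auto
    then show ?case using d by blast
  qed
  then obtain c where c: "c \<in> A" "\<forall>x\<in>F. x \<preceq> c" by blast
  have "F \<subseteq> carrier S" using F idealD[OF A] by blast
  then have "t \<preceq> c" using t c idealD(4)[OF A c(1)] by (simp add: nat_lub_iff)
  then show ?thesis using idealD(3)[OF A c(1)] by blast
qed

lemma ideal_compatible: "ideal A \<Longrightarrow> a \<in> A \<Longrightarrow> b \<in> A \<Longrightarrow> compatible S a b"
  using bounded_compatible by (metis ideal_directed)

lemma completion_carrier_iff [simp]: "A \<in> carrier (completion S) \<longleftrightarrow> ideal A"
proof -
  have "order_ideal S A \<and> compatible_set S A \<and>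
      (\<forall>a\<in>A. \<forall>b\<in>A. \<forall>s. nat_lub S s {a, b} \<longrightarrow> s \<in> A) \<longleftrightarrow> ideal A" (is "?l \<longleftrightarrow> _")
  proof
    assume l: ?l
    then have l1: "order_ideal S A" and l2: "compatible_set S A" by blast+
    then have A: "A \<noteq> {}" "A \<subseteq> carrier S" by (auto simp: order_ideal_def)
    have lower: "b \<in> A" if "a \<in> A" "b \<in> carrier S" "b \<preceq> a" for a b
      using l1 that unfolding order_ideal_def by blast
    show "ideal A"
      unfolding ideal_def
    proof (intro conjI ballI allI impI A)
      show "b \<in> A" if "a \<in> A" "b \<preceq> a" for a b
        using lower[OF that(1) _ that(2)] le_carrier[OF that(2)] that(1) A(2) by blast
      fix a b assume ab: "a \<in> A" "b \<in> A"
      then have "compatible_set S {a, b}" using l2 unfolding compatible_set_def by auto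
      then obtain s where s: "nat_lub S s {a, b}" using join_exists[of "{a, b}"] by auto
      then have "s \<in> A" using l ab by blast
      moreover have "{a, b} \<subseteq> carrier S" using ab A by auto
      then have "a \<preceq> s" "b \<preceq> s" using s by (auto simp: nat_lub_iff)
      ultimately show "\<exists>c\<in>A. a \<preceq> c \<and> b \<preceq> c" by blast
    qed
  next
    assume A: "ideal A"
    have "s \<in> A" if "a \<in> A" "b \<in> A" "nat_lub S s {a, b}" for a b s
      using ideal_finite_lub[OF A, of "{a, b}" s] that by simp
    then show ?l
      using idealD[OF A] ideal_compatible[OF A] unfolding order_ideal_def compatible_set_def by blast
  qed
  moreover have "A \<in> carrier (completion S) \<longleftrightarrow> order_ideal S A \<and> compatible_set S A \<and>
      (\<forall>a\<in>A. \<forall>b\<in>A. \<forall>s. nat_lub S s {a, b} \<longrightarrow> s \<in> A)"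
    unfolding completion_def Let_def by simp
  ultimately show ?thesis by (rule trans[rotated])
qed

lemma completion_sel:
  "rmult (completion S) A B = {a \<odot> b | a b. a \<in> A \<and> b \<in> B}"
  "lam (completion S) A = lam S ` A" "rho (completion S) A = rho S ` A"
  by (simp_all add: completion_def Let_def)

lemma completion_proj_iff [simp]: "A \<in> proj (completion S) \<longleftrightarrow> ideal A \<and> A \<subseteq> proj S"
proof -
  have "A \<in> proj (completion S) \<longleftrightarrow> A \<in> carrier (completion S) \<and> A \<subseteq> proj S"
    by (simp add: completion_def Let_def)
  then show ?thesis by simp
qed

lemma idealI:
  assumes "A \<noteq> {}" "A \<subseteq> carrier S" "\<And>a b. a \<in> A \<Longrightarrow> b \<preceq> a \<Longrightarrow> b \<in> A"
    "\<And>a b. a \<in> A \<Longrightarrow> b \<in> A \<Longrightarrow> \<exists>c\<in>A. a \<preceq> c \<and> b \<preceq> c"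
  shows "ideal A"
  using assms unfolding ideal_def by blast

text \<open>An element below \<open>a \<odot> b\<close> is \<open>(g \<odot> a) \<odot> b\<close> for a projection \<open>g\<close>, so a product of lower
  sets is a lower set.\<close>

lemma ideal_mult:
  assumes A: "ideal A" and B: "ideal B"
  shows "ideal {a \<odot> b | a b. a \<in> A \<and> b \<in> B}" (is "ideal ?P")
proof (rule idealI)
  show "?P \<noteq> {}" "?P \<subseteq> carrier S" using idealD[OF A] idealD[OF B] by auto
  fix x y assume "x \<in> ?P"
  then obtain a b where ab: "x = a \<odot> b" "a \<in> A" "b \<in> B" by blast
  then have C: "a \<in> carrier S" "b \<in> carrier S" using idealD[OF A] idealD[OF B] by auto
  show "y \<in> ?P" if "y \<preceq> x"
  proof -
    have yC: "y \<in> carrier S" using le_carrier[OF that] ab C by simp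
    then have "y = (rho S y \<odot> a) \<odot> b" using leD_rho[OF that] ab C by (simp add: mult_assoc)
    moreover have "rho S y \<odot> a \<in> A" using idealD(3)[OF A ab(2)] proj_mult_le[OF C(1)] yC by simp
    ultimately show ?thesis using ab by blast
  qed
  assume "y \<in> ?P"
  then obtain a' b' where ab': "y = a' \<odot> b'" "a' \<in> A" "b' \<in> B" by blast
  obtain c where c: "c \<in> A" "a \<preceq> c" "a' \<preceq> c" "c \<in> carrier S" using ideal_directed[OF A ab(2) ab'(2)] .
  obtain d where d: "d \<in> B" "b \<preceq> d" "b' \<preceq> d" "d \<in> carrier S" using ideal_directed[OF B ab(3) ab'(3)] .
  have "x \<preceq> c \<odot> d" "y \<preceq> c \<odot> d" using mult_mono c d ab ab' by simp_all
  then show "\<exists>c\<in>?P. x \<preceq> c \<and> y \<preceq> c" using c d by blast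
qed

lemma ideal_lam:
  assumes A: "ideal A"
  shows "ideal (lam S ` A)"
proof (rule idealI)
  show "lam S ` A \<noteq> {}" "lam S ` A \<subseteq> carrier S" using idealD[OF A] by auto
  fix x y assume "x \<in> lam S ` A"
  then obtain a where a: "x = lam S a" "a \<in> A" by blast
  then have C: "a \<in> carrier S" using idealD[OF A] by auto
  show "y \<in> lam S ` A" if "y \<preceq> x"
  proof -
    have yp: "y \<in> proj S" using le_proj[OF that] a C by simp
    then have "y = lam S (a \<odot> y)" using that a C by (simp add: lam_mult_proj proj_le_iff)
    moreover have "a \<odot> y \<in> A" using idealD(3)[OF A a(2)] mult_proj_le[OF C yp] .
    ultimately show ?thesis by (rule image_eqI)
  qed
  assume "y \<in> lam S ` A"
  then obtain b where b: "y = lam S b" "b \<in> A" by blast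
  obtain c where "c \<in> A" "a \<preceq> c" "b \<preceq> c" "c \<in> carrier S" using ideal_directed[OF A a(2) b(2)] .
  then show "\<exists>c\<in>lam S ` A. x \<preceq> c \<and> y \<preceq> c" using a b lam_mono by blast
qed

lemma ideal_rho:
  assumes A: "ideal A"
  shows "ideal (rho S ` A)"
proof (rule idealI)
  show "rho S ` A \<noteq> {}" "rho S ` A \<subseteq> carrier S" using idealD[OF A] by auto
  fix x y assume "x \<in> rho S ` A"
  then obtain a where a: "x = rho S a" "a \<in> A" by blast
  then have C: "a \<in> carrier S" using idealD[OF A] by auto
  show "y \<in> rho S ` A" if "y \<preceq> x"
  proof -
    have yp: "y \<in> proj S" using le_proj[OF that] a C by simp
    then have "y = rho S (y \<odot> a)" using that a C by (simp add: rho_mult_below)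
    moreover have "y \<odot> a \<in> A" using idealD(3)[OF A a(2)] proj_mult_le[OF C yp] .
    ultimately show ?thesis by (rule image_eqI)
  qed
  assume "y \<in> rho S ` A"
  then obtain b where b: "y = rho S b" "b \<in> A" by blast
  obtain c where "c \<in> A" "a \<preceq> c" "b \<preceq> c" "c \<in> carrier S" using ideal_directed[OF A a(2) b(2)] .
  then show "\<exists>c\<in>rho S ` A. x \<preceq> c \<and> y \<preceq> c" using a b rho_mono by blast
qed

lemma ideal_proj: "ideal (proj S)"
proof (rule idealI)
  show "proj S \<noteq> {}" "proj S \<subseteq> carrier S" by (rule proj_nonempty, rule proj_subset)
  show "b \<in> proj S" if "a \<in> proj S" "b \<preceq> a" for a b using le_proj that by blast
  fix a b assume ab: "a \<in> proj S" "b \<in> proj S"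
  then obtain h where h: "h \<in> proj S" "nat_lub S h {a, b}" using proj_nat_lub_exists[of "{a, b}"] by auto
  then have "a \<preceq> h" "b \<preceq> h" using ab by (auto simp: nat_lub_iff)
  then show "\<exists>c\<in>proj S. a \<preceq> c \<and> b \<preceq> c" using h by blast
qed

text \<open>In a directed set the elements \<open>a\<close> and \<open>b\<close> have a common bound \<open>c\<close>, and
  \<open>c \<odot> lam b = b\<close>. The restriction laws for the completion reduce to those for \<open>S\<close> by this
  inclusion and its dual.\<close>

lemma ideal_mult_lam_mem:
  assumes A: "ideal A" and B: "ideal B" "B \<subseteq> A" and ab: "a \<in> A" "b \<in> B"
  shows "a \<odot> lam S b \<in> B"
proof -
  have bA: "b \<in> A" "b \<in> carrier S" "a \<in> carrier S" using assms idealD[OF A] by auto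
  obtain c where c: "c \<in> A" "a \<preceq> c" "b \<preceq> c" "c \<in> carrier S" using ideal_directed[OF A ab(1) bA(1)] .
  have "a \<odot> lam S b \<preceq> c \<odot> lam S b" using c bA by (intro mult_mono) simp_all
  also have "c \<odot> lam S b = b" using leD[OF c(3) bA(2) c(4)] .
  finally show ?thesis using idealD(3)[OF B(1) ab(2)] by blast
qed

lemma ideal_rho_mult_mem:
  assumes A: "ideal A" and B: "ideal B" "B \<subseteq> A" and ab: "a \<in> A" "b \<in> B"
  shows "rho S b \<odot> a \<in> B"
proof -
  have bA: "b \<in> A" "b \<in> carrier S" "a \<in> carrier S" using assms idealD[OF A] by auto
  obtain c where c: "c \<in> A" "a \<preceq> c" "b \<preceq> c" "c \<in> carrier S" using ideal_directed[OF A ab(1) bA(1)] .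
  have "rho S b \<odot> a \<preceq> rho S b \<odot> c" using c bA by (intro mult_mono) simp_all
  also have "rho S b \<odot> c = b" using leD_rho[OF c(3) bA(2) c(4)] .
  finally show ?thesis using idealD(3)[OF B(1) ab(2)] by blast
qed

lemma completion_restriction_semigroup: "restriction_semigroup (completion S)"
proof unfold_locales
  fix A B assume A: "A \<in> carrier (completion S)" and B: "B \<in> carrier (completion S)"
  then have iA: "ideal A" and iB: "ideal B" by simp_all
  have C: "A \<subseteq> carrier S" "B \<subseteq> carrier S" using idealD[OF iA] idealD[OF iB] by auto
  show "A \<odot>\<^bsub>completion S\<^esub> B \<in> carrier (completion S)"
    using ideal_mult[OF iA iB] by (simp add: completion_sel)
  show "lam (completion S) (lam (completion S) A \<odot>\<^bsub>completion S\<^esub> B) =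
      lam (completion S) (A \<odot>\<^bsub>completion S\<^esub> B)" (is "?l = ?r")
  proof (intro equalityI subsetI)
    fix x assume "x \<in> ?l"
    then obtain a b where ab: "a \<in> A" "b \<in> B" "x = lam S (lam S a \<odot> b)" unfolding completion_sel by blast
    have "a \<in> carrier S" "b \<in> carrier S" using C ab by blast+
    then have "x = lam S (a \<odot> b)" using ab(3) by (simp add: lam_lam_mult)
    then show "x \<in> ?r" unfolding completion_sel using ab(1,2) by blast
  next
    fix x assume "x \<in> ?r"
    then obtain a b where ab: "a \<in> A" "b \<in> B" "x = lam S (a \<odot> b)" unfolding completion_sel by blast
    have "a \<in> carrier S" "b \<in> carrier S" using C ab by blast+
    then have "x = lam S (lam S a \<odot> b)" using ab(3) by (simp add: lam_lam_mult)
    then show "x \<in> ?l" unfolding completion_sel using ab(1,2) by blast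
  qed
  show "rho (completion S) (A \<odot>\<^bsub>completion S\<^esub> rho (completion S) B) =
      rho (completion S) (A \<odot>\<^bsub>completion S\<^esub> B)" (is "?l = ?r")
  proof (intro equalityI subsetI)
    fix x assume "x \<in> ?l"
    then obtain a b where ab: "a \<in> A" "b \<in> B" "x = rho S (a \<odot> rho S b)" unfolding completion_sel by blast
    have "a \<in> carrier S" "b \<in> carrier S" using C ab by blast+
    then have "x = rho S (a \<odot> b)" using ab(3) by (simp add: rho_mult_rho)
    then show "x \<in> ?r" unfolding completion_sel using ab(1,2) by blast
  next
    fix x assume "x \<in> ?r"
    then obtain a b where ab: "a \<in> A" "b \<in> B" "x = rho S (a \<odot> b)" unfolding completion_sel by blast
    have "a \<in> carrier S" "b \<in> carrier S" using C ab by blast+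
    then have "x = rho S (a \<odot> rho S b)" using ab(3) by (simp add: rho_mult_rho)
    then show "x \<in> ?l" unfolding completion_sel using ab(1,2) by blast
  qed
  fix D assume "D \<in> carrier (completion S)"
  then have D: "D \<subseteq> carrier S" using idealD by simp
  show "A \<odot>\<^bsub>completion S\<^esub> B \<odot>\<^bsub>completion S\<^esub> D = A \<odot>\<^bsub>completion S\<^esub> (B \<odot>\<^bsub>completion S\<^esub> D)" (is "?l = ?r")
  proof (intro equalityI subsetI)
    fix x assume "x \<in> ?l"
    then obtain a b d where x: "a \<in> A" "b \<in> B" "d \<in> D" "x = a \<odot> b \<odot> d" unfolding completion_sel by blast
    have "a \<in> carrier S" "b \<in> carrier S" "d \<in> carrier S" using C D x by blast+
    then have "x = a \<odot> (b \<odot> d)" using x(4) by (simp add: mult_assoc)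
    then show "x \<in> ?r" using x(1-3) unfolding completion_sel by blast
  next
    fix x assume "x \<in> ?r"
    then obtain a b d where x: "a \<in> A" "b \<in> B" "d \<in> D" "x = a \<odot> (b \<odot> d)" unfolding completion_sel by blast
    have "a \<in> carrier S" "b \<in> carrier S" "d \<in> carrier S" using C D x by blast+
    then have "x = a \<odot> b \<odot> d" using x(4) by (simp add: mult_assoc)
    then show "x \<in> ?l" using x(1-3) unfolding completion_sel by blast
  qed
next
  show "proj (completion S) \<subseteq> carrier (completion S)" by auto
  show "proj (completion S) \<noteq> {}" using ideal_proj completion_proj_iff by blast
next
  fix A B assume A: "A \<in> proj (completion S)" and B: "B \<in> proj (completion S)"
  then have i: "ideal A" "ideal B" "A \<subseteq> proj S" "B \<subseteq> proj S" by simp_all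
  show "A \<odot>\<^bsub>completion S\<^esub> B \<in> proj (completion S)"
    unfolding completion_proj_iff completion_sel using ideal_mult[OF i(1,2)] i(3,4) proj_closed by blast
  show "A \<odot>\<^bsub>completion S\<^esub> B = B \<odot>\<^bsub>completion S\<^esub> A"
  proof -
    have "{a \<odot> b |a b. a \<in> A \<and> b \<in> B} \<subseteq> {b \<odot> a |b a. b \<in> B \<and> a \<in> A}"
      if "A \<subseteq> proj S" "B \<subseteq> proj S" for A B using that proj_comm by blast
    then show ?thesis unfolding completion_sel using i(3,4) by (intro equalityI)
  qed
next
  fix A assume A: "A \<in> proj (completion S)"
  then have i: "ideal A" "A \<subseteq> proj S" by simp_all
  show "A \<odot>\<^bsub>completion S\<^esub> A = A"
    unfolding completion_sel
  proof (intro equalityI subsetI)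
    fix x assume "x \<in> {a \<odot> b |a b. a \<in> A \<and> b \<in> A}"
    then obtain a b where ab: "a \<in> A" "b \<in> A" "x = a \<odot> b" by blast
    then have "a \<in> proj S" "b \<in> proj S" using i(2) by blast+
    then have "x \<preceq> a" using ab(3) mult_proj_le[of a b] by simp
    then show "x \<in> A" using idealD(3)[OF i(1) ab(1)] by blast
  next
    fix x assume x: "x \<in> A"
    then have "x \<in> proj S" using i(2) by blast
    then have "x = x \<odot> x" by (simp add: proj_idem)
    then show "x \<in> {a \<odot> b |a b. a \<in> A \<and> b \<in> A}" using x by blast
  qed
  have "x \<in> proj S" if "x \<in> A" for x using that i(2) by blast
  then have "lam S ` A = (\<lambda>x. x) ` A" "rho S ` A = (\<lambda>x. x) ` A" by (intro image_cong refl; simp)+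
  then show "lam (completion S) A = A" "rho (completion S) A = A" by (simp_all add: completion_sel)
next
  fix A assume "A \<in> carrier (completion S)"
  then have i: "ideal A" by simp
  show "lam (completion S) A \<in> proj (completion S)" "rho (completion S) A \<in> proj (completion S)"
    using ideal_lam[OF i] ideal_rho[OF i] idealD[OF i] by (auto simp: completion_sel)
  show "A \<odot>\<^bsub>completion S\<^esub> lam (completion S) A = A"
    unfolding completion_sel
  proof (intro equalityI subsetI)
    fix x assume "x \<in> {a \<odot> b |a b. a \<in> A \<and> b \<in> lam S ` A}"
    then show "x \<in> A" using ideal_mult_lam_mem[OF i i] by auto
  next
    fix x assume x: "x \<in> A"
    then have "x = x \<odot> lam S x" using idealD[OF i] by auto
    then show "x \<in> {a \<odot> b |a b. a \<in> A \<and> b \<in> lam S ` A}" using x by blast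
  qed
  show "rho (completion S) A \<odot>\<^bsub>completion S\<^esub> A = A"
    unfolding completion_sel
  proof (intro equalityI subsetI)
    fix x assume "x \<in> {a \<odot> b |a b. a \<in> rho S ` A \<and> b \<in> A}"
    then show "x \<in> A" using ideal_rho_mult_mem[OF i i] by auto
  next
    fix x assume x: "x \<in> A"
    then have "x = rho S x \<odot> x" using idealD[OF i] by auto
    then show "x \<in> {a \<odot> b |a b. a \<in> rho S ` A \<and> b \<in> A}" using x by blast
  qed
next
  fix A F assume "A \<in> carrier (completion S)" and "F \<in> proj (completion S)"
  then have i: "ideal A" "ideal F" "F \<subseteq> proj S" by simp_all
  have C: "a \<in> carrier S" if "a \<in> A" for a using that idealD[OF i(1)] by auto
  have FA: "ideal {f \<odot> a |f a. f \<in> F \<and> a \<in> A}" "{f \<odot> a |f a. f \<in> F \<and> a \<in> A} \<subseteq> A"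
    using ideal_mult[OF i(2,1)] idealD(3)[OF i(1)] proj_mult_le i(3) C by blast+
  have AF: "ideal {a \<odot> f |a f. a \<in> A \<and> f \<in> F}" "{a \<odot> f |a f. a \<in> A \<and> f \<in> F} \<subseteq> A"
    using ideal_mult[OF i(1,2)] idealD(3)[OF i(1)] mult_proj_le i(3) C by blast+
  show "F \<odot>\<^bsub>completion S\<^esub> A = A \<odot>\<^bsub>completion S\<^esub> lam (completion S) (F \<odot>\<^bsub>completion S\<^esub> A)"
    unfolding completion_sel
  proof (intro equalityI subsetI)
    fix x assume x: "x \<in> {f \<odot> a |f a. f \<in> F \<and> a \<in> A}"
    then obtain f a where "f \<in> F" "a \<in> A" "x = f \<odot> a" by blast
    moreover then have "x = a \<odot> lam S x" using left_restriction[of a f] C i(3) by auto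
    ultimately show "x \<in> {a \<odot> b |a b. a \<in> A \<and> b \<in> lam S ` {f \<odot> a |f a. f \<in> F \<and> a \<in> A}}" using x by blast
  next
    fix x assume "x \<in> {a \<odot> b |a b. a \<in> A \<and> b \<in> lam S ` {f \<odot> a |f a. f \<in> F \<and> a \<in> A}}"
    then show "x \<in> {f \<odot> a |f a. f \<in> F \<and> a \<in> A}" using ideal_mult_lam_mem[OF i(1) FA] by blast
  qed
  show "A \<odot>\<^bsub>completion S\<^esub> F = rho (completion S) (A \<odot>\<^bsub>completion S\<^esub> F) \<odot>\<^bsub>completion S\<^esub> A"
    unfolding completion_sel
  proof (intro equalityI subsetI)
    fix x assume x: "x \<in> {a \<odot> f |a f. a \<in> A \<and> f \<in> F}"
    then obtain f a where "f \<in> F" "a \<in> A" "x = a \<odot> f" by blast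
    moreover then have "x = rho S x \<odot> a" using right_restriction[of a f] C i(3) by auto
    ultimately show "x \<in> {b \<odot> a |b a. b \<in> rho S ` {a \<odot> f |a f. a \<in> A \<and> f \<in> F} \<and> a \<in> A}" using x by blast
  next
    fix x assume "x \<in> {b \<odot> a |b a. b \<in> rho S ` {a \<odot> f |a f. a \<in> A \<and> f \<in> F} \<and> a \<in> A}"
    then show "x \<in> {a \<odot> f |a f. a \<in> A \<and> f \<in> F}" using ideal_rho_mult_mem[OF i(1) AF] by blast
  qed
qed

lemma completion_le_iff:
  assumes A: "ideal A" and B: "ideal B"
  shows "A \<preceq>\<^bsub>completion S\<^esub> B \<longleftrightarrow> A \<subseteq> B"
proof -
  have "A \<preceq>\<^bsub>completion S\<^esub> B \<longleftrightarrow> A = {b \<odot> l |b l. b \<in> B \<and> l \<in> lam S ` A}"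
    using restriction_semigroup.le_iff_lam[OF completion_restriction_semigroup, of A B] A B
    by (simp add: completion_sel)
  also have "\<dots> \<longleftrightarrow> A \<subseteq> B"
  proof
    assume eq: "A = {b \<odot> l |b l. b \<in> B \<and> l \<in> lam S ` A}"
    have "b \<odot> lam S a \<in> B" if "b \<in> B" "a \<in> A" for a b
      using that idealD(3)[OF B that(1)] mult_proj_le[of b "lam S a"] idealD[OF A] idealD[OF B] by auto
    then show "A \<subseteq> B" by (subst eq) blast
  next
    assume sub: "A \<subseteq> B"
    show "A = {b \<odot> l |b l. b \<in> B \<and> l \<in> lam S ` A}"
    proof (intro equalityI subsetI)
      fix x assume x: "x \<in> A"
      then have "x = x \<odot> lam S x" using idealD[OF A] by auto
      then show "x \<in> {b \<odot> l |b l. b \<in> B \<and> l \<in> lam S ` A}" using x sub by blast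
    next
      fix x assume "x \<in> {b \<odot> l |b l. b \<in> B \<and> l \<in> lam S ` A}"
      then show "x \<in> A" using ideal_mult_lam_mem[OF B A sub] by blast
    qed
  qed
  finally show ?thesis .
qed

lemma completion_lub_iff:
  assumes "\<And>A. A \<in> X \<Longrightarrow> ideal A"
  shows "nat_lub (completion S) J X \<longleftrightarrow> ideal J \<and> (\<forall>A\<in>X. A \<subseteq> J) \<and>
    (\<forall>U. ideal U \<longrightarrow> (\<forall>A\<in>X. A \<subseteq> U) \<longrightarrow> J \<subseteq> U)"
proof -
  have "X \<subseteq> carrier (completion S)" using assms by auto
  moreover have "(\<forall>A\<in>X. A \<preceq>\<^bsub>completion S\<^esub> U) \<longleftrightarrow> (\<forall>A\<in>X. A \<subseteq> U)" if "ideal U" for U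
    using completion_le_iff[OF assms that] by (intro ball_cong refl)
  ultimately show ?thesis
    by (simp add: nat_lub_iff completion_le_iff Ball_def[of "carrier (completion S)"] cong: conj_cong)
qed

lemma completion_proj_lub_iff:
  assumes "X \<subseteq> proj (completion S)"
  shows "proj_lub (completion S) J X \<longleftrightarrow> J \<in> proj (completion S) \<and> (\<forall>A\<in>X. A \<subseteq> J) \<and>
    (\<forall>U\<in>proj (completion S). (\<forall>A\<in>X. A \<subseteq> U) \<longrightarrow> J \<subseteq> U)"
proof -
  have iX: "A \<in> X \<Longrightarrow> ideal A" for A using assms by auto
  have "(\<forall>A\<in>X. A \<preceq>\<^bsub>completion S\<^esub> U) \<longleftrightarrow> (\<forall>A\<in>X. A \<subseteq> U)" if "ideal U" for U
    using completion_le_iff[OF iX that] by (intro ball_cong refl)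
  then show ?thesis unfolding proj_lub_iff[OF assms]
    by (simp add: completion_le_iff Ball_def[of "proj (completion S)"] cong: conj_cong)
qed

text \<open>Compatibility of the ideals relates \<open>a \<odot> lam b\<close> to some other element of \<open>B\<close>, not to
  \<open>b\<close> itself. Since \<open>B\<close> is directed, both elements are below a common \<open>d \<in> B\<close>, and
  their images under \<open>lam\<close> agree.\<close>

lemma completion_compatibleD:
  assumes A: "ideal A" and B: "ideal B" and c: "compatible (completion S) A B"
    and ab: "a \<in> A" "b \<in> B"
  shows "compatible S a b"
proof -
  have C: "a \<in> carrier S" "b \<in> carrier S" using ab idealD[OF A] idealD[OF B] by auto
  have "a \<odot> lam S b \<in> {b \<odot> l |b l. b \<in> B \<and> l \<in> lam S ` A}"
    using c ab unfolding compatible_def completion_sel by blast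
  then obtain b' a' where b': "b' \<in> B" "a' \<in> A" "a \<odot> lam S b = b' \<odot> lam S a'" by blast
  obtain d where d: "d \<in> B" "b \<preceq> d" "b' \<preceq> d" "d \<in> carrier S" using ideal_directed[OF B ab(2) b'(1)] .
  have C': "a' \<in> carrier S" "b' \<in> carrier S" using b' idealD[OF A] idealD[OF B] by auto
  have "a \<odot> lam S b \<preceq> d"
    unfolding b'(3) using le_trans[OF mult_proj_le d(3,4)] C' by simp
  moreover have "b \<odot> lam S a \<preceq> d" using le_trans[OF mult_proj_le d(2,4)] C by simp
  moreover have "lam S (a \<odot> lam S b) = lam S (b \<odot> lam S a)"
    using C by (simp add: lam_mult_proj proj_comm)
  ultimately have 1: "a \<odot> lam S b = b \<odot> lam S a"
    using bounded_eqI_lam[OF _ _ d(4)] by blast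
  have "rho S b \<odot> a \<in> {r \<odot> b |r b. r \<in> rho S ` A \<and> b \<in> B}"
    using c ab unfolding compatible_def completion_sel by blast
  then obtain b' a' where b': "b' \<in> B" "a' \<in> A" "rho S b \<odot> a = rho S a' \<odot> b'" by blast
  obtain d where d: "d \<in> B" "b \<preceq> d" "b' \<preceq> d" "d \<in> carrier S" using ideal_directed[OF B ab(2) b'(1)] .
  have C': "a' \<in> carrier S" "b' \<in> carrier S" using b' idealD[OF A] idealD[OF B] by auto
  have "rho S b \<odot> a \<preceq> d"
    unfolding b'(3) using le_trans[OF proj_mult_le d(3,4)] C' by simp
  moreover have "rho S a \<odot> b \<preceq> d" using le_trans[OF proj_mult_le d(2,4)] C by simp
  moreover have "rho S (rho S b \<odot> a) = rho S (rho S a \<odot> b)"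
    using C by (simp add: rho_proj_mult proj_comm)
  ultimately have 2: "rho S b \<odot> a = rho S a \<odot> b"
    using bounded_eqI_rho[OF _ _ d(4)] by blast
  show ?thesis using 1 2 by (simp add: compatible_def)
qed

text \<open>Any two elements of the union of a compatible set of ideals are compatible, so its finite subsets
  have joins, and these generate the join of the ideals.\<close>

lemma completion_nat_lub:
  assumes X: "compatible_set (completion S) X"
  shows "nat_lub (completion S) {s. \<exists>F t. finite F \<and> F \<noteq> {} \<and> F \<subseteq> \<Union>X \<and> nat_lub S t F \<and> s \<preceq> t} X"
    (is "nat_lub _ ?J X")
proof -
  have iX: "ideal A" if "A \<in> X" for A using X that by (auto simp: compatible_set_def)
  have UC: "\<Union>X \<subseteq> carrier S" using iX idealD(2) by blast
  have ex: "\<exists>t. nat_lub S t F" if "finite F" "F \<noteq> {}" "F \<subseteq> \<Union>X" for F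
  proof -
    have "compatible_set S F"
      unfolding compatible_set_def
    proof (intro conjI ballI)
      fix a b assume "a \<in> F" "b \<in> F"
      then obtain A B where "A \<in> X" "B \<in> X" "a \<in> A" "b \<in> B" using \<open>F \<subseteq> \<Union>X\<close> by blast
      then show "compatible S a b" using completion_compatibleD[of A B a b] iX X by (auto simp: compatible_set_def)
    qed (use that UC in auto)
    then show ?thesis using join_exists that by simp
  qed
  have mem: "a \<in> ?J" if "A \<in> X" "a \<in> A" for a A
  proof -
    have "a \<in> carrier S" using that UC by blast
    then show ?thesis using that nat_lub_singleton[of a] by (intro CollectI exI[of _ "{a}"] exI[of _ a]) auto
  qed
  have memt: "t \<in> ?J" if "finite F" "F \<noteq> {}" "F \<subseteq> \<Union>X" "nat_lub S t F" for F t
  proof -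
    have "t \<in> carrier S" using least_closed[OF that(4)] by simp
    then show ?thesis using that by (intro CollectI exI[of _ F] exI[of _ t]) simp
  qed
  have J: "ideal ?J"
  proof (rule idealI)
    obtain A where "A \<in> X" using X by (auto simp: compatible_set_def)
    then obtain a where "a \<in> A" using idealD(1)[OF iX] by blast
    then have "a \<in> ?J" using mem \<open>A \<in> X\<close> by simp
    then show "?J \<noteq> {}" by (metis empty_iff)
    have tC: "t \<in> carrier S" if "nat_lub S t F" for t F using least_closed[OF that] by simp
    show "?J \<subseteq> carrier S"
    proof
      fix s assume "s \<in> ?J"
      then obtain F t where "nat_lub S t F" "s \<preceq> t" by (elim CollectE exE conjE)
      then show "s \<in> carrier S" using le_carrier tC by simp
    qed
    show "b \<in> ?J" if a: "a \<in> ?J" and "b \<preceq> a" for a b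
    proof -
      from a obtain F t where F: "finite F" "F \<noteq> {}" "F \<subseteq> \<Union>X" "nat_lub S t F" "a \<preceq> t"
        by (elim CollectE exE conjE)
      then have "b \<preceq> t" using le_trans[OF \<open>b \<preceq> a\<close> F(5) tC[OF F(4)]] by simp
      then show ?thesis using F by (intro CollectI exI[of _ F] exI[of _ t] conjI)
    qed
    fix a b assume "a \<in> ?J" "b \<in> ?J"
    then obtain F t G u where F: "finite F" "F \<noteq> {}" "F \<subseteq> \<Union>X" "nat_lub S t F" "a \<preceq> t"
      and G: "finite G" "G \<noteq> {}" "G \<subseteq> \<Union>X" "nat_lub S u G" "b \<preceq> u" by blast
    then obtain v where v: "nat_lub S v (F \<union> G)" using ex[of "F \<union> G"] by auto
    have sub: "F \<subseteq> carrier S" "G \<subseteq> carrier S" "F \<union> G \<subseteq> carrier S" using F G UC by blast+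
    note v' = v[unfolded nat_lub_iff[OF sub(3)]]
    have "t \<preceq> v" "u \<preceq> v"
      using F(4)[unfolded nat_lub_iff[OF sub(1)]] G(4)[unfolded nat_lub_iff[OF sub(2)]] v' by auto
    then have "a \<preceq> v" "b \<preceq> v" using le_trans F(5) G(5) v' by blast+
    moreover have "v \<in> ?J" using memt[of "F \<union> G" v] F G v by simp
    ultimately show "\<exists>c\<in>?J. a \<preceq> c \<and> b \<preceq> c" by blast
  qed
  have least: "?J \<subseteq> U" if U: "ideal U" "\<forall>A\<in>X. A \<subseteq> U" for U
  proof
    fix s assume "s \<in> ?J"
    then obtain F t where F: "finite F" "F \<noteq> {}" "F \<subseteq> \<Union>X" "nat_lub S t F" "s \<preceq> t" by blast
    then have "t \<in> U" using ideal_finite_lub[OF U(1), of F t] U(2) by blast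
    then show "s \<in> U" using idealD(3)[OF U(1)] F(5) by blast
  qed
  show ?thesis using completion_lub_iff[OF iX, where J = ?J and X = X] J mem least by blast
qed

text \<open>The join of ideals of projections. In contrast to \<open>completion_nat_lub\<close> the empty set is
  included, and \<open>F = {}\<close> contributes the least projection.\<close>

definition generated :: "'a set set \<Rightarrow> 'a set" where
  "generated X = {s. \<exists>F t. finite F \<and> F \<subseteq> \<Union>X \<and> proj_lub S t F \<and> s \<preceq> t}"

lemma proj_ideal_finite_lub:
  assumes U: "ideal U" "U \<subseteq> proj S" and F: "finite F" "F \<subseteq> U" "proj_lub S t F"
  shows "t \<in> U"
proof (cases "F = {}")
  case True
  then have "t \<preceq> u" if "u \<in> proj S" for u using F(3) that by (simp add: least_def)
  moreover obtain u where "u \<in> U" using idealD(1)[OF U(1)] by blast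
  ultimately show ?thesis using idealD(3)[OF U(1), of u t] U(2) by blast
next
  case False
  have "F \<subseteq> proj S" using F U by blast
  then show ?thesis
    using ideal_finite_lub[OF U(1) F(1) False F(2)] proj_lub_iff_nat_lub[OF _ False] F by simp
qed

lemma completion_lub_generated:
  assumes X: "X \<subseteq> proj (completion S)"
  shows "proj_lub (completion S) (generated X) X"
proof -
  have iX: "ideal A" "A \<subseteq> proj S" if "A \<in> X" for A
    using subsetD[OF X that] by simp_all
  then have UC: "\<Union>X \<subseteq> proj S" by blast
  have tC: "t \<in> proj S" if "proj_lub S t F" for t F using least_closed[OF that] by simp
  have memt: "t \<in> generated X" if "finite F" "F \<subseteq> \<Union>X" "proj_lub S t F" for F t
    unfolding generated_def using that tC[OF that(3)] by (intro CollectI exI[of _ F] exI[of _ t]) simp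
  have ex: "\<exists>t. proj_lub S t F" if "finite F" "F \<subseteq> \<Union>X" for F
    using proj_join_exists[of F] that UC by auto
  have mem: "a \<in> generated X" if "A \<in> X" "a \<in> A" for a A
  proof -
    have "a \<in> proj S" using that UC by blast
    then have "proj_lub S a {a}" by (simp add: proj_lub_iff)
    then show ?thesis using memt[of "{a}" a] that by blast
  qed
  have J: "ideal (generated X)" "generated X \<subseteq> proj S"
  proof -
    show "ideal (generated X)"
    proof (rule idealI)
      obtain t where "proj_lub S t {}" using ex[of "{}"] by auto
      then show "generated X \<noteq> {}" using memt[of "{}" t] by auto
      show "generated X \<subseteq> carrier S"
      proof
        fix s assume "s \<in> generated X"
        then obtain F t where "proj_lub S t F" "s \<preceq> t" unfolding generated_def by (elim CollectE exE conjE)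
        then show "s \<in> carrier S" using le_carrier tC by simp
      qed
      show "b \<in> generated X" if a: "a \<in> generated X" and "b \<preceq> a" for a b
      proof -
        from a obtain F t where F: "finite F" "F \<subseteq> \<Union>X" "proj_lub S t F" "a \<preceq> t"
          unfolding generated_def by (elim CollectE exE conjE)
        then have "b \<preceq> t" using le_trans[OF \<open>b \<preceq> a\<close> F(4)] tC[OF F(3)] by simp
        then show ?thesis unfolding generated_def using F by (intro CollectI exI[of _ F] exI[of _ t] conjI)
      qed
      fix a b assume "a \<in> generated X" "b \<in> generated X"
      then obtain F t G u where F: "finite F" "F \<subseteq> \<Union>X" "proj_lub S t F" "a \<preceq> t"
        and G: "finite G" "G \<subseteq> \<Union>X" "proj_lub S u G" "b \<preceq> u" unfolding generated_def by blast
      then obtain v where v: "proj_lub S v (F \<union> G)" using ex[of "F \<union> G"] by auto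
      have sub: "F \<subseteq> proj S" "G \<subseteq> proj S" "F \<union> G \<subseteq> proj S" using F G UC by blast+
      note v' = v[unfolded proj_lub_iff[OF sub(3)]]
      have "t \<preceq> v" "u \<preceq> v"
        using F(3)[unfolded proj_lub_iff[OF sub(1)]] G(3)[unfolded proj_lub_iff[OF sub(2)]] v' by auto
      then have "a \<preceq> v" "b \<preceq> v" using le_trans F(4) G(4) v' proj_carrier by blast+
      moreover have "v \<in> generated X" using memt[of "F \<union> G" v] F G v by simp
      ultimately show "\<exists>c\<in>generated X. a \<preceq> c \<and> b \<preceq> c" by blast
    qed
    show "generated X \<subseteq> proj S"
    proof
      fix s assume "s \<in> generated X"
      then obtain F t where "proj_lub S t F" "s \<preceq> t" unfolding generated_def by (elim CollectE exE conjE)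
      then show "s \<in> proj S" using le_proj tC by blast
    qed
  qed
  have least: "generated X \<subseteq> U" if U: "ideal U" "U \<subseteq> proj S" "\<forall>A\<in>X. A \<subseteq> U" for U
  proof
    fix s assume "s \<in> generated X"
    then obtain F t where F: "finite F" "F \<subseteq> \<Union>X" "proj_lub S t F" "s \<preceq> t" unfolding generated_def by blast
    then have "t \<in> U" using proj_ideal_finite_lub[OF U(1,2), of F t] U(3) by blast
    then show "s \<in> U" using idealD(3)[OF U(1)] F(4) by blast
  qed
  show ?thesis unfolding completion_proj_lub_iff[OF X] using J mem least by auto
qed

text \<open>Only the inclusion from left to right needs an argument: \<open>h \<odot> t\<close> is the join of the
  finite set \<open>h \<odot> F\<close> by distributivity in \<open>S\<close>.\<close>

lemma generated_distrib:
  assumes X: "X \<subseteq> proj (completion S)" and H: "H \<in> proj (completion S)"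
  shows "H \<odot>\<^bsub>completion S\<^esub> generated X = generated ((\<odot>\<^bsub>completion S\<^esub>) H ` X)"
proof -
  interpret K: restriction_semigroup "completion S" by (rule completion_restriction_semigroup)
  have HX: "(\<odot>\<^bsub>completion S\<^esub>) H ` X \<subseteq> proj (completion S)"
    using X H K.proj_closed[OF H] by blast
  have Hp: "H \<subseteq> proj S" using H by simp
  have gX: "generated X \<in> proj (completion S)" "\<forall>A\<in>X. A \<subseteq> generated X"
    using completion_lub_generated[OF X] unfolding completion_proj_lub_iff[OF X] by blast+
  have UX: "\<Union>X \<subseteq> proj S" using subsetD[OF X] by (intro Union_least) simp
  show ?thesis
  proof
    show "H \<odot>\<^bsub>completion S\<^esub> generated X \<subseteq> generated ((\<odot>\<^bsub>completion S\<^esub>) H ` X)"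
    proof
      fix x assume "x \<in> H \<odot>\<^bsub>completion S\<^esub> generated X"
      then obtain h s F t where x: "x = h \<odot> s" "h \<in> H" "finite F" "F \<subseteq> \<Union>X" "proj_lub S t F" "s \<preceq> t"
        unfolding completion_sel generated_def by blast
      have hp: "h \<in> proj S" using x Hp by blast
      have tp: "t \<in> proj S" using least_closed[OF x(5)] by simp
      obtain t' where t': "proj_lub S t' F" "proj_lub S (h \<odot> t') ((\<odot>) h ` F)"
        using proj_join_exists[of F] x(3,4) UX hp by auto
      have "t' = t" using t'(1) x(5) partial_order.least_unique[OF proj_order_partial_order] by blast
      then have "proj_lub S (h \<odot> t) ((\<odot>) h ` F)" using t' by simp
      moreover have "(\<odot>) h ` F \<subseteq> \<Union>((\<odot>\<^bsub>completion S\<^esub>) H ` X)"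
      proof
        fix z assume "z \<in> (\<odot>) h ` F"
        then obtain y where y: "y \<in> F" "z = h \<odot> y" by blast
        then obtain A where "A \<in> X" "y \<in> A" using x(4) by blast
        then show "z \<in> \<Union>((\<odot>\<^bsub>completion S\<^esub>) H ` X)"
          using y x(2) unfolding completion_sel by blast
      qed
      moreover have "x \<preceq> h \<odot> t" unfolding x(1) using x(6) hp tp by (intro mult_mono) simp_all
      ultimately show "x \<in> generated ((\<odot>\<^bsub>completion S\<^esub>) H ` X)"
        unfolding generated_def using x(3) by blast
    qed
    have "\<forall>A\<in>(\<odot>\<^bsub>completion S\<^esub>) H ` X. A \<subseteq> H \<odot>\<^bsub>completion S\<^esub> generated X"
      using gX(2) unfolding completion_sel by blast
    then show "generated ((\<odot>\<^bsub>completion S\<^esub>) H ` X) \<subseteq> H \<odot>\<^bsub>completion S\<^esub> generated X"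
      using completion_lub_generated[OF HX] K.proj_closed[OF H gX(1)] unfolding completion_proj_lub_iff[OF HX] by blast
  qed
qed

lemma completion_joined: "joined_restriction_semigroup (completion S) False"
proof (rule joined_restriction_semigroupI[OF completion_restriction_semigroup])
  interpret K: restriction_semigroup "completion S" by (rule completion_restriction_semigroup)
  fix X
  show "compatible_set (completion S) X \<Longrightarrow> \<exists>s. nat_lub (completion S) s X"
    using completion_nat_lub by blast
  assume X: "X \<subseteq> proj (completion S)"
  have "proj_lub (completion S) (H \<odot>\<^bsub>completion S\<^esub> generated X) ((\<odot>\<^bsub>completion S\<^esub>) H ` X)"
    if H: "H \<in> proj (completion S)" for H
    unfolding generated_distrib[OF X H] using X K.proj_closed[OF H] by (intro completion_lub_generated) blast
  then show "\<exists>h. proj_lub (completion S) h X \<and> (\<forall>f\<in>proj (completion S).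
      proj_lub (completion S) (f \<odot>\<^bsub>completion S\<^esub> h) ((\<odot>\<^bsub>completion S\<^esub>) f ` X))"
    using completion_lub_generated[OF X] by blast
qed

text \<open>The identity is the ideal of all projections; \<open>S\<close> itself need not have an identity.\<close>

lemma completion_crm: "complete_restriction_monoid (completion S)"
  unfolding complete_restriction_monoid_iff
proof (intro conjI completion_joined bexI[of _ "proj S"] ballI)
  show "proj S \<in> carrier (completion S)" using ideal_proj by simp
  fix A assume "A \<in> carrier (completion S)"
  then have A: "ideal A" by simp
  show "proj S \<odot>\<^bsub>completion S\<^esub> A = A"
    unfolding completion_sel
  proof (intro equalityI subsetI)
    fix x assume "x \<in> {f \<odot> a |f a. f \<in> proj S \<and> a \<in> A}"
    then show "x \<in> A" using idealD(3)[OF A] proj_mult_le idealD(4)[OF A] by blast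
  next
    fix x assume x: "x \<in> A"
    then have "x = rho S x \<odot> x" "rho S x \<in> proj S" using idealD(4)[OF A] by simp_all
    then show "x \<in> {f \<odot> a |f a. f \<in> proj S \<and> a \<in> A}" using x by blast
  qed
  show "A \<odot>\<^bsub>completion S\<^esub> proj S = A"
    unfolding completion_sel
  proof (intro equalityI subsetI)
    fix x assume "x \<in> {a \<odot> f |a f. a \<in> A \<and> f \<in> proj S}"
    then show "x \<in> A" using idealD(3)[OF A] mult_proj_le idealD(4)[OF A] by blast
  next
    fix x assume x: "x \<in> A"
    then have "x = x \<odot> lam S x" "lam S x \<in> proj S" using idealD(4)[OF A] by simp_all
    then show "x \<in> {a \<odot> f |a f. a \<in> A \<and> f \<in> proj S}" using x by blast
  qed
qed

lemma ideal_down [simp]: "a \<in> carrier S \<Longrightarrow> ideal (down a)"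
proof (rule idealI)
  assume a: "a \<in> carrier S"
  have "a \<in> down a" using a by (simp add: down_def)
  then show "down a \<noteq> {}" by blast
  show "\<exists>c\<in>down a. x \<preceq> c \<and> y \<preceq> c" if "x \<in> down a" "y \<in> down a" for x y
    using that \<open>a \<in> down a\<close> by (auto simp: down_def)
  show "down a \<subseteq> carrier S" using a le_carrier by (auto simp: down_def)
  show "y \<in> down a" if "x \<in> down a" "y \<preceq> x" for x y
    using that le_trans[OF that(2) _ a] by (simp add: down_def)
qed

lemma down_subset_ideal_iff: "a \<in> carrier S \<Longrightarrow> ideal A \<Longrightarrow> down a \<subseteq> A \<longleftrightarrow> a \<in> A"
  using idealD(3)[of A a] subsetD[of "down a" A a] by (auto simp: down_def)

lemma down_eq_iff: "a \<in> carrier S \<Longrightarrow> b \<in> carrier S \<Longrightarrow> down a = down b \<longleftrightarrow> a = b"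
proof
  assume ab: "a \<in> carrier S" "b \<in> carrier S" and eq: "down a = down b"
  have "a \<preceq> b" "b \<preceq> a" using down_subset_iff[OF ab] down_subset_iff[OF ab(2,1)] eq by simp_all
  then show "a = b" using le_antisym ab(1) by blast
qed simp

lemma down_proj: "a \<in> carrier S \<Longrightarrow> down a \<in> proj (completion S) \<longleftrightarrow> a \<in> proj S"
proof
  assume a: "a \<in> carrier S"
  show "a \<in> proj S" if "down a \<in> proj (completion S)"
    using that subsetD[of "down a" "proj S" a] a by simp
  show "down a \<in> proj (completion S)" if "a \<in> proj S"
  proof -
    have "down a \<subseteq> proj S" using le_proj[OF _ that] by (intro subsetI) simp
    then show ?thesis using a by simp
  qed
qed

lemma down_mult:
  assumes "a \<in> carrier S" "b \<in> carrier S"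
  shows "down a \<odot>\<^bsub>completion S\<^esub> down b = down (a \<odot> b)"
proof -
  have i: "ideal (down a \<odot>\<^bsub>completion S\<^esub> down b)"
    unfolding completion_sel using assms by (intro ideal_mult) simp_all
  have "a \<odot> b \<in> down a \<odot>\<^bsub>completion S\<^esub> down b" unfolding completion_sel using assms by force
  then have "down (a \<odot> b) \<subseteq> down a \<odot>\<^bsub>completion S\<^esub> down b"
    using down_subset_ideal_iff[OF _ i] assms by simp
  moreover have "down a \<odot>\<^bsub>completion S\<^esub> down b \<subseteq> down (a \<odot> b)"
    unfolding completion_sel using assms mult_mono by auto
  ultimately show ?thesis by blast
qed

lemma down_lam: "a \<in> carrier S \<Longrightarrow> lam S ` down a = down (lam S a)"
  using down_subset_ideal_iff[OF _ ideal_lam[OF ideal_down[of a]], of "lam S a"] lam_mono[of _ a]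
  by (force simp: image_iff)

lemma down_rho: "a \<in> carrier S \<Longrightarrow> rho S ` down a = down (rho S a)"
  using down_subset_ideal_iff[OF _ ideal_rho[OF ideal_down[of a]], of "rho S a"] rho_mono[of _ a]
  by (force simp: image_iff)

end

lemma distributive_semigroupI: "distributive_rs S \<Longrightarrow> distributive_semigroup S"
  by (simp add: distributive_rs_iff distributive_semigroup_def)

section \<open>Coherence of the completion\<close>

context distributive_semigroup begin

lemma completion_frame: "frame (proj_order (completion S))"
  using completion_crm by (simp add: complete_restriction_monoid_def)

lemma completion_complete_lattice: "complete_lattice (proj_order (completion S))"
  using completion_frame by (rule frame_complete)

lemma completion_proj_lub_down:
  assumes A: "A \<in> proj (completion S)"
  shows "proj_lub (completion S) A (down ` A)"
proof -
  have i: "ideal A" "A \<subseteq> proj S" using A by simp_all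
  have mem: "down a \<in> proj (completion S)" "down a \<subseteq> A" "a \<in> down a" if "a \<in> A" for a
  proof -
    have aC: "a \<in> carrier S" "a \<in> proj S" using idealD(4)[OF i(1) that] that i(2) by auto
    show "down a \<in> proj (completion S)" using aC(2) by (simp only: down_proj[OF aC(1)])
    show "down a \<subseteq> A" using down_subset_ideal_iff[OF aC(1) i(1)] that by blast
    show "a \<in> down a" using aC by simp
  qed
  then have X: "down ` A \<subseteq> proj (completion S)" by blast
  show ?thesis unfolding completion_proj_lub_iff[OF X]
  proof (intro conjI ballI impI A)
    show "B \<subseteq> A" if "B \<in> down ` A" for B using that mem(2) by blast
    show "A \<subseteq> U" if "\<forall>B\<in>down ` A. B \<subseteq> U" for U using that mem(3) by blast
  qed
qed

text \<open>An ideal is the directed join of its principal ideals, hence principal if it is finite.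
  Conversely \<open>p\<close> belongs to a join of ideals by virtue of finitely many of their elements.\<close>

lemma finite_element_completion_iff:
  "finite_element (proj_order (completion S)) A \<longleftrightarrow> (\<exists>p\<in>proj S. A = down p)"
proof
  assume fin: "finite_element (proj_order (completion S)) A"
  then have A: "A \<in> proj (completion S)" using finite_element_carrier by fastforce
  then have i: "ideal A" "A \<subseteq> proj S" by simp_all
  have X: "down ` A \<subseteq> carrier (proj_order (completion S))" "down ` A \<noteq> {}"
    using i down_proj idealD[OF i(1)] by auto
  have le: "P \<preceq>\<^bsub>completion S\<^esub> Q \<longleftrightarrow> P \<subseteq> Q" if "ideal P" "ideal Q" for P Q
    using completion_le_iff that by blast
  have ia: "ideal (down a)" "a \<in> carrier S" if "a \<in> A" for a using idealD(4)[OF i(1) that] by simp_all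
  have dir: "\<exists>Z\<in>down ` A. P \<sqsubseteq>\<^bsub>proj_order (completion S)\<^esub> Z \<and> Q \<sqsubseteq>\<^bsub>proj_order (completion S)\<^esub> Z"
    if PQ: "P \<in> down ` A" "Q \<in> down ` A" for P Q
  proof -
    obtain a b where ab: "a \<in> A" "b \<in> A" "P = down a" "Q = down b" using PQ by blast
    obtain c where c: "c \<in> A" "a \<preceq> c" "b \<preceq> c" "c \<in> carrier S" using ideal_directed[OF i(1) ab(1,2)] .
    then have "P \<subseteq> down c" "Q \<subseteq> down c" using ab ia down_subset_iff by simp_all
    then show ?thesis using c(1) ab ia le by (intro bexI[of _ "down c"]) simp_all
  qed
  have "A \<sqsubseteq>\<^bsub>proj_order (completion S)\<^esub> A" using le i(1) by simp
  from finite_element_directed[OF completion_frame fin X(1) completion_proj_lub_down[OF A] this X(2) dir]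
  obtain a where a: "a \<in> A" "A \<preceq>\<^bsub>completion S\<^esub> down a" by auto
  then have "A \<subseteq> down a" using le i(1) ia by blast
  moreover have "down a \<subseteq> A" using down_subset_ideal_iff[of a A] a ia i(1) by simp
  ultimately show "\<exists>p\<in>proj S. A = down p" using a(1) i(2) by blast
next
  assume "\<exists>p\<in>proj S. A = down p"
  then obtain p where p: "p \<in> proj S" "A = down p" by blast
  show "finite_element (proj_order (completion S)) A"
  proof (rule finite_elementI[OF completion_complete_lattice])
    show "A \<in> carrier (proj_order (completion S))" using p down_proj by simp
    fix M assume M: "M \<subseteq> carrier (proj_order (completion S))" "proj_lub (completion S) A M"
    then have Mp: "M \<subseteq> proj (completion S)" by simp
    have "A = generated M"
      by (rule partial_order.least_unique[OF restriction_semigroup.proj_order_partial_order[OF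
          completion_restriction_semigroup] M(2) completion_lub_generated[OF Mp]])
    moreover have "p \<in> A" using p by simp
    ultimately have "p \<in> generated M" by (simp only:)
    then obtain F t where F: "finite F" "F \<subseteq> \<Union>M" "proj_lub S t F" "p \<preceq> t"
      unfolding generated_def by (elim CollectE exE conjE)
    have "\<forall>x\<in>F. \<exists>B. B \<in> M \<and> x \<in> B" using F(2) by blast
    from bchoice[OF this] obtain B where B: "\<forall>x\<in>F. B x \<in> M \<and> x \<in> B x" by (elim exE)
    have "A \<subseteq> U" if U: "U \<in> proj (completion S)" "\<forall>x\<in>B ` F. x \<preceq>\<^bsub>completion S\<^esub> U" for U
    proof -
      have iU: "ideal U" "U \<subseteq> proj S" using U by simp_all
      have "x \<in> U" if "x \<in> F" for x
      proof -
        have "ideal (B x)" "x \<in> B x" using subsetD[OF Mp, of "B x"] B that by simp_all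
        then show ?thesis using U(2) that completion_le_iff[of "B x" U] iU by blast
      qed
      then have "t \<in> U" using proj_ideal_finite_lub[OF iU F(1) _ F(3)] by blast
      then have "p \<in> U" using idealD(3)[OF iU(1)] F(4) by blast
      then show ?thesis using p down_subset_ideal_iff[of p U] iU(1) by simp
    qed
    moreover have "ideal A" using p by simp
    ultimately have "\<forall>U\<in>carrier (proj_order (completion S)). (\<forall>x\<in>B ` F. x \<sqsubseteq>\<^bsub>proj_order (completion S)\<^esub> U) \<longrightarrow>
        A \<sqsubseteq>\<^bsub>proj_order (completion S)\<^esub> U"
      using completion_le_iff[of A] by simp
    moreover have "B ` F \<subseteq> M" using B by blast
    ultimately show "\<exists>G. G \<subseteq> M \<and> finite G \<and> (\<forall>U\<in>carrier (proj_order (completion S)).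
        (\<forall>x\<in>G. x \<sqsubseteq>\<^bsub>proj_order (completion S)\<^esub> U) \<longrightarrow> A \<sqsubseteq>\<^bsub>proj_order (completion S)\<^esub> U)"
      using F(1) by (intro exI[of _ "B ` F"] conjI finite_imageI)
  qed
qed

text \<open>The meet of the principal ideals of \<open>p\<close> and \<open>q\<close> is that of \<open>p \<odot> q\<close>.\<close>

lemma completion_coherent: "coherent_crm (completion S)"
  unfolding coherent_crm_def coherent_frame_iff[OF completion_complete_lattice]
proof (intro conjI completion_crm completion_frame ballI allI impI)
  interpret K: restriction_semigroup "completion S" by (rule completion_restriction_semigroup)
  fix A assume "A \<in> carrier (proj_order (completion S))"
  then have A: "A \<in> proj (completion S)" by simp
  have "down ` A \<subseteq> {m \<in> carrier (proj_order (completion S)). finite_element (proj_order (completion S)) m}"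
  proof
    fix B assume "B \<in> down ` A"
    then obtain a where a: "B = down a" "a \<in> A" by blast
    then have "a \<in> proj S" using A by auto
    then have "finite_element (proj_order (completion S)) B"
      unfolding finite_element_completion_iff a(1) by blast
    then show "B \<in> {m \<in> carrier (proj_order (completion S)). finite_element (proj_order (completion S)) m}"
      by (intro CollectI conjI) (rule finite_element_carrier)
  qed
  then show "\<exists>M. M \<subseteq> {m \<in> carrier (proj_order (completion S)). finite_element (proj_order (completion S)) m} \<and>
      proj_lub (completion S) A M" using completion_proj_lub_down[OF A] by blast
next
  interpret K: restriction_semigroup "completion S" by (rule completion_restriction_semigroup)
  fix A B M
  assume AB: "A \<in> carrier (proj_order (completion S))" "B \<in> carrier (proj_order (completion S))"
    and fin: "finite_element (proj_order (completion S)) A" "finite_element (proj_order (completion S)) B"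
    and M: "is_glb (proj_order (completion S)) M {A, B}"
  have "M = A \<odot>\<^bsub>completion S\<^esub> B"
    by (rule partial_order.greatest_unique[OF K.proj_order_partial_order M K.proj_order_glb])
      (use AB in simp_all)
  moreover obtain p q where "p \<in> proj S" "q \<in> proj S" "A = down p" "B = down q"
    using fin unfolding finite_element_completion_iff by blast
  ultimately show "finite_element (proj_order (completion S)) M"
    unfolding finite_element_completion_iff using down_mult[of p q] by (intro bexI[of _ "p \<odot> q"]) simp_all
qed

section \<open>The finite part of the completion\<close>

text \<open>If \<open>lam ` A\<close> has a greatest element, attained at \<open>a \<in> A\<close>, then \<open>a\<close> is the greatest
  element of \<open>A\<close>: any other element has a common bound with \<open>a\<close>, and \<open>lam\<close> reflects the order
  there.\<close>

lemma finite_part_completion_iff: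
  "A \<in> carrier (finite_part (completion S)) \<longleftrightarrow> (\<exists>a\<in>carrier S. A = down a)"
proof
  assume "A \<in> carrier (finite_part (completion S))"
  then obtain p where A: "ideal A" and p: "p \<in> proj S" "lam S ` A = down p"
    unfolding finite_part_sel completion_sel finite_element_completion_iff completion_carrier_iff by blast
  have "p \<in> lam S ` A" unfolding p(2) using p(1) by simp
  then obtain a where a: "a \<in> A" "lam S a = p" by blast
  have aC: "a \<in> carrier S" using idealD(4)[OF A a(1)] .
  have "b \<preceq> a" if b: "b \<in> A" for b
  proof -
    obtain c where c: "c \<in> A" "a \<preceq> c" "b \<preceq> c" "c \<in> carrier S" using ideal_directed[OF A a(1) b] .
    have "lam S b \<in> down p" using b p(2) by blast
    then show ?thesis using bounded_le_iff[OF c(3,2,4)] a(2) by simp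
  qed
  then have "A = down a" using idealD(3)[OF A a(1)] by auto
  then show "\<exists>a\<in>carrier S. A = down a" using aC by blast
next
  assume "\<exists>a\<in>carrier S. A = down a"
  then obtain a where "a \<in> carrier S" "A = down a" by blast
  then show "A \<in> carrier (finite_part (completion S))"
    by (auto simp: completion_sel down_lam finite_element_completion_iff)
qed

lemma completion_coherent_monoid: "coherent_monoid (completion S)"
  using completion_coherent by (rule coherent_monoidI)

definition principal_iso :: "'a set \<Rightarrow> 'a set" where
  "principal_iso = (\<lambda>A\<in>carrier (finite_part (completion S)). {a \<in> carrier S. A = down a})"

lemma principal_iso_down: "a \<in> carrier S \<Longrightarrow> principal_iso (down a) = {a}"
  unfolding principal_iso_def using finite_part_completion_iff[of "down a"] down_eq_iff[of a]
  by (auto simp del: finite_part_sel(1))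

lemma principal_iso: "rs_iso (finite_part (completion S)) (lift_rs S) principal_iso"
proof (rule rs_isoI)
  interpret K: coherent_monoid "completion S" by (rule completion_coherent_monoid)
  show "restriction_semigroup (finite_part (completion S))" by (rule K.finite_part_restriction_semigroup)
  show "restriction_semigroup (lift_rs S)"
    using rs_iso_restriction_semigroup lift_rs_iso restriction_semigroup_axioms by blast
  note C = finite_part_completion_iff
  show "rs_hom (finite_part (completion S)) (lift_rs S) principal_iso"
    unfolding rs_hom_def
  proof (intro conjI ballI)
    have "principal_iso A \<in> carrier (lift_rs S)" if A: "A \<in> carrier (finite_part (completion S))" for A
    proof -
      obtain a where "a \<in> carrier S" "A = down a" using A C by blast
      then show ?thesis by (simp add: principal_iso_down lift_rs_def)
    qed
    moreover have "principal_iso \<in> extensional (carrier (finite_part (completion S)))"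
      by (simp only: principal_iso_def restrict_extensional)
    ultimately show "principal_iso \<in> carrier (finite_part (completion S)) \<rightarrow>\<^sub>E carrier (lift_rs S)"
      unfolding PiE_iff by blast
  next
    fix A B assume "A \<in> carrier (finite_part (completion S))" "B \<in> carrier (finite_part (completion S))"
    then obtain a b where "a \<in> carrier S" "A = down a" "b \<in> carrier S" "B = down b" unfolding C by blast
    then show "principal_iso (A \<odot>\<^bsub>finite_part (completion S)\<^esub> B) =
        principal_iso A \<odot>\<^bsub>lift_rs S\<^esub> principal_iso B"
      by (simp add: down_mult principal_iso_down lift_rs_def)
  next
    fix A assume "A \<in> carrier (finite_part (completion S))"
    then obtain a where "a \<in> carrier S" "A = down a" unfolding C by blast
    then show "principal_iso (lam (finite_part (completion S)) A) = lam (lift_rs S) (principal_iso A)"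
      "principal_iso (rho (finite_part (completion S)) A) = rho (lift_rs S) (principal_iso A)"
      by (simp_all add: completion_sel down_lam down_rho principal_iso_down lift_rs_def)
  qed
  show "bij_betw principal_iso (carrier (finite_part (completion S))) (carrier (lift_rs S))"
  proof (rule bij_betw_byWitness[where f' = "\<lambda>X. down (the_elem X)"])
    show "\<forall>A\<in>carrier (finite_part (completion S)). down (the_elem (principal_iso A)) = A"
      using C principal_iso_down by fastforce
    show "\<forall>X\<in>carrier (lift_rs S). principal_iso (down (the_elem X)) = X"
      using principal_iso_down by (auto simp: lift_rs_def)
    show "principal_iso ` carrier (finite_part (completion S)) \<subseteq> carrier (lift_rs S)"
      using C principal_iso_down by (fastforce simp: lift_rs_def)
    show "(\<lambda>X. down (the_elem X)) ` carrier (lift_rs S) \<subseteq> carrier (finite_part (completion S))"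
      unfolding image_subset_iff C by (auto simp: lift_rs_def)
  qed
qed

text \<open>The intersection of two ideals is directed, because the join of two of its elements lies in both
  ideals. The intersection may be empty, and then there is no common lower bound at all.\<close>

lemma completion_glb_iff:
  assumes A: "ideal A" and B: "ideal B"
  shows "is_glb (natural_order (completion S)) M {A, B} \<longleftrightarrow> A \<inter> B \<noteq> {} \<and> M = A \<inter> B"
proof -
  have sub: "{A, B} \<subseteq> carrier (natural_order (completion S))" using A B by simp
  have int: "ideal (A \<inter> B)" if ne: "A \<inter> B \<noteq> {}"
  proof (rule idealI)
    show "A \<inter> B \<noteq> {}" by fact
    show "A \<inter> B \<subseteq> carrier S" using idealD(2)[OF A] by blast
    show "b \<in> A \<inter> B" if "a \<in> A \<inter> B" "b \<preceq> a" for a b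
      using that idealD(3)[OF A] idealD(3)[OF B] by blast
    fix a b assume ab: "a \<in> A \<inter> B" "b \<in> A \<inter> B"
    then obtain c where c: "a \<preceq> c" "b \<preceq> c" "c \<in> carrier S" using ideal_directed[OF A, of a b] by blast
    have "compatible_set S {a, b}" by (rule bounded_compatible_set[of _ c]) (use c in auto)
    then obtain s where s: "nat_lub S s {a, b}" using join_exists[of "{a, b}"] by auto
    have F: "finite {a, b}" "{a, b} \<noteq> {}" "{a, b} \<subseteq> A" "{a, b} \<subseteq> B" using ab by simp_all
    then have "s \<in> A" "s \<in> B"
      using ideal_finite_lub[OF A F(1-3) s] ideal_finite_lub[OF B F(1,2,4) s] by simp_all
    moreover have "{a, b} \<subseteq> carrier S" using ab idealD(2)[OF A] by blast
    then have "a \<preceq> s" "b \<preceq> s" using s by (auto simp: nat_lub_iff)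
    ultimately show "\<exists>c\<in>A \<inter> B. a \<preceq> c \<and> b \<preceq> c" by blast
  qed
  have "is_glb (natural_order (completion S)) M {A, B} \<longleftrightarrow>
      ideal M \<and> M \<subseteq> A \<and> M \<subseteq> B \<and> (\<forall>U. ideal U \<longrightarrow> U \<subseteq> A \<and> U \<subseteq> B \<longrightarrow> U \<subseteq> M)"
    unfolding is_glb_iff[OF sub]
    using A B by (simp add: completion_le_iff Ball_def[of "carrier (completion S)"] cong: conj_cong)
  also have "\<dots> \<longleftrightarrow> A \<inter> B \<noteq> {} \<and> M = A \<inter> B" (is "?l \<longleftrightarrow> ?r")
  proof
    assume l: ?l
    then have ne: "A \<inter> B \<noteq> {}" using idealD(1)[of M] by blast
    have "A \<inter> B \<subseteq> M" using l int[OF ne] by blast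
    then show ?r using l ne by blast
  qed (use int in blast)
  finally show ?thesis .
qed

end

section \<open>The completion of a morphism\<close>

locale distributive_morphism = S: distributive_semigroup S + T: distributive_semigroup T
  for S :: "'a rsemigroup" and T :: "'b rsemigroup" +
  fixes f
  assumes drs_mor: "drs_morphism S T f"
begin

sublocale join_homomorphism S T True f
  using drs_mor drs_morphism_iff[OF S.distributive T.distributive]
  by unfold_locales simp

definition extension :: "'a set \<Rightarrow> 'b set" where
  "extension A = {t \<in> carrier T. \<exists>a\<in>A. t \<preceq>\<^bsub>T\<^esub> f a}"

lemma extension_mem: "S.ideal A \<Longrightarrow> t \<in> extension A \<longleftrightarrow> (\<exists>a\<in>A. t \<preceq>\<^bsub>T\<^esub> f a)"
  unfolding extension_def using S.idealD(4) T.le_carrier hom_closed by blast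

lemma hom_mem_extension: "S.ideal A \<Longrightarrow> a \<in> A \<Longrightarrow> f a \<in> extension A"
  unfolding extension_def using S.idealD(4)[of A a] by (intro CollectI conjI bexI[of _ a]) simp_all

lemma extension_ideal:
  assumes A: "S.ideal A"
  shows "T.ideal (extension A)"
proof (rule T.idealI)
  note C = S.idealD(4)[OF A]
  show "extension A \<noteq> {}" using S.idealD(1)[OF A] hom_mem_extension[OF A] by blast
  show "extension A \<subseteq> carrier T" by (auto simp: extension_def)
  show "y \<in> extension A" if x: "x \<in> extension A" and le: "y \<preceq>\<^bsub>T\<^esub> x" for x y
  proof -
    obtain a where a: "a \<in> A" "x \<preceq>\<^bsub>T\<^esub> f a" using x extension_mem[OF A] by blast
    then have "y \<preceq>\<^bsub>T\<^esub> f a" using T.le_trans[OF le a(2)] C by simp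
    then show ?thesis using a(1) extension_mem[OF A] by blast
  qed
  fix x y assume "x \<in> extension A" "y \<in> extension A"
  then obtain a b where ab: "a \<in> A" "x \<preceq>\<^bsub>T\<^esub> f a" "b \<in> A" "y \<preceq>\<^bsub>T\<^esub> f b" using extension_mem[OF A] by blast
  obtain c where c: "c \<in> A" "a \<preceq>\<^bsub>S\<^esub> c" "b \<preceq>\<^bsub>S\<^esub> c" "c \<in> carrier S" using S.ideal_directed[OF A ab(1,3)] .
  have "x \<preceq>\<^bsub>T\<^esub> f c" "y \<preceq>\<^bsub>T\<^esub> f c"
    using T.le_trans[OF ab(2) hom_mono[OF c(2,4)]] T.le_trans[OF ab(4) hom_mono[OF c(3,4)]] c by simp_all
  then show "\<exists>c\<in>extension A. x \<preceq>\<^bsub>T\<^esub> c \<and> y \<preceq>\<^bsub>T\<^esub> c" using hom_mem_extension[OF A c(1)] by blast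
qed

lemma extension_mono: "A \<subseteq> B \<Longrightarrow> extension A \<subseteq> extension B"
  unfolding extension_def by blast

text \<open>The extension of \<open>A\<close> is the least ideal that contains the image of \<open>A\<close>. Inclusions between
  extensions are thereby reduced to elements of \<open>A\<close>.\<close>

lemma extension_subset_iff:
  assumes A: "S.ideal A" and U: "T.ideal U"
  shows "extension A \<subseteq> U \<longleftrightarrow> (\<forall>a\<in>A. f a \<in> U)"
  using hom_mem_extension[OF A] T.idealD(3)[OF U] extension_mem[OF A] by blast

lemma extension_down: "a \<in> carrier S \<Longrightarrow> extension (S.down a) = T.down (f a)"
proof -
  assume a: "a \<in> carrier S"
  have "f b \<preceq>\<^bsub>T\<^esub> f a" if "b \<preceq>\<^bsub>S\<^esub> a" for b using hom_mono[OF that a] .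
  then have "extension (S.down a) \<subseteq> T.down (f a)"
    using a by (subst extension_subset_iff) simp_all
  moreover have "T.down (f a) \<subseteq> extension (S.down a)"
    using a hom_mem_extension[of "S.down a" a] T.down_subset_ideal_iff[OF _ extension_ideal] by simp
  ultimately show ?thesis by blast
qed

lemma extension_mult:
  assumes A: "S.ideal A" and B: "S.ideal B"
  shows "extension (A \<odot>\<^bsub>completion S\<^esub> B) = extension A \<odot>\<^bsub>completion T\<^esub> extension B"
proof -
  have P: "S.ideal {a \<odot>\<^bsub>S\<^esub> b |a b. a \<in> A \<and> b \<in> B}" using S.ideal_mult[OF A B] .
  have Q: "T.ideal {a \<odot>\<^bsub>T\<^esub> b |a b. a \<in> extension A \<and> b \<in> extension B}"
    using T.ideal_mult[OF extension_ideal[OF A] extension_ideal[OF B]] .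
  have "f (a \<odot>\<^bsub>S\<^esub> b) = f a \<odot>\<^bsub>T\<^esub> f b" if "a \<in> A" "b \<in> B" for a b
    using that hom_mult S.idealD(4)[OF A] S.idealD(4)[OF B] by blast
  then have "extension {a \<odot>\<^bsub>S\<^esub> b |a b. a \<in> A \<and> b \<in> B} \<subseteq> {a \<odot>\<^bsub>T\<^esub> b |a b. a \<in> extension A \<and> b \<in> extension B}"
    unfolding extension_subset_iff[OF P Q] using hom_mem_extension[OF A] hom_mem_extension[OF B] by blast
  moreover have "x \<odot>\<^bsub>T\<^esub> y \<in> extension {a \<odot>\<^bsub>S\<^esub> b |a b. a \<in> A \<and> b \<in> B}"
    if xy: "x \<in> extension A" "y \<in> extension B" for x y
  proof -
    obtain a b where ab: "a \<in> A" "x \<preceq>\<^bsub>T\<^esub> f a" "b \<in> B" "y \<preceq>\<^bsub>T\<^esub> f b"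
      using xy extension_mem[OF A] extension_mem[OF B] by blast
    then have C: "a \<in> carrier S" "b \<in> carrier S" using S.idealD(4)[OF A] S.idealD(4)[OF B] by simp_all
    have "x \<odot>\<^bsub>T\<^esub> y \<preceq>\<^bsub>T\<^esub> f (a \<odot>\<^bsub>S\<^esub> b)" using T.mult_mono[OF ab(2,4)] C by (simp add: hom_mult)
    then show ?thesis unfolding extension_mem[OF P] using ab by blast
  qed
  ultimately show ?thesis unfolding S.completion_sel T.completion_sel by blast
qed

lemma extension_lam:
  assumes A: "S.ideal A"
  shows "extension (lam S ` A) = lam T ` extension A"
proof
  note C = S.idealD(4)[OF A]
  note P = S.ideal_lam[OF A] and Q = T.ideal_lam[OF extension_ideal[OF A]]
  show "extension (lam S ` A) \<subseteq> lam T ` extension A"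
    unfolding extension_subset_iff[OF P Q] using hom_mem_extension[OF A] C hom_lam by auto
  show "lam T ` extension A \<subseteq> extension (lam S ` A)"
  proof
    fix y assume "y \<in> lam T ` extension A"
    then obtain t a where t: "y = lam T t" "a \<in> A" "t \<preceq>\<^bsub>T\<^esub> f a" using extension_mem[OF A] by blast
    then have "y \<preceq>\<^bsub>T\<^esub> f (lam S a)" using T.lam_mono[OF t(3)] C by (simp add: hom_lam)
    then show "y \<in> extension (lam S ` A)" unfolding extension_mem[OF P] using t(2) by blast
  qed
qed

lemma extension_rho:
  assumes A: "S.ideal A"
  shows "extension (rho S ` A) = rho T ` extension A"
proof
  note C = S.idealD(4)[OF A]
  note P = S.ideal_rho[OF A] and Q = T.ideal_rho[OF extension_ideal[OF A]]
  show "extension (rho S ` A) \<subseteq> rho T ` extension A"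
    unfolding extension_subset_iff[OF P Q] using hom_mem_extension[OF A] C hom_rho by auto
  show "rho T ` extension A \<subseteq> extension (rho S ` A)"
  proof
    fix y assume "y \<in> rho T ` extension A"
    then obtain t a where t: "y = rho T t" "a \<in> A" "t \<preceq>\<^bsub>T\<^esub> f a" using extension_mem[OF A] by blast
    then have "y \<preceq>\<^bsub>T\<^esub> f (rho S a)" using T.rho_mono[OF t(3)] C by (simp add: hom_rho)
    then show "y \<in> extension (rho S ` A)" unfolding extension_mem[OF P] using t(2) by blast
  qed
qed

abbreviation completion_map :: "'a set \<Rightarrow> 'b set" where "completion_map \<equiv> restrict extension (carrier (completion S))"

lemma completion_map_eq: "S.ideal A \<Longrightarrow> completion_map A = extension A"
  by simp

lemma extension_proj: "A \<in> proj (completion S) \<Longrightarrow> extension A \<in> proj (completion T)"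
proof -
  assume "A \<in> proj (completion S)"
  then have A: "S.ideal A" "A \<subseteq> proj S" by simp_all
  then have "extension A \<subseteq> proj T"
    using T.le_proj hom_proj extension_mem[OF A(1)] by blast
  then show ?thesis using extension_ideal[OF A(1)] by simp
qed

lemma completion_map_rs_hom: "rs_hom (completion S) (completion T) completion_map"
  unfolding rs_hom_def
proof (intro conjI ballI)
  interpret KS: restriction_semigroup "completion S" by (rule S.completion_restriction_semigroup)
  show "completion_map \<in> carrier (completion S) \<rightarrow>\<^sub>E carrier (completion T)" using extension_ideal by auto
  fix A B assume "A \<in> carrier (completion S)" "B \<in> carrier (completion S)"
  then have i: "S.ideal A" "S.ideal B" "S.ideal (A \<odot>\<^bsub>completion S\<^esub> B)"
    using KS.mult_closed[of A B] by simp_all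
  show "completion_map (A \<odot>\<^bsub>completion S\<^esub> B) = completion_map A \<odot>\<^bsub>completion T\<^esub> completion_map B"
    unfolding i[THEN completion_map_eq] using extension_mult[OF i(1,2)] .
next
  fix A assume "A \<in> carrier (completion S)"
  then have A: "S.ideal A" by simp
  show "completion_map (lam (completion S) A) = lam (completion T) (completion_map A)"
    unfolding S.completion_sel T.completion_sel completion_map_eq[OF A] completion_map_eq[OF S.ideal_lam[OF A]] using extension_lam[OF A] .
  show "completion_map (rho (completion S) A) = rho (completion T) (completion_map A)"
    unfolding S.completion_sel T.completion_sel completion_map_eq[OF A] completion_map_eq[OF S.ideal_rho[OF A]] using extension_rho[OF A] .
qed

text \<open>An element of a join of ideals is below a finite join of elements of these ideals, and \<open>f\<close>
  preserves finite joins.\<close>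

lemma completion_map_join_morphism: "join_morphism False (completion S) (completion T) completion_map"
  unfolding join_morphism_def
proof (intro conjI allI impI ballI)
  show "rs_hom (completion S) (completion T) completion_map" by (rule completion_map_rs_hom)
  fix X J assume X: "X \<subseteq> proj (completion S)" and J: "proj_lub (completion S) J X"
  have "J = S.generated X"
    by (rule partial_order.least_unique[OF restriction_semigroup.proj_order_partial_order[OF
        S.completion_restriction_semigroup] J S.completion_lub_generated[OF X]])
  note J' = J[unfolded S.completion_proj_lub_iff[OF X]]
  have iX: "S.ideal A" "A \<subseteq> proj S" if "A \<in> X" for A using subsetD[OF X that] by simp_all
  have eX: "extension ` X \<subseteq> proj (completion T)" using X extension_proj by blast
  have "proj_lub (completion T) (extension J) (extension ` X)"
    unfolding T.completion_proj_lub_iff[OF eX]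
  proof (intro conjI ballI impI)
    show "extension J \<in> proj (completion T)" using J' extension_proj by blast
    show "B \<subseteq> extension J" if "B \<in> extension ` X" for B using that J' extension_mono by blast
    fix U assume U: "U \<in> proj (completion T)" "\<forall>B\<in>extension ` X. B \<subseteq> U"
    then have iU: "T.ideal U" "U \<subseteq> proj T" by simp_all
    have iJ: "S.ideal J" using J' by simp
    show "extension J \<subseteq> U"
      unfolding extension_subset_iff[OF iJ iU(1)]
    proof
      fix s assume "s \<in> J"
      then obtain F t where F: "finite F" "F \<subseteq> \<Union>X" "proj_lub S t F" "s \<preceq>\<^bsub>S\<^esub> t"
        unfolding \<open>J = S.generated X\<close> S.generated_def by (elim CollectE exE conjE)
      have "F \<subseteq> proj S" using F(2) iX(2) by blast
      then have "proj_lub T (f t) (f ` F)" using join_morphism F unfolding join_morphism_def by simp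
      moreover have "f x \<in> U" if x: "x \<in> F" for x
      proof -
        obtain A where "A \<in> X" "x \<in> A" using x F(2) by blast
        then show ?thesis using hom_mem_extension[OF iX(1)] U(2) by blast
      qed
      ultimately have "f t \<in> U" using T.proj_ideal_finite_lub[OF iU, of "f ` F"] F(1) by blast
      moreover have "f s \<preceq>\<^bsub>T\<^esub> f t" using hom_mono[OF F(4)] least_closed[OF F(3)] by simp
      ultimately show "f s \<in> U" using T.idealD(3)[OF iU(1)] by blast
    qed
  qed
  moreover have "completion_map J = extension J" using J' by (intro completion_map_eq) simp
  moreover have "completion_map ` X = extension ` X" using iX(1) by (intro image_cong refl completion_map_eq)
  ultimately show "proj_lub (completion T) (completion_map J) (completion_map ` X)" by (simp only:)
next
  fix U assume "U \<in> proj (completion T)"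
  then have U: "T.ideal U" "U \<subseteq> proj T" by simp_all
  have "U \<subseteq> extension (proj S)"
  proof
    fix u assume u: "u \<in> U"
    then obtain h where "h \<in> proj S" "u \<preceq>\<^bsub>T\<^esub> f h" using U(2) join_morphism unfolding join_morphism_def by blast
    then show "u \<in> extension (proj S)" unfolding extension_mem[OF S.ideal_proj] by blast
  qed
  then have "U \<preceq>\<^bsub>completion T\<^esub> completion_map (proj S)"
    unfolding completion_map_eq[OF S.ideal_proj] using T.completion_le_iff[OF U(1) extension_ideal[OF S.ideal_proj]] by simp
  then show "\<exists>H\<in>proj (completion S). U \<preceq>\<^bsub>completion T\<^esub> completion_map H"
    using S.ideal_proj by (intro bexI[of _ "proj S"]) simp_all
qed

text \<open>The extension sends principal ideals to principal ideals.\<close>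

lemma completion_map_preserves_finite: "preserves_finite_projections (completion S) (completion T) completion_map"
  unfolding preserves_finite_projections_def S.finite_element_completion_iff T.finite_element_completion_iff
proof (intro allI impI)
  fix A assume "\<exists>p\<in>proj S. A = S.down p"
  then obtain p where "p \<in> proj S" "A = S.down p" by blast
  then show "\<exists>p\<in>proj T. completion_map A = T.down p" by (intro bexI[of _ "f p"]) (simp_all add: extension_down)
qed

text \<open>An ideal is covered by the principal ideals of its elements below the image of \<open>f\<close>, as
  finite joins of such elements already exhaust the ideal.\<close>

lemma completion_map_proper:
  assumes "drs_proper S T f"
  shows "proper_morphism False (completion S) (completion T) completion_map"
  unfolding proper_morphism_def
proof
  fix U assume "U \<in> carrier (completion T)"
  then have U: "T.ideal U" by simp
  have pm: "proper_morphism True S T f" using assms by (simp add: drs_proper_iff)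
  let ?D = "{x \<in> U. \<exists>s\<in>carrier S. x \<preceq>\<^bsub>T\<^esub> f s}"
  have D: "T.ideal (T.down x)" "x \<in> carrier T" "T.down x \<subseteq> U" if "x \<in> ?D" for x
  proof -
    have x: "x \<in> U" using that by blast
    show xC: "x \<in> carrier T" using T.idealD(4)[OF U x] .
    then show "T.ideal (T.down x)" by simp
    show "T.down x \<subseteq> U" using T.down_subset_ideal_iff[OF xC U] x by simp
  qed
  have cover: "\<exists>F. finite F \<and> F \<noteq> {} \<and> F \<subseteq> ?D \<and> nat_lub T u F" if u: "u \<in> U" for u
  proof -
    from proper_morphismE[OF pm T.idealD(4)[OF U u]] obtain F where F: "F \<subseteq> carrier T" "F \<noteq> {}"
      "small True F" "nat_lub T u F" "\<And>x. x \<in> F \<Longrightarrow> \<exists>s\<in>carrier S. x \<preceq>\<^bsub>T\<^esub> f s" by metis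
    have "x \<in> U" if "x \<in> F" for x
      using F(4)[unfolded nat_lub_iff[OF F(1)]] that T.idealD(3)[OF U u] by blast
    then show ?thesis using F by (intro exI[of _ F]) auto
  qed
  have ne: "?D \<noteq> {}"
  proof -
    obtain u where "u \<in> U" using T.idealD(1)[OF U] by blast
    from cover[OF this] show ?thesis by blast
  qed
  have iX: "A \<in> T.down ` ?D \<Longrightarrow> T.ideal A" for A using D(1) by blast
  have "nat_lub (completion T) U (T.down ` ?D)"
  proof (subst T.completion_lub_iff, erule iX, intro conjI ballI allI impI U)
    show "A \<subseteq> U" if "A \<in> T.down ` ?D" for A using that D(3) by blast
    fix V assume V: "T.ideal V" "\<forall>A\<in>T.down ` ?D. A \<subseteq> V"
    have DV: "x \<in> V" if "x \<in> ?D" for x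
      using V(2) that T.down_subset_ideal_iff[OF D(2)[OF that] V(1)] by blast
    show "U \<subseteq> V"
    proof
      fix u assume "u \<in> U"
      then obtain F where F: "finite F" "F \<noteq> {}" "F \<subseteq> ?D" "nat_lub T u F" using cover by blast
      then show "u \<in> V" using T.ideal_finite_lub[OF V(1) F(1,2) _ F(4)] DV by blast
    qed
  qed
  moreover have "\<exists>A\<in>carrier (completion S). B \<preceq>\<^bsub>completion T\<^esub> completion_map A" if B: "B \<in> T.down ` ?D" for B
  proof -
    obtain x s where x: "B = T.down x" "x \<in> ?D" "s \<in> carrier S" "x \<preceq>\<^bsub>T\<^esub> f s" using B by blast
    have "B \<subseteq> T.down (f s)" unfolding x(1) using T.down_subset_iff[OF D(2)[OF x(2)]] x(3,4) by simp
    then have "B \<preceq>\<^bsub>completion T\<^esub> completion_map (S.down s)"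
      using T.completion_le_iff[of B "T.down (f s)"] D(1)[OF x(2)] x(1,3) by (simp add: extension_down)
    then show ?thesis using x(3) by (intro bexI[of _ "S.down s"]) simp_all
  qed
  moreover have "T.down ` ?D \<subseteq> carrier (completion T)"
    by (intro subsetI, unfold T.completion_carrier_iff) (rule iX)
  ultimately show "\<exists>X. X \<subseteq> carrier (completion T) \<and> X \<noteq> {} \<and> small False X \<and>
      nat_lub (completion T) U X \<and> (\<forall>B\<in>X. \<exists>A\<in>carrier (completion S). B \<preceq>\<^bsub>completion T\<^esub> completion_map A)"
    using ne by (intro exI[of _ "T.down ` ?D"] conjI ballI) simp_all
qed

text \<open>Weak preservation of meets gives \<open>f(A \<inter> B) = f(A) \<inter> f(B)\<close> for the extension. Moreover the
  intersection on the right is empty if and only if \<open>A \<inter> B\<close> is, so the existence of the meets agrees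
  as well.\<close>

lemma completion_map_meet_preserving:
  assumes w: "drs_weakly_meet_preserving S T f"
  shows "crm_meet_preserving (completion S) (completion T) completion_map"
  unfolding crm_meet_preserving_def
proof (intro ballI allI)
  fix A B M assume "A \<in> carrier (completion S)" "B \<in> carrier (completion S)"
  then have AB: "S.ideal A" "S.ideal B" by simp_all
  have int: "extension (A \<inter> B) = extension A \<inter> extension B"
  proof
    show "extension (A \<inter> B) \<subseteq> extension A \<inter> extension B" unfolding extension_def by blast
    show "extension A \<inter> extension B \<subseteq> extension (A \<inter> B)"
    proof
      fix t assume "t \<in> extension A \<inter> extension B"
      then obtain a b where ab: "t \<in> carrier T" "a \<in> A" "b \<in> B" "t \<preceq>\<^bsub>T\<^esub> f a" "t \<preceq>\<^bsub>T\<^esub> f b"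
        unfolding extension_def by blast
      have "a \<in> carrier S" "b \<in> carrier S" using ab S.idealD(4)[OF AB(1)] S.idealD(4)[OF AB(2)] by simp_all
      then obtain c where c: "c \<in> carrier S" "c \<preceq>\<^bsub>S\<^esub> a" "c \<preceq>\<^bsub>S\<^esub> b" "t \<preceq>\<^bsub>T\<^esub> f c"
        using w ab unfolding drs_weakly_meet_preserving_def by blast
      then have "c \<in> A \<inter> B" using S.idealD(3)[OF AB(1) ab(2)] S.idealD(3)[OF AB(2) ab(3)] by blast
      then show "t \<in> extension (A \<inter> B)" unfolding extension_def using ab(1) c(4) by blast
    qed
  qed
  have ne: "extension A \<inter> extension B \<noteq> {} \<longleftrightarrow> A \<inter> B \<noteq> {}"
  proof
    assume "extension A \<inter> extension B \<noteq> {}"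
    then obtain t where "t \<in> extension (A \<inter> B)" unfolding int by blast
    then show "A \<inter> B \<noteq> {}" unfolding extension_def by blast
  next
    assume "A \<inter> B \<noteq> {}"
    then obtain a where "a \<in> A" "a \<in> B" by blast
    then have "f a \<in> extension A \<inter> extension B" using hom_mem_extension[OF AB(1)] hom_mem_extension[OF AB(2)] by blast
    then show "extension A \<inter> extension B \<noteq> {}" by blast
  qed
  have ideal_int: "S.ideal (A \<inter> B)" if "A \<inter> B \<noteq> {}"
  proof -
    have "is_glb (natural_order (completion S)) (A \<inter> B) {A, B}"
      unfolding S.completion_glb_iff[OF AB] using that by (intro conjI HOL.refl)
    from greatest_closed[OF this] show ?thesis by simp
  qed
  have "is_glb (natural_order (completion T)) M {completion_map A, completion_map B} \<longleftrightarrow> extension A \<inter> extension B \<noteq> {} \<and> M = extension A \<inter> extension B"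
    unfolding completion_map_eq[OF AB(1)] completion_map_eq[OF AB(2)] by (rule T.completion_glb_iff[OF AB[THEN extension_ideal]])
  also have "\<dots> \<longleftrightarrow> A \<inter> B \<noteq> {} \<and> M = completion_map (A \<inter> B)"
  proof -
    have "M = extension A \<inter> extension B \<longleftrightarrow> M = completion_map (A \<inter> B)" if "A \<inter> B \<noteq> {}"
      unfolding int[symmetric] completion_map_eq[OF ideal_int[OF that]] ..
    then show ?thesis unfolding ne by (rule conj_cong[OF HOL.refl])
  qed
  also have "\<dots> \<longleftrightarrow> (\<exists>C. is_glb (natural_order (completion S)) C {A, B} \<and> M = completion_map C)"
    unfolding S.completion_glb_iff[OF AB] by blast
  finally show "is_glb (natural_order (completion T)) M {completion_map A, completion_map B} \<longleftrightarrow>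
      (\<exists>C. is_glb (natural_order (completion S)) C {A, B} \<and> M = completion_map C)" .
qed

end

lemma distributive_morphismI:
  "distributive_rs S \<Longrightarrow> distributive_rs T \<Longrightarrow> drs_hom k S T f \<Longrightarrow> distributive_morphism S T f"
  by (simp add: distributive_morphism_def distributive_morphism_axioms_def distributive_semigroupI drs_hom_def)

lemma completion_crm_hom:
  fixes S T :: "'a rsemigroup"
  assumes S: "distributive_rs S" and T: "distributive_rs T" and f: "drs_hom k S T f"
  shows "crm_hom k (completion S) (completion T) (on_arr completion_functor S T f)"
proof -
  interpret distributive_morphism S T f using assms by (rule distributive_morphismI)
  have arr: "on_arr completion_functor S T f = completion_map"
    unfolding completion_functor_def extension_def by simp
  have m: "crm_morphism (completion S) (completion T) completion_map"
    using completion_map_join_morphism crm_morphism_iff[OF S.completion_crm T.completion_crm] by simp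
  show ?thesis
    unfolding arr crm_hom_def crm_proper_iff[OF S.completion_crm T.completion_crm m]
    using m completion_map_preserves_finite completion_map_proper completion_map_meet_preserving f by (auto simp: drs_hom_def)
qed

section \<open>A coherent monoid is the completion of its finite part\<close>

context coherent_monoid begin

lemma finite_part_distributive_semigroup: "distributive_semigroup (finite_part S)"
  using finite_part_distributive_rs by (rule distributive_semigroupI)

sublocale F: distributive_semigroup "finite_part S"
  by (rule finite_part_distributive_semigroup)

lemma fin_ideal_subset:
  assumes "F.ideal A"
  shows "A \<subseteq> carrier S" "a \<in> A \<Longrightarrow> a \<in> carrier S" "a \<in> A \<Longrightarrow> a \<in> carrier (finite_part S)"
  using F.idealD(4)[OF assms] by auto

lemma fin_ideal_directed:
  assumes A: "F.ideal A" and ab: "a \<in> A" "b \<in> A"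
  shows "\<exists>c\<in>A. a \<preceq> c \<and> b \<preceq> c"
proof -
  obtain c where c: "c \<in> A" "a \<preceq>\<^bsub>finite_part S\<^esub> c" "b \<preceq>\<^bsub>finite_part S\<^esub> c"
    using F.ideal_directed[OF A ab] by metis
  then show ?thesis
    using finite_part_le_iff[OF fin_ideal_subset(3)[OF A] fin_ideal_subset(3)[OF A]] ab by blast
qed

lemma fin_ideal_lub_exists:
  assumes A: "F.ideal A"
  shows "\<exists>s. nat_lub S s A"
proof -
  have "compatible_set S A"
    unfolding compatible_set_def
  proof (intro conjI ballI)
    fix a b assume "a \<in> A" "b \<in> A"
    then obtain c where "c \<in> A" "a \<preceq> c" "b \<preceq> c" using fin_ideal_directed[OF A] by blast
    then show "compatible S a b" using bounded_compatible fin_ideal_subset(2)[OF A] by blast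
  qed (rule F.idealD(1)[OF A], rule fin_ideal_subset(1)[OF A])
  then show ?thesis using join_exists by simp
qed

definition lub_of :: "'a set \<Rightarrow> 'a" where
  "lub_of A = (THE s. nat_lub S s A)"

lemma lub_of_eqI: "nat_lub S s A \<Longrightarrow> lub_of A = s"
  unfolding lub_of_def using nat_lub_unique by blast

lemma nat_lub_lub_of: "F.ideal A \<Longrightarrow> nat_lub S (lub_of A) A"
  using fin_ideal_lub_exists lub_of_eqI by metis

lemma lub_of_carrier: "F.ideal A \<Longrightarrow> lub_of A \<in> carrier S"
  using least_closed[OF nat_lub_lub_of] by simp

lemma lub_of_upper: "F.ideal A \<Longrightarrow> a \<in> A \<Longrightarrow> a \<preceq> lub_of A"
  using nat_lub_lub_of[of A] fin_ideal_subset(1)[of A] nat_lub_iff[of A S] by blast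

lemma fin_below_ideal:
  assumes s: "s \<in> carrier S"
  shows "F.ideal (fin_below s)"
proof (rule F.idealI)
  show "fin_below s \<noteq> {}" using fin_below_nonempty[OF s] .
  show "fin_below s \<subseteq> carrier (finite_part S)" by (rule fin_below_subset)
  show "b \<in> fin_below s" if a: "a \<in> fin_below s" and le: "b \<preceq>\<^bsub>finite_part S\<^esub> a" for a b
  proof -
    have aF: "a \<in> carrier (finite_part S)" "a \<preceq> s" using a by (auto simp: fin_below_def)
    have bF: "b \<in> carrier (finite_part S)" using F.le_carrier[OF le aF(1)] .
    then have "b \<preceq> a" using finite_part_le_iff[OF bF aF(1)] le by blast
    then have "b \<preceq> s" using le_trans aF(2) s by blast
    then show ?thesis using bF unfolding fin_below_def by blast
  qed
  fix a b assume ab: "a \<in> fin_below s" "b \<in> fin_below s"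
  then obtain c where c: "c \<in> fin_below s" "a \<preceq> c" "b \<preceq> c" using fin_below_directed[OF s] by blast
  have "a \<preceq>\<^bsub>finite_part S\<^esub> c" "b \<preceq>\<^bsub>finite_part S\<^esub> c"
    using finite_part_le_iff[of _ c] c ab subsetD[OF fin_below_subset(2)] by blast+
  then show "\<exists>c\<in>fin_below s. a \<preceq>\<^bsub>finite_part S\<^esub> c \<and> b \<preceq>\<^bsub>finite_part S\<^esub> c" using c(1) by blast
qed

lemma lub_of_fin_below: "s \<in> carrier S \<Longrightarrow> lub_of (fin_below s) = s"
  by (rule lub_of_eqI[OF nat_lub_fin_below])

text \<open>Here finiteness is used: a finite element below the join of a directed set is below a member.\<close>

lemma fin_below_lub_of:
  assumes A: "F.ideal A"
  shows "fin_below (lub_of A) = A"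
proof (intro equalityI subsetI)
  fix t assume "t \<in> fin_below (lub_of A)"
  then have t: "t \<in> carrier (finite_part S)" "t \<preceq> lub_of A" by (auto simp: fin_below_def)
  obtain a where a: "a \<in> A" "t \<preceq> a"
    using finite_below_directed_lub[OF t(1) F.idealD(1)[OF A] fin_ideal_subset(1)[OF A]
        nat_lub_lub_of[OF A] t(2)] fin_ideal_directed[OF A] by blast
  then have "t \<preceq>\<^bsub>finite_part S\<^esub> a" using finite_part_le_iff[OF t(1) fin_ideal_subset(3)[OF A a(1)]] by blast
  then show "t \<in> A" using F.idealD(3)[OF A a(1)] by blast
next
  fix a assume a: "a \<in> A"
  show "a \<in> fin_below (lub_of A)"
    unfolding fin_below_def using fin_ideal_subset(3)[OF A a] lub_of_upper[OF A a] by blast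
qed

text \<open>Multiplication preserves joins in both arguments.\<close>

lemma lub_of_mult:
  assumes A: "F.ideal A" and B: "F.ideal B"
  shows "lub_of (A \<odot>\<^bsub>completion (finite_part S)\<^esub> B) = lub_of A \<odot> lub_of B"
proof (rule lub_of_eqI)
  note C = fin_ideal_subset(2)[OF A] fin_ideal_subset(2)[OF B] lub_of_carrier[OF A] lub_of_carrier[OF B]
  have eq: "A \<odot>\<^bsub>completion (finite_part S)\<^esub> B = {a \<odot> b |a b. a \<in> A \<and> b \<in> B}"
    by (simp add: F.completion_sel)
  have sub: "{a \<odot> b |a b. a \<in> A \<and> b \<in> B} \<subseteq> carrier S" using C by auto
  show "nat_lub S (lub_of A \<odot> lub_of B) (A \<odot>\<^bsub>completion (finite_part S)\<^esub> B)"
    unfolding eq nat_lub_iff[OF sub]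
  proof (intro conjI ballI impI)
    show "lub_of A \<odot> lub_of B \<in> carrier S" using C by simp
    show "x \<preceq> lub_of A \<odot> lub_of B" if x: "x \<in> {a \<odot> b |a b. a \<in> A \<and> b \<in> B}" for x
    proof -
      obtain a b where "a \<in> A" "b \<in> B" "x = a \<odot> b" using x by blast
      then show ?thesis using mult_mono[OF lub_of_upper[OF A] lub_of_upper[OF B] C(3,4)] by blast
    qed
    fix u assume u: "u \<in> carrier S" "\<forall>x\<in>{a \<odot> b |a b. a \<in> A \<and> b \<in> B}. x \<preceq> u"
    have "a \<odot> lub_of B \<preceq> u" if a: "a \<in> A" for a
    proof -
      have sub': "(\<odot>) a ` B \<subseteq> carrier S" using C a by auto
      have "nat_lub S (a \<odot> lub_of B) ((\<odot>) a ` B)"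
        by (rule nat_lub_mult_left[OF _ F.idealD(1)[OF B] fin_ideal_subset(1)[OF B]
              nat_lub_lub_of[OF B] C(1)[OF a]]) simp
      then show ?thesis unfolding nat_lub_iff[OF sub'] using u a by blast
    qed
    moreover have sub': "(\<lambda>x. x \<odot> lub_of B) ` A \<subseteq> carrier S" using C by auto
    moreover have "nat_lub S (lub_of A \<odot> lub_of B) ((\<lambda>x. x \<odot> lub_of B) ` A)"
      by (rule nat_lub_mult_right[OF _ F.idealD(1)[OF A] fin_ideal_subset(1)[OF A]
            nat_lub_lub_of[OF A] C(4)]) simp
    ultimately show "lub_of A \<odot> lub_of B \<preceq> u" unfolding nat_lub_iff[OF sub'] using u(1) by blast
  qed
qed

definition lub_iso :: "'a set \<Rightarrow> 'a set" where
  "lub_iso = (\<lambda>A\<in>carrier (completion (finite_part S)). {lub_of A})"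

lemma lub_iso_eq: "F.ideal A \<Longrightarrow> lub_iso A = {lub_of A}"
  unfolding lub_iso_def by simp

lemma lub_iso: "rs_iso (completion (finite_part S)) (lift_rs S) lub_iso"
proof (rule rs_isoI)
  interpret K: restriction_semigroup "completion (finite_part S)" by (rule F.completion_restriction_semigroup)
  show "restriction_semigroup (completion (finite_part S))" by (rule K.restriction_semigroup_axioms)
  show "restriction_semigroup (lift_rs S)"
    using rs_iso_restriction_semigroup lift_rs_iso restriction_semigroup_axioms by blast
  show "rs_hom (completion (finite_part S)) (lift_rs S) lub_iso"
    unfolding rs_hom_def
  proof (intro conjI ballI)
    show "lub_iso \<in> carrier (completion (finite_part S)) \<rightarrow>\<^sub>E carrier (lift_rs S)"
      unfolding lub_iso_def by (auto simp: lift_rs_def lub_of_carrier)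
    fix A B assume "A \<in> carrier (completion (finite_part S))" "B \<in> carrier (completion (finite_part S))"
    then have i: "F.ideal A" "F.ideal B" "F.ideal (A \<odot>\<^bsub>completion (finite_part S)\<^esub> B)"
      using K.mult_closed[of A B] by simp_all
    show "lub_iso (A \<odot>\<^bsub>completion (finite_part S)\<^esub> B) = lub_iso A \<odot>\<^bsub>lift_rs S\<^esub> lub_iso B"
      unfolding lub_iso_eq[OF i(1)] lub_iso_eq[OF i(2)] lub_iso_eq[OF i(3)] lub_of_mult[OF i(1,2)]
      by (simp add: lift_rs_def)
  next
    fix A assume "A \<in> carrier (completion (finite_part S))"
    then have A: "F.ideal A" by simp
    have i: "F.ideal (lam S ` A)" "F.ideal (rho S ` A)" using F.ideal_lam[OF A] F.ideal_rho[OF A] by simp_all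
    have eq: "lam (completion (finite_part S)) A = lam S ` A" "rho (completion (finite_part S)) A = rho S ` A"
      by (simp_all add: F.completion_sel)
    have "lub_of (lam S ` A) = lam S (lub_of A)"
      by (intro lub_of_eqI nat_lub_lam nat_lub_lub_of A fin_ideal_subset(1)[OF A] F.idealD(1)[OF A]) simp
    then show "lub_iso (lam (completion (finite_part S)) A) = lam (lift_rs S) (lub_iso A)"
      unfolding eq lub_iso_eq[OF A] lub_iso_eq[OF i(1)] by (simp add: lift_rs_def)
    have "lub_of (rho S ` A) = rho S (lub_of A)"
      by (intro lub_of_eqI nat_lub_rho nat_lub_lub_of A fin_ideal_subset(1)[OF A] F.idealD(1)[OF A]) simp
    then show "lub_iso (rho (completion (finite_part S)) A) = rho (lift_rs S) (lub_iso A)"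
      unfolding eq lub_iso_eq[OF A] lub_iso_eq[OF i(2)] by (simp add: lift_rs_def)
  qed
  show "bij_betw lub_iso (carrier (completion (finite_part S))) (carrier (lift_rs S))"
  proof (rule bij_betw_byWitness[where f' = "\<lambda>X. fin_below (the_elem X)"])
    show "\<forall>A\<in>carrier (completion (finite_part S)). fin_below (the_elem (lub_iso A)) = A"
    proof
      fix A assume "A \<in> carrier (completion (finite_part S))"
      then have A: "F.ideal A" by simp
      show "fin_below (the_elem (lub_iso A)) = A"
        unfolding lub_iso_eq[OF A] by (simp add: fin_below_lub_of[OF A])
    qed
    show "\<forall>X\<in>carrier (lift_rs S). lub_iso (fin_below (the_elem X)) = X"
      by (auto simp: lift_rs_def lub_iso_eq fin_below_ideal lub_of_fin_below)
    show "lub_iso ` carrier (completion (finite_part S)) \<subseteq> carrier (lift_rs S)"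
      unfolding lub_iso_def by (auto simp: lift_rs_def lub_of_carrier)
    show "(\<lambda>X. fin_below (the_elem X)) ` carrier (lift_rs S) \<subseteq> carrier (completion (finite_part S))"
      by (auto simp: lift_rs_def fin_below_ideal)
  qed
qed

end

text \<open>Naturality of \<open>lub_iso\<close>: the lower set generated by \<open>f ` A\<close> has the same join as \<open>f ` A\<close>.\<close>

lemma (in coherent_morphism) lub_of_extension:
  assumes extension: "distributive_morphism (finite_part S) (finite_part T) finite_part_map"
    and A: "S.F.ideal A"
  shows "T.lub_of (distributive_morphism.extension (finite_part T) finite_part_map A) = f (S.lub_of A)"
proof (rule T.lub_of_eqI)
  interpret M: distributive_morphism "finite_part S" "finite_part T" finite_part_map by fact
  have E: "T.F.ideal (M.extension A)" using M.extension_ideal[OF A] .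
  have lub: "nat_lub T (f (S.lub_of A)) (f ` A)"
    by (rule hom_nat_lub[OF _ S.F.idealD(1)[OF A] S.fin_ideal_subset(1)[OF A] S.nat_lub_lub_of[OF A]]) simp
  have fA: "f ` A \<subseteq> carrier T" using S.fin_ideal_subset(2)[OF A] by auto
  note lub' = lub[unfolded nat_lub_iff[OF fA]]
  show "nat_lub T (f (S.lub_of A)) (M.extension A)"
    unfolding nat_lub_iff[OF T.fin_ideal_subset(1)[OF E]]
  proof (intro conjI ballI impI)
    show "f (S.lub_of A) \<in> carrier T" using S.lub_of_carrier[OF A] by simp
    show "t \<preceq>\<^bsub>T\<^esub> f (S.lub_of A)" if t: "t \<in> M.extension A" for t
    proof -
      obtain a where a: "a \<in> A" "t \<preceq>\<^bsub>finite_part T\<^esub> finite_part_map a" using t M.extension_mem[OF A] by blast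
      note aF = S.fin_ideal_subset(3)[OF A a(1)]
      have "t \<preceq>\<^bsub>T\<^esub> f a"
        using a(2) T.finite_part_le_iff[OF T.fin_ideal_subset(3)[OF E t] hom_finite_part[OF aF]]
        unfolding finite_part_map_eq[OF aF] by blast
      moreover have "f a \<preceq>\<^bsub>T\<^esub> f (S.lub_of A)" using lub' a(1) by blast
      ultimately show ?thesis using T.le_trans lub' by blast
    qed
    fix u assume u: "u \<in> carrier T" "\<forall>x\<in>M.extension A. x \<preceq>\<^bsub>T\<^esub> u"
    have "f a \<preceq>\<^bsub>T\<^esub> u" if a: "a \<in> A" for a
      using M.hom_mem_extension[OF A a] u(2) unfolding finite_part_map_eq[OF S.fin_ideal_subset(3)[OF A a]] by blast
    then show "f (S.lub_of A) \<preceq>\<^bsub>T\<^esub> u" using lub' u(1) by blast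
  qed
qed

section \<open>Strongly coherent monoids\<close>

locale strongly_coherent_monoid = joined_restriction_semigroup S False for S :: "'a rsemigroup" (structure) +
  assumes strongly_coherent: "strongly_coherent_crm S"
begin

lemma Lvee_coherent: "coherent_frame (Lvee S)"
  using strongly_coherent by (simp add: strongly_coherent_crm_def)

lemma Lvee_complete: "complete_lattice (Lvee S)"
  using Lvee_coherent by (intro frame_complete coherent_frame_frame)

lemma crm: "complete_restriction_monoid S"
  using strongly_coherent by (simp add: strongly_coherent_crm_def)

lemma proj_complete: "complete_lattice (proj_order S)"
  using crm by (simp add: complete_restriction_monoid_def frame_complete)

lemma down_Lvee:
  assumes a: "a \<in> carrier S"
  shows "down a \<in> carrier (Lvee S)"
  unfolding Lvee_carrier
proof (intro conjI allI impI)
  have dC: "down a \<subseteq> carrier S" using le_carrier[OF _ a] by (intro subsetI) simp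
  have "down a \<noteq> {}" using le_refl[OF a] mem_down by blast
  moreover have "b \<in> down a" if "x \<in> down a" "b \<preceq> x" for x b
    using that le_trans[OF that(2) _ a] by simp
  ultimately show "order_ideal S (down a)" unfolding order_ideal_def using dC by blast
  fix X s assume X: "X \<subseteq> down a" "nat_lub S s X"
  have XC: "X \<subseteq> carrier S" using X(1) dC by blast
  have "\<forall>x\<in>X. x \<preceq> a" using X(1) mem_down by blast
  then show "s \<in> down a" using X(2) a unfolding nat_lub_iff[OF XC] by simp
qed

text \<open>Such a set is compatible, being bounded by \<open>a\<close>, so it contains its join.\<close>

lemma Lvee_below_down:
  assumes a: "a \<in> carrier S" and A: "A \<in> carrier (Lvee S)" "A \<subseteq> down a"
  shows "\<exists>b. b \<preceq> a \<and> A = down b"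
proof -
  have A': "A \<noteq> {}" "A \<subseteq> carrier S" "\<And>x b. x \<in> A \<Longrightarrow> b \<in> carrier S \<Longrightarrow> b \<preceq> x \<Longrightarrow> b \<in> A"
    using A(1) unfolding Lvee_carrier order_ideal_def by blast+
  have comp: "compatible_set S A"
    using A(2) by (intro bounded_compatible_set[OF A'(1) a]) auto
  then obtain s where s: "nat_lub S s A" using join_exists by auto
  note s' = s[unfolded nat_lub_iff[OF A'(2)]]
  have sA: "s \<in> A" using A(1) comp s unfolding Lvee_carrier by blast
  have "A = down s"
  proof (intro equalityI subsetI)
    show "x \<in> down s" if "x \<in> A" for x using s' that by simp
    show "x \<in> A" if "x \<in> down s" for x
      using that A'(3)[OF sA, of x] le_carrier[of x s] s' by simp
  qed
  moreover have "s \<preceq> a" using sA A(2) by auto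
  ultimately show ?thesis by blast
qed

text \<open>By the preceding lemma, what is below the principal ideal of \<open>a\<close> in \<open>Lvee S\<close> are the
  elements of \<open>S\<close> below \<open>a\<close>, and these correspond to the projections below \<open>lam a\<close>.\<close>

lemma down_Lvee_order_iso:
  assumes a: "a \<in> carrier S"
  shows "order_iso (down_order (proj_order S) (lam S a)) (down_order (Lvee S) (down a)) (\<lambda>f. down (a \<odot> f))"
proof -
  have le: "down (a \<odot> f) \<subseteq> down (a \<odot> f') \<longleftrightarrow> f \<preceq> f'"
    if f: "f \<in> proj S" "f \<preceq> lam S a" "f' \<in> proj S" "f' \<preceq> lam S a" for f f'
  proof -
    have "down (a \<odot> f) \<subseteq> down (a \<odot> f') \<longleftrightarrow> a \<odot> f \<preceq> a \<odot> f'" using f a by (intro down_subset_iff) simp_all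
    also have "\<dots> \<longleftrightarrow> lam S (a \<odot> f) \<preceq> lam S (a \<odot> f')"
      using f a by (intro bounded_le_iff[of _ a] mult_proj_le) simp_all
    also have "\<dots> \<longleftrightarrow> f \<preceq> f'" using f a by (simp add: lam_mult_proj proj_le_iff)
    finally show ?thesis .
  qed
  show ?thesis
    unfolding order_iso_def bij_betw_def
  proof (intro conjI ballI)
    show "inj_on (\<lambda>f. down (a \<odot> f)) (carrier (down_order (proj_order S) (lam S a)))"
    proof (rule inj_onI)
      fix f f' assume f: "f \<in> carrier (down_order (proj_order S) (lam S a))"
        "f' \<in> carrier (down_order (proj_order S) (lam S a))" and eq: "down (a \<odot> f) = down (a \<odot> f')"
      then have f': "f \<in> proj S" "f \<preceq> lam S a" "f' \<in> proj S" "f' \<preceq> lam S a" by simp_all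
      have "f \<preceq> f'" using le[OF f'] eq by simp
      moreover have "f' \<preceq> f" using le[OF f'(3,4,1,2)] eq by simp
      ultimately show "f = f'" using le_antisym f'(1) proj_carrier by blast
    qed
    show "(\<lambda>f. down (a \<odot> f)) ` carrier (down_order (proj_order S) (lam S a)) = carrier (down_order (Lvee S) (down a))"
    proof (intro equalityI subsetI)
      fix A assume "A \<in> (\<lambda>f. down (a \<odot> f)) ` carrier (down_order (proj_order S) (lam S a))"
      then obtain f where f: "f \<in> proj S" "A = down (a \<odot> f)" by auto
      then have "A \<subseteq> down a" using down_subset_iff[of "a \<odot> f" a] mult_proj_le[OF a f(1)] a by simp
      then show "A \<in> carrier (down_order (Lvee S) (down a))" using down_Lvee[of "a \<odot> f"] f a by simp
    next
      fix A assume "A \<in> carrier (down_order (Lvee S) (down a))"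
      then obtain b where b: "b \<preceq> a" "A = down b" using Lvee_below_down[OF a] by auto
      have bC: "b \<in> carrier S" using le_carrier[OF b(1) a] .
      have "A = down (a \<odot> lam S b)" using b leD[OF b(1) bC a] by simp
      moreover have "lam S b \<in> carrier (down_order (proj_order S) (lam S a))"
        using lam_mono[OF b(1) a] bC by simp
      ultimately show "A \<in> (\<lambda>f. down (a \<odot> f)) ` carrier (down_order (proj_order S) (lam S a))" by (rule image_eqI)
    qed
    fix f f' assume "f \<in> carrier (down_order (proj_order S) (lam S a))"
      "f' \<in> carrier (down_order (proj_order S) (lam S a))"
    then show "down (a \<odot> f) \<sqsubseteq>\<^bsub>down_order (Lvee S) (down a)\<^esub> down (a \<odot> f') \<longleftrightarrow>
        f \<sqsubseteq>\<^bsub>down_order (proj_order S) (lam S a)\<^esub> f'" using le[of f f'] by simp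
  qed
qed

lemma finite_down_iff:
  assumes a: "a \<in> carrier S"
  shows "finite_element (Lvee S) (down a) \<longleftrightarrow> finite_element (proj_order S) (lam S a)"
proof -
  have l: "lam S a \<in> carrier (proj_order S)" using a by simp
  have "finite_element (down_order (Lvee S) (down a)) (down (a \<odot> lam S a)) \<longleftrightarrow>
      finite_element (down_order (proj_order S) (lam S a)) (lam S a)"
    by (rule order_iso_finite_element[OF down_Lvee_order_iso[OF a] down_order_complete[OF proj_complete l]
          partial_order.down_order_partial_order[OF Lvee_partial_order]]) (use l le_refl in simp)
  then show ?thesis
    unfolding down_order_finite_element[OF Lvee_complete down_Lvee[OF a]]
      down_order_finite_element[OF proj_complete l] using a by simp
qed

text \<open>The ideal generated by the identity is the set of projections, so the frame of projections is
  isomorphic to a principal ideal of the coherent frame \<open>Lvee S\<close>.\<close>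

lemma coherent: "coherent_crm S"
proof -
  obtain e where e: "e \<in> carrier S" "\<forall>a\<in>carrier S. e \<odot> a = a \<and> a \<odot> e = a"
    using crm unfolding complete_restriction_monoid_iff by blast
  note ep = identity_proj[OF e]
  have "down_order (proj_order S) (lam S e) = proj_order S"
    using ep by (simp add: down_order_def proj_order_def natural_order_def) (auto simp: nat_le_iff)
  then have "order_iso (down_order (Lvee S) (down e)) (proj_order S)
      (inv_into (carrier (proj_order S)) (\<lambda>f. down (e \<odot> f)))"
    using order_iso_inv[OF down_Lvee_order_iso[OF e(1)]] by simp
  then have "coherent_frame (proj_order S)"
    by (rule order_iso_coherent_frame[OF _ down_order_coherent_frame[OF Lvee_complete down_Lvee[OF e(1)] Lvee_coherent]
          proj_order_partial_order])
  then show ?thesis using crm by (simp add: coherent_crm_def)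
qed

text \<open>The intersection of two finite principal ideals is finite by coherence of \<open>Lvee S\<close>, and it is
  principal because it lies below a principal ideal. Its generator is the meet.\<close>

lemma finite_part_distributive_meet_rs: "distributive_meet_rs (finite_part S)"
  unfolding distributive_meet_rs_def
proof (intro conjI ballI)
  interpret C: coherent_monoid S using coherent by (rule coherent_monoidI)
  show "distributive_rs (finite_part S)" by (rule C.finite_part_distributive_rs)
  fix a b assume ab: "a \<in> carrier (finite_part S)" "b \<in> carrier (finite_part S)"
  then have abC: "a \<in> carrier S" "b \<in> carrier S" by simp_all
  have fin: "finite_element (Lvee S) (down a)" "finite_element (Lvee S) (down b)"
    using ab finite_down_iff by simp_all
  have sub: "{down a, down b} \<subseteq> carrier (Lvee S)" using down_Lvee abC by simp
  obtain M where M: "is_glb (Lvee S) M {down a, down b}"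
    using Lvee_complete sub by (metis complete_lattice.inf_exists)
  note M' = M[unfolded is_glb_iff[OF sub]]
  have finM: "finite_element (Lvee S) M"
    by (rule Lvee_coherent[unfolded coherent_frame_iff[OF Lvee_complete], THEN conjunct2, THEN conjunct2,
          rule_format, OF down_Lvee[OF abC(1)] down_Lvee[OF abC(2)] fin M])
  have "M \<subseteq> down a" "M \<subseteq> down b" "M \<in> carrier (Lvee S)" using M' by simp_all
  then obtain c where c: "c \<preceq> a" "M = down c" using Lvee_below_down[OF abC(1)] by blast
  have cC: "c \<in> carrier S" using le_carrier[OF c(1) abC(1)] .
  have cb: "c \<preceq> b" using \<open>M \<subseteq> down b\<close> down_subset_iff[OF cC abC(2)] c(2) by simp
  have cF: "c \<in> carrier (finite_part S)" using finM finite_down_iff[OF cC] cC c(2) by simp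
  have sub': "{a, b} \<subseteq> carrier (natural_order (finite_part S))" using ab by simp
  have "is_glb (natural_order (finite_part S)) c {a, b}"
    unfolding is_glb_iff[OF sub']
  proof (intro conjI ballI impI)
    show "c \<in> carrier (natural_order (finite_part S))" using cF by simp
    show "c \<preceq>\<^bsub>finite_part S\<^esub> x" if "x \<in> {a, b}" for x
      using that C.finite_part_le_iff[OF cF ab(1)] C.finite_part_le_iff[OF cF ab(2)] c(1) cb by auto
    fix u assume "u \<in> carrier (natural_order (finite_part S))" and le: "\<forall>x\<in>{a, b}. u \<preceq>\<^bsub>finite_part S\<^esub> x"
    then have uF: "u \<in> carrier (finite_part S)" "u \<in> carrier S" by simp_all
    have "u \<preceq> a" "u \<preceq> b"
      using le C.finite_part_le_iff[OF uF(1) ab(1)] C.finite_part_le_iff[OF uF(1) ab(2)] by simp_all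
    then have "down u \<subseteq> down a" "down u \<subseteq> down b" using down_subset_iff uF(2) abC by simp_all
    then have "down u \<subseteq> M" using M' down_Lvee[OF uF(2)] by simp
    then have "u \<preceq> c" using c(2) down_subset_iff[OF uF(2) cC] by simp
    then show "u \<preceq>\<^bsub>finite_part S\<^esub> c" using C.finite_part_le_iff[OF uF(1) cF] by simp
  qed
  then show "\<exists>m. is_glb (natural_order (finite_part S)) m {a, b}" by blast
qed

end

lemma strongly_coherent_monoidI: "strongly_coherent_crm S \<Longrightarrow> strongly_coherent_monoid S"
  by (simp add: strongly_coherent_monoid_def strongly_coherent_monoid_axioms_def
      strongly_coherent_crm_def complete_restriction_monoid_iff)

section \<open>Completions of meet semigroups\<close>

locale distributive_meet_semigroup = distributive_semigroup +
  assumes meets: "a \<in> carrier S \<Longrightarrow> b \<in> carrier S \<Longrightarrow> \<exists>m. is_glb (natural_order S) m {a, b}"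
begin

text \<open>Arbitrary joins of ideals are generated by finite joins of elements, so a member of \<open>Lvee\<close> of the
  completion is determined by the principal ideals in it. Their generators form a set that is closed in
  this sense.\<close>

definition closed :: "'a set \<Rightarrow> bool" where
  "closed D \<longleftrightarrow> D \<noteq> {} \<and> D \<subseteq> carrier S \<and> (\<forall>a\<in>D. \<forall>b. b \<preceq> a \<longrightarrow> b \<in> D) \<and>
     (\<forall>F s. finite F \<longrightarrow> F \<noteq> {} \<longrightarrow> F \<subseteq> D \<longrightarrow> nat_lub S s F \<longrightarrow> s \<in> D)"

lemma closedD:
  assumes "closed D"
  shows "D \<noteq> {}" "D \<subseteq> carrier S" "a \<in> D \<Longrightarrow> b \<preceq> a \<Longrightarrow> b \<in> D" "a \<in> D \<Longrightarrow> a \<in> carrier S"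
    "finite F \<Longrightarrow> F \<noteq> {} \<Longrightarrow> F \<subseteq> D \<Longrightarrow> nat_lub S s F \<Longrightarrow> s \<in> D"
  using assms unfolding closed_def by blast+

definition closed_order :: "'a set gorder" where
  "closed_order = \<lparr>carrier = {D. closed D}, eq = (=), le = (\<subseteq>)\<rparr>"

lemma closed_order_sel [simp]:
  "carrier closed_order = {D. closed D}" "eq closed_order = (=)" "le closed_order = (\<subseteq>)"
  by (simp_all add: closed_order_def)

lemma closed_order_partial_order: "partial_order closed_order"
  by unfold_locales auto

lemma glbE:
  assumes "a \<in> carrier S" "b \<in> carrier S"
  obtains m where "m \<in> carrier S" "m \<preceq> a" "m \<preceq> b" "\<And>u. u \<preceq> a \<Longrightarrow> u \<preceq> b \<Longrightarrow> u \<preceq> m"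
proof -
  obtain m where m: "is_glb (natural_order S) m {a, b}" using meets assms by blast
  have "{a, b} \<subseteq> carrier (natural_order S)" using assms by simp
  note m' = m[unfolded is_glb_iff[OF this]]
  show thesis
  proof (rule that[of m])
    show "u \<preceq> m" if "u \<preceq> a" "u \<preceq> b" for u using m' that le_carrier[OF that(1) assms(1)] by simp
  qed (use m' in simp_all)
qed

text \<open>The meet of an element with the least projection is a projection, hence is the least projection.\<close>

lemma zero_exists: "\<exists>z\<in>carrier S. \<forall>a\<in>carrier S. z \<preceq> a"
proof -
  obtain z where z: "z \<in> proj S" "\<forall>f\<in>proj S. z \<preceq> f" using proj_zero_exists by blast
  have "z \<preceq> a" if a: "a \<in> carrier S" for a
  proof -
    obtain m where m: "m \<preceq> z" "m \<preceq> a" "m \<in> carrier S" using glbE[OF proj_carrier[OF z(1)] a] by metis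
    have "z \<preceq> m" using z le_proj[OF m(1) z(1)] by blast
    then show ?thesis using le_trans m(2) a by blast
  qed
  then show ?thesis using z(1) by (intro bexI[of _ z] ballI) simp_all
qed

definition zero :: 'a where "zero = (SOME z. z \<in> carrier S \<and> (\<forall>a\<in>carrier S. z \<preceq> a))"

lemma zero: "zero \<in> carrier S" "a \<in> carrier S \<Longrightarrow> zero \<preceq> a"
proof -
  have "zero \<in> carrier S \<and> (\<forall>a\<in>carrier S. zero \<preceq> a)"
    unfolding zero_def by (rule someI_ex) (use zero_exists in blast)
  then show "zero \<in> carrier S" "a \<in> carrier S \<Longrightarrow> zero \<preceq> a" by blast+
qed

lemma zero_closed: "closed D \<Longrightarrow> zero \<in> D"
  using closedD(1,3,4)[of D] zero(2) by blast

text \<open>Adding the zero makes the hull of the empty set the least closed set. For a set \<open>U\<close> the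
  description by joins of elements below \<open>U\<close> needs no iteration (\<open>closed_closed_hull\<close>).\<close>

definition closed_hull :: "'a set \<Rightarrow> 'a set" where
  "closed_hull U = {s. \<exists>F. finite F \<and> F \<noteq> {} \<and> F \<subseteq> carrier S \<and> nat_lub S s F \<and>
     (\<forall>x\<in>F. \<exists>u\<in>insert zero U. x \<preceq> u)}"

lemma closed_hullI:
  assumes "finite F" "F \<noteq> {}" "F \<subseteq> carrier S" "nat_lub S s F" "\<And>x. x \<in> F \<Longrightarrow> \<exists>u\<in>insert zero U. x \<preceq> u"
  shows "s \<in> closed_hull U"
  unfolding closed_hull_def using assms by (intro CollectI exI[of _ F]) simp

lemma closed_hullE:
  assumes "s \<in> closed_hull U"
  obtains F where "finite F" "F \<noteq> {}" "F \<subseteq> carrier S" "nat_lub S s F" "\<forall>x\<in>F. \<exists>u\<in>insert zero U. x \<preceq> u"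
  using assms unfolding closed_hull_def by blast

lemma closed_hull_below: "s \<in> carrier S \<Longrightarrow> s \<preceq> u \<Longrightarrow> u \<in> insert zero U \<Longrightarrow> s \<in> closed_hull U"
  by (rule closed_hullI[of "{s}"]) (auto simp: nat_lub_singleton)

lemma closed_hull_superset: "U \<subseteq> carrier S \<Longrightarrow> U \<subseteq> closed_hull U"
proof
  fix u assume "U \<subseteq> carrier S" "u \<in> U"
  then have "u \<in> carrier S" by blast
  then show "u \<in> closed_hull U" using closed_hull_below[of u u U] \<open>u \<in> U\<close> by simp
qed

text \<open>If \<open>c\<close> is below the join of \<open>F\<close>, then it is the join of the elements
  \<open>x \<odot> lam c\<close> for \<open>x \<in> F\<close>; so the hull is a lower set, although \<open>c\<close> need not be below an
  element of \<open>F\<close>.\<close>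

lemma closed_closed_hull:
  assumes UC: "U \<subseteq> carrier S"
  shows "closed (closed_hull U)"
  unfolding closed_def
proof (intro conjI ballI allI impI)
  have "zero \<in> closed_hull U" using closed_hull_below[of zero zero U] zero(1) by simp
  then show "closed_hull U \<noteq> {}" by blast
  show "closed_hull U \<subseteq> carrier S"
  proof
    fix s assume "s \<in> closed_hull U"
    then obtain F where "nat_lub S s F" by (rule closed_hullE)
    from least_closed[OF this] show "s \<in> carrier S" by simp
  qed
  show "c \<in> closed_hull U" if s: "s \<in> closed_hull U" and le: "c \<preceq> s" for s c
  proof -
    from s obtain F where F: "finite F" "F \<noteq> {}" "F \<subseteq> carrier S" "nat_lub S s F"
      "\<forall>x\<in>F. \<exists>u\<in>insert zero U. x \<preceq> u" by (rule closed_hullE)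
    have sC: "s \<in> carrier S" using least_closed[OF F(4)] by simp
    have cC: "c \<in> carrier S" using le_carrier[OF le sC] .
    show ?thesis
    proof (rule closed_hullI)
      show "nat_lub S c ((\<lambda>x. x \<odot> lam S c) ` F)" using F(1) by (intro nat_lub_below[OF _ F(2-4) le]) simp
      show "finite ((\<lambda>x. x \<odot> lam S c) ` F)" "(\<lambda>x. x \<odot> lam S c) ` F \<noteq> {}" using F by simp_all
      show "(\<lambda>x. x \<odot> lam S c) ` F \<subseteq> carrier S" using F(3) cC by auto
      fix y assume "y \<in> (\<lambda>x. x \<odot> lam S c) ` F"
      then obtain x where x: "x \<in> F" "y = x \<odot> lam S c" by blast
      then have xC: "x \<in> carrier S" using F(3) by blast
      then have yx: "y \<preceq> x" using x(2) mult_proj_le[of x "lam S c"] cC by simp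
      obtain u where u: "u \<in> insert zero U" "x \<preceq> u" using bspec[OF F(5) x(1)] by blast
      have "y \<preceq> u" using le_trans[OF yx u(2)] UC u(1) zero(1) by blast
      then show "\<exists>u\<in>insert zero U. y \<preceq> u" using u(1) by blast
    qed
  qed
  fix G t assume G: "finite G" "G \<noteq> {}" "G \<subseteq> closed_hull U" "nat_lub S t G"
  have GC: "G \<subseteq> carrier S"
  proof
    fix s assume "s \<in> G"
    then have "s \<in> closed_hull U" using G(3) by blast
    then obtain F where "nat_lub S s F" by (rule closed_hullE)
    from least_closed[OF this] show "s \<in> carrier S" by simp
  qed
  have "\<forall>g\<in>G. \<exists>F. finite F \<and> F \<noteq> {} \<and> F \<subseteq> carrier S \<and> nat_lub S g F \<and> (\<forall>x\<in>F. \<exists>u\<in>insert zero U. x \<preceq> u)"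
    using G(3) unfolding closed_hull_def by blast
  from bchoice[OF this] obtain F where F0: "\<forall>g\<in>G. finite (F g) \<and> F g \<noteq> {} \<and> F g \<subseteq> carrier S \<and>
      nat_lub S g (F g) \<and> (\<forall>x\<in>F g. \<exists>u\<in>insert zero U. x \<preceq> u)" by (elim exE)
  have F: "finite (F g)" "F g \<noteq> {}" "F g \<subseteq> carrier S" "nat_lub S g (F g)"
    "\<forall>x\<in>F g. \<exists>u\<in>insert zero U. x \<preceq> u" if "g \<in> G" for g using bspec[OF F0 that] by simp_all
  show "t \<in> closed_hull U"
  proof (rule closed_hullI)
    show "nat_lub S t (\<Union>g\<in>G. F g)" by (rule nat_lub_Union[OF G(4) GC F(4,3)])
    show "finite (\<Union>g\<in>G. F g)" using G(1) F(1) by blast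
    show "(\<Union>g\<in>G. F g) \<noteq> {}"
    proof -
      obtain g where "g \<in> G" using G(2) by blast
      then show ?thesis using F(2)[of g] by blast
    qed
    show "(\<Union>g\<in>G. F g) \<subseteq> carrier S" using F(3) by (rule UN_least)
    show "\<exists>u\<in>insert zero U. x \<preceq> u" if "x \<in> (\<Union>g\<in>G. F g)" for x using that F(5) by blast
  qed
qed

lemma closed_hull_least:
  assumes D: "closed D" and U: "U \<subseteq> D"
  shows "closed_hull U \<subseteq> D"
proof
  fix s assume "s \<in> closed_hull U"
  then obtain F where F: "finite F" "F \<noteq> {}" "F \<subseteq> carrier S" "nat_lub S s F"
    "\<forall>x\<in>F. \<exists>u\<in>insert zero U. x \<preceq> u" by (rule closed_hullE)
  have "x \<in> D" if x: "x \<in> F" for x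
  proof -
    obtain u where "u \<in> insert zero U" "x \<preceq> u" using bspec[OF F(5) x] by blast
    moreover then have "u \<in> D" using U zero_closed[OF D] by blast
    ultimately show ?thesis using closedD(3)[OF D] by blast
  qed
  then show "s \<in> D" using closedD(5)[OF D F(1,2) _ F(4)] by blast
qed

lemma closed_lub_iff:
  assumes X: "\<And>D. D \<in> X \<Longrightarrow> closed D"
  shows "is_lub closed_order D X \<longleftrightarrow> D = closed_hull (\<Union>X)"
proof -
  have XC: "X \<subseteq> carrier closed_order" using X by auto
  have UC: "\<Union>X \<subseteq> carrier S" using closedD(2)[OF X] by blast
  have "is_lub closed_order (closed_hull (\<Union>X)) X"
    unfolding is_lub_iff[OF XC]
  proof (intro conjI ballI impI)
    show "closed_hull (\<Union>X) \<in> carrier closed_order" using closed_closed_hull[OF UC] by simp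
    show "E \<sqsubseteq>\<^bsub>closed_order\<^esub> closed_hull (\<Union>X)" if "E \<in> X" for E using closed_hull_superset[OF UC] that by auto
    show "closed_hull (\<Union>X) \<sqsubseteq>\<^bsub>closed_order\<^esub> E" if "E \<in> carrier closed_order" "\<forall>x\<in>X. x \<sqsubseteq>\<^bsub>closed_order\<^esub> E" for E
      using that closed_hull_least[of E "\<Union>X"] by (simp add: Union_least)
  qed
  then show ?thesis using partial_order.least_unique[OF closed_order_partial_order] by blast
qed

lemma closed_Int:
  assumes A: "closed A" and B: "closed B"
  shows "closed (A \<inter> B)"
  unfolding closed_def
proof (intro conjI ballI allI impI)
  show "A \<inter> B \<noteq> {}" using zero_closed[OF A] zero_closed[OF B] by blast
  show "A \<inter> B \<subseteq> carrier S" using closedD(2)[OF A] by blast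
  show "b \<in> A \<inter> B" if "a \<in> A \<inter> B" "b \<preceq> a" for a b
    using that closedD(3)[OF A] closedD(3)[OF B] by blast
  show "s \<in> A \<inter> B" if "finite F" "F \<noteq> {}" "F \<subseteq> A \<inter> B" "nat_lub S s F" for F s
    using closedD(5)[OF A that(1,2) _ that(4)] closedD(5)[OF B that(1,2) _ that(4)] that(3) by blast
qed

lemma closed_glb_iff:
  assumes A: "closed A" and B: "closed B"
  shows "is_glb closed_order M {A, B} \<longleftrightarrow> M = A \<inter> B"
proof -
  have sub: "{A, B} \<subseteq> carrier closed_order" using A B by simp
  have "is_glb closed_order (A \<inter> B) {A, B}"
    unfolding is_glb_iff[OF sub] using closed_Int[OF A B] by auto
  then show ?thesis using partial_order.greatest_unique[OF closed_order_partial_order] by blast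
qed

text \<open>If \<open>c \<in> A\<close> is a join of elements below members of the sets in \<open>X\<close>, then these elements belong
  to \<open>A\<close> as well.\<close>

lemma closed_frame: "frame closed_order"
  unfolding partial_order.frame_iff[OF closed_order_partial_order]
proof (intro conjI allI impI ballI)
  fix X assume "X \<subseteq> carrier closed_order"
  then have X: "D \<in> X \<Longrightarrow> closed D" for D by auto
  show "\<exists>s. is_lub closed_order s X" using closed_lub_iff[OF X] by blast
next
  fix A X s m
  assume A0: "A \<in> carrier closed_order" and X0: "X \<subseteq> carrier closed_order"
    and s: "is_lub closed_order s X" and m: "is_glb closed_order m {A, s}"
  have A: "closed A" using A0 by simp
  have X: "D \<in> X \<Longrightarrow> closed D" for D using X0 by auto
  have UC: "\<Union>X \<subseteq> carrier S" using closedD(2)[OF X] by blast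
  have s_eq: "s = closed_hull (\<Union>X)" using s closed_lub_iff[OF X] by blast
  have m_eq: "m = A \<inter> closed_hull (\<Union>X)" using m closed_glb_iff[OF A closed_closed_hull[OF UC]] unfolding s_eq by blast
  have eq: "{n. \<exists>x\<in>X. is_glb closed_order n {A, x}} = (\<lambda>B. A \<inter> B) ` X"
    using closed_glb_iff[OF A X] by blast
  have iX: "closed D" if "D \<in> (\<lambda>B. A \<inter> B) ` X" for D using that closed_Int[OF A X] by blast
  have "A \<inter> closed_hull (\<Union>X) = closed_hull (\<Union>((\<lambda>B. A \<inter> B) ` X))"
  proof (intro equalityI subsetI)
    fix c assume c: "c \<in> A \<inter> closed_hull (\<Union>X)"
    then have "c \<in> closed_hull (\<Union>X)" by blast
    then obtain F where F: "finite F" "F \<noteq> {}" "F \<subseteq> carrier S" "nat_lub S c F"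
      "\<forall>x\<in>F. \<exists>u\<in>insert zero (\<Union>X). x \<preceq> u" by (rule closed_hullE)
    have "\<exists>u\<in>insert zero (\<Union>((\<lambda>B. A \<inter> B) ` X)). x \<preceq> u" if x: "x \<in> F" for x
    proof -
      have xC: "x \<in> carrier S" using x F(3) by blast
      have "x \<preceq> c" using F(4)[unfolded nat_lub_iff[OF F(3)]] x by blast
      then have xA: "x \<in> A" using closedD(3)[OF A] c by blast
      obtain u where u: "u \<in> insert zero (\<Union>X)" "x \<preceq> u" using bspec[OF F(5) x] by blast
      show ?thesis
      proof (cases "u = zero")
        case False
        then obtain B where B: "B \<in> X" "u \<in> B" using u(1) by blast
        then have "x \<in> A \<inter> B" using closedD(3)[OF X[OF B(1)] B(2) u(2)] xA by blast
        then have "x \<in> insert zero (\<Union>((\<lambda>B. A \<inter> B) ` X))" using B(1) by blast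
        then show ?thesis using le_refl[OF xC] by blast
      qed (use u(2) in blast)
    qed
    then show "c \<in> closed_hull (\<Union>((\<lambda>B. A \<inter> B) ` X))" by (rule closed_hullI[OF F(1-4)])
  next
    fix c assume "c \<in> closed_hull (\<Union>((\<lambda>B. A \<inter> B) ` X))"
    moreover have "\<Union>X \<subseteq> closed_hull (\<Union>X)" using closedD(2)[OF X] by (intro closed_hull_superset Union_least)
    then have "\<Union>((\<lambda>B. A \<inter> B) ` X) \<subseteq> A \<inter> closed_hull (\<Union>X)" by blast
    then have "closed_hull (\<Union>((\<lambda>B. A \<inter> B) ` X)) \<subseteq> A \<inter> closed_hull (\<Union>X)" by (rule closed_hull_least[OF closed_Int[OF A closed_closed_hull[OF UC]]])
    ultimately show "c \<in> A \<inter> closed_hull (\<Union>X)" by blast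
  qed
  then show "is_lub closed_order m {n. \<exists>x\<in>X. is_glb closed_order n {A, x}}"
    unfolding eq m_eq using closed_lub_iff[of "(\<lambda>B. A \<inter> B) ` X", OF iX] by blast
qed

lemma closed_complete: "complete_lattice closed_order"
  using closed_frame by (rule frame_complete)

lemma mem_closed_hull_Union:
  assumes M: "\<And>D. D \<in> M \<Longrightarrow> closed D" and g: "g \<in> closed_hull (\<Union>M)"
  shows "\<exists>H. H \<subseteq> M \<and> finite H \<and> (\<forall>U. closed U \<longrightarrow> (\<forall>D\<in>H. D \<subseteq> U) \<longrightarrow> g \<in> U)"
proof -
  from g obtain F where F: "finite F" "F \<noteq> {}" "F \<subseteq> carrier S" "nat_lub S g F"
    "\<forall>x\<in>F. \<exists>u\<in>insert zero (\<Union>M). x \<preceq> u" by (rule closed_hullE)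
  have "\<forall>x\<in>F. \<exists>H. H \<subseteq> M \<and> finite H \<and> (\<forall>U. closed U \<longrightarrow> (\<forall>D\<in>H. D \<subseteq> U) \<longrightarrow> x \<in> U)"
  proof
    fix x assume "x \<in> F"
    from bspec[OF F(5) this] obtain u where u: "u \<in> insert zero (\<Union>M)" "x \<preceq> u" by blast
    show "\<exists>H. H \<subseteq> M \<and> finite H \<and> (\<forall>U. closed U \<longrightarrow> (\<forall>D\<in>H. D \<subseteq> U) \<longrightarrow> x \<in> U)"
    proof (cases "u = zero")
      case True
      have "x \<in> U" if "closed U" for U using closedD(3)[OF that zero_closed[OF that]] u(2) True by blast
      then show ?thesis by (intro exI[of _ "{}"]) simp
    next
      case False
      then obtain B where B: "B \<in> M" "u \<in> B" using u(1) by blast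
      have "x \<in> U" if "closed U" "B \<subseteq> U" for U using closedD(3)[OF that(1) _ u(2)] B(2) that(2) by blast
      then show ?thesis using B(1) by (intro exI[of _ "{B}"]) simp
    qed
  qed
  from bchoice[OF this] obtain H where H: "\<forall>x\<in>F. H x \<subseteq> M \<and> finite (H x) \<and>
      (\<forall>U. closed U \<longrightarrow> (\<forall>D\<in>H x. D \<subseteq> U) \<longrightarrow> x \<in> U)" by (elim exE)
  show ?thesis
  proof (intro exI[of _ "\<Union>x\<in>F. H x"] conjI allI impI)
    show "(\<Union>x\<in>F. H x) \<subseteq> M" using H by blast
    show "finite (\<Union>x\<in>F. H x)" using H F(1) by blast
    fix U assume U: "closed U" "\<forall>D\<in>(\<Union>x\<in>F. H x). D \<subseteq> U"
    have "x \<in> U" if "x \<in> F" for x using bspec[OF H that] U that by blast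
    then show "g \<in> U" using closedD(5)[OF U(1) F(1,2) _ F(4)] by blast
  qed
qed

text \<open>Each closed set is the join of the hulls of its elements. Conversely, membership in a hull
  involves finitely many elements only.\<close>

lemma finite_closed_iff:
  "finite_element closed_order D \<longleftrightarrow> (\<exists>G. finite G \<and> G \<subseteq> carrier S \<and> D = closed_hull G)"
proof
  assume fin: "finite_element closed_order D"
  then have D: "closed D" using finite_element_carrier by fastforce
  let ?M = "(\<lambda>d. closed_hull {d}) ` D"
  have M: "closed E" if "E \<in> ?M" for E
  proof -
    obtain d where "d \<in> D" "E = closed_hull {d}" using \<open>E \<in> ?M\<close> by blast
    then show ?thesis using closed_closed_hull[of "{d}"] closedD(4)[OF D] by blast
  qed
  have MC: "?M \<subseteq> carrier closed_order" using M by auto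
  have dsub: "d \<in> closed_hull {d}" if "d \<in> D" for d using closed_hull_superset[of "{d}"] closedD(4)[OF D that] by blast
  have D_eq: "D = closed_hull (\<Union>?M)"
  proof
    have "\<Union>?M \<subseteq> D" using closed_hull_least[OF D] by blast
    then show "closed_hull (\<Union>?M) \<subseteq> D" by (rule closed_hull_least[OF D])
    have "D \<subseteq> \<Union>?M" using dsub by blast
    also have "\<Union>?M \<subseteq> closed_hull (\<Union>?M)" using closedD(2)[OF M] by (intro closed_hull_superset Union_least)
    finally show "D \<subseteq> closed_hull (\<Union>?M)" .
  qed
  then have "is_lub closed_order D ?M" using closed_lub_iff[OF M] by blast
  then obtain F where F: "F \<subseteq> ?M" "finite F" "is_lub closed_order D F"
    using fin MC unfolding finite_element_iff[OF closed_complete] by blast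
  from finite_subset_image[OF F(2,1)] obtain G where G: "G \<subseteq> D" "finite G" "F = (\<lambda>d. closed_hull {d}) ` G" by blast
  have F': "closed E" if "E \<in> F" for E using that M F(1) by blast
  have "D = closed_hull (\<Union>F)" using F(3) closed_lub_iff[OF F'] by blast
  moreover have GC: "G \<subseteq> carrier S" using G(1) closedD(2)[OF D] by blast
  have "closed_hull (\<Union>F) \<subseteq> closed_hull G"
  proof (rule closed_hull_least[OF closed_closed_hull[OF GC]])
    have "closed_hull {d} \<subseteq> closed_hull G" if "d \<in> G" for d
      using closed_hull_least[OF closed_closed_hull[OF GC], of "{d}"] closed_hull_superset[OF GC] that by blast
    then show "\<Union>F \<subseteq> closed_hull G" unfolding G(3) by blast
  qed
  moreover have "closed_hull G \<subseteq> D" by (rule closed_hull_least[OF D G(1)])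
  ultimately have "D = closed_hull G" by blast
  then show "\<exists>G. finite G \<and> G \<subseteq> carrier S \<and> D = closed_hull G" using G(2) GC by blast
next
  assume "\<exists>G. finite G \<and> G \<subseteq> carrier S \<and> D = closed_hull G"
  then obtain G where G: "finite G" "G \<subseteq> carrier S" "D = closed_hull G" by blast
  show "finite_element closed_order D"
  proof (rule finite_elementI[OF closed_complete])
    show "D \<in> carrier closed_order" using closed_closed_hull[OF G(2)] G(3) by simp
    fix M assume MC: "M \<subseteq> carrier closed_order" and lub: "is_lub closed_order D M"
    have M: "closed E" if "E \<in> M" for E using that MC by auto
    have "D = closed_hull (\<Union>M)" using lub closed_lub_iff[OF M] by blast
    then have "G \<subseteq> closed_hull (\<Union>M)" using closed_hull_superset[OF G(2)] G(3) by blast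
    then have "\<forall>g\<in>G. \<exists>H. H \<subseteq> M \<and> finite H \<and> (\<forall>U. closed U \<longrightarrow> (\<forall>D\<in>H. D \<subseteq> U) \<longrightarrow> g \<in> U)"
      by (intro ballI mem_closed_hull_Union[OF M subsetD])
    from bchoice[OF this] obtain H where H: "\<forall>g\<in>G. H g \<subseteq> M \<and> finite (H g) \<and>
      (\<forall>U. closed U \<longrightarrow> (\<forall>D\<in>H g. D \<subseteq> U) \<longrightarrow> g \<in> U)" by (elim exE)
    have "D \<subseteq> U" if U: "closed U" "\<forall>D\<in>(\<Union>g\<in>G. H g). D \<subseteq> U" for U
    proof -
      have "g \<in> U" if g: "g \<in> G" for g
      proof -
        have "\<forall>D\<in>H g. D \<subseteq> U" using U(2) g by blast
        then show ?thesis using bspec[OF H g] U(1) by simp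
      qed
      then show ?thesis unfolding G(3) by (intro closed_hull_least[OF U(1)] subsetI)
    qed
    moreover have "(\<Union>g\<in>G. H g) \<subseteq> M" "finite (\<Union>g\<in>G. H g)" using H G(1) by blast+
    ultimately show "\<exists>F. F \<subseteq> M \<and> finite F \<and> (\<forall>u\<in>carrier closed_order.
        (\<forall>x\<in>F. x \<sqsubseteq>\<^bsub>closed_order\<^esub> u) \<longrightarrow> D \<sqsubseteq>\<^bsub>closed_order\<^esub> u)"
      by (intro exI[of _ "\<Union>g\<in>G. H g"]) simp
  qed
qed

text \<open>Let \<open>c\<close> be the join of elements \<open>x\<close> below generators \<open>g \<in> G\<close>, and of elements \<open>y\<close>
  below generators \<open>h \<in> H\<close>. Then \<open>c\<close> is the join of the elements \<open>y \<odot> lam x\<close>, which lie below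
  both \<open>x\<close> and \<open>y\<close>, and thus below the meet of \<open>g\<close> and \<open>h\<close>.\<close>

lemma closed_finite_Int:
  assumes G: "finite G" "G \<subseteq> carrier S" and H: "finite H" "H \<subseteq> carrier S"
  shows "\<exists>K. finite K \<and> K \<subseteq> carrier S \<and> closed_hull G \<inter> closed_hull H = closed_hull K"
proof -
  \<comment> \<open>The zero counts as a generator of every hull, hence it takes part in the pairwise meets.\<close>
  let ?G = "insert zero G" and ?H = "insert zero H"
  have GH: "?G \<subseteq> carrier S" "?H \<subseteq> carrier S" using G(2) H(2) zero(1) by blast+
  have "\<forall>p\<in>?G \<times> ?H. \<exists>m. m \<in> carrier S \<and> m \<preceq> fst p \<and> m \<preceq> snd p \<and> (\<forall>u. u \<preceq> fst p \<longrightarrow> u \<preceq> snd p \<longrightarrow> u \<preceq> m)"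
  proof
    fix p assume "p \<in> ?G \<times> ?H"
    then have "fst p \<in> carrier S" "snd p \<in> carrier S" using GH by auto
    then show "\<exists>m. m \<in> carrier S \<and> m \<preceq> fst p \<and> m \<preceq> snd p \<and> (\<forall>u. u \<preceq> fst p \<longrightarrow> u \<preceq> snd p \<longrightarrow> u \<preceq> m)"
      using glbE by metis
  qed
  from bchoice[OF this] obtain m where m0: "\<forall>p\<in>?G \<times> ?H. m p \<in> carrier S \<and> m p \<preceq> fst p \<and> m p \<preceq> snd p \<and>
      (\<forall>u. u \<preceq> fst p \<longrightarrow> u \<preceq> snd p \<longrightarrow> u \<preceq> m p)" by (elim exE)
  have m: "m (g, h) \<in> carrier S" "m (g, h) \<preceq> g" "m (g, h) \<preceq> h" "\<And>u. u \<preceq> g \<Longrightarrow> u \<preceq> h \<Longrightarrow> u \<preceq> m (g, h)"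
    if "g \<in> ?G" "h \<in> ?H" for g h
  proof -
    have "(g, h) \<in> ?G \<times> ?H" using that by (rule SigmaI)
    from bspec[OF m0 this] show "m (g, h) \<in> carrier S" "m (g, h) \<preceq> g" "m (g, h) \<preceq> h"
      "\<And>u. u \<preceq> g \<Longrightarrow> u \<preceq> h \<Longrightarrow> u \<preceq> m (g, h)" unfolding fst_conv snd_conv by blast+
  qed
  let ?K = "m ` (?G \<times> ?H)"
  have K: "finite ?K" "?K \<subseteq> carrier S" using G(1) H(1) m(1) by auto
  have "closed_hull G \<inter> closed_hull H = closed_hull ?K"
  proof
    have "m (g, h) \<in> closed_hull G \<inter> closed_hull H" if "g \<in> ?G" "h \<in> ?H" for g h
      using closed_hull_below[OF m(1,2)[OF that] that(1)] closed_hull_below[OF m(1,3)[OF that] that(2)] by blast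
    then show "closed_hull ?K \<subseteq> closed_hull G \<inter> closed_hull H" by (intro closed_hull_least[OF closed_Int[OF closed_closed_hull[OF G(2)] closed_closed_hull[OF H(2)]]]) auto
    show "closed_hull G \<inter> closed_hull H \<subseteq> closed_hull ?K"
    proof
      fix c assume "c \<in> closed_hull G \<inter> closed_hull H"
      then have c: "c \<in> closed_hull G" "c \<in> closed_hull H" by blast+
      from c(1) obtain X where X: "finite X" "X \<noteq> {}" "X \<subseteq> carrier S" "nat_lub S c X"
        "\<forall>x\<in>X. \<exists>u\<in>?G. x \<preceq> u" by (rule closed_hullE)
      from c(2) obtain Y where Y: "finite Y" "Y \<noteq> {}" "Y \<subseteq> carrier S" "nat_lub S c Y"
        "\<forall>y\<in>Y. \<exists>u\<in>?H. y \<preceq> u" by (rule closed_hullE)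
      have cC: "c \<in> carrier S" using least_closed[OF X(4)] by simp
      let ?Z = "\<Union>x\<in>X. (\<lambda>y. y \<odot> lam S x) ` Y"
      have xC: "x \<in> carrier S" "x \<preceq> c" if "x \<in> X" for x
        using that X(3) X(4)[unfolded nat_lub_iff[OF X(3)]] by blast+
      have yC: "y \<in> carrier S" "y \<preceq> c" if "y \<in> Y" for y
        using that Y(3) Y(4)[unfolded nat_lub_iff[OF Y(3)]] by blast+
      have xlub: "nat_lub S x ((\<lambda>y. y \<odot> lam S x) ` Y)" if "x \<in> X" for x
        using Y(1) by (intro nat_lub_below[OF _ Y(2-4) xC(2)[OF that]]) simp
      have sub: "(\<lambda>y. y \<odot> lam S x) ` Y \<subseteq> carrier S" if "x \<in> X" for x
        using xC(1)[OF that] yC(1) by auto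
      show "c \<in> closed_hull ?K"
      proof (rule closed_hullI)
        show "nat_lub S c ?Z" by (rule nat_lub_Union[OF X(4,3) xlub sub])
        show "finite ?Z" using X(1) Y(1) by blast
        show "?Z \<noteq> {}" using X(2) Y(2) by blast
        show "?Z \<subseteq> carrier S" using sub by (rule UN_least)
        fix z assume "z \<in> ?Z"
        then obtain x y where xy: "x \<in> X" "y \<in> Y" "z = y \<odot> lam S x" by blast
        obtain g where g: "g \<in> ?G" "x \<preceq> g" using bspec[OF X(5) xy(1)] by blast
        obtain h where h: "h \<in> ?H" "y \<preceq> h" using bspec[OF Y(5) xy(2)] by blast
        have ghC: "g \<in> carrier S" "h \<in> carrier S" using g(1) h(1) GH by blast+
        have "z \<preceq> y" unfolding xy(3) using xC(1)[OF xy(1)] yC(1)[OF xy(2)] by (intro mult_proj_le) simp_all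
        then have zh: "z \<preceq> h" using le_trans h(2) ghC by blast
        have "compatible S y x" using bounded_compatible[OF yC(2)[OF xy(2)] xC(2)[OF xy(1)] cC] .
        then have "z \<preceq> x" unfolding xy(3) using compatible_le xC(1)[OF xy(1)] yC(1)[OF xy(2)] by blast
        then have zg: "z \<preceq> g" using le_trans g(2) ghC by blast
        show "\<exists>u\<in>insert zero ?K. z \<preceq> u" using m(4)[OF g(1) h(1) zg zh] g(1) h(1) by blast
      qed
    qed
  qed
  then show ?thesis using K by blast
qed

lemma closed_coherent: "coherent_frame closed_order"
  unfolding coherent_frame_iff[OF closed_complete]
proof (intro conjI closed_frame ballI allI impI)
  fix D assume "D \<in> carrier closed_order"
  then have D: "closed D" by simp
  let ?M = "(\<lambda>d. closed_hull {d}) ` D"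
  have M: "closed E" if "E \<in> ?M" for E
  proof -
    obtain d where "d \<in> D" "E = closed_hull {d}" using \<open>E \<in> ?M\<close> by blast
    then show ?thesis using closed_closed_hull[of "{d}"] closedD(4)[OF D] by blast
  qed
  have fin: "?M \<subseteq> {m \<in> carrier closed_order. finite_element closed_order m}"
  proof
    fix E assume "E \<in> ?M"
    then obtain d where d: "d \<in> D" "E = closed_hull {d}" by blast
    then have "finite_element closed_order E"
      unfolding finite_closed_iff using closedD(4)[OF D] by (intro exI[of _ "{d}"]) simp
    then show "E \<in> {m \<in> carrier closed_order. finite_element closed_order m}"
      by (intro CollectI conjI) (rule finite_element_carrier)
  qed
  have dsub: "d \<in> closed_hull {d}" if "d \<in> D" for d using closed_hull_superset[of "{d}"] closedD(4)[OF D that] by blast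
  have "D = closed_hull (\<Union>?M)"
  proof
    have "\<Union>?M \<subseteq> D" using closed_hull_least[OF D] by blast
    then show "closed_hull (\<Union>?M) \<subseteq> D" by (rule closed_hull_least[OF D])
    have "D \<subseteq> \<Union>?M" using dsub by blast
    also have "\<Union>?M \<subseteq> closed_hull (\<Union>?M)" using closedD(2)[OF M] by (intro closed_hull_superset Union_least)
    finally show "D \<subseteq> closed_hull (\<Union>?M)" .
  qed
  then have "is_lub closed_order D ?M" using closed_lub_iff[OF M] by blast
  then show "\<exists>M. M \<subseteq> {m \<in> carrier closed_order. finite_element closed_order m} \<and> is_lub closed_order D M"
    using fin by blast
next
  fix A B M assume AB0: "A \<in> carrier closed_order" "B \<in> carrier closed_order"
    and fin: "finite_element closed_order A" "finite_element closed_order B"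
    and M: "is_glb closed_order M {A, B}"
  have AB: "closed A" "closed B" using AB0 by simp_all
  have "M = A \<inter> B" using M closed_glb_iff[OF AB] by blast
  then show "finite_element closed_order M"
    using fin closed_finite_Int unfolding finite_closed_iff by metis
qed

lemma down_Lvee_mem:
  assumes I: "I \<in> carrier (Lvee (completion S))"
  shows "A \<in> I \<Longrightarrow> ideal A" "A \<in> I \<Longrightarrow> ideal B \<Longrightarrow> B \<subseteq> A \<Longrightarrow> B \<in> I"
    "A \<in> I \<Longrightarrow> a \<in> A \<Longrightarrow> down a \<in> I"
proof -
  have oi: "order_ideal (completion S) I" using I unfolding Lvee_carrier by blast
  show i: "ideal A" if "A \<in> I" for A
    using oi that unfolding order_ideal_def by auto
  show lower: "B \<in> I" if "A \<in> I" "ideal B" "B \<subseteq> A" for A B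
  proof -
    have "B \<preceq>\<^bsub>completion S\<^esub> A" using completion_le_iff[OF that(2) i[OF that(1)]] that(3) by blast
    then show ?thesis using oi that(1,2) unfolding order_ideal_def by simp
  qed
  show "down a \<in> I" if "A \<in> I" "a \<in> A"
    using lower[OF that(1), of "down a"] idealD(4)[OF i[OF that(1)] that(2)]
      down_subset_ideal_iff[of a A] i[OF that(1)] that(2) by simp
qed

lemma nat_lub_down_image:
  assumes A: "ideal A"
  shows "compatible_set (completion S) (down ` A)" "nat_lub (completion S) A (down ` A)"
proof -
  interpret K: restriction_semigroup "completion S" by (rule completion_restriction_semigroup)
  have sub: "ideal (down a)" "down a \<subseteq> A" if "a \<in> A" for a
    using idealD(4)[OF A that] down_subset_ideal_iff[of a A] A that by simp_all
  have iX: "ideal B" if "B \<in> down ` A" for B using that sub(1) by blast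
  show "compatible_set (completion S) (down ` A)"
  proof (rule K.bounded_compatible_set)
    show "down ` A \<noteq> {}" using idealD(1)[OF A] by blast
    show "A \<in> carrier (completion S)" using A by simp
    show "B \<preceq>\<^bsub>completion S\<^esub> A" if "B \<in> down ` A" for B
      using completion_le_iff[OF iX[OF that] A] that sub(2) by blast
  qed
  show "nat_lub (completion S) A (down ` A)"
  proof (subst completion_lub_iff, erule iX, intro conjI ballI allI impI A)
    show "B \<subseteq> A" if "B \<in> down ` A" for B using that sub(2) by blast
    show "A \<subseteq> U" if "ideal U" "\<forall>B\<in>down ` A. B \<subseteq> U" for U
      using that(2) down_subset_ideal_iff[OF idealD(4)[OF A] that(1)] by blast
  qed
qed

lemma nat_lub_down:
  assumes F: "finite F" "F \<noteq> {}" "F \<subseteq> carrier S" "nat_lub S s F"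
  shows "compatible_set (completion S) (down ` F)" "nat_lub (completion S) (down s) (down ` F)"
proof -
  interpret K: restriction_semigroup "completion S" by (rule completion_restriction_semigroup)
  have s: "s \<in> carrier S" "\<And>x. x \<in> F \<Longrightarrow> x \<preceq> s" using F(4) unfolding nat_lub_iff[OF F(3)] by blast+
  have C: "x \<in> carrier S" if "x \<in> F" for x using that F(3) by blast
  have iX: "ideal B" if "B \<in> down ` F" for B using that C by auto
  have ids: "ideal (down s)" using s by simp
  have sub: "B \<subseteq> down s" if "B \<in> down ` F" for B
    using that down_subset_iff[OF C s(1)] s(2) by blast
  show "compatible_set (completion S) (down ` F)"
  proof (rule K.bounded_compatible_set)
    show "down ` F \<noteq> {}" using F(2) by blast
    show "down s \<in> carrier (completion S)" using s by simp
    show "B \<preceq>\<^bsub>completion S\<^esub> down s" if "B \<in> down ` F" for B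
      using completion_le_iff[OF iX[OF that] ids] sub[OF that] by blast
  qed
  show "nat_lub (completion S) (down s) (down ` F)"
  proof (subst completion_lub_iff, erule iX, intro conjI ballI allI impI ids)
    show "B \<subseteq> down s" if "B \<in> down ` F" for B using sub that .
    show "down s \<subseteq> U" if U: "ideal U" "\<forall>B\<in>down ` F. B \<subseteq> U" for U
    proof -
      have "F \<subseteq> U" using U(2) down_subset_ideal_iff[OF C U(1)] by blast
      then have "s \<in> U" by (rule ideal_finite_lub[OF U(1) F(1,2) _ F(4)])
      then show ?thesis using down_subset_ideal_iff[OF s(1) U(1)] by blast
    qed
  qed
qed

text \<open>Joins in the completion are generated by finite joins, under which \<open>D\<close> is closed.\<close>

lemma ideals_in_closed_Lvee:
  assumes D: "closed D"
  shows "{A. ideal A \<and> A \<subseteq> D} \<in> carrier (Lvee (completion S))"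
  unfolding Lvee_carrier
proof (intro conjI allI impI)
  interpret K: restriction_semigroup "completion S" by (rule completion_restriction_semigroup)
  have "down zero \<subseteq> D" using closedD(3)[OF D zero_closed[OF D]] by (intro subsetI) simp
  then have ne: "down zero \<in> {A. ideal A \<and> A \<subseteq> D}" using zero(1) by simp
  show "order_ideal (completion S) {A. ideal A \<and> A \<subseteq> D}"
    unfolding order_ideal_def
  proof (intro conjI ballI impI)
    show "{A. ideal A \<and> A \<subseteq> D} \<noteq> {}" using ne by blast
    show "{A. ideal A \<and> A \<subseteq> D} \<subseteq> carrier (completion S)" by (intro subsetI) simp
    fix A B assume "A \<in> {A. ideal A \<and> A \<subseteq> D}" "B \<in> carrier (completion S)" "B \<preceq>\<^bsub>completion S\<^esub> A"
    moreover then have "ideal A" "ideal B" "A \<subseteq> D" by simp_all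
    ultimately show "B \<in> {A. ideal A \<and> A \<subseteq> D}" using completion_le_iff[of B A] by blast
  qed
  fix X J assume X: "X \<subseteq> {A. ideal A \<and> A \<subseteq> D}" "compatible_set (completion S) X" "nat_lub (completion S) J X"
  have "ideal J" using least_closed[OF X(3)] by simp
  have J: "J = {s. \<exists>F t. finite F \<and> F \<noteq> {} \<and> F \<subseteq> \<Union>X \<and> nat_lub S t F \<and> s \<preceq> t}"
    by (rule K.nat_lub_unique[OF X(3) completion_nat_lub[OF X(2)]])
  have "J \<subseteq> D"
  proof
    fix s assume "s \<in> J"
    then obtain F t where F: "finite F" "F \<noteq> {}" "F \<subseteq> \<Union>X" "nat_lub S t F" "s \<preceq> t"
      unfolding J by (elim CollectE exE conjE)
    have "F \<subseteq> D" using F(3) X(1) by blast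
    then have "t \<in> D" by (rule closedD(5)[OF D F(1,2) _ F(4)])
    then show "s \<in> D" using closedD(3)[OF D] F(5) by blast
  qed
  then show "J \<in> {A. ideal A \<and> A \<subseteq> D}" using \<open>ideal J\<close> by blast
qed

lemma principal_members_closed:
  assumes I: "I \<in> carrier (Lvee (completion S))"
  shows "closed {s \<in> carrier S. down s \<in> I}"
  unfolding closed_def
proof (intro conjI ballI allI impI)
  have "I \<noteq> {}" using I unfolding Lvee_carrier order_ideal_def by blast
  then obtain A where A: "A \<in> I" by blast
  then obtain a where "a \<in> A" using idealD(1)[OF down_Lvee_mem(1)[OF I]] by blast
  then show "{s \<in> carrier S. down s \<in> I} \<noteq> {}"
    using down_Lvee_mem(3)[OF I A] idealD(4)[OF down_Lvee_mem(1)[OF I A]] by blast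
  show "{s \<in> carrier S. down s \<in> I} \<subseteq> carrier S" by blast
  show "b \<in> {s \<in> carrier S. down s \<in> I}" if "a \<in> {s \<in> carrier S. down s \<in> I}" "b \<preceq> a" for a b
    using that le_carrier[OF that(2)] down_Lvee_mem(3)[OF I, of "down a" b] by simp
  fix F s assume F: "finite F" "F \<noteq> {}" "F \<subseteq> {s \<in> carrier S. down s \<in> I}" "nat_lub S s F"
  have FC: "F \<subseteq> carrier S" using F(3) by blast
  have "down ` F \<subseteq> I" using F(3) by blast
  then have "down s \<in> I"
    using I nat_lub_down[OF F(1,2) FC F(4)] unfolding Lvee_carrier by blast
  then show "s \<in> {s \<in> carrier S. down s \<in> I}" using least_closed[OF F(4)] by simp
qed

lemma closed_order_iso: "order_iso closed_order (Lvee (completion S)) (\<lambda>D. {A. ideal A \<and> A \<subseteq> D})"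
  unfolding order_iso_def
proof (intro conjI ballI)
  have inv1: "{s \<in> carrier S. down s \<in> {A. ideal A \<and> A \<subseteq> D}} = D" if D: "closed D" for D
  proof (intro equalityI subsetI)
    fix s assume "s \<in> {s \<in> carrier S. down s \<in> {A. ideal A \<and> A \<subseteq> D}}"
    then have "s \<in> carrier S" "down s \<subseteq> D" by blast+
    then show "s \<in> D" using subsetD[of "down s" D s] by simp
  next
    fix s assume s: "s \<in> D"
    have "down s \<subseteq> D" using closedD(3)[OF D s] by (intro subsetI) simp
    then show "s \<in> {s \<in> carrier S. down s \<in> {A. ideal A \<and> A \<subseteq> D}}" using closedD(4)[OF D s] by simp
  qed
  have inv2: "{A. ideal A \<and> A \<subseteq> {s \<in> carrier S. down s \<in> I}} = I" if I: "I \<in> carrier (Lvee (completion S))" for I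
  proof (intro equalityI subsetI)
    fix A assume "A \<in> {A. ideal A \<and> A \<subseteq> {s \<in> carrier S. down s \<in> I}}"
    then have A: "ideal A" "down ` A \<subseteq> I" by blast+
    then show "A \<in> I" using nat_lub_down_image[OF A(1)] I unfolding Lvee_carrier by blast
  next
    fix A assume A: "A \<in> I"
    note iA = down_Lvee_mem(1)[OF I A]
    show "A \<in> {A. ideal A \<and> A \<subseteq> {s \<in> carrier S. down s \<in> I}}"
      using iA idealD(4)[OF iA] down_Lvee_mem(3)[OF I A] by blast
  qed
  show "bij_betw (\<lambda>D. {A. ideal A \<and> A \<subseteq> D}) (carrier closed_order) (carrier (Lvee (completion S)))"
  proof (rule bij_betw_byWitness[where f' = "\<lambda>I. {s \<in> carrier S. down s \<in> I}"])
    show "\<forall>D\<in>carrier closed_order. {s \<in> carrier S. down s \<in> {A. ideal A \<and> A \<subseteq> D}} = D"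
      unfolding closed_order_sel using inv1 by blast
    show "\<forall>I\<in>carrier (Lvee (completion S)). {A. ideal A \<and> A \<subseteq> {s \<in> carrier S. down s \<in> I}} = I"
      using inv2 by (rule ballI)
    show "(\<lambda>D. {A. ideal A \<and> A \<subseteq> D}) ` carrier closed_order \<subseteq> carrier (Lvee (completion S))"
      unfolding image_subset_iff closed_order_sel using ideals_in_closed_Lvee by blast
    show "(\<lambda>I. {s \<in> carrier S. down s \<in> I}) ` carrier (Lvee (completion S)) \<subseteq> carrier closed_order"
      unfolding image_subset_iff closed_order_sel using principal_members_closed by blast
  qed
  fix D E assume "D \<in> carrier closed_order" "E \<in> carrier closed_order"
  then have DE: "closed D" "closed E" by simp_all
  have "D \<subseteq> E" if "{A. ideal A \<and> A \<subseteq> D} \<subseteq> {A. ideal A \<and> A \<subseteq> E}"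
    using inv1[OF DE(1)] inv1[OF DE(2)] that by blast
  then show "{A. ideal A \<and> A \<subseteq> D} \<sqsubseteq>\<^bsub>Lvee (completion S)\<^esub> {A. ideal A \<and> A \<subseteq> E} \<longleftrightarrow> D \<sqsubseteq>\<^bsub>closed_order\<^esub> E"
    unfolding Lvee_le closed_order_sel by blast
qed

lemma completion_strongly_coherent: "strongly_coherent_crm (completion S)"
  unfolding strongly_coherent_crm_def
  using completion_crm order_iso_coherent_frame[OF closed_order_iso closed_coherent Lvee_partial_order] ..

end

lemma distributive_meet_semigroupI: "distributive_meet_rs S \<Longrightarrow> distributive_meet_semigroup S"
  by (simp add: distributive_meet_rs_def distributive_meet_semigroup_def
      distributive_meet_semigroup_axioms_def distributive_semigroupI)

section \<open>The equivalences\<close>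

lemma rs_iso_id: "restriction_semigroup S \<Longrightarrow> rs_iso S S (restrict id (carrier S))"
proof (rule rs_isoI)
  assume S: "restriction_semigroup S"
  then interpret restriction_semigroup S .
  show "restriction_semigroup S" "restriction_semigroup S" by (rule S)+
  show "rs_hom S S (restrict id (carrier S))" unfolding rs_hom_def by simp
  show "bij_betw (restrict id (carrier S)) (carrier S) (carrier S)"
    by (rule bij_betw_byWitness[where f' = id]) auto
qed

lemma concrete_cat_is_category:
  assumes PiE: "\<And>S T f. H S T f \<Longrightarrow> f \<in> carrier S \<rightarrow>\<^sub>E carrier T"
    and ident: "\<And>S. P S \<Longrightarrow> H S S (restrict id (carrier S))"
    and comp: "\<And>S T U f g. P S \<Longrightarrow> P T \<Longrightarrow> P U \<Longrightarrow> H S T f \<Longrightarrow> H T U g \<Longrightarrow>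
      H S U (compose (carrier S) g f)"
  shows "is_category (concrete_cat P H)"
  unfolding is_category_def concrete_cat_simps
proof (intro conjI ballI; unfold mem_Collect_eq)
  show "P S \<Longrightarrow> H S S (restrict id (carrier S))" for S by (rule ident)
  show "P S \<Longrightarrow> P T \<Longrightarrow> P U \<Longrightarrow> H S T f \<Longrightarrow> H T U g \<Longrightarrow> H S U (compose (carrier S) g f)" for S T U f g
    by (rule comp)
  show "compose (carrier S) f (restrict id (carrier S)) = f" if "H S T f" for S T f
    using PiE[OF that] by (auto simp: compose_def fun_eq_iff PiE_iff extensional_def)
  show "compose (carrier S) (restrict id (carrier T)) f = f" if "H S T f" for S T f
    using PiE[OF that] by (auto simp: compose_def fun_eq_iff PiE_iff extensional_def)
  show "compose (carrier W) (compose (carrier X) h g) f = compose (carrier W) h (compose (carrier W) g f)"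
    if "H W X f" for W X f g h
    using PiE[OF that] by (auto simp: compose_def fun_eq_iff)
qed

lemma coherent_crm_crm: "coherent_crm S \<Longrightarrow> complete_restriction_monoid S"
  by (simp add: coherent_crm_def)

lemma coherent_crm_restriction_semigroup: "coherent_crm S \<Longrightarrow> restriction_semigroup S"
  by (simp add: coherent_crm_def complete_restriction_monoid_def)

lemma distributive_rs_restriction_semigroup: "distributive_rs S \<Longrightarrow> restriction_semigroup S"
  by (simp add: distributive_rs_def)

lemma coherent_crm_hom_iso: "coherent_crm S \<Longrightarrow> rs_iso S T \<phi> \<Longrightarrow> crm_hom k S T \<phi>"
  by (rule rs_isomorphism.iso_crm_hom[OF rs_isomorphismI[OF coherent_crm_restriction_semigroup] coherent_crm_crm])

lemma distributive_drs_hom_iso: "distributive_rs S \<Longrightarrow> rs_iso S T \<phi> \<Longrightarrow> drs_hom k S T \<phi>"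
  by (rule rs_isomorphism.iso_drs_hom[OF rs_isomorphismI[OF distributive_rs_restriction_semigroup]])

lemma coherent_cat_is_category: "is_category (coherent_cat k)"
  unfolding coherent_cat_def
proof (rule concrete_cat_is_category)
  show "crm_hom k S S (restrict id (carrier S))" if "coherent_crm S" for S :: "'a rsemigroup"
    using that by (intro coherent_crm_hom_iso rs_iso_id coherent_crm_restriction_semigroup)
  show "crm_hom k S U (compose (carrier S) g f)"
    if "coherent_crm S" "coherent_crm T" "coherent_crm U" "crm_hom k S T f" "crm_hom k T U g"
    for S T U :: "'a rsemigroup" and f g
    using that by (intro crm_hom_compose[of S T U] coherent_crm_crm)
qed (rule crm_hom_PiE)

lemma distributive_cat_is_category: "is_category (distributive_cat k)"
  unfolding distributive_cat_def
proof (rule concrete_cat_is_category)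
  show "drs_hom k S S (restrict id (carrier S))" if "distributive_rs S" for S :: "'a rsemigroup"
    using that by (intro distributive_drs_hom_iso rs_iso_id distributive_rs_restriction_semigroup)
  show "drs_hom k S U (compose (carrier S) g f)"
    if "distributive_rs S" "distributive_rs T" "distributive_rs U" "drs_hom k S T f" "drs_hom k T U g"
    for S T U :: "'a rsemigroup" and f g
    using that by (rule drs_hom_compose)
qed (rule drs_hom_PiE)

lemma strongly_coherent_imp_coherent:
  fixes S :: "'a rsemigroup"
  shows "strongly_coherent_crm S \<Longrightarrow> coherent_crm S"
  by (rule strongly_coherent_monoid.coherent[OF strongly_coherent_monoidI])

lemma distributive_meet_imp_distributive: "distributive_meet_rs S \<Longrightarrow> distributive_rs S"
  by (simp add: distributive_meet_rs_def)

lemma lift_coherent_crm: "coherent_crm S \<Longrightarrow> coherent_crm (lift_rs S)"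
  by (rule rs_isomorphism.iso_coherent_crm[OF lift_rs_isomorphism[OF coherent_crm_restriction_semigroup]])

lemma lift_distributive_rs: "distributive_rs S \<Longrightarrow> distributive_rs (lift_rs S)"
  by (rule rs_isomorphism.iso_distributive_rs[OF lift_rs_isomorphism[OF distributive_rs_restriction_semigroup]])

lemma lift_strongly_coherent_crm: "strongly_coherent_crm S \<Longrightarrow> strongly_coherent_crm (lift_rs S)"
  by (rule rs_isomorphism.iso_strongly_coherent_crm[OF lift_rs_isomorphism[OF
        coherent_crm_restriction_semigroup[OF strongly_coherent_imp_coherent]]])

lemma lift_distributive_meet_rs: "distributive_meet_rs S \<Longrightarrow> distributive_meet_rs (lift_rs S)"
  by (rule rs_isomorphism.iso_distributive_meet_rs[OF lift_rs_isomorphism[OF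
        distributive_rs_restriction_semigroup[OF distributive_meet_imp_distributive]]])

lemma coherent_crm_hom_lift_iff:
  "coherent_crm S \<Longrightarrow> coherent_crm T \<Longrightarrow> f \<in> carrier S \<rightarrow>\<^sub>E carrier T \<Longrightarrow>
    crm_hom k (lift_rs S) (lift_rs T) (on_arr lift_functor S T f) \<longleftrightarrow> crm_hom k S T f"
  by (intro crm_hom_lift_iff coherent_crm_crm)

lemma lift_functor_coherent:
  "is_functor (coherent_cat k) (coherent_cat k) lift_functor"
  "fully_faithful (coherent_cat k) (coherent_cat k) lift_functor"
  unfolding coherent_cat_def
  subgoal
    by (rule lift_functor_fully_faithful(1);
      (rule coherent_crm_restriction_semigroup lift_coherent_crm crm_hom_PiE coherent_crm_hom_lift_iff; assumption))
  subgoal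
    by (rule lift_functor_fully_faithful(2);
      (rule coherent_crm_restriction_semigroup lift_coherent_crm crm_hom_PiE coherent_crm_hom_lift_iff; assumption))
  done

lemma lift_functor_distributive:
  "is_functor (distributive_cat k) (distributive_cat k) lift_functor"
  "fully_faithful (distributive_cat k) (distributive_cat k) lift_functor"
  unfolding distributive_cat_def
  subgoal
    by (rule lift_functor_fully_faithful(1);
      (rule distributive_rs_restriction_semigroup lift_distributive_rs drs_hom_PiE drs_hom_lift_iff; assumption))
  subgoal
    by (rule lift_functor_fully_faithful(2);
      (rule distributive_rs_restriction_semigroup lift_distributive_rs drs_hom_PiE drs_hom_lift_iff; assumption))
  done

lemma concrete_functorI:
  assumes obj: "\<And>S. P S \<Longrightarrow> Q (on_obj F S)"
    and arr: "\<And>S T f. P S \<Longrightarrow> P T \<Longrightarrow> H S T f \<Longrightarrow> K (on_obj F S) (on_obj F T) (on_arr F S T f)"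
    and ident: "\<And>S. P S \<Longrightarrow> on_arr F S S (restrict id (carrier S)) = restrict id (carrier (on_obj F S))"
    and comp: "\<And>S T U f g. P S \<Longrightarrow> P T \<Longrightarrow> P U \<Longrightarrow> H S T f \<Longrightarrow> H T U g \<Longrightarrow>
      on_arr F S U (compose (carrier S) g f) = compose (carrier (on_obj F S)) (on_arr F T U g) (on_arr F S T f)"
  shows "is_functor (concrete_cat P H) (concrete_cat Q K) F"
  unfolding is_functor_def concrete_cat_simps using obj arr ident comp by simp

lemma finite_part_functor_sel [simp]:
  "on_obj finite_part_functor S = finite_part S"
  "on_arr finite_part_functor S T f = restrict f (carrier (finite_part S))"
  by (simp_all add: finite_part_functor_def)

lemma completion_functor_obj [simp]: "on_obj completion_functor S = completion S"
  by (simp add: completion_functor_def)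

lemma lift_functor_obj [simp]: "on_obj lift_functor S = lift_rs S"
  by (simp add: lift_functor_def)

lemma completion_functor_arr:
  fixes S T :: "'a rsemigroup"
  assumes "distributive_morphism S T f" "distributive_semigroup.ideal S A"
  shows "on_arr completion_functor S T f A = distributive_morphism.extension T f A"
proof -
  interpret distributive_morphism S T f by fact
  show ?thesis unfolding completion_functor_def extension_def using assms(2) by simp
qed

lemma finite_part_is_functor: "is_functor (coherent_cat k) (distributive_cat k) finite_part_functor"
  unfolding coherent_cat_def distributive_cat_def
proof (rule concrete_functorI; unfold finite_part_functor_sel)
  show "distributive_rs (finite_part S)" if "coherent_crm S" for S :: "'a rsemigroup"
    by (rule coherent_monoid.finite_part_distributive_rs[OF coherent_monoidI[OF that]])
  show "drs_hom k (finite_part S) (finite_part T) (restrict f (carrier (finite_part S)))"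
    if "coherent_crm S" "coherent_crm T" "crm_hom k S T f" for S T :: "'a rsemigroup" and f
    by (rule finite_part_drs_hom[OF that])
  show "restrict (restrict id (carrier S)) (carrier (finite_part S)) = restrict id (carrier (finite_part S))"
    for S :: "'a rsemigroup" by (auto simp: fun_eq_iff restrict_def)
  fix S T U :: "'a rsemigroup" and f g
  assume ST: "coherent_crm S" "coherent_crm T" "crm_hom k S T f"
  interpret coherent_morphism S T f using ST by (rule coherent_morphismI)
  show "restrict (compose (carrier S) g f) (carrier (finite_part S)) =
      compose (carrier (finite_part S)) (restrict g (carrier (finite_part T))) (restrict f (carrier (finite_part S)))"
  proof
    fix x
    show "restrict (compose (carrier S) g f) (carrier (finite_part S)) x =
      compose (carrier (finite_part S)) (restrict g (carrier (finite_part T))) (restrict f (carrier (finite_part S))) x"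
    proof (cases "x \<in> carrier (finite_part S)")
      case True
      then have "x \<in> carrier S" by simp
      with True hom_finite_part[OF True] show ?thesis
        by (simp only: compose_def restrict_apply if_True)
    qed (simp only: compose_def restrict_apply if_False)
  qed
qed

lemma completion_is_functor: "is_functor (distributive_cat k) (coherent_cat k) completion_functor"
  unfolding coherent_cat_def distributive_cat_def
proof (rule concrete_functorI; unfold completion_functor_obj)
  show "coherent_crm (completion S)" if "distributive_rs S" for S :: "'a rsemigroup"
    by (rule distributive_semigroup.completion_coherent[OF distributive_semigroupI[OF that]])
  show "crm_hom k (completion S) (completion T) (on_arr completion_functor S T f)"
    if "distributive_rs S" "distributive_rs T" "drs_hom k S T f" for S T :: "'a rsemigroup" and f
    by (rule completion_crm_hom[OF that])
next
  fix S :: "'a rsemigroup" assume "distributive_rs S"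
  then interpret distributive_semigroup S by (rule distributive_semigroupI)
  show "on_arr completion_functor S S (restrict id (carrier S)) = restrict id (carrier (completion S))"
  proof
    fix A
    show "on_arr completion_functor S S (restrict id (carrier S)) A = restrict id (carrier (completion S)) A"
    proof (cases "ideal A")
      case True
      have "{t \<in> carrier S. \<exists>a\<in>A. t \<preceq>\<^bsub>S\<^esub> restrict id (carrier S) a} = A"
      proof (intro equalityI subsetI)
        fix t assume "t \<in> {t \<in> carrier S. \<exists>a\<in>A. t \<preceq>\<^bsub>S\<^esub> restrict id (carrier S) a}"
        then obtain a where a: "a \<in> A" "t \<preceq>\<^bsub>S\<^esub> restrict id (carrier S) a" by blast
        then have "t \<preceq>\<^bsub>S\<^esub> a" using idealD(4)[OF True a(1)] by simp
        then show "t \<in> A" using idealD(3)[OF True a(1)] by blast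
      next
        fix t assume t: "t \<in> A"
        then have "t \<in> carrier S" using idealD(4)[OF True] by blast
        then show "t \<in> {t \<in> carrier S. \<exists>a\<in>A. t \<preceq>\<^bsub>S\<^esub> restrict id (carrier S) a}"
          using t by (intro CollectI conjI bexI[of _ t]) simp_all
      qed
      then show ?thesis using True by (simp add: completion_functor_def)
    qed (simp add: completion_functor_def)
  qed
next
  fix S T U :: "'a rsemigroup" and f g
  assume S: "distributive_rs S" and T: "distributive_rs T" and U: "distributive_rs U"
    and f: "drs_hom k S T f" and g: "drs_hom k T U g"
  interpret f: distributive_morphism S T f using S T f by (rule distributive_morphismI)
  interpret g: distributive_morphism T U g using T U g by (rule distributive_morphismI)
  have gf: "distributive_morphism S U (compose (carrier S) g f)"
    by (rule distributive_morphismI[OF S U drs_hom_compose[OF S T U f g]])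
  interpret gf: distributive_morphism S U "compose (carrier S) g f" by (rule gf)
  show "on_arr completion_functor S U (compose (carrier S) g f) =
      compose (carrier (completion S)) (on_arr completion_functor T U g) (on_arr completion_functor S T f)"
  proof
    fix A
    show "on_arr completion_functor S U (compose (carrier S) g f) A =
      compose (carrier (completion S)) (on_arr completion_functor T U g) (on_arr completion_functor S T f) A"
    proof (cases "f.S.ideal A")
      case A: True
      have E: "f.T.ideal (f.extension A)" using f.extension_ideal[OF A] .
      have GE: "g.T.ideal (g.extension (f.extension A))" using g.extension_ideal[OF E] .
      have c: "compose (carrier S) g f a = g (f a)" if "a \<in> A" for a
        using f.S.idealD(4)[OF A that] by (simp add: compose_eq)
      have "gf.extension A = g.extension (f.extension A)"
      proof
        show "gf.extension A \<subseteq> g.extension (f.extension A)"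
          unfolding gf.extension_subset_iff[OF A GE] using c g.hom_mem_extension[OF E] f.hom_mem_extension[OF A] by simp
        have "g t \<in> gf.extension A" if t: "t \<in> f.extension A" for t
        proof -
          obtain a where a: "a \<in> A" "t \<preceq>\<^bsub>T\<^esub> f a" using t f.extension_mem[OF A] by blast
          then have "g t \<preceq>\<^bsub>U\<^esub> g (f a)" using g.hom_mono f.S.idealD(4)[OF A a(1)] by simp
          then show ?thesis unfolding gf.extension_mem[OF A] using a(1) c by force
        qed
        then show "g.extension (f.extension A) \<subseteq> gf.extension A" using g.extension_subset_iff[OF E gf.extension_ideal[OF A]] by blast
      qed
      then show ?thesis
        using completion_functor_arr[OF gf A] completion_functor_arr[OF f.distributive_morphism_axioms A]
          completion_functor_arr[OF g.distributive_morphism_axioms E] A by (simp add: compose_eq)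
    next
      case False
      then show ?thesis by (simp add: compose_def completion_functor_def)
    qed
  qed
qed

lemma naturally_isomorphicI_concrete:
  assumes iso: "\<And>S. P S \<Longrightarrow> is_iso (concrete_cat Q K) (on_obj F S) (on_obj G S) (\<eta> S)"
    and nat: "\<And>S T f. P S \<Longrightarrow> P T \<Longrightarrow> H S T f \<Longrightarrow>
      compose (carrier (on_obj F S)) (\<eta> T) (on_arr F S T f) =
      compose (carrier (on_obj F S)) (on_arr G S T f) (\<eta> S)"
  shows "naturally_isomorphic (concrete_cat P H) (concrete_cat Q K) F G"
  unfolding naturally_isomorphic_def concrete_cat_simps using iso nat by (intro exI[of _ \<eta>]) simp

text \<open>The components \<open>lub_iso\<close> are isomorphisms of semigroups and hence isomorphisms in the
  category; naturality is \<open>lub_of_extension\<close>.\<close>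

lemma completion_of_finite_part:
  "naturally_isomorphic (coherent_cat k) (coherent_cat k)
     (completion_functor \<circ>\<^sub>F finite_part_functor) lift_functor"
  unfolding coherent_cat_def
proof (rule naturally_isomorphicI_concrete[where \<eta> = coherent_monoid.lub_iso])
  fix S :: "'a rsemigroup" assume S: "coherent_crm S"
  interpret coherent_monoid S using S by (rule coherent_monoidI)
  have "is_iso (concrete_cat coherent_crm (crm_hom k)) (completion (finite_part S)) (lift_rs S) lub_iso"
    using lub_iso F.completion_coherent lift_coherent_crm[OF S]
    by (intro concrete_cat_is_iso F.completion_restriction_semigroup) (auto intro: coherent_crm_hom_iso)
  then show "is_iso (concrete_cat coherent_crm (crm_hom k))
      (on_obj (completion_functor \<circ>\<^sub>F finite_part_functor) S) (on_obj lift_functor S) lub_iso"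
    by (simp add: fctr_comp_def)
next
  fix S T :: "'a rsemigroup" and f
  assume S: "coherent_crm S" and T: "coherent_crm T" and f: "crm_hom k S T f"
  interpret coherent_morphism S T f using S T f by (rule coherent_morphismI)
  have finite_part_map: "distributive_morphism (finite_part S) (finite_part T) finite_part_map"
    by (rule distributive_morphismI[OF S.finite_part_distributive_rs T.finite_part_distributive_rs
          finite_part_drs_hom[OF S T f]])
  interpret E: distributive_morphism "finite_part S" "finite_part T" finite_part_map by (rule finite_part_map)
  have "compose (carrier (completion (finite_part S))) T.lub_iso
        (on_arr completion_functor (finite_part S) (finite_part T) finite_part_map) =
      compose (carrier (completion (finite_part S))) (on_arr lift_functor S T f) S.lub_iso"
  proof
    fix A
    show "compose (carrier (completion (finite_part S))) T.lub_iso
        (on_arr completion_functor (finite_part S) (finite_part T) finite_part_map) A =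
      compose (carrier (completion (finite_part S))) (on_arr lift_functor S T f) S.lub_iso A"
    proof (cases "S.F.ideal A")
      case A: True
      have "T.lub_iso (E.extension A) = {f (S.lub_of A)}"
        unfolding T.lub_iso_eq[OF E.extension_ideal[OF A]] lub_of_extension[OF finite_part_map A] ..
      moreover have "on_arr lift_functor S T f (S.lub_iso A) = {f (S.lub_of A)}"
        unfolding S.lub_iso_eq[OF A] using S.lub_of_carrier[OF A] by (simp add: lift_functor_def lift_rs_def)
      ultimately show ?thesis
        using A completion_functor_arr[OF finite_part_map A] by (simp add: compose_eq)
    next
      case False
      then show ?thesis by (simp add: compose_def)
    qed
  qed
  then show "compose (carrier (on_obj (completion_functor \<circ>\<^sub>F finite_part_functor) S)) T.lub_iso
        (on_arr (completion_functor \<circ>\<^sub>F finite_part_functor) S T f) =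
      compose (carrier (on_obj (completion_functor \<circ>\<^sub>F finite_part_functor) S)) (on_arr lift_functor S T f) S.lub_iso"
    by (simp add: fctr_comp_def)
qed

text \<open>Naturality says that the extension of \<open>f\<close> sends the principal ideal of \<open>a\<close> to that of
  \<open>f a\<close>.\<close>

lemma finite_part_of_completion:
  "naturally_isomorphic (distributive_cat k) (distributive_cat k)
     (finite_part_functor \<circ>\<^sub>F completion_functor) lift_functor"
  unfolding distributive_cat_def
proof (rule naturally_isomorphicI_concrete[where \<eta> = distributive_semigroup.principal_iso])
  fix S :: "'a rsemigroup" assume S: "distributive_rs S"
  interpret distributive_semigroup S using S by (rule distributive_semigroupI)
  interpret K: coherent_monoid "completion S" by (rule completion_coherent_monoid)
  have "is_iso (concrete_cat distributive_rs (drs_hom k)) (finite_part (completion S)) (lift_rs S) principal_iso"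
    using principal_iso K.finite_part_distributive_rs lift_distributive_rs[OF S]
    by (intro concrete_cat_is_iso K.finite_part_restriction_semigroup) (auto intro: distributive_drs_hom_iso)
  then show "is_iso (concrete_cat distributive_rs (drs_hom k))
      (on_obj (finite_part_functor \<circ>\<^sub>F completion_functor) S) (on_obj lift_functor S) principal_iso"
    by (simp add: fctr_comp_def)
next
  fix S T :: "'a rsemigroup" and f
  assume S: "distributive_rs S" and T: "distributive_rs T" and f: "drs_hom k S T f"
  interpret distributive_morphism S T f using S T f by (rule distributive_morphismI)
  let ?C = "carrier (finite_part (completion S))"
  let ?g = "restrict (on_arr completion_functor S T f) ?C"
  have "compose ?C T.principal_iso ?g = compose ?C (on_arr lift_functor S T f) S.principal_iso"
  proof
    fix A
    show "compose ?C T.principal_iso ?g A = compose ?C (on_arr lift_functor S T f) S.principal_iso A"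
    proof (cases "A \<in> ?C")
      case True
      then obtain a where a: "a \<in> carrier S" "A = S.down a" unfolding S.finite_part_completion_iff by blast
      have "?g A = on_arr completion_functor S T f A" using True by (simp only: restrict_apply if_True)
      also have "\<dots> = extension (S.down a)"
        unfolding a(2) by (rule completion_functor_arr[OF distributive_morphism_axioms S.ideal_down[OF a(1)]])
      also have "\<dots> = T.down (f a)" by (rule extension_down[OF a(1)])
      finally have "compose ?C T.principal_iso ?g A = {f a}"
        unfolding compose_eq[OF True] using T.principal_iso_down[of "f a"] a(1) by simp
      moreover have "S.principal_iso A = {a}" unfolding a(2) by (rule S.principal_iso_down[OF a(1)])
      then have "compose ?C (on_arr lift_functor S T f) S.principal_iso A = {f a}"
        unfolding compose_eq[OF True] using a(1) by (simp add: lift_functor_def lift_rs_def)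
      ultimately show ?thesis by (simp only:)
    next
      case False
      then show ?thesis by (simp only: compose_def restrict_apply if_False)
    qed
  qed
  then show "compose (carrier (on_obj (finite_part_functor \<circ>\<^sub>F completion_functor) S)) T.principal_iso
        (on_arr (finite_part_functor \<circ>\<^sub>F completion_functor) S T f) =
      compose (carrier (on_obj (finite_part_functor \<circ>\<^sub>F completion_functor) S))
        (on_arr lift_functor S T f) S.principal_iso"
    by (simp add: fctr_comp_def)
qed

lemma coherent_equivalence:
  "equivalence_across_universes
     (coherent_cat k :: ('a rsemigroup, 'a \<Rightarrow> 'a) cat)
     (coherent_cat k :: ('a set rsemigroup, 'a set \<Rightarrow> 'a set) cat)
     (distributive_cat k :: ('a rsemigroup, 'a \<Rightarrow> 'a) cat)
     (distributive_cat k :: ('a set rsemigroup, 'a set \<Rightarrow> 'a set) cat)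
     lift_functor lift_functor finite_part_functor finite_part_functor completion_functor"
  unfolding equivalence_across_universes_def
  by (intro conjI coherent_cat_is_category distributive_cat_is_category lift_functor_coherent
      lift_functor_distributive finite_part_is_functor completion_is_functor
      completion_of_finite_part finite_part_of_completion)

lemma is_category_full_subcategory:
  assumes "is_category (concrete_cat P H)" "\<And>S. P0 S \<Longrightarrow> P S"
  shows "is_category (concrete_cat P0 H)"
  using assms(1) unfolding is_category_def concrete_cat_simps
  by (elim conjE, intro conjI) (blast dest: assms(2))+

lemma is_functor_full_subcategory:
  assumes "is_functor (concrete_cat P H) (concrete_cat Q K) F" "\<And>S. P0 S \<Longrightarrow> P S"
    and "\<And>S. P0 S \<Longrightarrow> Q0 (on_obj F S)"
  shows "is_functor (concrete_cat P0 H) (concrete_cat Q0 K) F"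
  using assms unfolding is_functor_def concrete_cat_simps by simp

lemma fully_faithful_full_subcategory:
  assumes "fully_faithful (concrete_cat P H) (concrete_cat Q K) F" "\<And>S. P0 S \<Longrightarrow> P S"
  shows "fully_faithful (concrete_cat P0 H) (concrete_cat Q0 K) F"
  using assms unfolding fully_faithful_def concrete_cat_simps by simp

lemma naturally_isomorphic_full_subcategory:
  assumes "naturally_isomorphic (concrete_cat P H) (concrete_cat Q K) F G" "\<And>S. P0 S \<Longrightarrow> P S"
  shows "naturally_isomorphic (concrete_cat P0 H) (concrete_cat Q0 K) F G"
proof -
  have iso: "is_iso (concrete_cat Q0 K) X Y f \<longleftrightarrow> is_iso (concrete_cat Q K) X Y f" for X Y f
    unfolding is_iso_def concrete_cat_simps ..
  show ?thesis
    using assms unfolding naturally_isomorphic_def concrete_cat_simps iso by (elim exE) (intro exI, auto)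
qed

text \<open>All conditions in an equivalence except the preservation of objects are inherited by full
  subcategories.\<close>

lemma equivalence_full_subcategories:
  assumes E: "equivalence_across_universes (concrete_cat P H) (concrete_cat P' H')
      (concrete_cat Q K) (concrete_cat Q' K') I J F F' G"
    and sub: "\<And>S. P0 S \<Longrightarrow> P S" "\<And>S. P0' S \<Longrightarrow> P' S" "\<And>S. Q0 S \<Longrightarrow> Q S" "\<And>S. Q0' S \<Longrightarrow> Q' S"
    and obj: "\<And>S. P0 S \<Longrightarrow> P0' (on_obj I S)" "\<And>S. Q0 S \<Longrightarrow> Q0' (on_obj J S)"
      "\<And>S. P0 S \<Longrightarrow> Q0 (on_obj F S)" "\<And>S. P0' S \<Longrightarrow> Q0' (on_obj F' S)" "\<And>S. Q0 S \<Longrightarrow> P0' (on_obj G S)"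
  shows "equivalence_across_universes (concrete_cat P0 H) (concrete_cat P0' H')
      (concrete_cat Q0 K) (concrete_cat Q0' K') I J F F' G"
proof -
  note E' = E[unfolded equivalence_across_universes_def]
  show ?thesis
    unfolding equivalence_across_universes_def
  proof (intro conjI)
    show "is_category (concrete_cat P0 H)"
      using E' sub(1) by (intro is_category_full_subcategory[of P H P0]) simp_all
    show "is_category (concrete_cat P0' H')"
      using E' sub(2) by (intro is_category_full_subcategory[of P' H' P0']) simp_all
    show "is_category (concrete_cat Q0 K)"
      using E' sub(3) by (intro is_category_full_subcategory[of Q K Q0]) simp_all
    show "is_category (concrete_cat Q0' K')"
      using E' sub(4) by (intro is_category_full_subcategory[of Q' K' Q0']) simp_all
    show "is_functor (concrete_cat P0 H) (concrete_cat P0' H') I"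
      using E' sub(1) obj(1) by (intro is_functor_full_subcategory[of P H P' H' I P0 P0']) simp_all
    show "fully_faithful (concrete_cat P0 H) (concrete_cat P0' H') I"
      using E' sub(1) by (intro fully_faithful_full_subcategory[of P H P' H' I P0 P0']) simp_all
    show "is_functor (concrete_cat Q0 K) (concrete_cat Q0' K') J"
      using E' sub(3) obj(2) by (intro is_functor_full_subcategory[of Q K Q' K' J Q0 Q0']) simp_all
    show "fully_faithful (concrete_cat Q0 K) (concrete_cat Q0' K') J"
      using E' sub(3) by (intro fully_faithful_full_subcategory[of Q K Q' K' J Q0 Q0']) simp_all
    show "is_functor (concrete_cat P0 H) (concrete_cat Q0 K) F"
      using E' sub(1) obj(3) by (intro is_functor_full_subcategory[of P H Q K F P0 Q0]) simp_all
    show "is_functor (concrete_cat P0' H') (concrete_cat Q0' K') F'"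
      using E' sub(2) obj(4) by (intro is_functor_full_subcategory[of P' H' Q' K' F' P0' Q0']) simp_all
    show "is_functor (concrete_cat Q0 K) (concrete_cat P0' H') G"
      using E' sub(3) obj(5) by (intro is_functor_full_subcategory[of Q K P' H' G Q0 P0']) simp_all
    show "naturally_isomorphic (concrete_cat P0 H) (concrete_cat P0' H') (G \<circ>\<^sub>F F) I"
      using E' sub(1) by (intro naturally_isomorphic_full_subcategory[of P H P' H' "G \<circ>\<^sub>F F" I P0 P0']) simp_all
    show "naturally_isomorphic (concrete_cat Q0 K) (concrete_cat Q0' K') (F' \<circ>\<^sub>F G) J"
      using E' sub(3) by (intro naturally_isomorphic_full_subcategory[of Q K Q' K' "F' \<circ>\<^sub>F G" J Q0 Q0']) simp_all
  qed
qed

lemma strongly_coherent_finite_part: "strongly_coherent_crm S \<Longrightarrow> distributive_meet_rs (finite_part S)"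
  by (rule strongly_coherent_monoid.finite_part_distributive_meet_rs[OF strongly_coherent_monoidI])

lemma distributive_meet_completion: "distributive_meet_rs S \<Longrightarrow> strongly_coherent_crm (completion S)"
  by (rule distributive_meet_semigroup.completion_strongly_coherent[OF distributive_meet_semigroupI])

lemma strongly_coherent_equivalence:
  "equivalence_across_universes
     (strongly_coherent_cat k :: ('a rsemigroup, 'a \<Rightarrow> 'a) cat)
     (strongly_coherent_cat k :: ('a set rsemigroup, 'a set \<Rightarrow> 'a set) cat)
     (distributive_meet_cat k :: ('a rsemigroup, 'a \<Rightarrow> 'a) cat)
     (distributive_meet_cat k :: ('a set rsemigroup, 'a set \<Rightarrow> 'a set) cat)
     lift_functor lift_functor finite_part_functor finite_part_functor completion_functor"
  unfolding strongly_coherent_cat_def distributive_meet_cat_def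
  by (rule equivalence_full_subcategories[OF coherent_equivalence[unfolded coherent_cat_def distributive_cat_def]])
    (simp_all add: strongly_coherent_imp_coherent strongly_coherent_finite_part distributive_meet_completion
      lift_strongly_coherent_crm lift_distributive_meet_rs distributive_meet_imp_distributive)

theorem theorem8p17:
  fixes k :: nat
  assumes "k \<in> {1, 2, 3, 4}"
  shows "equivalence_across_universes
           (coherent_cat k :: ('a rsemigroup, 'a \<Rightarrow> 'a) cat)
           (coherent_cat k :: ('a set rsemigroup, 'a set \<Rightarrow> 'a set) cat)
           (distributive_cat k :: ('a rsemigroup, 'a \<Rightarrow> 'a) cat)
           (distributive_cat k :: ('a set rsemigroup, 'a set \<Rightarrow> 'a set) cat)
           lift_functor lift_functor finite_part_functor finite_part_functor completion_functor
       \<and> equivalence_across_universes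
           (strongly_coherent_cat k :: ('a rsemigroup, 'a \<Rightarrow> 'a) cat)
           (strongly_coherent_cat k :: ('a set rsemigroup, 'a set \<Rightarrow> 'a set) cat)
           (distributive_meet_cat k :: ('a rsemigroup, 'a \<Rightarrow> 'a) cat)
           (distributive_meet_cat k :: ('a set rsemigroup, 'a set \<Rightarrow> 'a set) cat)
           lift_functor lift_functor finite_part_functor finite_part_functor completion_functor"
  by (intro conjI coherent_equivalence strongly_coherent_equivalence)

end
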